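(* Let $\ell>0$ and let $f:\mathbb{R}\to\mathbb{R}$ be locally Lipschitz continuous, nondecreasing, with $f(0)=0$, and such that $|f(s)|\le C(1+|s|^p)$ for every $s\in\mathbb{R}\setminus\{0\}$, for some constants $C>0$ and $p\ge 1$. Let $\eta_0\in H^2\cap H^1_0(0,\pi)$, $\theta_0\in H^1_0(0,\pi)$ and $\eta_1,\theta_1\in L^2(0,\pi)$. Then there exists a unique solution $(y,\theta)$ (in the sense defined in the context) of the problem $$\begin{cases} y_{tt}+y_{xxxx}+f(y+\ell\sin\theta)+f(y-\ell\sin\theta)=0 & 0<x<\pi,\ t>0,\\ \ell\theta_{tt}-\ell\theta_{xx}+3\cos\theta\,\big(f(y+\ell\sin\theta)-f(y-\ell\sin\theta)\big)=0 & 0<x<\pi,\ t>0,\end{cases}$$ with boundary conditions $y(0,t)=y_{xx}(0,t)=y(\pi,t)=y_{xx}(\pi,t)=\theta(0,t)=\theta(\pi,t)=0$ for $t\ge0$, and initial conditions $y(x,0)=\eta_0(x)$, $y_t(x,0)=\eta_1(x)$, $\theta(x,0)=\theta_0(x)$, $\theta_t(x,0)=\theta_1(x)$ for $0<x<\pi$.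
   Context: Let $H^*=(H^2\cap H^1_0(0,\pi))'$ and $H^{-1}=(H^1_0(0,\pi))'$, with duality pairings $\langle\cdot,\cdot\rangle_{H^*}$, $\langle\cdot,\cdot\rangle_{H^{-1}}$, and let $(\cdot,\cdot)$ be the scalar product of $L^2(0,\pi)$. A solution is a pair of functions $y\in C^0(\mathbb{R}_+;H^2\cap H^1_0(0,\pi))\cap C^1(\mathbb{R}_+;L^2(0,\pi))\cap C^2(\mathbb{R}_+;H^* )$ and $\theta\in C^0(\mathbb{R}_+;H^1_0(0,\pi))\cap C^1(\mathbb{R}_+;L^2(0,\pi))\cap C^2(\mathbb{R}_+;H^{-1})$ satisfying the initial conditions and, for all $t>0$, $\langle y_{tt},\varphi\rangle_{H^*}+(y_{xx},\varphi'')+(f(y-\ell\sin\theta)+f(y+\ell\sin\theta),\varphi)=0$ for all $\varphi\in H^2\cap H^1_0(0,\pi)$, and $\ell\langle\theta_{tt},\psi\rangle_{H^{-1}}+\ell(\theta_x,\psi')+3(\cos\theta\,(f(y+\ell\sin\theta)-f(y-\ell\sin\theta)),\psi)=0$ for all $\psi\in H^1_0(0,\pi)$. *)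

theory Defs
  imports "HOL-Analysis.Analysis"
begin

text \<open>Functions on the interval (0,pi) are represented as total functions real => real;
  only their values on (0,pi) matter.  Sobolev spaces are defined as in the paper
  (weak derivatives, closure of test functions).\<close>

definition I0pi :: "real set" where "I0pi = {0<..<pi}"

definition L2 :: "(real \<Rightarrow> real) set" where
  "L2 = {u. set_borel_measurable lborel I0pi u \<and> set_integrable lborel I0pi (\<lambda>x. (u x)\<^sup>2)}"

definition l2_inner :: "(real \<Rightarrow> real) \<Rightarrow> (real \<Rightarrow> real) \<Rightarrow> real" where
  "l2_inner u v = (LINT x:I0pi|lborel. u x * v x)"

definition l2_norm :: "(real \<Rightarrow> real) \<Rightarrow> real" where
  "l2_norm u = sqrt (LINT x:I0pi|lborel. (u x)\<^sup>2)"

definition ae_eq :: "(real \<Rightarrow> real) \<Rightarrow> (real \<Rightarrow> real) \<Rightarrow> bool" where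
  "ae_eq u v \<longleftrightarrow> (AE x in lborel. x \<in> I0pi \<longrightarrow> u x = v x)"

definition test_fun :: "(real \<Rightarrow> real) \<Rightarrow> bool" where
  "test_fun \<phi> \<longleftrightarrow> (\<forall>k x. ((deriv ^^ k) \<phi>) differentiable (at x)) \<and>
     (\<exists>a b. 0 < a \<and> a \<le> b \<and> b < pi \<and> (\<forall>x. x \<notin> {a..b} \<longrightarrow> \<phi> x = 0))"

definition weak_deriv :: "(real \<Rightarrow> real) \<Rightarrow> (real \<Rightarrow> real) \<Rightarrow> bool" where
  "weak_deriv u g \<longleftrightarrow> (\<forall>\<phi>. test_fun \<phi> \<longrightarrow>
     (LINT x:I0pi|lborel. u x * deriv \<phi> x) = - (LINT x:I0pi|lborel. g x * \<phi> x))"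

text \<open>The (an) L^2 weak derivative; unique up to a.e. equality.\<close>
definition wd :: "(real \<Rightarrow> real) \<Rightarrow> (real \<Rightarrow> real)" where
  "wd u = (SOME g. g \<in> L2 \<and> weak_deriv u g)"

definition H1 :: "(real \<Rightarrow> real) set" where
  "H1 = {u. u \<in> L2 \<and> (\<exists>g\<in>L2. weak_deriv u g)}"

definition H2 :: "(real \<Rightarrow> real) set" where
  "H2 = {u. u \<in> L2 \<and> (\<exists>g\<in>L2. \<exists>h\<in>L2. weak_deriv u g \<and> weak_deriv g h)}"

definition h1_norm :: "(real \<Rightarrow> real) \<Rightarrow> real" where
  "h1_norm u = sqrt ((l2_norm u)\<^sup>2 + (l2_norm (wd u))\<^sup>2)"

definition h2_norm :: "(real \<Rightarrow> real) \<Rightarrow> real" where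
  "h2_norm u = sqrt ((l2_norm u)\<^sup>2 + (l2_norm (wd u))\<^sup>2 + (l2_norm (wd (wd u)))\<^sup>2)"

definition H10 :: "(real \<Rightarrow> real) set" where
  "H10 = {u. u \<in> H1 \<and> (\<exists>\<phi>s. (\<forall>n. test_fun (\<phi>s n)) \<and>
                (\<lambda>n. h1_norm (\<lambda>x. \<phi>s n x - u x)) \<longlonglongrightarrow> 0)}"

definition H2H10 :: "(real \<Rightarrow> real) set" where
  "H2H10 = H2 \<inter> H10"

definition dual_space :: "(real \<Rightarrow> real) set \<Rightarrow> ((real \<Rightarrow> real) \<Rightarrow> real)
    \<Rightarrow> (((real \<Rightarrow> real) \<Rightarrow> real)) set" where
  "dual_space V nrm = {\<Lambda>. (\<forall>u\<in>V. \<forall>v\<in>V. \<forall>a b::real.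
        \<Lambda> (\<lambda>x. a * u x + b * v x) = a * \<Lambda> u + b * \<Lambda> v) \<and>
        (\<exists>K. \<forall>u\<in>V. \<bar>\<Lambda> u\<bar> \<le> K * nrm u)}"

definition dual_norm :: "(real \<Rightarrow> real) set \<Rightarrow> ((real \<Rightarrow> real) \<Rightarrow> real)
    \<Rightarrow> ((real \<Rightarrow> real) \<Rightarrow> real) \<Rightarrow> real" where
  "dual_norm V nrm \<Lambda> = Sup {\<bar>\<Lambda> u\<bar> | u. u \<in> V \<and> nrm u \<le> 1}"

definition curve_cont :: "((real \<Rightarrow> real) \<Rightarrow> real) \<Rightarrow> (real \<Rightarrow> real \<Rightarrow> real) \<Rightarrow> bool" where
  "curve_cont nrm u \<longleftrightarrow> (\<forall>t\<ge>0. ((\<lambda>s. nrm (\<lambda>x. u s x - u t x)) \<longlongrightarrow> 0) (at t within {0..}))"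

definition curve_deriv :: "((real \<Rightarrow> real) \<Rightarrow> real) \<Rightarrow> (real \<Rightarrow> real \<Rightarrow> real)
    \<Rightarrow> (real \<Rightarrow> real \<Rightarrow> real) \<Rightarrow> bool" where
  "curve_deriv nrm u v \<longleftrightarrow> (\<forall>t\<ge>0.
     ((\<lambda>s. nrm (\<lambda>x. (u s x - u t x) / (s - t) - v t x)) \<longlongrightarrow> 0) (at t within {0..}))"

text \<open>Curves with values in a dual space; the L^2-valued curve w is identified with
  the functionals phi |-> (w t, phi).\<close>
definition dcurve_cont :: "(real \<Rightarrow> real) set \<Rightarrow> ((real \<Rightarrow> real) \<Rightarrow> real)
    \<Rightarrow> (real \<Rightarrow> (real \<Rightarrow> real) \<Rightarrow> real) \<Rightarrow> bool" where
  "dcurve_cont V nrm z \<longleftrightarrow> (\<forall>t\<ge>0.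
     ((\<lambda>s. dual_norm V nrm (\<lambda>\<phi>. z s \<phi> - z t \<phi>)) \<longlongrightarrow> 0) (at t within {0..}))"

definition dcurve_deriv_of_l2 :: "(real \<Rightarrow> real) set \<Rightarrow> ((real \<Rightarrow> real) \<Rightarrow> real)
    \<Rightarrow> (real \<Rightarrow> real \<Rightarrow> real) \<Rightarrow> (real \<Rightarrow> (real \<Rightarrow> real) \<Rightarrow> real) \<Rightarrow> bool" where
  "dcurve_deriv_of_l2 V nrm w z \<longleftrightarrow> (\<forall>t\<ge>0.
     ((\<lambda>s. dual_norm V nrm (\<lambda>\<phi>. (l2_inner (w s) \<phi> - l2_inner (w t) \<phi>) / (s - t) - z t \<phi>))
        \<longlongrightarrow> 0) (at t within {0..}))"

definition is_solution :: "real \<Rightarrow> (real \<Rightarrow> real) \<Rightarrow> (real \<Rightarrow> real) \<Rightarrow> (real \<Rightarrow> real)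
    \<Rightarrow> (real \<Rightarrow> real) \<Rightarrow> (real \<Rightarrow> real)
    \<Rightarrow> (real \<Rightarrow> real \<Rightarrow> real) \<Rightarrow> (real \<Rightarrow> real \<Rightarrow> real) \<Rightarrow> bool" where
  "is_solution l f \<eta>0 \<eta>1 \<theta>0 \<theta>1 y \<theta> \<longleftrightarrow>
   (\<exists>yt ytt \<theta>t \<theta>tt.
     \<comment> \<open>y in C^0(R_+; H^2 cap H^1_0) cap C^1(R_+; L^2) cap C^2(R_+; H^*)\<close>
     (\<forall>t\<ge>0. y t \<in> H2H10) \<and> curve_cont h2_norm y \<and>
     (\<forall>t\<ge>0. yt t \<in> L2) \<and> curve_deriv l2_norm y yt \<and> curve_cont l2_norm yt \<and>
     (\<forall>t\<ge>0. ytt t \<in> dual_space H2H10 h2_norm) \<and>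
     dcurve_deriv_of_l2 H2H10 h2_norm yt ytt \<and> dcurve_cont H2H10 h2_norm ytt \<and>
     \<comment> \<open>theta in C^0(R_+; H^1_0) cap C^1(R_+; L^2) cap C^2(R_+; H^-1)\<close>
     (\<forall>t\<ge>0. \<theta> t \<in> H10) \<and> curve_cont h1_norm \<theta> \<and>
     (\<forall>t\<ge>0. \<theta>t t \<in> L2) \<and> curve_deriv l2_norm \<theta> \<theta>t \<and> curve_cont l2_norm \<theta>t \<and>
     (\<forall>t\<ge>0. \<theta>tt t \<in> dual_space H10 h1_norm) \<and>
     dcurve_deriv_of_l2 H10 h1_norm \<theta>t \<theta>tt \<and> dcurve_cont H10 h1_norm \<theta>tt \<and>
     \<comment> \<open>initial conditions\<close>
     ae_eq (y 0) \<eta>0 \<and> ae_eq (yt 0) \<eta>1 \<and> ae_eq (\<theta> 0) \<theta>0 \<and> ae_eq (\<theta>t 0) \<theta>1 \<and>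
     \<comment> \<open>weak equations\<close>
     (\<forall>t>0. \<forall>\<phi>\<in>H2H10.
        ytt t \<phi> + l2_inner (wd (wd (y t))) (wd (wd \<phi>))
        + l2_inner (\<lambda>x. f (y t x - l * sin (\<theta> t x)) + f (y t x + l * sin (\<theta> t x))) \<phi> = 0) \<and>
     (\<forall>t>0. \<forall>\<psi>\<in>H10.
        l * \<theta>tt t \<psi> + l * l2_inner (wd (\<theta> t)) (wd \<psi>)
        + 3 * l2_inner (\<lambda>x. cos (\<theta> t x) * (f (y t x + l * sin (\<theta> t x)) - f (y t x - l * sin (\<theta> t x)))) \<psi> = 0))"

end

theory Submission
  imports Defs
begin

text \<open>
  Everything is expressed through the sine coefficients of \<open>y\<close> and \<open>\<theta>\<close>: a function of
  \<open>L\<^sup>2(0, \<pi>)\<close> lies in \<open>H\<^sup>1\<^sub>0\<close> (in \<open>H\<^sup>2 \<inter> H\<^sup>1\<^sub>0\<close>) iff its coefficients stay square summable after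
  multiplication by \<open>n\<close> (by \<open>n\<^sup>2\<close>), and both equations become families of forced harmonic oscillators,
  with frequencies \<open>n\<^sup>2\<close> and \<open>n\<close>, coupled through the nonlinearity.

  If \<open>f\<close> is truncated outside \<open>[-R, R]\<close>, the nonlinearity becomes bounded and globally Lipschitz, and
  Duhamel's formula defines a contraction on continuous functions of \<open>(t, x)\<close> in a sup norm with weight
  \<open>exp (-K t)\<close>; this gives a global solution of the truncated problem. Since \<open>f\<close> is nondecreasing with
  \<open>f 0 = 0\<close>, the potential energy is nonnegative, so conservation of energy bounds \<open>y\<close> in
  \<open>H\<^sup>2 \<inter> H\<^sup>1\<^sub>0\<close>, hence uniformly, by a constant that does not depend on \<open>R\<close>. For large \<open>R\<close> the
  truncation is therefore never active.

  For uniqueness, two solutions are bounded on \<open>[0, T]\<close>, so they solve a common truncated problem there;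
  the energy \<open>\<Phi>\<close> of their difference satisfies \<open>\<Phi>' \<le> C \<Phi>\<close> and \<open>\<Phi> 0 = 0\<close>.
\<close>

section \<open>The Hilbert space \<open>L\<^sup>2(0, \<pi>)\<close>\<close>

text \<open>The acceleration of a weak solution lives only in a dual space, so the equations cannot
  be tested with the velocity. Energy identities are therefore proved for finitely many modes, where
  everything is differentiable in time, and passed to the limit under a majorant that is summable
  over the modes and uniform in time on [0, T]; hence the last clause of \<open>modal_curve\<close>.
  Sup bounds come from the sum of 1/n^2 being finite (\<open>CW\<close>): if n a_n is square
  summable, then a_n is absolutely summable, so finite energy makes a sine series continuous and
  bounded.

  The two equations share one energy only after the second, divided by l, is weighted by l^2/3: if F
  is an antiderivative of f, then F(y - l sin z) + F(y + l sin z) has the partial derivatives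
  \<open>NY\<close> in y and l^2/3 times \<open>NT\<close> in z. The angle needs no a priori bound,
  because it enters through sine and cosine only; a bound on y alone keeps the arguments of f within
  a fixed interval. The radius R must be chosen before the solution exists, which works because the
  initial potential energy sees f only on a range fixed by the data.\<close>

definition mu :: "real measure" where "mu = restrict_space lborel I0pi"

lemma space_mu [simp]: "space mu = {0<..<pi}"
  by (simp add: mu_def space_restrict_space I0pi_def)

lemma finite_measure_mu: "finite_measure mu"
  unfolding mu_def I0pi_def by (intro finite_measureI) (simp add: emeasure_restrict_space space_restrict_space)

interpretation mu: finite_measure mu by (rule finite_measure_mu)

lemma measure_mu: "measure mu (space mu) = pi"
  unfolding mu_def by (simp add: measure_restrict_space I0pi_def space_restrict_space)

lemma LINT_mu: "(LINT x:I0pi|lborel. (f x::real)) = integral\<^sup>L mu f"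
  unfolding mu_def set_lebesgue_integral_def by (subst integral_restrict_space) (auto simp: I0pi_def)

lemma set_integrable_mu: "set_integrable lborel I0pi (f::real\<Rightarrow>real) \<longleftrightarrow> integrable mu f"
  unfolding mu_def set_integrable_def by (subst integrable_restrict_space) (auto simp: I0pi_def)

lemma set_borel_measurable_mu:
  "set_borel_measurable lborel I0pi (f::real\<Rightarrow>real) \<longleftrightarrow> f \<in> borel_measurable mu"
  unfolding mu_def set_borel_measurable_def
  by (subst borel_measurable_restrict_space_iff) (auto simp: I0pi_def)

lemma L2_iff: "u \<in> L2 \<longleftrightarrow> u \<in> borel_measurable mu \<and> integrable mu (\<lambda>x. (u x)\<^sup>2)"
  by (simp add: L2_def set_integrable_mu set_borel_measurable_mu)

lemma L2_measurable: "u \<in> L2 \<Longrightarrow> u \<in> borel_measurable mu"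
  by (simp add: L2_iff)

lemma ae_eq_iff: "ae_eq u v \<longleftrightarrow> (AE x in mu. u x = v x)"
  unfolding ae_eq_def mu_def by (subst AE_restrict_space_iff) (auto simp: I0pi_def)

lemma l2_inner_mu: "l2_inner u v = (\<integral>x. u x * v x \<partial>mu)"
  by (simp add: l2_inner_def LINT_mu)

lemma l2_norm_power2: "(l2_norm u)\<^sup>2 = l2_inner u u"
  by (simp add: l2_norm_def l2_inner_mu LINT_mu power2_eq_square)

lemma l2_norm_nonneg [simp]: "l2_norm u \<ge> 0"
  by (simp add: l2_norm_def LINT_mu)

lemma l2_norm_eq: "l2_norm u = sqrt (l2_inner u u)"
  by (simp add: l2_norm_def l2_inner_mu LINT_mu power2_eq_square)

lemma integrable_bounded:
  assumes "u \<in> borel_measurable mu" "AE x in mu. \<bar>u x\<bar> \<le> B"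
  shows "integrable mu (u::real\<Rightarrow>real)"
  using assms by (intro mu.integrable_const_bound[of u B]) auto

lemma borel_measurable_mu_continuous:
  assumes "continuous_on {0<..<pi} (u::real\<Rightarrow>real)" shows "u \<in> borel_measurable mu"
  using assms borel_measurable_continuous_on_restrict[OF assms]
  unfolding mu_def I0pi_def using measurable_cong_sets sets_restrict_space_cong[OF sets_lborel] by blast

lemma L2_bounded:
  assumes "u \<in> borel_measurable mu" "AE x in mu. \<bar>u x\<bar> \<le> B" shows "u \<in> L2"
  unfolding L2_iff
proof (intro conjI integrable_bounded[where B="B\<^sup>2"])
  show "AE x in mu. \<bar>(u x)\<^sup>2\<bar> \<le> B\<^sup>2"
    using assms(2) by eventually_elim (simp add: abs_le_square_iff[symmetric])
qed (use assms in auto)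

lemma L2_continuous:
  assumes "continuous_on UNIV (u::real\<Rightarrow>real)" shows "u \<in> L2"
proof -
  have "compact (u ` {0..pi})"
    using assms by (intro compact_continuous_image) (auto intro: continuous_on_subset)
  then obtain B where B: "\<And>x. x \<in> {0..pi} \<Longrightarrow> \<bar>u x\<bar> \<le> B"
    by (metis compact_imp_bounded bounded_iff image_eqI real_norm_def)
  show ?thesis
    by (rule L2_bounded[where B=B])
       (use assms B in \<open>auto intro!: borel_measurable_mu_continuous AE_I2 intro: continuous_on_subset\<close>)
qed

lemma L2_integrable_mult:
  assumes "u \<in> L2" "v \<in> L2" shows "integrable mu (\<lambda>x. u x * v x)"
proof (rule Bochner_Integration.integrable_bound)
  show "integrable mu (\<lambda>x. (u x)\<^sup>2 + (v x)\<^sup>2)" using assms by (auto simp: L2_iff)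
  have "\<bar>a * b\<bar> \<le> a\<^sup>2 + b\<^sup>2" for a b :: real
    using sum_squares_bound[of a b] sum_squares_bound[of a "-b"] by (auto simp: abs_if)
  then show "AE x in mu. norm (u x * v x) \<le> norm ((u x)\<^sup>2 + (v x)\<^sup>2)"
    by (auto intro!: AE_I2 order_trans[OF _ abs_ge_self])
qed (use assms in \<open>auto simp: L2_iff\<close>)

lemma L2_scale: assumes "u \<in> L2" shows "(\<lambda>x. a * u x) \<in> L2"
  using assms by (auto simp: L2_iff power_mult_distrib)

lemma L2_add: assumes "u \<in> L2" "v \<in> L2" shows "(\<lambda>x. u x + v x) \<in> L2"
  using assms L2_integrable_mult[OF assms]
  by (auto simp: L2_iff power2_sum mult.assoc intro!: Bochner_Integration.integrable_add)

lemma L2_zero: "(\<lambda>x. 0) \<in> L2" by (simp add: L2_iff)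

lemma L2_diff: assumes "u \<in> L2" "v \<in> L2" shows "(\<lambda>x. u x - v x) \<in> L2"
  using L2_add[OF assms(1) L2_scale[OF assms(2), of "-1"]] by simp

lemma L2_divide: assumes "u \<in> L2" shows "(\<lambda>x. u x / a) \<in> L2"
  using L2_scale[OF assms, of "1/a"] by simp

lemma L2_sum: assumes "\<And>i. i \<in> A \<Longrightarrow> u i \<in> L2" shows "(\<lambda>x. \<Sum>i\<in>A. u i x) \<in> L2"
  using assms by (induction A rule: infinite_finite_induct) (auto intro!: L2_add L2_zero)

lemma l2_inner_commute: "l2_inner u v = l2_inner v u"
  by (simp add: l2_inner_mu mult.commute)

lemma l2_inner_scale_left: "l2_inner (\<lambda>x. a * u x) v = a * l2_inner u v"
  by (simp add: l2_inner_mu mult.assoc)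

lemma l2_inner_scale_right: "l2_inner v (\<lambda>x. a * u x) = a * l2_inner v u"
  by (simp add: l2_inner_mu mult.left_commute)

lemma l2_inner_divide_left: "l2_inner (\<lambda>x. u x / a) v = l2_inner u v / a"
  by (simp add: l2_inner_mu)

lemma l2_inner_add_left:
  "u \<in> L2 \<Longrightarrow> v \<in> L2 \<Longrightarrow> w \<in> L2 \<Longrightarrow> l2_inner (\<lambda>x. u x + v x) w = l2_inner u w + l2_inner v w"
  by (simp add: l2_inner_mu distrib_right L2_integrable_mult)

lemma l2_inner_add_right:
  "u \<in> L2 \<Longrightarrow> v \<in> L2 \<Longrightarrow> w \<in> L2 \<Longrightarrow> l2_inner w (\<lambda>x. u x + v x) = l2_inner w u + l2_inner w v"
  by (simp add: l2_inner_mu distrib_left L2_integrable_mult)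

lemma l2_inner_diff_left:
  "u \<in> L2 \<Longrightarrow> v \<in> L2 \<Longrightarrow> w \<in> L2 \<Longrightarrow> l2_inner (\<lambda>x. u x - v x) w = l2_inner u w - l2_inner v w"
  by (simp add: l2_inner_mu left_diff_distrib L2_integrable_mult)

lemma l2_inner_diff_right:
  "u \<in> L2 \<Longrightarrow> v \<in> L2 \<Longrightarrow> w \<in> L2 \<Longrightarrow> l2_inner w (\<lambda>x. u x - v x) = l2_inner w u - l2_inner w v"
  by (simp add: l2_inner_mu right_diff_distrib L2_integrable_mult)

lemma l2_inner_sum_left:
  assumes "\<And>i. i \<in> A \<Longrightarrow> u i \<in> L2" "w \<in> L2"
  shows "l2_inner (\<lambda>x. \<Sum>i\<in>A. u i x) w = (\<Sum>i\<in>A. l2_inner (u i) w)"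
  using assms unfolding l2_inner_mu
  by (simp add: sum_distrib_right L2_integrable_mult Bochner_Integration.integral_sum)

lemma l2_inner_self_nonneg: "l2_inner u u \<ge> 0"
  by (simp add: l2_inner_mu)

lemma l2_inner_cong_ae:
  assumes "ae_eq u u'" "ae_eq v v'" "u \<in> borel_measurable mu" "u' \<in> borel_measurable mu"
    "v \<in> borel_measurable mu" "v' \<in> borel_measurable mu"
  shows "l2_inner u v = l2_inner u' v'"
  unfolding l2_inner_mu using assms by (intro integral_cong_AE) (auto simp: ae_eq_iff)

lemma l2_Cauchy_Schwarz:
  assumes "u \<in> L2" "v \<in> L2" shows "\<bar>l2_inner u v\<bar> \<le> l2_norm u * l2_norm v"
proof -
  have *: "0 \<le> l2_inner u u + 2 * t * l2_inner u v + t\<^sup>2 * l2_inner v v" for t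
  proof -
    have "0 \<le> l2_inner (\<lambda>x. u x + t * v x) (\<lambda>x. u x + t * v x)" by (rule l2_inner_self_nonneg)
    also have "\<dots> = l2_inner u u + 2 * t * l2_inner u v + t\<^sup>2 * l2_inner v v"
      using assms
      by (simp add: l2_inner_add_left l2_inner_add_right L2_scale L2_add l2_inner_scale_left
          l2_inner_scale_right power2_eq_square l2_inner_commute[of v u] distrib_left)
    finally show ?thesis .
  qed
  have "(l2_inner u v)\<^sup>2 \<le> l2_inner u u * l2_inner v v"
  proof (cases "l2_inner v v = 0")
    case True
    then have **: "0 \<le> l2_inner u u + 2 * t * l2_inner u v" for t using *[of t] by simp
    \<comment> \<open>Without a quadratic term the expression is affine in t and nonnegative, so its
      slope vanishes: for a nonzero slope, the t chosen here would give the value -1.\<close>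
    have "l2_inner u v = 0"
      using **[of "- (l2_inner u u + 1) / (2 * l2_inner u v)"] by (cases "l2_inner u v = 0") (auto simp: field_simps)
    then show ?thesis using True by simp
  next
    case False
    then have p: "l2_inner v v > 0" using l2_inner_self_nonneg[of v] by linarith
    from *[of "- l2_inner u v / l2_inner v v"] p show ?thesis
      by (simp add: field_simps power2_eq_square)
  qed
  then have "(\<bar>l2_inner u v\<bar>)\<^sup>2 \<le> (l2_norm u * l2_norm v)\<^sup>2"
    by (simp add: power_mult_distrib l2_norm_power2)
  then show ?thesis by (rule power2_le_imp_le) simp
qed

lemma l2_norm_triangle:
  assumes "u \<in> L2" "v \<in> L2" shows "l2_norm (\<lambda>x. u x + v x) \<le> l2_norm u + l2_norm v"
proof (rule power2_le_imp_le)
  have "(l2_norm (\<lambda>x. u x + v x))\<^sup>2 = (l2_norm u)\<^sup>2 + 2 * l2_inner u v + (l2_norm v)\<^sup>2"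
    using assms by (simp add: l2_norm_power2 l2_inner_add_left l2_inner_add_right
        L2_add l2_inner_commute[of v u])
  also have "\<dots> \<le> (l2_norm u + l2_norm v)\<^sup>2"
    using l2_Cauchy_Schwarz[OF assms] by (simp add: power2_sum)
  finally show "(l2_norm (\<lambda>x. u x + v x))\<^sup>2 \<le> (l2_norm u + l2_norm v)\<^sup>2" .
qed simp

lemma l2_norm_scale: "l2_norm (\<lambda>x. a * u x) = \<bar>a\<bar> * l2_norm u"
  by (simp add: l2_norm_eq l2_inner_scale_left l2_inner_scale_right real_sqrt_mult mult.assoc[symmetric])

lemma l2_norm_le_bound:
  assumes "u \<in> borel_measurable mu" "AE x in mu. \<bar>u x\<bar> \<le> B" "B \<ge> 0"
  shows "l2_norm u \<le> sqrt pi * B"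
proof -
  have "(\<integral>x. (u x)\<^sup>2 \<partial>mu) \<le> (\<integral>x. B\<^sup>2 \<partial>mu)"
    using L2_bounded[OF assms(1,2)] assms(2)
    by (intro integral_mono_AE) (auto simp: L2_iff abs_le_square_iff[symmetric] elim: eventually_mono)
  also have "\<dots> = pi * B\<^sup>2" by (simp add: measure_mu[simplified])
  finally have "l2_norm u \<le> sqrt (pi * B\<^sup>2)" by (simp add: l2_norm_def LINT_mu)
  then show ?thesis using assms(3) by (simp add: real_sqrt_mult)
qed

lemma mu_FTC:
  fixes F f :: "real \<Rightarrow> real"
  assumes "\<And>x. (F has_real_derivative f x) (at x)" "continuous_on UNIV f"
  shows "integral\<^sup>L mu f = F pi - F 0"
proof -
  have "(LBINT x=ereal 0..ereal pi. f x) = F pi - F 0"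
    using assms by (intro interval_integral_FTC_finite)
      (auto intro: continuous_on_subset has_field_derivative_at_within
            simp: has_real_derivative_iff_has_vector_derivative[symmetric])
  also have "(LBINT x=ereal 0..ereal pi. f x) = (LINT x:I0pi|lborel. f x)"
    by (simp add: interval_lebesgue_integral_def I0pi_def)
  finally show ?thesis by (simp add: LINT_mu)
qed

lemma l2_tendsto_dominated:
  assumes "\<And>k::nat. u k \<in> borel_measurable mu" "v \<in> borel_measurable mu"
    and "AE x in mu. (\<lambda>k. u k x) \<longlonglongrightarrow> v x"
    and "\<And>k. AE x in mu. \<bar>u k x - v x\<bar> \<le> B"
  shows "(\<lambda>k. l2_norm (\<lambda>x. u k x - v x)) \<longlonglongrightarrow> 0"
proof -
  have "(\<lambda>k. \<integral>x. (u k x - v x)\<^sup>2 \<partial>mu) \<longlonglongrightarrow> (\<integral>x. 0 \<partial>mu)"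
  proof (rule integral_dominated_convergence[where w="\<lambda>x. B\<^sup>2"])
    show "AE x in mu. (\<lambda>k. (u k x - v x)\<^sup>2) \<longlonglongrightarrow> 0"
      using assms(3)
    proof eventually_elim
      case (elim x)
      then show ?case by (auto intro!: tendsto_eq_intros)
    qed
    show "AE x in mu. norm ((u k x - v x)\<^sup>2) \<le> B\<^sup>2" for k
      using assms(4)[of k] by eventually_elim (simp add: abs_le_square_iff[symmetric])
  qed (use assms in auto)
  then have "(\<lambda>k. sqrt (\<integral>x. (u k x - v x)\<^sup>2 \<partial>mu)) \<longlonglongrightarrow> sqrt 0"
    by (intro tendsto_real_sqrt) simp
  then show ?thesis by (simp add: l2_norm_def LINT_mu)
qed

lemma l2_inner_tendsto:
  assumes "\<And>k. u k \<in> L2" "v \<in> L2" "w \<in> L2" "((\<lambda>k. l2_norm (\<lambda>x. u k x - v x)) \<longlongrightarrow> 0) F"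
  shows "((\<lambda>k. l2_inner (u k) w) \<longlongrightarrow> l2_inner v w) F"
proof -
  have "((\<lambda>k. l2_inner (u k) w - l2_inner v w) \<longlongrightarrow> 0) F"
  proof (rule Lim_null_comparison)
    show "\<forall>\<^sub>F k in F. norm (l2_inner (u k) w - l2_inner v w) \<le> l2_norm (\<lambda>x. u k x - v x) * l2_norm w"
      using assms l2_Cauchy_Schwarz[OF L2_diff[OF assms(1) assms(2)] assms(3)]
      by (auto simp: l2_inner_diff_left)
    show "((\<lambda>k. l2_norm (\<lambda>x. u k x - v x) * l2_norm w) \<longlongrightarrow> 0) F"
      using tendsto_mult_left_zero[OF assms(4)] by simp
  qed
  then show ?thesis by (simp add: LIM_zero_iff)
qed

section \<open>Orthonormal expansions\<close>

definition orthonormal :: "(nat \<Rightarrow> real \<Rightarrow> real) \<Rightarrow> bool" where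
  "orthonormal \<phi> \<longleftrightarrow> (\<forall>n. \<phi> n \<in> L2) \<and> (\<forall>m n. l2_inner (\<phi> m) (\<phi> n) = (if m = n then 1 else 0))"

lemma orthonormal_L2: "orthonormal \<phi> \<Longrightarrow> \<phi> n \<in> L2"
  by (simp add: orthonormal_def)

lemma orthonormal_inner: "orthonormal \<phi> \<Longrightarrow> l2_inner (\<phi> m) (\<phi> n) = (if m = n then 1 else 0)"
  by (simp add: orthonormal_def)

lemma orthonormal_sum_L2: "orthonormal \<phi> \<Longrightarrow> (\<lambda>x. \<Sum>n\<in>A. a n * \<phi> n x) \<in> L2"
  by (intro L2_sum L2_scale orthonormal_L2)

lemma orthonormal_inner_sum:
  assumes "orthonormal \<phi>" "v \<in> L2"
  shows "l2_inner (\<lambda>x. \<Sum>n\<in>A. a n * \<phi> n x) v = (\<Sum>n\<in>A. a n * l2_inner (\<phi> n) v)"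
  using assms by (subst l2_inner_sum_left) (auto intro: L2_scale orthonormal_L2 simp: l2_inner_scale_left)

lemma orthonormal_norm_sum:
  assumes "orthonormal \<phi>" "finite A"
  shows "(l2_norm (\<lambda>x. \<Sum>n\<in>A. a n * \<phi> n x))\<^sup>2 = (\<Sum>n\<in>A. (a n)\<^sup>2)"
proof -
  have "l2_inner (\<phi> m) (\<lambda>x. \<Sum>n\<in>A. a n * \<phi> n x) = a m" if "m \<in> A" for m
    using assms that
    by (subst l2_inner_commute, subst orthonormal_inner_sum)
       (auto intro: orthonormal_L2 simp: orthonormal_inner if_distrib cong: if_cong)
  then show ?thesis
    using assms by (simp add: l2_norm_power2 orthonormal_inner_sum orthonormal_sum_L2 power2_eq_square[of "a _"])
qed

lemma Bessel_finite:
  assumes "orthonormal \<phi>" "u \<in> L2" "finite A"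
  shows "(\<Sum>n\<in>A. (l2_inner u (\<phi> n))\<^sup>2) \<le> l2_inner u u"
proof -
  let ?s = "\<lambda>x. \<Sum>n\<in>A. l2_inner u (\<phi> n) * \<phi> n x"
  note s = orthonormal_sum_L2[OF assms(1), where A=A and a="\<lambda>n. l2_inner u (\<phi> n)"]
  have "0 \<le> l2_inner (\<lambda>x. u x - ?s x) (\<lambda>x. u x - ?s x)" by (rule l2_inner_self_nonneg)
  also have "\<dots> = l2_inner u u - 2 * l2_inner ?s u + l2_inner ?s ?s"
    using assms s
    by (simp only: l2_inner_diff_left l2_inner_diff_right L2_diff l2_inner_commute[of u ?s])
  also have "l2_inner ?s ?s = (\<Sum>n\<in>A. (l2_inner u (\<phi> n))\<^sup>2)"
    using orthonormal_norm_sum[OF assms(1,3)] by (simp add: l2_norm_power2)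
  also have "l2_inner ?s u = (\<Sum>n\<in>A. (l2_inner u (\<phi> n))\<^sup>2)"
    using assms by (simp only: orthonormal_inner_sum power2_eq_square l2_inner_commute[of u])
  finally show ?thesis by simp
qed

lemma Bessel:
  assumes "orthonormal \<phi>" "u \<in> L2"
  shows "summable (\<lambda>n. (l2_inner u (\<phi> n))\<^sup>2)" "(\<Sum>n. (l2_inner u (\<phi> n))\<^sup>2) \<le> l2_inner u u"
proof -
  show *: "summable (\<lambda>n. (l2_inner u (\<phi> n))\<^sup>2)"
    using Bessel_finite[OF assms] by (intro summableI_nonneg_bounded[where x="l2_inner u u"]) auto
  show "(\<Sum>n. (l2_inner u (\<phi> n))\<^sup>2) \<le> l2_inner u u"
    using Bessel_finite[OF assms] by (intro suminf_le_const *) auto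
qed

text \<open>Membership in \<open>L2\<close> is part of the notion because \<open>l2_norm\<close> is
  0 for a function whose square is not integrable, and the limit alone would then say
  nothing.\<close>

definition l2_expands :: "(nat \<Rightarrow> real \<Rightarrow> real) \<Rightarrow> (nat \<Rightarrow> real) \<Rightarrow> (real \<Rightarrow> real) \<Rightarrow> bool" where
  "l2_expands \<phi> a u \<longleftrightarrow> u \<in> L2 \<and> (\<lambda>N. l2_norm (\<lambda>x. (\<Sum>n<N. a n * \<phi> n x) - u x)) \<longlonglongrightarrow> 0"

lemma l2_expands_inner:
  assumes "orthonormal \<phi>" "l2_expands \<phi> a u" "v \<in> L2"
  shows "(\<lambda>n. a n * l2_inner (\<phi> n) v) sums l2_inner u v"
proof -
  have "(\<lambda>N. l2_inner (\<lambda>x. \<Sum>n<N. a n * \<phi> n x) v) \<longlonglongrightarrow> l2_inner u v"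
    using assms by (intro l2_inner_tendsto) (auto intro: orthonormal_sum_L2 simp: l2_expands_def)
  then show ?thesis using assms by (simp add: sums_def orthonormal_inner_sum)
qed

lemma l2_expands_coeff:
  assumes "orthonormal \<phi>" "l2_expands \<phi> a u"
  shows "l2_inner u (\<phi> n) = a n"
proof -
  have "(\<lambda>m. a m * l2_inner (\<phi> m) (\<phi> n)) sums l2_inner u (\<phi> n)"
    using assms by (intro l2_expands_inner) (auto intro: orthonormal_L2)
  moreover have "(\<lambda>m. a m * l2_inner (\<phi> m) (\<phi> n)) = (\<lambda>m. if m = n then a m else 0)"
    using assms(1) by (auto simp: orthonormal_def)
  ultimately show ?thesis using sums_single[of n a] sums_unique2 by metis
qed

lemma l2_expands_parseval:
  assumes "orthonormal \<phi>" "l2_expands \<phi> a u" "l2_expands \<phi> b v"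
  shows "(\<lambda>n. a n * b n) sums l2_inner u v"
  using l2_expands_inner[OF assms(1,2), of v] assms(3)
  by (simp add: l2_expands_def l2_inner_commute[of "\<phi> _"] l2_expands_coeff[OF assms(1,3)])

text \<open>The partial sums are Cauchy in L2, but a limit function has to be built pointwise: along
  a subsequence with geometrically small increments they converge almost everywhere, and Fatou's
  lemma carries the tail estimate over to the pointwise limit. The tail of the series then controls
  the distance of every partial sum, not only of those in the subsequence.\<close>

lemma Riesz_Fischer:
  assumes on: "orthonormal \<phi>" and sm: "summable (\<lambda>n. (a n)\<^sup>2)"
  obtains u where "l2_expands \<phi> a u"
proof -
  define s where "s N x = (\<Sum>n<N. a n * \<phi> n x)" for N x
  have sL2: "s N \<in> L2" for N unfolding s_def by (rule orthonormal_sum_L2[OF on])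
  note [measurable] = L2_measurable[OF sL2]
  have dn: "(l2_norm (\<lambda>x. s M x - s N x))\<^sup>2 = (\<Sum>n\<in>{N..<M}. (a n)\<^sup>2)" if "N \<le> M" for M N
  proof -
    have "s M x - s N x = (\<Sum>n\<in>{N..<M}. a n * \<phi> n x)" for x
      unfolding s_def using that by (simp add: sum_diff_nat_ivl[of 0 N M "\<lambda>n. a n * \<phi> n x", symmetric] lessThan_atLeast0)
    then show ?thesis using orthonormal_norm_sum[OF on] by simp
  qed
  have dn': "l2_norm (\<lambda>x. s M x - s N x) \<le> sqrt (\<Sum>n. (a (n + N))\<^sup>2)" if "N \<le> M" for M N
  proof -
    have "(\<Sum>n\<in>{N..<M}. (a n)\<^sup>2) = (\<Sum>n<M-N. (a (n + N))\<^sup>2)"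
      using that sum.shift_bounds_nat_ivl[of "\<lambda>n. (a n)\<^sup>2" 0 N "M-N"] by (simp add: lessThan_atLeast0)
    also have "\<dots> \<le> (\<Sum>n. (a (n + N))\<^sup>2)"
      using sm by (intro sum_le_suminf) (auto simp: summable_iff_shift[of "\<lambda>n. (a n)\<^sup>2"])
    finally show ?thesis using dn[OF that] by (intro real_le_rsqrt) simp
  qed
  have tail: "(\<lambda>N. sqrt (\<Sum>n. (a (n + N))\<^sup>2)) \<longlonglongrightarrow> 0"
    using tendsto_real_sqrt[OF suminf_exist_split2[OF sm]] by simp
  have "\<exists>N. sqrt (\<Sum>n. (a (n + N))\<^sup>2) < (1/2)^k \<and> N > m" for k m
  proof -
    have "\<forall>\<^sub>F N in sequentially. sqrt (\<Sum>n. (a (n + N))\<^sup>2) < (1/2)^k \<and> N > m"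
      using order_tendstoD(2)[OF tail, of "(1/2)^k"] eventually_gt_at_top by (intro eventually_conj) auto
    then show ?thesis using eventually_happens by fastforce
  qed
  then obtain nx where nx: "\<And>k m. sqrt (\<Sum>n. (a (n + nx k m))\<^sup>2) < (1/2)^k" "\<And>k m. nx k m > m" by metis
  \<comment> \<open>Step k + 1 of the recursion asks for an index beyond r k whose tail is below
    (1/2)^(k+1), so r is increasing and the k-th increment is below (1/2)^k.\<close>
  define r where "r = rec_nat (nx 0 0) (\<lambda>k m. nx (Suc k) m)"
  have r: "sqrt (\<Sum>n. (a (n + r k))\<^sup>2) < (1/2)^k" "r (Suc k) > r k" for k
    using nx(1)[of 0 0] by (cases k; simp add: r_def nx del: power_Suc)+
  then have rmono: "strict_mono r" by (simp add: strict_mono_Suc_iff)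
  define d where "d k x = s (r (Suc k)) x - s (r k) x" for k x
  have dL2: "d k \<in> L2" for k unfolding d_def by (intro L2_diff sL2)
  note [measurable] = L2_measurable[OF dL2]
  \<comment> \<open>On a finite measure space, pairing with the constant 1 bounds the L1 norm by the
    L2 norm; L1 norms are what can be summed under the integral.\<close>
  have one: "(\<lambda>x. 1) \<in> L2" by (rule L2_bounded[where B=1]) auto
  have absd: "(\<lambda>x. \<bar>d k x\<bar>) \<in> L2" for k using dL2[of k] by (auto simp: L2_iff)
  have dint: "integrable mu (\<lambda>x. \<bar>d k x\<bar>)" for k
    using L2_integrable_mult[OF absd one] by simp
  have nd: "(\<integral>x. \<bar>d k x\<bar> \<partial>mu) \<le> (1/2)^k * l2_norm (\<lambda>x. 1)" for k
  proof -
    have "(\<integral>x. \<bar>d k x\<bar> \<partial>mu) = l2_inner (\<lambda>x. \<bar>d k x\<bar>) (\<lambda>x. 1)" by (simp add: l2_inner_mu)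
    also have "\<dots> \<le> l2_norm (\<lambda>x. \<bar>d k x\<bar>) * l2_norm (\<lambda>x. 1)"
      using l2_Cauchy_Schwarz[OF absd one] by (metis abs_le_D1)
    also have "l2_norm (\<lambda>x. \<bar>d k x\<bar>) = l2_norm (d k)" by (simp add: l2_norm_def)
    also have "l2_norm (d k) \<le> (1/2)^k"
      unfolding d_def using dn'[of "r k" "r (Suc k)"] r(1)[of k] r(2)[of k] by linarith
    finally show ?thesis by (simp add: mult_right_mono)
  qed
  have "(\<integral>\<^sup>+x. (\<Sum>k. ennreal \<bar>d k x\<bar>) \<partial>mu) = (\<Sum>k. \<integral>\<^sup>+x. ennreal \<bar>d k x\<bar> \<partial>mu)"
    by (rule nn_integral_suminf) auto
  also have "\<dots> = (\<Sum>k. ennreal (\<integral>x. \<bar>d k x\<bar> \<partial>mu))"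
    by (intro suminf_cong nn_integral_eq_integral dint) auto
  also have "\<dots> \<le> (\<Sum>k. ennreal ((1/2)^k * l2_norm (\<lambda>x. 1)))"
    by (intro suminf_le ennreal_leI nd) auto
  also have "\<dots> = ennreal (\<Sum>k. (1/2)^k * l2_norm (\<lambda>x. 1))"
    by (rule suminf_ennreal2) (auto intro!: summable_mult2 summable_geometric)
  also have "\<dots> < \<infinity>" by simp
  finally have "(\<integral>\<^sup>+x. (\<Sum>k. ennreal \<bar>d k x\<bar>) \<partial>mu) \<noteq> \<infinity>" by (rule less_imp_neq)
  then have "AE x in mu. (\<Sum>k. ennreal \<bar>d k x\<bar>) \<noteq> \<infinity>"
    by (intro nn_integral_PInf_AE) auto
  then have conv: "AE x in mu. convergent (\<lambda>k. s (r k) x)"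
  proof eventually_elim
    case (elim x)
    then have "summable (\<lambda>k. \<bar>d k x\<bar>)" by (intro summable_suminf_not_top) auto
    then have "summable (\<lambda>k. d k x)" by (rule summable_rabs_cancel)
    then have "convergent (\<lambda>k. \<Sum>j<k. d j x)" by (simp add: summable_iff_convergent)
    moreover have "(\<Sum>j<k. d j x) = s (r k) x - s (r 0) x" for k
      unfolding d_def by (rule sum_lessThan_telescope)
    ultimately have "convergent (\<lambda>k. s (r k) x - s (r 0) x)" by simp
    then show ?case by (simp add: convergent_diff_const_right_iff)
  qed
  define u where "u x = lim (\<lambda>k. s (r k) x)" for x
  have um [measurable]: "u \<in> borel_measurable mu" unfolding u_def by measurable
  have lim: "AE x in mu. (\<lambda>k. s (r k) x) \<longlonglongrightarrow> u x"
    using conv by eventually_elim (simp add: u_def convergent_LIMSEQ_iff)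
  \<comment> \<open>Stated with the nonnegative integral, because integrability of the squared
    difference is not known yet and is read off from this very bound.\<close>
  have fatou: "(\<integral>\<^sup>+x. ennreal ((s N x - u x)\<^sup>2) \<partial>mu) \<le> ennreal (\<Sum>n. (a (n + N))\<^sup>2)" for N
  proof -
    have "(\<integral>\<^sup>+x. ennreal ((s N x - u x)\<^sup>2) \<partial>mu)
      = (\<integral>\<^sup>+x. liminf (\<lambda>k. ennreal ((s N x - s (r k) x)\<^sup>2)) \<partial>mu)"
    proof (rule nn_integral_cong_AE)
      show "AE x in mu. ennreal ((s N x - u x)\<^sup>2) = liminf (\<lambda>k. ennreal ((s N x - s (r k) x)\<^sup>2))"
        using lim
      proof eventually_elim
        case (elim x)
        then have "(\<lambda>k. ennreal ((s N x - s (r k) x)\<^sup>2)) \<longlonglongrightarrow> ennreal ((s N x - u x)\<^sup>2)"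
          by (intro tendsto_intros)
        then show ?case by (metis lim_imp_Liminf sequentially_bot)
      qed
    qed
    also have "\<dots> \<le> liminf (\<lambda>k. \<integral>\<^sup>+x. ennreal ((s N x - s (r k) x)\<^sup>2) \<partial>mu)"
      by (rule nn_integral_liminf) auto
    also have "\<dots> \<le> ennreal (\<Sum>n. (a (n + N))\<^sup>2)"
    proof (rule Liminf_le)
      have "\<forall>\<^sub>F k in sequentially. N \<le> r k"
        using filterlim_subseq[OF rmono] by (auto simp: filterlim_at_top)
      then show "\<forall>\<^sub>F k in sequentially. (\<integral>\<^sup>+x. ennreal ((s N x - s (r k) x)\<^sup>2) \<partial>mu) \<le> ennreal (\<Sum>n. (a (n + N))\<^sup>2)"
      proof eventually_elim
        case (elim k)
        have "(\<integral>\<^sup>+x. ennreal ((s N x - s (r k) x)\<^sup>2) \<partial>mu) = ennreal (\<integral>x. (s N x - s (r k) x)\<^sup>2 \<partial>mu)"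
          using L2_diff[OF sL2[of N] sL2[of "r k"]] by (intro nn_integral_eq_integral) (auto simp: L2_iff)
        also have "(\<integral>x. (s N x - s (r k) x)\<^sup>2 \<partial>mu) = (l2_norm (\<lambda>x. s (r k) x - s N x))\<^sup>2"
          by (simp add: l2_norm_def LINT_mu power2_commute)
        also have "\<dots> \<le> (sqrt (\<Sum>n. (a (n + N))\<^sup>2))\<^sup>2"
          by (intro power_mono dn' elim) auto
        also have "\<dots> = (\<Sum>n. (a (n + N))\<^sup>2)"
          using sm by (intro real_sqrt_pow2 suminf_nonneg) (auto simp: summable_iff_shift[of "\<lambda>n. (a n)\<^sup>2"])
        finally show ?case by (simp add: ennreal_leI)
      qed
    qed simp
    finally show ?thesis .
  qed
  have duL2: "(\<lambda>x. s N x - u x) \<in> L2" for N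
    unfolding L2_iff using fatou[of N]
    by (auto intro!: integrableI_bounded simp: le_less_trans)
  have uL2: "u \<in> L2" using L2_diff[OF sL2[of 0] duL2[of 0]] by simp
  have nb: "l2_norm (\<lambda>x. s N x - u x) \<le> sqrt (\<Sum>n. (a (n + N))\<^sup>2)" for N
  proof -
    have "ennreal (\<integral>x. (s N x - u x)\<^sup>2 \<partial>mu) \<le> ennreal (\<Sum>n. (a (n + N))\<^sup>2)"
      using fatou[of N] duL2[of N] by (subst nn_integral_eq_integral[symmetric]) (auto simp: L2_iff)
    then have "(\<integral>x. (s N x - u x)\<^sup>2 \<partial>mu) \<le> (\<Sum>n. (a (n + N))\<^sup>2)"
      using sm by (subst (asm) ennreal_le_iff) (auto intro!: suminf_nonneg simp: summable_iff_shift[of "\<lambda>n. (a n)\<^sup>2"])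
    then show ?thesis by (simp add: l2_norm_def LINT_mu)
  qed
  have "(\<lambda>N. l2_norm (\<lambda>x. s N x - u x)) \<longlonglongrightarrow> 0"
    by (rule Lim_null_comparison[OF _ tail]) (use nb in auto)
  then have "l2_expands \<phi> a u" using uL2 by (simp add: l2_expands_def s_def)
  then show thesis by (rule that)
qed

section \<open>The sine basis\<close>

text \<open>Modes are counted from 0: the frequency of mode \<open>n\<close> is \<open>n + 1\<close>.\<close>

definition W :: "nat \<Rightarrow> real" where "W n = real (Suc n)"

definition se :: "nat \<Rightarrow> real \<Rightarrow> real" where "se n x = sqrt (2/pi) * sin (W n * x)"

definition ce :: "nat \<Rightarrow> real \<Rightarrow> real" where "ce n x = sqrt (2/pi) * cos (W n * x)"

lemma W_ge_1: "W n \<ge> 1" and W_pos: "W n > 0" and W_nonzero [simp]: "W n \<noteq> 0"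
  by (auto simp: W_def)

lemma se_bound: "\<bar>se n x\<bar> \<le> 1" and ce_bound: "\<bar>ce n x\<bar> \<le> 1"
proof -
  have "sqrt (2/pi) \<le> 1" using pi_ge_two by simp
  then show "\<bar>se n x\<bar> \<le> 1" "\<bar>ce n x\<bar> \<le> 1"
    using abs_sin_le_one[of "W n * x"] abs_cos_le_one[of "W n * x"] 
    unfolding se_def ce_def abs_mult by (auto intro!: mult_le_one)
qed

lemma DERIV_se: "(se n has_real_derivative W n * ce n x) (at x)"
  unfolding se_def[abs_def] ce_def by (auto intro!: derivative_eq_intros)

lemma DERIV_ce: "(ce n has_real_derivative - W n * se n x) (at x)"
  unfolding ce_def[abs_def] se_def by (auto intro!: derivative_eq_intros)

lemma continuous_on_se [continuous_intros]: "continuous_on A (se n)"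
  and continuous_on_ce [continuous_intros]: "continuous_on A (ce n)"
  unfolding se_def[abs_def] ce_def[abs_def] by (intro continuous_intros)+

lemma se_L2: "se n \<in> L2" and ce_L2: "ce n \<in> L2"
  by (rule L2_continuous, rule continuous_on_se, rule L2_continuous, rule continuous_on_ce)

lemma integral_cos_mu: "(\<integral>x. cos (real_of_int k * x) \<partial>mu) = (if k = 0 then pi else 0)"
proof (cases "k = 0")
  case True then show ?thesis using measure_mu by simp
next
  case False
  have "(\<integral>x. cos (real_of_int k * x) \<partial>mu) = sin (real_of_int k * pi) / k - sin (real_of_int k * 0) / k"
    by (rule mu_FTC) (use False in \<open>auto intro!: derivative_eq_intros continuous_intros\<close>)
  then show ?thesis using False by (simp add: mult.commute)
qed

text \<open>The product formulas reduce each inner product to integrals of cos(k x) with integer k,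
  which vanish unless k = 0. The sum of two frequencies is m + n + 2 > 0, so only the difference m -
  n can contribute.\<close>

lemma orthonormal_se: "orthonormal se" and orthonormal_ce: "orthonormal ce"
proof -
  have ci: "integrable mu (\<lambda>x. cos (c * x))" for c by (rule integrable_bounded[where B=1])
      (auto intro!: borel_measurable_mu_continuous continuous_intros)
  have sq: "(sqrt (2/pi) * a) * (sqrt (2/pi) * b) = (2/pi) * (a * b)" for a b
  proof -
    have "(sqrt (2/pi) * a) * (sqrt (2/pi) * b) = (sqrt (2/pi) * sqrt (2/pi)) * (a * b)"
      by (simp only: ac_simps)
    also have "sqrt (2/pi) * sqrt (2/pi) = 2/pi" by simp
    finally show ?thesis .
  qed
  have e: "se m x * se n x = (1/pi) * (cos (real_of_int (int m - int n) * x) - cos (real_of_int (int m + int n + 2) * x))"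
          "ce m x * ce n x = (1/pi) * (cos (real_of_int (int m - int n) * x) + cos (real_of_int (int m + int n + 2) * x))" for m n x
  proof -
    have "se m x * se n x = (2/pi) * (sin (W m * x) * sin (W n * x))"
      unfolding se_def by (rule sq)
    also have "\<dots> = (1/pi) * (cos (W m * x - W n * x) - cos (W m * x + W n * x))"
      by (simp add: sin_times_sin field_simps)
    finally show "se m x * se n x = (1/pi) * (cos (real_of_int (int m - int n) * x) - cos (real_of_int (int m + int n + 2) * x))"
      by (simp add: W_def algebra_simps)
    have "ce m x * ce n x = (2/pi) * (cos (W m * x) * cos (W n * x))"
      unfolding ce_def by (rule sq)
    also have "\<dots> = (1/pi) * (cos (W m * x - W n * x) + cos (W m * x + W n * x))"
      by (simp add: cos_times_cos field_simps)
    finally show "ce m x * ce n x = (1/pi) * (cos (real_of_int (int m - int n) * x) + cos (real_of_int (int m + int n + 2) * x))"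
      by (simp add: W_def algebra_simps)
  qed
  have k: "int m + int n + 2 \<noteq> 0" for m n by simp
  show "orthonormal se" "orthonormal ce"
    unfolding orthonormal_def l2_inner_mu e
    by (simp_all only: integral_mult_right_zero Bochner_Integration.integral_diff Bochner_Integration.integral_add
         ci integral_cos_mu k se_L2 ce_L2) auto
qed

text \<open>The sign of v is almost everywhere the limit of continuous functions. Clamped to [-1, 1]
  these are dominated, so orthogonality passes to the limit and shows that |v| has integral
  0.\<close>

lemma continuous_orthogonal_imp_ae_zero:
  assumes v: "integrable mu v" and orth: "\<And>h. continuous_on UNIV h \<Longrightarrow> (\<integral>x. v x * h x \<partial>mu) = 0"
  shows "ae_eq v (\<lambda>x. 0)"
proof -
  have vm [measurable]: "v \<in> borel_measurable mu" using v by auto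
  have "(\<lambda>x. sgn (v x)) \<in> borel_measurable mu" by measurable
  then have "(\<lambda>x. indicator I0pi x *\<^sub>R sgn (v x)) \<in> borel_measurable lborel"
    unfolding mu_def by (subst (asm) borel_measurable_restrict_space_iff) (auto simp: I0pi_def)
  then have "(\<lambda>x. indicator I0pi x *\<^sub>R sgn (v x)) \<in> borel_measurable lebesgue"
    by (rule measurable_completion)
  then have "(\<lambda>x. sgn (v x)) \<in> borel_measurable (lebesgue_on I0pi)"
    by (subst borel_measurable_restrict_space_iff) (auto simp: I0pi_def)
  then have "(\<lambda>x. sgn (v x)) measurable_on I0pi"
    by (simp add: measurable_on_iff_borel_measurable I0pi_def)
  then obtain N g where N: "negligible N" and g: "\<And>n::nat. continuous_on UNIV (g n)"
    and lim: "\<And>x. x \<notin> N \<Longrightarrow> (\<lambda>n. g n x) \<longlonglongrightarrow> (if x \<in> I0pi then sgn (v x) else 0)"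
    unfolding measurable_on_def by blast
  define h where "h n x = max (-1) (min 1 (g n x))" for n x
  have hc: "continuous_on UNIV (h n)" for n unfolding h_def by (intro continuous_intros g)
  have hm [measurable]: "h n \<in> borel_measurable mu" for n
    by (intro borel_measurable_mu_continuous continuous_on_subset[OF hc]) auto
  have "AE x in lebesgue. x \<notin> N" using N by (simp add: negligible_iff_null_sets AE_not_in)
  then have "AE x in lborel. x \<notin> N" by (simp add: AE_completion_iff)
  then have "AE x in mu. x \<notin> N"
    unfolding mu_def by (subst AE_restrict_space_iff) (auto simp: I0pi_def elim: eventually_mono)
  then have ae: "AE x in mu. (\<lambda>n. v x * h n x) \<longlonglongrightarrow> \<bar>v x\<bar>"
    using AE_space
  proof eventually_elim
    case (elim x)
    then have "(\<lambda>n. v x * h n x) \<longlonglongrightarrow> v x * max (-1) (min 1 (sgn (v x)))"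
      using lim[of x] unfolding h_def by (auto intro!: tendsto_intros simp: I0pi_def)
    moreover have "v x * max (-1) (min 1 (sgn (v x))) = \<bar>v x\<bar>" by (auto simp: sgn_if)
    ultimately show ?case by (simp only:)
  qed
  have "(\<lambda>n. \<integral>x. v x * h n x \<partial>mu) \<longlonglongrightarrow> (\<integral>x. \<bar>v x\<bar> \<partial>mu)"
  proof (rule integral_dominated_convergence[where w="\<lambda>x. \<bar>v x\<bar>"])
    show "AE x in mu. norm (v x * h n x) \<le> \<bar>v x\<bar>" for n
    proof (intro AE_I2)
      fix x
      have "\<bar>h n x\<bar> \<le> 1" by (auto simp: h_def)
      then have "\<bar>v x\<bar> * \<bar>h n x\<bar> \<le> \<bar>v x\<bar> * 1" by (intro mult_left_mono) auto
      then show "norm (v x * h n x) \<le> \<bar>v x\<bar>" by (simp add: abs_mult)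
    qed
  qed (use v ae in auto)
  then have "(\<integral>x. \<bar>v x\<bar> \<partial>mu) = 0" using orth[OF hc] by (simp add: LIMSEQ_const_iff)
  then have "AE x in mu. \<bar>v x\<bar> = 0" using v by (subst (asm) integral_nonneg_eq_0_iff_AE) auto
  then show ?thesis by (simp add: ae_eq_iff)
qed

text \<open>Orthogonality to sin(n x) for all n means that u sin is orthogonal to all polynomials in
  cos x. Since cosine maps (0, pi) injectively into [-1, 1], Weierstrass approximation of h o arccos
  makes these polynomials uniformly dense among the continuous functions, and sin x > 0 inside the
  interval gives u = 0.\<close>

lemma sine_complete:
  assumes u: "u \<in> L2" and z: "\<And>n. l2_inner u (se n) = 0"
  shows "ae_eq u (\<lambda>x. 0)"
proof -
  define s where "s = (\<lambda>(n::nat) x::real. sin (real n * x))"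
  have cL2: "(\<lambda>x. s n x * cos x ^ k) \<in> L2" for n k
    unfolding s_def by (intro L2_continuous continuous_intros)
  \<comment> \<open>Induction on k via sin(n x) cos x = (sin((n+1) x) + sin((n-1) x)) / 2. The index
    n is the true frequency here and may be 0, where the function vanishes.\<close>
  have sk: "l2_inner u (\<lambda>x. s n x * cos x ^ k) = 0" for n k
  proof (induction k arbitrary: n)
    case 0
    show ?case
    proof (cases n)
      case 0 then show ?thesis by (simp add: s_def l2_inner_mu)
    next
      case (Suc m)
      have "l2_inner u (se m) = sqrt (2/pi) * l2_inner u (s n)"
        unfolding se_def s_def Suc W_def by (rule l2_inner_scale_right)
      then show ?thesis using z[of m] by simp
    qed
  next
    case (Suc k)
    show ?case
    proof (cases n)
      case 0 then show ?thesis by (simp add: s_def l2_inner_mu)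
    next
      case (Suc m)
      have "s n x * cos x ^ Suc k = (1/2) * (s (Suc n) x * cos x ^ k + s m x * cos x ^ k)" for x
      proof -
        have "s n x * cos x = (sin (real n * x + x) + sin (real n * x - x)) / 2"
          unfolding s_def by (rule sin_times_cos)
        also have "\<dots> = (s (Suc n) x + s m x) / 2" unfolding s_def Suc by (simp add: algebra_simps)
        finally have "s n x * cos x = (s (Suc n) x + s m x) / 2" .
        then have "(s n x * cos x) * cos x ^ k = ((s (Suc n) x + s m x) / 2) * cos x ^ k" by (rule arg_cong)
        then show ?thesis by (simp add: algebra_simps)
      qed
      then have "l2_inner u (\<lambda>x. s n x * cos x ^ Suc k)
          = (1/2) * l2_inner u (\<lambda>x. s (Suc n) x * cos x ^ k + s m x * cos x ^ k)"
        by (simp only: l2_inner_scale_right)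
      then show ?thesis
        using Suc.IH u by (simp add: l2_inner_add_right cL2 del: power_Suc)
    qed
  qed
  define v where "v x = u x * sin x" for x
  have sL2: "sin \<in> L2" by (intro L2_continuous continuous_intros)
  have v: "integrable mu v" unfolding v_def by (rule L2_integrable_mult[OF u sL2])
  have vk: "(\<integral>x. v x * cos x ^ k \<partial>mu) = 0" for k
    using sk[of 1 k] by (simp add: l2_inner_mu s_def v_def mult.assoc)
  have ib: "integrable mu (\<lambda>x. v x * h x)" if h: "continuous_on UNIV h" for h :: "real \<Rightarrow> real"
    using L2_integrable_mult[OF u L2_continuous[of "\<lambda>x. sin x * h x"]] h
    by (simp add: v_def mult.assoc continuous_intros)
  have "(\<integral>x. v x * h x \<partial>mu) = 0" if h: "continuous_on UNIV h" for h :: "real \<Rightarrow> real"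
  proof -
    have "\<bar>\<integral>x. v x * h x \<partial>mu\<bar> \<le> e" if e: "e > 0" for e
    proof -
      \<comment> \<open>The summand 1 keeps the denominator positive also when v vanishes almost
        everywhere.\<close>
      define d where "d = e / (1 + (\<integral>x. \<bar>v x\<bar> \<partial>mu))"
      have p: "1 + (\<integral>x. \<bar>v x\<bar> \<partial>mu) > 0" by (auto intro: add_pos_nonneg)
      then have d: "d > 0" using e by (simp add: d_def)
      have "continuous_on {-1..1} (\<lambda>y. h (arccos y))"
        by (intro continuous_intros continuous_on_compose2[OF h]) auto
      then obtain q where q: "real_polynomial_function q" "\<And>y. y \<in> {-1..1} \<Longrightarrow> \<bar>h (arccos y) - q y\<bar> < d"
        using Stone_Weierstrass_real_polynomial_function[OF compact_Icc _ d] by metis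
      obtain a n where qa: "q = (\<lambda>x. \<Sum>i\<le>n. a i * x^i)"
        using q(1) by (auto simp: real_polynomial_function_iff_sum)
      have qc: "continuous_on UNIV (\<lambda>x. q (cos x))" unfolding qa by (intro continuous_intros)
      have "(\<integral>x. v x * q (cos x) \<partial>mu) = (\<integral>x. (\<Sum>i\<le>n. a i * (v x * cos x ^ i)) \<partial>mu)"
        unfolding qa by (simp add: sum_distrib_left mult.left_commute)
      also have "\<dots> = (\<Sum>i\<le>n. a i * (\<integral>x. v x * cos x ^ i \<partial>mu))"
        by (subst Bochner_Integration.integral_sum) (auto intro!: integrable_mult_right ib continuous_intros)
      finally have "(\<integral>x. v x * q (cos x) \<partial>mu) = 0" by (simp add: vk)
      then have "\<bar>\<integral>x. v x * h x \<partial>mu\<bar> = \<bar>\<integral>x. v x * h x - v x * q (cos x) \<partial>mu\<bar>"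
        using ib[OF h] ib[OF qc] by simp
      also have "\<dots> \<le> (\<integral>x. \<bar>v x * h x - v x * q (cos x)\<bar> \<partial>mu)" by (rule integral_abs_bound)
      also have "\<dots> \<le> (\<integral>x. \<bar>v x\<bar> * d \<partial>mu)"
      proof (rule integral_mono)
        fix x assume "x \<in> space mu"
        then have "\<bar>h x - q (cos x)\<bar> < d" using q(2)[of "cos x"] by (simp add: arccos_cos)
        then have "\<bar>v x\<bar> * \<bar>h x - q (cos x)\<bar> \<le> \<bar>v x\<bar> * d" by (intro mult_left_mono) auto
        then show "\<bar>v x * h x - v x * q (cos x)\<bar> \<le> \<bar>v x\<bar> * d"
          by (simp add: abs_mult[symmetric] right_diff_distrib)
      qed (use v ib[OF h] ib[OF qc] in auto)
      also have "\<dots> = d * (\<integral>x. \<bar>v x\<bar> \<partial>mu)" by simp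
      also have "\<dots> \<le> e" using p e by (simp add: d_def field_simps)
      finally show ?thesis .
    qed
    then show ?thesis using field_le_epsilon[of "\<bar>\<integral>x. v x * h x \<partial>mu\<bar>" 0] by simp
  qed
  then have "ae_eq v (\<lambda>x. 0)" by (rule continuous_orthogonal_imp_ae_zero[OF v])
  then have "AE x in mu. v x = 0" by (simp add: ae_eq_iff)
  then have "AE x in mu. u x = 0"
    using AE_space
  proof eventually_elim
    case (elim x)
    then have "sin x > 0" by (simp add: sin_gt_zero)
    then show ?case using elim by (simp add: v_def)
  qed
  then show ?thesis by (simp add: ae_eq_iff)
qed

section \<open>Smooth functions with compact support\<close>

definition smooth :: "(real \<Rightarrow> real) \<Rightarrow> bool" where
  "smooth u \<longleftrightarrow> (\<forall>k x. ((deriv ^^ k) u) differentiable (at x))"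

text \<open>A family of differentiable functions that is closed under \<open>deriv\<close> contains
  all iterated derivatives of its members. Smoothness is thus reduced to an invariant, and no
  formula for higher derivatives is ever written down.\<close>

lemma smooth_coinduct:
  assumes "P u" and step: "\<And>v. P v \<Longrightarrow> (\<forall>x. v differentiable (at x)) \<and> P (deriv v)"
  shows "smooth u"
proof -
  have "P ((deriv ^^ k) u)" for k by (induction k) (use assms in auto)
  then show ?thesis using step by (auto simp: smooth_def)
qed

lemma smooth_differentiable: "smooth u \<Longrightarrow> u differentiable (at x)"
  unfolding smooth_def by (metis funpow_0)

lemma smooth_DERIV: "smooth u \<Longrightarrow> (u has_real_derivative deriv u x) (at x)"
  by (simp add: DERIV_deriv_iff_real_differentiable smooth_differentiable)

lemma smooth_deriv: "smooth u \<Longrightarrow> smooth (deriv u)"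
  unfolding smooth_def by (metis funpow_Suc_right o_apply)

lemma smooth_continuous: "smooth u \<Longrightarrow> continuous_on A u"
  by (meson continuous_at_imp_continuous_on differentiable_imp_continuous_within smooth_differentiable)

text \<open>The derivative of a sum, product or composite is again built from sums, products and
  composites, so this closure is an invariant for \<open>smooth_coinduct\<close>. In
  \<open>comp\<close> the outer function is smooth outright, so that its derivative may be composed
  again.\<close>

inductive smooth_closure :: "(real \<Rightarrow> real) \<Rightarrow> bool" where
  base: "smooth u \<Longrightarrow> smooth_closure u"
| add: "smooth_closure u \<Longrightarrow> smooth_closure v \<Longrightarrow> smooth_closure (\<lambda>x. u x + v x)"
| mult: "smooth_closure u \<Longrightarrow> smooth_closure v \<Longrightarrow> smooth_closure (\<lambda>x. u x * v x)"
| comp: "smooth u \<Longrightarrow> smooth_closure v \<Longrightarrow> smooth_closure (\<lambda>x. u (v x))"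

lemma smooth_closure_DERIV:
  "smooth_closure u \<Longrightarrow> \<exists>u'. smooth_closure u' \<and> (\<forall>x. (u has_real_derivative u' x) (at x))"
proof (induction rule: smooth_closure.induct)
  case (base u)
  then show ?case by (intro exI[of _ "deriv u"]) (auto intro: smooth_closure.base smooth_deriv smooth_DERIV)
next
  case (add u v)
  then obtain u' v' where "smooth_closure u'" "smooth_closure v'"
    "\<And>x. (u has_real_derivative u' x) (at x)" "\<And>x. (v has_real_derivative v' x) (at x)" by blast
  then show ?case
    by (intro exI[of _ "\<lambda>x. u' x + v' x"]) (auto intro!: smooth_closure.add derivative_intros)
next
  case (mult u v)
  then obtain u' v' where "smooth_closure u'" "smooth_closure v'"
    "\<And>x. (u has_real_derivative u' x) (at x)" "\<And>x. (v has_real_derivative v' x) (at x)" by blast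
  then show ?case using mult
    by (intro exI[of _ "\<lambda>x. u' x * v x + v' x * u x"])
       (auto intro!: smooth_closure.add smooth_closure.mult intro: DERIV_mult)
next
  case (comp u v)
  then obtain v' where "smooth_closure v'" "\<And>x. (v has_real_derivative v' x) (at x)" by blast
  moreover have "smooth_closure (\<lambda>x. deriv u (v x))"
    by (rule smooth_closure.comp[OF smooth_deriv]) fact+
  moreover have "\<And>x. (u has_real_derivative deriv u (v x)) (at (v x))"
    by (rule smooth_DERIV) fact
  ultimately show ?case
    by (intro exI[of _ "\<lambda>x. deriv u (v x) * v' x"] conjI smooth_closure.mult allI DERIV_chain2)
qed

lemma smooth_closure_smooth:
  assumes "smooth_closure u" shows "smooth u"
proof (rule smooth_coinduct[where P=smooth_closure, OF assms])
  fix v assume "smooth_closure v"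
  then obtain v' where v': "smooth_closure v'" "\<And>x. (v has_real_derivative v' x) (at x)"
    using smooth_closure_DERIV by blast
  then have "deriv v = v'" by (auto intro: DERIV_imp_deriv)
  then show "(\<forall>x. v differentiable (at x)) \<and> smooth_closure (deriv v)"
    using v' by (auto simp: real_differentiable_def)
qed

lemma smooth_add: "smooth u \<Longrightarrow> smooth v \<Longrightarrow> smooth (\<lambda>x. u x + v x)"
  by (rule smooth_closure_smooth) (intro smooth_closure.add smooth_closure.base)

lemma smooth_mult: "smooth u \<Longrightarrow> smooth v \<Longrightarrow> smooth (\<lambda>x. u x * v x)"
  by (rule smooth_closure_smooth) (intro smooth_closure.mult smooth_closure.base)

lemma smooth_compose: "smooth u \<Longrightarrow> smooth v \<Longrightarrow> smooth (\<lambda>x. u (v x))"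
  by (rule smooth_closure_smooth, rule smooth_closure.comp, assumption, rule smooth_closure.base)

lemma smooth_const: "smooth (\<lambda>x. c)"
  by (rule smooth_coinduct[where P="\<lambda>v. \<exists>c. v = (\<lambda>x. c)"]) auto

lemma smooth_ident: "smooth (\<lambda>x. x)"
proof (rule smooth_coinduct[where P="\<lambda>v. v = (\<lambda>x. x) \<or> (\<exists>c. v = (\<lambda>x. c))"])
  fix v :: "real \<Rightarrow> real" assume "v = (\<lambda>x. x) \<or> (\<exists>c. v = (\<lambda>x. c))"
  moreover have "deriv (\<lambda>x. x) = (\<lambda>x::real. 1)" by (rule ext) (simp add: deriv_ident)
  ultimately show "(\<forall>x. v differentiable (at x)) \<and> (deriv v = (\<lambda>x. x) \<or> (\<exists>c. deriv v = (\<lambda>x. c)))"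
    by auto
qed simp

lemma smooth_sum: "(\<And>i. i \<in> A \<Longrightarrow> smooth (u i)) \<Longrightarrow> smooth (\<lambda>x. \<Sum>i\<in>A. u i x)"
  by (induction A rule: infinite_finite_induct) (auto intro: smooth_const smooth_add)

lemma smooth_se: "smooth (se n)"
proof (rule smooth_coinduct[where P="\<lambda>v. \<exists>a b. v = (\<lambda>x. a * se n x + b * ce n x)"])
  show "\<exists>a b. se n = (\<lambda>x. a * se n x + b * ce n x)" by (rule exI[of _ 1], rule exI[of _ 0]) simp
  fix v assume "\<exists>a b. v = (\<lambda>x. a * se n x + b * ce n x)"
  then obtain a b where v: "v = (\<lambda>x. a * se n x + b * ce n x)" by blast
  have d: "(v has_real_derivative (- b * W n) * se n x + (a * W n) * ce n x) (at x)" for x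
    unfolding v by (auto intro!: derivative_eq_intros DERIV_se DERIV_ce)
  then have "deriv v = (\<lambda>x. (- b * W n) * se n x + (a * W n) * ce n x)" by (auto intro: DERIV_imp_deriv)
  then have "\<exists>a b. deriv v = (\<lambda>x. a * se n x + b * ce n x)" by blast
  with d show "(\<forall>x. v differentiable (at x)) \<and> (\<exists>a b. deriv v = (\<lambda>x. a * se n x + b * ce n x))"
    unfolding real_differentiable_def by blast
qed

section \<open>The flat function exp(-1/x) and its derivatives\<close>

definition flat :: "nat \<Rightarrow> real \<Rightarrow> real" where
  "flat k x = (if x > 0 then exp (- 1 / x) / x ^ k else 0)"

lemma power_over_fact_le_exp: "0 \<le> y \<Longrightarrow> y ^ n / fact n \<le> exp (y::real)"
  using sum_le_suminf[of "\<lambda>k. y ^ k /\<^sub>R fact k" "{n}"] sums_summable[OF exp_converges[of y]]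
    sums_unique[OF exp_converges[of y]] by (simp add: divide_inverse mult.commute)

text \<open>A single term of the exponential series at 1/x, of degree k + 1, beats the power in the
  denominator and leaves one factor x. This yields the derivative at 0 in the next lemma.\<close>

lemma flat_le: "\<bar>flat k x\<bar> \<le> fact (Suc k) * \<bar>x\<bar>"
proof (cases "x > 0")
  case True
  have "(1/x) ^ Suc k / fact (Suc k) \<le> exp (1/x)"
    using True by (intro power_over_fact_le_exp) simp
  then have "1 \<le> fact (Suc k) * x ^ Suc k * exp (1/x)"
    using True by (simp add: field_simps del: fact_Suc)
  then have "exp (- 1/x) \<le> fact (Suc k) * x ^ Suc k"
    using True by (simp add: exp_minus field_simps del: fact_Suc)
  then show ?thesis using True by (simp add: flat_def field_simps del: fact_Suc)
next
  case False
  then have "flat k x = 0" by (simp add: flat_def)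
  moreover have "0 \<le> fact (Suc k) * \<bar>x\<bar>" by (intro mult_nonneg_nonneg) auto
  ultimately show ?thesis by linarith
qed

text \<open>Differentiation raises the power in the denominator, which is why the whole family
  \<open>flat k\<close> is treated and not only exp(-1/x).\<close>

lemma DERIV_flat: "(flat k has_real_derivative flat (k+2) x - real k * flat (k+1) x) (at x)"
proof -
  consider "x > 0" | "x < 0" | "x = 0" by linarith
  then show ?thesis
  proof cases
    case 1
    have "real k * x ^ (k - Suc 0) = real k * x ^ k / x" using 1 by (cases k) auto
    then have "((\<lambda>x. exp (- 1 / x) / x ^ k) has_real_derivative flat (k+2) x - real k * flat (k+1) x) (at x)"
      using 1 by (auto intro!: derivative_eq_intros simp: flat_def) (simp add: field_simps power2_eq_square)
    moreover have ev: "\<forall>\<^sub>F y in nhds x. flat k y = exp (- 1 / y) / y ^ k"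
      using eventually_nhds_in_open[of "{0<..}" x] 1 by (auto simp: flat_def elim: eventually_mono)
    ultimately show ?thesis by (subst DERIV_cong_ev[OF refl ev refl])
  next
    case 2
    have "\<forall>\<^sub>F y in nhds x. flat k y = 0"
      using eventually_nhds_in_open[of "{..<0}" x] 2 by (auto simp: flat_def elim: eventually_mono)
    from DERIV_cong_ev[OF refl this refl, of 0] have "(flat k has_real_derivative 0) (at x)" by simp
    then show ?thesis using 2 by (simp add: flat_def)
  next
    case 3
    have "((\<lambda>h. (flat k (0 + h) - flat k 0) / h) \<longlongrightarrow> 0) (at 0)"
    proof (rule Lim_null_comparison)
      \<comment> \<open>The difference quotient of \<open>flat k\<close> at 0 is
        \<open>flat (Suc k)\<close>, so the linear bound applies to it.\<close>
      have "norm ((flat k (0 + h) - flat k 0) / h) \<le> fact (Suc (Suc k)) * \<bar>h\<bar>" for h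
      proof -
        have "(flat k (0 + h) - flat k 0) / h = flat (Suc k) h" by (simp add: flat_def)
        then show ?thesis using flat_le[of "Suc k" h] by simp
      qed
      then show "\<forall>\<^sub>F h in at 0. norm ((flat k (0 + h) - flat k 0) / h) \<le> fact (Suc (Suc k)) * \<bar>h\<bar>" by simp
      show "((\<lambda>h::real. fact (Suc (Suc k)) * \<bar>h\<bar>) \<longlongrightarrow> 0) (at 0)"
        by (auto intro!: tendsto_eq_intros)
    qed
    then show ?thesis using 3 by (simp add: DERIV_def flat_def)
  qed
qed

inductive flat_span :: "(real \<Rightarrow> real) \<Rightarrow> bool" where
  base: "flat_span (flat k)"
| lin: "flat_span u \<Longrightarrow> flat_span v \<Longrightarrow> flat_span (\<lambda>x. u x + c * v x)"

lemma smooth_flat: "smooth (flat k)"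
proof (rule smooth_coinduct[where P=flat_span, OF flat_span.base])
  fix v assume "flat_span v"
  then have "\<exists>v'. flat_span v' \<and> (\<forall>x. (v has_real_derivative v' x) (at x))"
  proof induction
    case (base k)
    have "flat_span (\<lambda>x. flat (k+2) x + (- real k) * flat (k+1) x)"
      by (intro flat_span.intros)
    then show ?case using DERIV_flat[of k] by (intro exI[of _ "\<lambda>x. flat (k+2) x + (- real k) * flat (k+1) x"]) auto
  next
    case (lin u v c)
    then obtain u' v' where "flat_span u'" "flat_span v'"
      "\<And>x. (u has_real_derivative u' x) (at x)" "\<And>x. (v has_real_derivative v' x) (at x)" by blast
    then show ?case
      by (intro exI[of _ "\<lambda>x. u' x + c * v' x"]) (auto intro!: flat_span.lin DERIV_add DERIV_cmult)
  qed
  then obtain v' where v': "flat_span v'" "\<And>x. (v has_real_derivative v' x) (at x)" by blast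
  then have "deriv v = v'" by (auto intro: DERIV_imp_deriv)
  then show "(\<forall>x. v differentiable (at x)) \<and> flat_span (deriv v)"
    using v' by (auto simp: real_differentiable_def)
qed

lemma flat_0_bounds: "0 \<le> flat 0 s" "flat 0 s \<le> 1"
  by (auto simp: flat_def)

text \<open>For the cutoff with s = K x (pi - x) - 1, the quantity s + 1 equals K x (pi - x), and
  \<open>flat 2\<close> is the derivative of \<open>flat 0\<close>; so this product measures the
  derivative of the cutoff against the vanishing of a sine mode at the ends. It is bounded uniformly
  in K here and tends to 0 for fixed x by \<open>flat_2_tendsto\<close>.\<close>

lemma flat_2_bounds: "0 \<le> (s + 1) * flat 2 s" "(s + 1) * flat 2 s \<le> 3"
proof -
  show "0 \<le> (s + 1) * flat 2 s" by (auto simp: flat_def)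
  show "(s + 1) * flat 2 s \<le> 3"
  proof (cases "s > 0")
    case True
    have "1 + 1/s + (1/s)\<^sup>2/2 \<le> exp (1/s)" using True by (intro exp_lower_Taylor_quadratic) simp
    moreover have "0 < 1/s" "0 < (1/s)\<^sup>2" using True by auto
    ultimately have "1/s + (1/s)\<^sup>2 \<le> 3 * exp (1/s)" by linarith
    moreover have "1/s + (1/s)\<^sup>2 = (s + 1) / s\<^sup>2" using True by (simp add: field_simps power2_eq_square)
    ultimately have "(s + 1) / s\<^sup>2 \<le> 3 * exp (1/s)" by simp
    then have "(s + 1) / s\<^sup>2 * exp (- 1/s) \<le> 3" using True by (simp add: exp_minus field_simps)
    then show ?thesis using True by (simp add: flat_def field_simps)
  qed (simp add: flat_def)
qed

lemma flat_0_tendsto: "(flat 0 \<longlongrightarrow> 1) at_top"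
proof (rule Lim_transform_eventually)
  have "((\<lambda>s::real. exp (- 1 * inverse s)) \<longlongrightarrow> exp (- 1 * 0)) at_top"
    by (intro tendsto_intros tendsto_inverse_0_at_top filterlim_ident)
  then show "((\<lambda>s::real. exp (- 1 / s)) \<longlongrightarrow> 1) at_top" by (simp add: field_simps)
  show "\<forall>\<^sub>F s in at_top. exp (- 1 / s) = flat 0 s"
    using eventually_gt_at_top[of 0] by eventually_elim (simp add: flat_def)
qed

lemma flat_2_tendsto: "((\<lambda>s. (s + 1) * flat 2 s) \<longlongrightarrow> 0) at_top"
proof (rule Lim_null_comparison)
  show "((\<lambda>s::real. 2 * inverse s) \<longlongrightarrow> 0) at_top"
    using tendsto_mult_right_zero[OF tendsto_inverse_0_at_top[OF filterlim_ident]] by simp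
  show "\<forall>\<^sub>F s in at_top. norm ((s + 1) * flat 2 s) \<le> 2 * inverse s"
    using eventually_ge_at_top[of 1]
  proof eventually_elim
    case (elim s)
    have "(s + 1) * (exp (- 1 / s) / s\<^sup>2) \<le> (2 * s) * (1 / s\<^sup>2)"
      using elim by (intro mult_mono divide_right_mono) auto
    then show ?case using elim by (simp add: flat_def field_simps power2_eq_square)
  qed
qed

section \<open>Sine modes as limits of test functions\<close>

lemma cutoff_filterlim:
  assumes "q > 0" shows "LIM k sequentially. real (Suc k) * q - 1 :> at_top"
proof -
  have "LIM k sequentially. q * real (Suc k) :> at_top"
    by (intro filterlim_tendsto_pos_mult_at_top[OF tendsto_const] assms
        filterlim_compose[OF filterlim_real_sequentially] filterlim_Suc)
  then have "LIM k sequentially. -1 + q * real (Suc k) :> at_top"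
    by (rule filterlim_tendsto_add_at_top[OF tendsto_const])
  then show ?thesis by (simp add: mult.commute)
qed

text \<open>Compactly supported approximations of the sine modes: \<open>flat 0\<close> tends to 1 at infinity, so
  the cutoff \<open>flat 0 (K x (\<pi> - x) - 1)\<close> tends to 1 inside the interval.\<close>

definition tst :: "nat \<Rightarrow> nat \<Rightarrow> real \<Rightarrow> real" where
  "tst n k x = flat 0 (real (Suc k) * (x * (pi - x)) - 1) * se n x"

text \<open>Let K = k + 1. At a point of (0, pi) outside the given interval one of the factors x, pi
  - x is below 1/(K pi) and the other below pi, so K x (pi - x) \<le> 1. The shift by -1 in the
  cutoff makes this a region where \<open>flat 0\<close> vanishes, and the support is
  compact.\<close>

lemma tst_support:
  assumes "x \<notin> {1/(real (Suc k) * pi) .. pi - 1/(real (Suc k) * pi)}"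
  shows "tst n k x = 0"
proof -
  let ?K = "real (Suc k)"
  have "?K * (x * (pi - x)) \<le> 1"
  proof (cases "0 < x \<and> x < pi")
    case True
    have p: "?K * pi > 0" by simp
    from assms consider "x < 1/(?K * pi)" | "pi - x < 1/(?K * pi)" by fastforce
    then have "x * (pi - x) \<le> 1/(?K * pi) * pi"
    proof cases
      case 1
      then show ?thesis using True p by (intro mult_mono) (auto intro: less_imp_le)
    next
      case 2
      then have "(pi - x) * x \<le> 1/(?K * pi) * pi" using True p by (intro mult_mono) (auto intro: less_imp_le)
      then show ?thesis by (simp only: mult.commute)
    qed
    then have "?K * (x * (pi - x)) \<le> ?K * (1/(?K * pi) * pi)" by (intro mult_left_mono) auto
    also have "\<dots> = 1" by (simp del: of_nat_Suc)
    finally show ?thesis .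
  next
    case False
    then consider "x \<le> 0" | "x \<ge> pi" by linarith
    then have "x * (pi - x) \<le> 0"
    proof cases
      case 1 then show ?thesis using pi_gt_zero by (intro mult_nonpos_nonneg) linarith+
    next
      case 2 then show ?thesis using pi_gt_zero by (intro mult_nonneg_nonpos) linarith+
    qed
    then have "?K * (x * (pi - x)) \<le> 0" by (rule mult_nonneg_nonpos[rotated]) simp
    then show ?thesis by simp
  qed
  then show ?thesis by (simp add: tst_def flat_def)
qed

lemma smooth_cutoff: "smooth (\<lambda>x. flat 0 (real (Suc k) * (x * (pi - x)) - 1))"
proof -
  have "smooth (\<lambda>x. real (Suc k) * (x * (pi + (-1) * x)) + (-1))"
    by (intro smooth_add smooth_mult smooth_const smooth_ident)
  then have "smooth (\<lambda>x. flat 0 (real (Suc k) * (x * (pi + (-1) * x)) + (-1)))"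
    by (rule smooth_compose[OF smooth_flat])
  then show ?thesis by simp
qed

lemma smooth_tst: "smooth (tst n k)"
  unfolding tst_def[abs_def] by (intro smooth_mult smooth_cutoff smooth_se)

lemma test_fun_iff: "test_fun u \<longleftrightarrow> smooth u \<and>
     (\<exists>a b. 0 < a \<and> a \<le> b \<and> b < pi \<and> (\<forall>x. x \<notin> {a..b} \<longrightarrow> u x = 0))"
  by (simp add: test_fun_def smooth_def)

lemma test_fun_sum_tst: "test_fun (\<lambda>x. \<Sum>n\<in>A. a n * tst n k x)"
  unfolding test_fun_iff
proof (intro conjI exI allI impI)
  let ?d = "1/(real (Suc k) * pi)"
  have "1 * 2 \<le> real (Suc k) * pi" using pi_ge_two by (intro mult_mono) auto
  then have "?d \<le> 1/2" by (intro divide_left_mono) auto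
  then show "?d \<le> pi - ?d" using pi_ge_two by linarith
  show "pi - ?d < pi" "0 < ?d" by simp_all
  show "smooth (\<lambda>x. \<Sum>n\<in>A. a n * tst n k x)"
    by (intro smooth_sum smooth_mult smooth_const smooth_tst)
  fix x assume "x \<notin> {?d .. pi - ?d}"
  then have "tst n k x = 0" for n by (rule tst_support)
  then show "(\<Sum>n\<in>A. a n * tst n k x) = 0" by simp
qed

lemma test_fun_tst: "test_fun (tst n k)"
  using test_fun_sum_tst[where A="{n}" and a="\<lambda>_. 1" and k=k] by simp

lemma deriv_tst:
  "(tst n k has_real_derivative flat 0 (real (Suc k) * (x * (pi - x)) - 1) * (W n * ce n x)
     + flat 2 (real (Suc k) * (x * (pi - x)) - 1) * (real (Suc k) * (pi - 2 * x)) * se n x) (at x)"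
proof -
  have "(flat 0 has_real_derivative flat 2 s) (at s)" for s
    using DERIV_flat[of 0 s] by (simp add: numeral_2_eq_2)
  moreover have "((\<lambda>x. real (Suc k) * (x * (pi - x)) - 1) has_real_derivative real (Suc k) * (pi - 2 * x)) (at x)"
    by (auto intro!: derivative_eq_intros simp: algebra_simps)
  ultimately have "((\<lambda>x. flat 0 (real (Suc k) * (x * (pi - x)) - 1)) has_real_derivative
      flat 2 (real (Suc k) * (x * (pi - x)) - 1) * (real (Suc k) * (pi - 2 * x))) (at x)"
    by (rule DERIV_chain2)
  from DERIV_mult[OF this DERIV_se[of n x]] show ?thesis
    unfolding tst_def[abs_def] by (simp only: ac_simps)
qed

text \<open>Near each end the mode is bounded by its slope times the distance to that end. Averaging
  the two bounds with weights pi - x and x produces the factor x (pi - x), which absorbs the factor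
  K from the derivative of the cutoff.\<close>

lemma se_boundary_bound:
  assumes "0 \<le> x" "x \<le> pi" shows "pi * \<bar>se n x\<bar> \<le> 2 * W n * (x * (pi - x))"
proof -
  have 1: "\<bar>se n x\<bar> \<le> \<bar>sin (W n * x)\<bar>"
  proof -
    have "sqrt (2/pi) \<le> 1" using pi_ge_two by simp
    then show ?thesis unfolding se_def abs_mult by (simp add: mult_left_le_one_le)
  qed
  have 2: "\<bar>sin (W n * x)\<bar> \<le> W n * x"
    using abs_sin_x_le_abs_x[of "W n * x"] assms W_pos[of n] by simp
  have "sin (W n * x) = sin (W n * pi - W n * (pi - x))" by (simp add: algebra_simps)
  also have "\<dots> = - cos (W n * pi) * sin (W n * (pi - x))"
    unfolding sin_diff by (simp add: W_def sin_npi del: of_nat_Suc)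
  finally have "\<bar>sin (W n * x)\<bar> \<le> \<bar>sin (W n * (pi - x))\<bar>"
    by (simp add: abs_mult mult_left_le_one_le)
  also have "\<dots> \<le> W n * (pi - x)"
    using abs_sin_x_le_abs_x[of "W n * (pi - x)"] assms W_pos[of n] by (simp add: abs_mult)
  finally have 3: "\<bar>sin (W n * x)\<bar> \<le> W n * (pi - x)" .
  have "(pi - x) * \<bar>se n x\<bar> \<le> (pi - x) * (W n * x)" "x * \<bar>se n x\<bar> \<le> x * (W n * (pi - x))"
    using 1 2 3 assms by (auto intro!: mult_left_mono)
  then show ?thesis by (simp add: algebra_simps)
qed

lemma continuous_on_deriv_tst: "continuous_on A (deriv (tst n k))"
  by (intro smooth_continuous smooth_deriv smooth_tst)

lemma tst_tendsto: "(\<lambda>k. l2_norm (\<lambda>x. tst n k x - se n x)) \<longlonglongrightarrow> 0"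
proof (rule l2_tendsto_dominated[where B=1])
  show "tst n k \<in> borel_measurable mu" for k
    by (intro borel_measurable_mu_continuous smooth_continuous smooth_tst)
  show "se n \<in> borel_measurable mu" by (intro L2_measurable se_L2)
  show "AE x in mu. (\<lambda>k. tst n k x) \<longlonglongrightarrow> se n x"
  proof (rule AE_I2)
    fix x assume "x \<in> space mu"
    then have q: "x * (pi - x) > 0" by simp
    define q where "q = x * (pi - x)"
    have "(\<lambda>k. flat 0 (real (Suc k) * q - 1)) \<longlonglongrightarrow> 1"
      using q unfolding q_def[symmetric] by (intro filterlim_compose[OF flat_0_tendsto] cutoff_filterlim)
    then show "(\<lambda>k. tst n k x) \<longlonglongrightarrow> se n x"
      unfolding tst_def q_def by (auto intro!: tendsto_eq_intros)
  qed
  show "AE x in mu. \<bar>tst n k x - se n x\<bar> \<le> 1" for k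
  proof (rule AE_I2)
    fix x
    let ?f = "flat 0 (real (Suc k) * (x * (pi - x)) - 1)"
    have "tst n k x - se n x = (?f - 1) * se n x" by (simp add: tst_def algebra_simps)
    then show "\<bar>tst n k x - se n x\<bar> \<le> 1"
      using flat_0_bounds[of "real (Suc k) * (x * (pi - x)) - 1"] se_bound[of n x]
      by (auto simp: abs_mult intro!: mult_le_one)
  qed
qed

text \<open>The product rule gives the cutoff times the derivative of the mode, plus the mode times
  the derivative of the cutoff, which carries a factor K. Since the mode vanishes at the ends, the
  second term stays below 6 W n and tends to 0 pointwise; together with the first term this gives
  the dominating constant 7 W n.\<close>

lemma deriv_tst_tendsto: "(\<lambda>k. l2_norm (\<lambda>x. deriv (tst n k) x - W n * ce n x)) \<longlonglongrightarrow> 0"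
proof (rule l2_tendsto_dominated[where B="7 * W n"])
  have d: "deriv (tst n k) x = flat 0 (real (Suc k) * (x * (pi - x)) - 1) * (W n * ce n x)
     + flat 2 (real (Suc k) * (x * (pi - x)) - 1) * (real (Suc k) * (pi - 2 * x)) * se n x" for k x
    by (rule DERIV_imp_deriv[OF deriv_tst])
  show "deriv (tst n k) \<in> borel_measurable mu" for k
    by (intro borel_measurable_mu_continuous continuous_on_deriv_tst)
  show "(\<lambda>x. W n * ce n x) \<in> borel_measurable mu" by (intro L2_measurable L2_scale ce_L2)
  show "AE x in mu. (\<lambda>k. deriv (tst n k) x) \<longlonglongrightarrow> W n * ce n x"
  proof (rule AE_I2)
    fix x assume "x \<in> space mu"
    then have q: "x * (pi - x) > 0" by simp
    define q where "q = x * (pi - x)"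
    have f0: "(\<lambda>k. flat 0 (real (Suc k) * q - 1)) \<longlonglongrightarrow> 1"
      using q unfolding q_def[symmetric] by (intro filterlim_compose[OF flat_0_tendsto] cutoff_filterlim)
    have "(\<lambda>k. (real (Suc k) * q - 1 + 1) * flat 2 (real (Suc k) * q - 1)) \<longlonglongrightarrow> 0"
      using q unfolding q_def[symmetric] by (intro filterlim_compose[OF flat_2_tendsto] cutoff_filterlim)
    then have "(\<lambda>k. ((real (Suc k) * q - 1 + 1) * flat 2 (real (Suc k) * q - 1)) / q) \<longlonglongrightarrow> 0"
      by (rule tendsto_divide_zero)
    then have f2: "(\<lambda>k. flat 2 (real (Suc k) * q - 1) * real (Suc k)) \<longlonglongrightarrow> 0"
      using q unfolding q_def[symmetric] by (simp add: mult.commute del: of_nat_Suc)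
    have "(\<lambda>k. flat 0 (real (Suc k) * q - 1) * (W n * ce n x)
       + (flat 2 (real (Suc k) * q - 1) * real (Suc k)) * ((pi - 2 * x) * se n x))
       \<longlonglongrightarrow> 1 * (W n * ce n x) + 0 * ((pi - 2 * x) * se n x)"
      by (intro tendsto_intros f0 f2)
    then show "(\<lambda>k. deriv (tst n k) x) \<longlonglongrightarrow> W n * ce n x"
      unfolding d q_def by (simp add: mult_ac)
  qed
  show "AE x in mu. \<bar>deriv (tst n k) x - W n * ce n x\<bar> \<le> 7 * W n" for k
  proof (rule AE_I2)
    fix x assume x: "x \<in> space mu"
    define K s where "K = real (Suc k)" and "s = K * (x * (pi - x)) - 1"
    have "deriv (tst n k) x - W n * ce n x = (flat 0 s - 1) * (W n * ce n x) + flat 2 s * K * ((pi - 2 * x) * se n x)"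
      unfolding d s_def K_def by (simp add: algebra_simps)
    then have "\<bar>deriv (tst n k) x - W n * ce n x\<bar> \<le> \<bar>(flat 0 s - 1) * (W n * ce n x)\<bar> + \<bar>flat 2 s * K * ((pi - 2 * x) * se n x)\<bar>"
      by (metis abs_triangle_ineq)
    moreover have "\<bar>(flat 0 s - 1) * (W n * ce n x)\<bar> \<le> 1 * (W n * 1)"
      unfolding abs_mult using flat_0_bounds[of s] ce_bound[of n x] W_pos[of n]
      by (intro mult_mono) auto
    moreover have "\<bar>flat 2 s * K * ((pi - 2 * x) * se n x)\<bar> \<le> 6 * W n"
    proof -
      have f2: "flat 2 s \<ge> 0" and K: "K \<ge> 0" by (auto simp: flat_def K_def)
      have "\<bar>(pi - 2 * x) * se n x\<bar> \<le> pi * \<bar>se n x\<bar>"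
        unfolding abs_mult using x by (intro mult_right_mono) auto
      also have "\<dots> \<le> 2 * W n * (x * (pi - x))" using x by (intro se_boundary_bound) auto
      finally have "(flat 2 s * K) * \<bar>(pi - 2 * x) * se n x\<bar> \<le> (flat 2 s * K) * (2 * W n * (x * (pi - x)))"
        using f2 K by (intro mult_left_mono) auto
      also have "\<dots> = 2 * W n * ((s + 1) * flat 2 s)" by (simp add: s_def)
      also have "\<dots> \<le> 2 * W n * 3" using flat_2_bounds[of s] W_pos[of n] by (intro mult_left_mono) auto
      finally show ?thesis using f2 K by (simp add: abs_mult)
    qed
    ultimately show "\<bar>deriv (tst n k) x - W n * ce n x\<bar> \<le> 7 * W n" by linarith
  qed
qed

section \<open>Weak derivatives and sine coefficients\<close>

lemma test_fun_smooth: "test_fun \<phi> \<Longrightarrow> smooth \<phi>"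
  by (simp add: test_fun_iff)

lemma test_fun_L2: "test_fun \<phi> \<Longrightarrow> \<phi> \<in> L2"
  by (intro L2_continuous smooth_continuous test_fun_smooth)

lemma test_fun_deriv_L2: "test_fun \<phi> \<Longrightarrow> deriv \<phi> \<in> L2"
  by (intro L2_continuous smooth_continuous smooth_deriv test_fun_smooth)

lemma test_fun_zero: assumes "test_fun \<phi>" shows "\<phi> 0 = 0" "\<phi> pi = 0"
proof -
  from assms obtain a b where "0 < a" "b < pi" "\<And>x. x \<notin> {a..b} \<Longrightarrow> \<phi> x = 0"
    by (auto simp: test_fun_iff)
  then show "\<phi> 0 = 0" "\<phi> pi = 0" by auto
qed

lemma weak_deriv_iff:
  "weak_deriv u g \<longleftrightarrow> (\<forall>\<phi>. test_fun \<phi> \<longrightarrow> l2_inner u (deriv \<phi>) = - l2_inner g \<phi>)"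
  by (simp add: weak_deriv_def l2_inner_def)

lemma l2_inner_by_parts:
  assumes F: "\<And>x. (F has_real_derivative F' x) (at x)" "continuous_on UNIV F'" and \<phi>: "test_fun \<phi>"
  shows "l2_inner F (deriv \<phi>) = - l2_inner F' \<phi>"
proof -
  have cF: "continuous_on UNIV F" using F(1) by (meson DERIV_isCont continuous_at_imp_continuous_on)
  note c = smooth_continuous[OF test_fun_smooth[OF \<phi>], of UNIV]
    smooth_continuous[OF smooth_deriv[OF test_fun_smooth[OF \<phi>]], of UNIV]
  have "(\<integral>x. F x * deriv \<phi> x + F' x * \<phi> x \<partial>mu) = F pi * \<phi> pi - F 0 * \<phi> 0"
    by (rule mu_FTC[where F="\<lambda>x. F x * \<phi> x"])
       (auto intro!: derivative_eq_intros F(1) smooth_DERIV test_fun_smooth[OF \<phi>] continuous_intros c cF F(2))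
  also have "(\<integral>x. F x * deriv \<phi> x + F' x * \<phi> x \<partial>mu) = l2_inner F (deriv \<phi>) + l2_inner F' \<phi>"
    unfolding l2_inner_mu
    by (intro Bochner_Integration.integral_add L2_integrable_mult L2_continuous c cF F(2))
  finally show ?thesis by (simp add: test_fun_zero[OF \<phi>])
qed

lemma weak_deriv_test: "test_fun \<phi> \<Longrightarrow> weak_deriv \<phi> (deriv \<phi>)"
  unfolding weak_deriv_iff
  by (intro allI impI l2_inner_by_parts smooth_DERIV smooth_continuous smooth_deriv test_fun_smooth)

lemma weak_deriv_diff:
  assumes "weak_deriv u g" "weak_deriv v h" "u \<in> L2" "v \<in> L2" "g \<in> L2" "h \<in> L2"
  shows "weak_deriv (\<lambda>x. u x - v x) (\<lambda>x. g x - h x)"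
  using assms unfolding weak_deriv_iff
  by (auto simp: l2_inner_diff_left test_fun_L2 test_fun_deriv_L2)

definition coef :: "(real \<Rightarrow> real) \<Rightarrow> nat \<Rightarrow> real" where "coef u n = l2_inner u (se n)"

text \<open>Each sine mode is an L2 limit of the test functions \<open>tst n k\<close>, so
  orthogonality to test functions implies orthogonality to the complete system of sines.\<close>

lemma test_orthogonal_imp_ae_zero:
  assumes "v \<in> L2" "\<And>\<phi>. test_fun \<phi> \<Longrightarrow> l2_inner v \<phi> = 0"
  shows "ae_eq v (\<lambda>x. 0)"
proof (rule sine_complete[OF assms(1)])
  fix n
  have "(\<lambda>k. l2_inner (tst n k) v) \<longlonglongrightarrow> l2_inner (se n) v"
    by (rule l2_inner_tendsto[OF test_fun_L2[OF test_fun_tst] se_L2 assms(1) tst_tendsto])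
  then show "l2_inner v (se n) = 0"
    using assms(2)[OF test_fun_tst] by (simp add: l2_inner_commute[of _ v] LIMSEQ_const_iff)
qed

lemma ae_eq_diff_zero: "ae_eq (\<lambda>x. u x - v x) (\<lambda>x. 0) \<longleftrightarrow> ae_eq u v"
  by (simp add: ae_eq_iff)

lemma ae_eq_sym: "ae_eq u v \<Longrightarrow> ae_eq v u"
  unfolding ae_eq_iff by (auto elim: eventually_mono)

lemma ae_eq_refl: "ae_eq u u" by (simp add: ae_eq_def)

lemma weak_deriv_unique:
  assumes "weak_deriv u g" "weak_deriv u h" "g \<in> L2" "h \<in> L2"
  shows "ae_eq g h"
proof -
  have "ae_eq (\<lambda>x. g x - h x) (\<lambda>x. 0)"
    using assms
    by (intro test_orthogonal_imp_ae_zero L2_diff) (auto simp: l2_inner_diff_left test_fun_L2 weak_deriv_iff)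
  then show ?thesis by (simp add: ae_eq_diff_zero)
qed

lemma wd_weak_deriv:
  assumes "weak_deriv u g" "g \<in> L2"
  shows "wd u \<in> L2" "weak_deriv u (wd u)" "ae_eq (wd u) g"
proof -
  show *: "wd u \<in> L2" "weak_deriv u (wd u)"
    unfolding wd_def using someI[of "\<lambda>g. g \<in> L2 \<and> weak_deriv u g" g] assms by auto
  show "ae_eq (wd u) g" using * assms by (intro weak_deriv_unique)
qed

lemma l2_norm_cong_ae:
  "ae_eq u v \<Longrightarrow> u \<in> L2 \<Longrightarrow> v \<in> L2 \<Longrightarrow> l2_norm u = l2_norm v"
  unfolding l2_norm_eq by (subst l2_inner_cong_ae[of u v u v]) (auto intro: L2_measurable)

lemma coef_cong_ae: "ae_eq u v \<Longrightarrow> u \<in> L2 \<Longrightarrow> v \<in> L2 \<Longrightarrow> coef u n = coef v n"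
  unfolding coef_def by (intro l2_inner_cong_ae) (auto intro: L2_measurable se_L2 ae_eq_refl)

lemma coef_diff: "u \<in> L2 \<Longrightarrow> v \<in> L2 \<Longrightarrow> coef (\<lambda>x. u x - v x) n = coef u n - coef v n"
  by (simp add: coef_def l2_inner_diff_left se_L2)

lemma coef_add: "u \<in> L2 \<Longrightarrow> v \<in> L2 \<Longrightarrow> coef (\<lambda>x. u x + v x) n = coef u n + coef v n"
  by (simp add: coef_def l2_inner_add_left se_L2)

lemma coef_scale: "coef (\<lambda>x. a * u x) n = a * coef u n"
  by (simp add: coef_def l2_inner_scale_left)

lemma coef_divide: "coef (\<lambda>x. u x / a) n = coef u n / a"
  by (simp add: coef_def l2_inner_divide_left)

lemma coef_se: "coef (se m) n = (if m = n then 1 else 0)"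
  by (simp add: coef_def orthonormal_inner[OF orthonormal_se])

lemma coef_eq_imp_ae_eq:
  assumes "u \<in> L2" "v \<in> L2" "\<And>n. coef u n = coef v n" shows "ae_eq u v"
  using sine_complete[OF L2_diff[OF assms(1,2)]] assms coef_diff[OF assms(1,2)]
  by (simp add: coef_def ae_eq_diff_zero)

lemma l2_expands_cong_ae:
  assumes "l2_expands \<phi> a u" "ae_eq u v" "v \<in> L2" "orthonormal \<phi>"
  shows "l2_expands \<phi> a v"
proof -
  have "l2_norm (\<lambda>x. (\<Sum>n<N. a n * \<phi> n x) - u x) = l2_norm (\<lambda>x. (\<Sum>n<N. a n * \<phi> n x) - v x)" for N
    using assms by (intro l2_norm_cong_ae L2_diff orthonormal_sum_L2)
      (auto simp: l2_expands_def ae_eq_iff elim: eventually_mono)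
  then show ?thesis using assms by (simp add: l2_expands_def)
qed

text \<open>Riesz-Fischer supplies a function with the same coefficients, and completeness of the
  sines identifies it with u.\<close>

lemma l2_expands_se: assumes "u \<in> L2" shows "l2_expands se (coef u) u"
proof -
  obtain v where v: "l2_expands se (coef u) v"
    using Riesz_Fischer[OF orthonormal_se, of "coef u"] Bessel(1)[OF orthonormal_se assms]
    by (auto simp: coef_def)
  have "ae_eq v u"
    using l2_expands_coeff[OF orthonormal_se v] v assms
    by (intro coef_eq_imp_ae_eq) (auto simp: coef_def l2_expands_def)
  then show ?thesis using v assms by (intro l2_expands_cong_ae[OF v] orthonormal_se)
qed

lemma parseval: "u \<in> L2 \<Longrightarrow> v \<in> L2 \<Longrightarrow> (\<lambda>n. coef u n * coef v n) sums l2_inner u v"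
  by (intro l2_expands_parseval[OF orthonormal_se] l2_expands_se)

lemma parseval_norm: assumes "u \<in> L2"
  shows "summable (\<lambda>n. (coef u n)\<^sup>2)" "(l2_norm u)\<^sup>2 = (\<Sum>n. (coef u n)\<^sup>2)"
  using parseval[OF assms assms]
  by (auto simp: power2_eq_square l2_norm_power2[unfolded power2_eq_square] sums_iff)

lemma coef_bound: "u \<in> L2 \<Longrightarrow> \<bar>coef u n\<bar> \<le> l2_norm u"
proof -
  assume "u \<in> L2"
  moreover have "l2_norm (se n) = 1" using orthonormal_inner[OF orthonormal_se] by (simp add: l2_norm_eq)
  ultimately show ?thesis using l2_Cauchy_Schwarz[OF _ se_L2, of u n] by (simp add: coef_def)
qed

lemma weak_deriv_se_series:
  assumes "u \<in> L2" "l2_expands se a u" "l2_expands ce (\<lambda>n. W n * a n) g"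
  shows "weak_deriv u g"
  unfolding weak_deriv_iff
proof (intro allI impI)
  fix \<phi> assume \<phi>: "test_fun \<phi>"
  have "l2_inner (se n) (deriv \<phi>) = - (W n * l2_inner (ce n) \<phi>)" for n
    using l2_inner_by_parts[OF DERIV_se _ \<phi>] by (simp add: l2_inner_scale_left continuous_intros)
  then have "(\<lambda>n. a n * - (W n * l2_inner (ce n) \<phi>)) sums l2_inner u (deriv \<phi>)"
    using l2_expands_inner[OF orthonormal_se assms(2) test_fun_deriv_L2[OF \<phi>]] by simp
  moreover have "(\<lambda>n. - (W n * a n * l2_inner (ce n) \<phi>)) sums - l2_inner g \<phi>"
    by (intro sums_minus l2_expands_inner[OF orthonormal_ce assms(3) test_fun_L2[OF \<phi>]])
  moreover have "(\<lambda>n. a n * - (W n * l2_inner (ce n) \<phi>)) = (\<lambda>n. - (W n * a n * l2_inner (ce n) \<phi>))"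
    by (simp add: mult_ac)
  ultimately show "l2_inner u (deriv \<phi>) = - l2_inner g \<phi>" by (metis sums_unique2)
qed

lemma weak_deriv_ce_series:
  assumes "l2_expands ce a g" "l2_expands se (\<lambda>n. - W n * a n) h"
  shows "weak_deriv g h"
  unfolding weak_deriv_iff
proof (intro allI impI)
  fix \<phi> assume \<phi>: "test_fun \<phi>"
  have "l2_inner (ce n) (deriv \<phi>) = W n * l2_inner (se n) \<phi>" for n
    using l2_inner_by_parts[OF DERIV_ce _ \<phi>, of n]
    by (simp add: l2_inner_scale_left[of "- W n", simplified] continuous_intros)
  then have "(\<lambda>n. a n * (W n * l2_inner (se n) \<phi>)) sums l2_inner g (deriv \<phi>)"
    using l2_expands_inner[OF orthonormal_ce assms(1) test_fun_deriv_L2[OF \<phi>]] by simp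
  moreover have "(\<lambda>n. - (- W n * a n * l2_inner (se n) \<phi>)) sums - l2_inner h \<phi>"
    by (intro sums_minus l2_expands_inner[OF orthonormal_se assms(2) test_fun_L2[OF \<phi>]])
  moreover have "(\<lambda>n. a n * (W n * l2_inner (se n) \<phi>)) = (\<lambda>n. - (- W n * a n * l2_inner (se n) \<phi>))"
    by (simp add: mult_ac)
  ultimately show "l2_inner g (deriv \<phi>) = - l2_inner h \<phi>" by (metis sums_unique2)
qed

section \<open>Spectral description of the spaces \<open>H10\<close> and
  \<open>H2H10\<close>\<close>

lemma l2_norm_sum_le:
  assumes "\<And>i. i \<in> A \<Longrightarrow> u i \<in> L2"
  shows "l2_norm (\<lambda>x. \<Sum>i\<in>A. u i x) \<le> (\<Sum>i\<in>A. l2_norm (u i))"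
  using assms
proof (induction A rule: infinite_finite_induct)
  case (insert a A)
  then show ?case
    using l2_norm_triangle[of "u a" "\<lambda>x. \<Sum>i\<in>A. u i x"] by (force intro: L2_sum)
qed (auto simp: l2_norm_def)

text \<open>Membership in \<open>H10\<close> asks for test functions close to u in the H1 norm. They
  arise in two stages: the sine series is truncated at N, then each of the finitely many modes is
  replaced by its cutoff \<open>tst n k\<close>. Both stages are controlled for u and for its
  derivative g, which makes four errors, each below e/4.\<close>

lemma H10_I:
  assumes u: "u \<in> L2" and s: "summable (\<lambda>n. (W n * coef u n)\<^sup>2)"
  shows "u \<in> H10" "l2_expands ce (\<lambda>n. W n * coef u n) (wd u)"
proof -
  obtain g where g: "l2_expands ce (\<lambda>n. W n * coef u n) g" using Riesz_Fischer[OF orthonormal_ce s] .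
  have gL2: "g \<in> L2" using g by (simp add: l2_expands_def)
  have ug: "weak_deriv u g" by (rule weak_deriv_se_series[OF u l2_expands_se[OF u] g])
  note wdu = wd_weak_deriv[OF ug gL2]
  show "l2_expands ce (\<lambda>n. W n * coef u n) (wd u)"
    by (rule l2_expands_cong_ae[OF g ae_eq_sym[OF wdu(3)] wdu(1) orthonormal_ce])
  have "\<exists>\<phi>. test_fun \<phi> \<and> h1_norm (\<lambda>x. \<phi> x - u x) < e" if e: "e > 0" for e
  proof -
    have "\<forall>\<^sub>F N in sequentially. l2_norm (\<lambda>x. (\<Sum>n<N. coef u n * se n x) - u x) < e/4 \<and>
        l2_norm (\<lambda>x. (\<Sum>n<N. (W n * coef u n) * ce n x) - g x) < e/4"
      using l2_expands_se[OF u] g e unfolding l2_expands_def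
      by (intro eventually_conj order_tendstoD(2)[where y=0]) auto
    then obtain N where N: "l2_norm (\<lambda>x. (\<Sum>n<N. coef u n * se n x) - u x) < e/4"
        "l2_norm (\<lambda>x. (\<Sum>n<N. (W n * coef u n) * ce n x) - g x) < e/4"
      using eventually_happens by fastforce
    define \<phi> where "\<phi> k x = (\<Sum>n<N. coef u n * tst n k x)" for k x
    have t: "test_fun (\<phi> k)" for k unfolding \<phi>_def by (rule test_fun_sum_tst)
    have "(\<phi> k has_real_derivative (\<Sum>n<N. coef u n * deriv (tst n k) x)) (at x)" for k x
      unfolding \<phi>_def by (auto intro!: derivative_eq_intros smooth_DERIV[OF smooth_tst] simp: mult.commute)
    then have d\<phi>: "deriv (\<phi> k) x = (\<Sum>n<N. coef u n * deriv (tst n k) x)" for k x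
      by (rule DERIV_imp_deriv)
    have "(\<lambda>k. (\<Sum>n<N. \<bar>coef u n\<bar> * l2_norm (\<lambda>x. tst n k x - se n x))) \<longlonglongrightarrow> (\<Sum>n<N. \<bar>coef u n\<bar> * 0)"
      by (intro tendsto_intros tst_tendsto)
    moreover have "(\<lambda>k. (\<Sum>n<N. \<bar>coef u n\<bar> * l2_norm (\<lambda>x. deriv (tst n k) x - W n * ce n x))) \<longlonglongrightarrow> (\<Sum>n<N. \<bar>coef u n\<bar> * 0)"
      by (intro tendsto_intros deriv_tst_tendsto)
    ultimately have "\<forall>\<^sub>F k in sequentially. (\<Sum>n<N. \<bar>coef u n\<bar> * l2_norm (\<lambda>x. tst n k x - se n x)) < e/4 \<and>
        (\<Sum>n<N. \<bar>coef u n\<bar> * l2_norm (\<lambda>x. deriv (tst n k) x - W n * ce n x)) < e/4"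
      using e by (intro eventually_conj order_tendstoD(2)[where y=0]) auto
    then obtain k where k: "(\<Sum>n<N. \<bar>coef u n\<bar> * l2_norm (\<lambda>x. tst n k x - se n x)) < e/4"
        "(\<Sum>n<N. \<bar>coef u n\<bar> * l2_norm (\<lambda>x. deriv (tst n k) x - W n * ce n x)) < e/4"
      using eventually_happens by fastforce
    note L = test_fun_L2[OF test_fun_tst] test_fun_deriv_L2[OF test_fun_tst] se_L2 L2_scale[OF ce_L2]
    have 1: "l2_norm (\<lambda>x. \<phi> k x - u x) < e/2"
    proof -
      have "\<phi> k x - u x = (\<Sum>n<N. coef u n * (tst n k x - se n x)) + ((\<Sum>n<N. coef u n * se n x) - u x)" for x
        by (simp add: \<phi>_def right_diff_distrib sum_subtractf)
      then have "l2_norm (\<lambda>x. \<phi> k x - u x) \<le> l2_norm (\<lambda>x. \<Sum>n<N. coef u n * (tst n k x - se n x))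
           + l2_norm (\<lambda>x. (\<Sum>n<N. coef u n * se n x) - u x)"
        using u by (simp only:) (intro l2_norm_triangle L2_sum L2_diff L2_scale L)
      moreover have "l2_norm (\<lambda>x. \<Sum>n<N. coef u n * (tst n k x - se n x)) \<le> (\<Sum>n<N. \<bar>coef u n\<bar> * l2_norm (\<lambda>x. tst n k x - se n x))"
        unfolding l2_norm_scale[symmetric] by (intro l2_norm_sum_le L2_scale L2_diff L)
      ultimately show ?thesis using N k by linarith
    qed
    have 2: "l2_norm (\<lambda>x. deriv (\<phi> k) x - g x) < e/2"
    proof -
      have "deriv (\<phi> k) x - g x = (\<Sum>n<N. coef u n * (deriv (tst n k) x - W n * ce n x)) + ((\<Sum>n<N. (W n * coef u n) * ce n x) - g x)" for x
        by (simp add: d\<phi> right_diff_distrib sum_subtractf mult_ac)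
      then have "l2_norm (\<lambda>x. deriv (\<phi> k) x - g x) \<le> l2_norm (\<lambda>x. \<Sum>n<N. coef u n * (deriv (tst n k) x - W n * ce n x))
           + l2_norm (\<lambda>x. (\<Sum>n<N. (W n * coef u n) * ce n x) - g x)"
        using gL2 by (simp only:) (intro l2_norm_triangle L2_sum L2_diff L2_scale L ce_L2)
      moreover have "l2_norm (\<lambda>x. \<Sum>n<N. coef u n * (deriv (tst n k) x - W n * ce n x)) \<le> (\<Sum>n<N. \<bar>coef u n\<bar> * l2_norm (\<lambda>x. deriv (tst n k) x - W n * ce n x))"
        unfolding l2_norm_scale[symmetric] by (intro l2_norm_sum_le L2_scale L2_diff L)
      ultimately show ?thesis using N k by linarith
    qed
    have wdd: "weak_deriv (\<lambda>x. \<phi> k x - u x) (\<lambda>x. deriv (\<phi> k) x - g x)"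
      by (intro weak_deriv_diff weak_deriv_test t ug u gL2 test_fun_L2 test_fun_deriv_L2)
    have "(\<lambda>x. deriv (\<phi> k) x - g x) \<in> L2" by (intro L2_diff gL2 test_fun_deriv_L2 t)
    note w = wd_weak_deriv[OF wdd this]
    have "l2_norm (wd (\<lambda>x. \<phi> k x - u x)) = l2_norm (\<lambda>x. deriv (\<phi> k) x - g x)"
      by (intro l2_norm_cong_ae w L2_diff gL2 test_fun_deriv_L2 t)
    then have "h1_norm (\<lambda>x. \<phi> k x - u x) \<le> l2_norm (\<lambda>x. \<phi> k x - u x) + l2_norm (\<lambda>x. deriv (\<phi> k) x - g x)"
      unfolding h1_norm_def by (simp add: sqrt_sum_squares_le_sum)
    then show ?thesis using 1 2 t by (intro exI[of _ "\<phi> k"]) auto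
  qed
  then have "\<exists>\<phi>. test_fun \<phi> \<and> h1_norm (\<lambda>x. \<phi> x - u x) < 1 / real (Suc n)" for n by simp
  then obtain \<phi>s where \<phi>s: "\<And>n. test_fun (\<phi>s n)" "\<And>n. h1_norm (\<lambda>x. \<phi>s n x - u x) < 1 / real (Suc n)" by metis
  have "(\<lambda>n. h1_norm (\<lambda>x. \<phi>s n x - u x)) \<longlonglongrightarrow> 0"
  proof (rule Lim_null_comparison)
    show "\<forall>\<^sub>F n in sequentially. norm (h1_norm (\<lambda>x. \<phi>s n x - u x)) \<le> inverse (real (Suc n))"
      using \<phi>s(2) by (auto intro!: always_eventually simp: h1_norm_def inverse_eq_divide less_imp_le)
  qed (rule LIMSEQ_inverse_real_of_nat)
  then show "u \<in> H10" using u ug gL2 \<phi>s(1) unfolding H10_def H1_def by blast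
qed

text \<open>The boundary condition enters here. The cosines do not vanish at the ends, so
  integration by parts against \<open>ce n\<close> is done for the approximating test functions; the
  resulting relation between the coefficients survives the H1 limit, and Bessel's inequality for the
  derivative gives summability.\<close>

lemma H10_D:
  assumes "u \<in> H10"
  shows "u \<in> L2" "summable (\<lambda>n. (W n * coef u n)\<^sup>2)"
proof -
  from assms obtain \<phi>s where u: "u \<in> L2" and "\<exists>g\<in>L2. weak_deriv u g"
    and t: "\<And>n. test_fun (\<phi>s n)" and lim: "(\<lambda>n. h1_norm (\<lambda>x. \<phi>s n x - u x)) \<longlonglongrightarrow> 0"
    unfolding H10_def H1_def by blast
  then obtain g where gL2: "g \<in> L2" and ug: "weak_deriv u g" by blast
  show "u \<in> L2" by fact
  have L: "(\<lambda>x. deriv (\<phi>s k) x - g x) \<in> L2" for k by (intro L2_diff gL2 test_fun_deriv_L2 t)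
  have "weak_deriv (\<lambda>x. \<phi>s k x - u x) (\<lambda>x. deriv (\<phi>s k) x - g x)" for k
    by (intro weak_deriv_diff weak_deriv_test t ug u gL2 test_fun_L2 test_fun_deriv_L2)
  note w = wd_weak_deriv[OF this L]
  have n: "l2_norm (wd (\<lambda>x. \<phi>s k x - u x)) = l2_norm (\<lambda>x. deriv (\<phi>s k) x - g x)" for k
    by (intro l2_norm_cong_ae w L)
  have l1: "(\<lambda>k. l2_norm (\<lambda>x. \<phi>s k x - u x)) \<longlonglongrightarrow> 0"
    by (rule Lim_null_comparison[OF _ lim]) (auto simp: h1_norm_def real_le_rsqrt)
  have l2: "(\<lambda>k. l2_norm (\<lambda>x. deriv (\<phi>s k) x - g x)) \<longlonglongrightarrow> 0"
    by (rule Lim_null_comparison[OF _ lim]) (auto simp: h1_norm_def n real_le_rsqrt)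
  have "l2_inner g (ce n) = W n * coef u n" for n
  proof (rule LIMSEQ_unique)
    show "(\<lambda>k. l2_inner (deriv (\<phi>s k)) (ce n)) \<longlonglongrightarrow> l2_inner g (ce n)"
      by (rule l2_inner_tendsto[OF test_fun_deriv_L2[OF t] gL2 ce_L2 l2])
    have "l2_inner (deriv (\<phi>s k)) (ce n) = W n * l2_inner (\<phi>s k) (se n)" for k
      using l2_inner_by_parts[OF DERIV_ce _ t, of n k]
      by (simp add: l2_inner_scale_left[of "- W n", simplified] continuous_intros l2_inner_commute)
    then show "(\<lambda>k. l2_inner (deriv (\<phi>s k)) (ce n)) \<longlonglongrightarrow> W n * coef u n"
      unfolding coef_def
      by (simp add: tendsto_mult_left l2_inner_tendsto[OF test_fun_L2[OF t] u se_L2 l1])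
  qed
  then show "summable (\<lambda>n. (W n * coef u n)\<^sup>2)" using Bessel(1)[OF orthonormal_ce gL2] by simp
qed

lemma H10_iff: "u \<in> H10 \<longleftrightarrow> u \<in> L2 \<and> summable (\<lambda>n. (W n * coef u n)\<^sup>2)"
  by (intro iffI conjI H10_D) (auto intro: H10_I(1))

lemma wd_weak_deriv_H10:
  assumes "u \<in> H10" shows "wd u \<in> L2" "weak_deriv u (wd u)" "l2_expands ce (\<lambda>n. W n * coef u n) (wd u)"
proof -
  obtain g where "g \<in> L2" "weak_deriv u g" using assms by (auto simp: H10_def H1_def)
  then show "wd u \<in> L2" "weak_deriv u (wd u)" using wd_weak_deriv by blast+
  show "l2_expands ce (\<lambda>n. W n * coef u n) (wd u)" by (rule H10_I(2)[OF H10_D[OF assms]])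
qed

lemma summable_W_of_W2:
  assumes "summable (\<lambda>n. ((W n)\<^sup>2 * a n)\<^sup>2)" shows "summable (\<lambda>n. (W n * a n)\<^sup>2)" 
proof (rule summable_comparison_test[OF _ assms], intro exI allI impI)
  fix n
  have "(W n * a n)\<^sup>2 \<le> (W n)\<^sup>2 * (W n * a n)\<^sup>2"
    using W_ge_1[of n] by (simp add: mult_le_cancel_right1)
  then show "norm ((W n * a n)\<^sup>2) \<le> ((W n)\<^sup>2 * a n)\<^sup>2"
    unfolding real_norm_def abs_power2 by (simp add: power2_eq_square mult_ac)
qed

text \<open>The second derivative is built from its intended sine coefficients; the cosine series of
  \<open>wd u\<close> is then differentiated termwise, each boundary term being killed by the test
  function.\<close>

lemma H2H10_I:
  assumes u: "u \<in> L2" and s: "summable (\<lambda>n. ((W n)\<^sup>2 * coef u n)\<^sup>2)"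
  shows "u \<in> H2H10" "l2_expands se (\<lambda>n. - ((W n)\<^sup>2 * coef u n)) (wd (wd u))"
proof -
  have uH: "u \<in> H10" using summable_W_of_W2[OF s] u by (simp add: H10_iff)
  note g = wd_weak_deriv_H10[OF uH]
  have "summable (\<lambda>n. (- ((W n)\<^sup>2 * coef u n))\<^sup>2)" using s by simp
  then obtain h where h: "l2_expands se (\<lambda>n. - ((W n)\<^sup>2 * coef u n)) h"
    by (rule Riesz_Fischer[OF orthonormal_se])
  have hL2: "h \<in> L2" using h by (simp add: l2_expands_def)
  have gh: "weak_deriv (wd u) h"
    by (rule weak_deriv_ce_series[OF g(3)]) (use h in \<open>simp add: power2_eq_square mult.assoc\<close>)
  show "u \<in> H2H10" using u uH g hL2 gh unfolding H2H10_def H2_def by blast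
  show "l2_expands se (\<lambda>n. - ((W n)\<^sup>2 * coef u n)) (wd (wd u))"
    by (rule l2_expands_cong_ae[OF h ae_eq_sym[OF wd_weak_deriv(3)[OF gh hL2]] wd_weak_deriv(1)[OF gh hL2] orthonormal_se])
qed

text \<open>The cosine coefficients of the first derivative g are known from membership in
  \<open>H10\<close>. Testing the weak relation between g and h with \<open>tst n k\<close> and
  letting k grow gives the sine coefficients of h, to which Bessel's inequality applies.\<close>

lemma H2H10_D:
  assumes "u \<in> H2H10"
  shows "u \<in> L2" "u \<in> H10" "summable (\<lambda>n. ((W n)\<^sup>2 * coef u n)\<^sup>2)"
proof -
  from assms obtain g h where u: "u \<in> L2" and uH: "u \<in> H10" and gL2: "g \<in> L2" and hL2: "h \<in> L2"
    and ug: "weak_deriv u g" and gh: "weak_deriv g h"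
    unfolding H2H10_def H2_def by blast
  show "u \<in> L2" "u \<in> H10" by fact+
  have "ae_eq (wd u) g" using wd_weak_deriv[OF ug gL2] by simp
  then have "l2_expands ce (\<lambda>n. W n * coef u n) g"
    by (intro l2_expands_cong_ae[OF wd_weak_deriv_H10(3)[OF uH]] gL2 orthonormal_ce)
  then have gc: "l2_inner g (ce n) = W n * coef u n" for n by (rule l2_expands_coeff[OF orthonormal_ce])
  have "l2_inner h (se n) = - ((W n)\<^sup>2 * coef u n)" for n
  proof (rule LIMSEQ_unique)
    show "(\<lambda>k. l2_inner h (tst n k)) \<longlonglongrightarrow> l2_inner h (se n)"
      using l2_inner_tendsto[OF test_fun_L2[OF test_fun_tst] se_L2 hL2 tst_tendsto] by (simp add: l2_inner_commute)
    have "l2_inner h (tst n k) = - l2_inner (deriv (tst n k)) g" for k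
      using gh test_fun_tst[of n k] by (simp add: weak_deriv_iff l2_inner_commute[of _ g])
    moreover have "(\<lambda>k. - l2_inner (deriv (tst n k)) g) \<longlonglongrightarrow> - l2_inner (\<lambda>x. W n * ce n x) g"
      by (intro tendsto_minus l2_inner_tendsto test_fun_deriv_L2[OF test_fun_tst] L2_scale ce_L2 gL2 deriv_tst_tendsto)
    moreover have "- l2_inner (\<lambda>x. W n * ce n x) g = - ((W n)\<^sup>2 * coef u n)"
      using gc[of n] by (simp add: l2_inner_scale_left l2_inner_commute[of _ g] power2_eq_square)
    ultimately show "(\<lambda>k. l2_inner h (tst n k)) \<longlonglongrightarrow> - ((W n)\<^sup>2 * coef u n)" by simp
  qed
  then show "summable (\<lambda>n. ((W n)\<^sup>2 * coef u n)\<^sup>2)" using Bessel(1)[OF orthonormal_se hL2] by simp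
qed

lemma H2H10_iff: "u \<in> H2H10 \<longleftrightarrow> u \<in> L2 \<and> summable (\<lambda>n. ((W n)\<^sup>2 * coef u n)\<^sup>2)"
  by (intro iffI conjI H2H10_D) (auto intro: H2H10_I(1))

lemma H10_inner:
  assumes "u \<in> H10" "v \<in> H10"
  shows "(\<lambda>n. (W n)\<^sup>2 * coef u n * coef v n) sums l2_inner (wd u) (wd v)"
  using l2_expands_parseval[OF orthonormal_ce wd_weak_deriv_H10(3)[OF assms(1)] wd_weak_deriv_H10(3)[OF assms(2)]]
  by (simp add: power2_eq_square mult_ac)

lemma H2H10_inner:
  assumes "u \<in> H2H10" "v \<in> H2H10"
  shows "(\<lambda>n. ((W n)\<^sup>2)\<^sup>2 * coef u n * coef v n) sums l2_inner (wd (wd u)) (wd (wd v))"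
proof -
  have "l2_expands se (\<lambda>n. - ((W n)\<^sup>2 * coef w n)) (wd (wd w))" if "w \<in> H2H10" for w
    by (rule H2H10_I(2)[OF H2H10_D(1)[OF that] H2H10_D(3)[OF that]])
  from l2_expands_parseval[OF orthonormal_se this[OF assms(1)] this[OF assms(2)]]
  have "(\<lambda>n. - ((W n)\<^sup>2 * coef u n) * - ((W n)\<^sup>2 * coef v n)) sums l2_inner (wd (wd u)) (wd (wd v))" .
  moreover have "- (p * a) * - (p * b) = p\<^sup>2 * a * b" for p a b :: real by (simp add: power2_eq_square)
  ultimately show ?thesis by (simp only:)
qed

lemma wd_norm_power2:
  assumes "u \<in> H10" shows "(\<lambda>n. (W n * coef u n)\<^sup>2) sums (l2_norm (wd u))\<^sup>2"
proof -
  have "(W n)\<^sup>2 * coef u n * coef u n = (W n * coef u n)\<^sup>2" for n by (simp add: power2_eq_square)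
  then show ?thesis using H10_inner[OF assms assms] by (simp only: l2_norm_power2)
qed

lemma wd_wd_norm_power2:
  assumes "u \<in> H2H10" shows "(\<lambda>n. ((W n)\<^sup>2 * coef u n)\<^sup>2) sums (l2_norm (wd (wd u)))\<^sup>2"
proof -
  have "((W n)\<^sup>2)\<^sup>2 * coef u n * coef u n = ((W n)\<^sup>2 * coef u n)\<^sup>2" for n by (simp add: power2_eq_square)
  then show ?thesis using H2H10_inner[OF assms assms] by (simp only: l2_norm_power2)
qed

lemma h1_norm_power2:
  assumes "u \<in> H10"
  shows "(h1_norm u)\<^sup>2 = (\<Sum>n. (coef u n)\<^sup>2) + (\<Sum>n. (W n * coef u n)\<^sup>2)"
proof -
  have "(h1_norm u)\<^sup>2 = (l2_norm u)\<^sup>2 + (l2_norm (wd u))\<^sup>2"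
    unfolding h1_norm_def by (rule real_sqrt_pow2) simp
  then show ?thesis
    using parseval_norm(2)[OF H10_D(1)[OF assms]] sums_unique[OF wd_norm_power2[OF assms]] by linarith
qed

lemma h2_norm_power2:
  assumes "u \<in> H2H10"
  shows "(h2_norm u)\<^sup>2 = (\<Sum>n. (coef u n)\<^sup>2) + (\<Sum>n. (W n * coef u n)\<^sup>2) + (\<Sum>n. ((W n)\<^sup>2 * coef u n)\<^sup>2)"
proof -
  have "(h2_norm u)\<^sup>2 = (l2_norm u)\<^sup>2 + (l2_norm (wd u))\<^sup>2 + (l2_norm (wd (wd u)))\<^sup>2"
    unfolding h2_norm_def by (rule real_sqrt_pow2) simp
  then show ?thesis
    using parseval_norm(2)[OF H2H10_D(1)[OF assms]] sums_unique[OF wd_norm_power2[OF H2H10_D(2)[OF assms]]]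
      sums_unique[OF wd_wd_norm_power2[OF assms]] by linarith
qed

section \<open>Sine series\<close>

lemma suminf_continuous_on:
  fixes f :: "nat \<Rightarrow> 'a::topological_space \<Rightarrow> real"
  assumes "\<And>n. continuous_on A (f n)" "\<And>n x. x \<in> A \<Longrightarrow> \<bar>f n x\<bar> \<le> M n" "summable M"
  shows "continuous_on A (\<lambda>x. \<Sum>n. f n x)"
proof (rule uniform_limit_theorem)
  show "uniform_limit A (\<lambda>n x. \<Sum>i<n. f i x) (\<lambda>x. \<Sum>n. f n x) sequentially"
    using assms(2,3) by (intro Weierstrass_m_test) auto
  show "\<forall>\<^sub>F n in sequentially. continuous_on A (\<lambda>x. \<Sum>i<n. f i x)"
    using assms(1) by (intro always_eventually allI continuous_on_sum) auto
qed simp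

text \<open>Tannery's theorem along an arbitrary filter; the limits in time below are one-sided at
  0, hence taken at t within [0, infinity).\<close>

lemma suminf_tendsto:
  fixes h :: "nat \<Rightarrow> 'a \<Rightarrow> real"
  assumes "\<And>n. (h n \<longlongrightarrow> b n) F" "\<forall>\<^sub>F s in F. \<forall>n. \<bar>h n s\<bar> \<le> M n" "summable M"
  shows "((\<lambda>s. \<Sum>n. h n s) \<longlongrightarrow> (\<Sum>n. b n)) F"
proof (cases "F = bot")
  case False
  have "\<forall>\<^sub>F x in sequentially \<times>\<^sub>F F. \<forall>n. \<bar>h n (snd x)\<bar> \<le> M n"
    using eventually_compose_filterlim[OF assms(2) filterlim_snd] .
  then have "\<forall>\<^sub>F (k, n) in sequentially \<times>\<^sub>F F. norm (h k n) \<le> M k"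
    by eventually_elim auto
  from tannerys_theorem[OF assms(1) this assms(3) False] show ?thesis by simp
qed simp

lemma suminf_tendsto_zero:
  fixes h :: "nat \<Rightarrow> 'a \<Rightarrow> real"
  assumes "\<And>n. (h n \<longlongrightarrow> 0) F" "\<forall>\<^sub>F s in F. \<forall>n. \<bar>h n s\<bar> \<le> M n" "summable M"
  shows "((\<lambda>s. \<Sum>n. h n s) \<longlongrightarrow> 0) F"
  using suminf_tendsto[OF assms] by simp

text \<open>The constant of the embedding of \<open>H10\<close> into the bounded functions: by
  Cauchy-Schwarz it bounds the absolute sum of the coefficients by the norm of the
  derivative.\<close>

definition CW :: real where "CW = sqrt (\<Sum>n. (1 / W n)\<^sup>2)"

lemma summable_W: "summable (\<lambda>n. (1 / W n)\<^sup>2)"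
proof -
  have "summable (\<lambda>n. inverse (real n ^ 2))" by (rule inverse_power_summable) simp
  then have "summable (\<lambda>n. inverse (real (Suc n) ^ 2))" by (subst summable_Suc_iff)
  then show ?thesis by (simp add: W_def power_divide inverse_eq_divide)
qed

lemma CW_nonneg: "CW \<ge> 0" unfolding CW_def by (simp add: summable_W suminf_nonneg)

lemma sum_weighted_le: "(\<Sum>n<N. \<bar>a n\<bar> / W n) \<le> CW * sqrt (\<Sum>n<N. (a n)\<^sup>2)"
proof -
  have "(\<Sum>n<N. \<bar>a n\<bar> / W n) = (\<Sum>n<N. \<bar>1 / W n\<bar> * \<bar>a n\<bar>)"
    using W_pos by (intro sum.cong) (auto simp: abs_of_pos)
  also have "\<dots> \<le> L2_set (\<lambda>n. 1 / W n) {..<N} * L2_set a {..<N}" by (rule L2_set_mult_ineq)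
  also have "\<dots> \<le> CW * sqrt (\<Sum>n<N. (a n)\<^sup>2)"
    unfolding L2_set_def CW_def
    by (intro mult_right_mono real_sqrt_le_mono sum_le_suminf summable_W) (auto intro: sum_nonneg)
  finally show ?thesis .
qed

lemma summable_abs_of_W:
  assumes "summable (\<lambda>n. (W n * a n)\<^sup>2)"
  shows "summable (\<lambda>n. \<bar>a n\<bar>)" "(\<Sum>n. \<bar>a n\<bar>) \<le> CW * sqrt (\<Sum>n. (W n * a n)\<^sup>2)"
proof -
  have *: "(\<Sum>n<N. \<bar>a n\<bar>) \<le> CW * sqrt (\<Sum>n. (W n * a n)\<^sup>2)" for N
  proof -
    have "(\<Sum>n<N. \<bar>a n\<bar>) = (\<Sum>n<N. \<bar>W n * a n\<bar> / W n)"
      using W_pos by (intro sum.cong) (auto simp: abs_mult abs_of_pos)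
    also have "\<dots> \<le> CW * sqrt (\<Sum>n<N. (W n * a n)\<^sup>2)" by (rule sum_weighted_le)
    also have "\<dots> \<le> CW * sqrt (\<Sum>n. (W n * a n)\<^sup>2)"
      using assms CW_nonneg by (intro mult_left_mono real_sqrt_le_mono sum_le_suminf) auto
    finally show ?thesis .
  qed
  show s: "summable (\<lambda>n. \<bar>a n\<bar>)" using * by (intro summableI_nonneg_bounded) auto
  show "(\<Sum>n. \<bar>a n\<bar>) \<le> CW * sqrt (\<Sum>n. (W n * a n)\<^sup>2)" using * by (intro suminf_le_const s)
qed

text \<open>A function on the whole line and not only on (0, pi): for absolutely summable
  coefficients it is continuous everywhere, which lets the fixed-point argument run on continuous
  functions of the plane.\<close>

definition ser :: "(nat \<Rightarrow> real) \<Rightarrow> real \<Rightarrow> real" where "ser a x = (\<Sum>n. a n * se n x)"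

lemma term_bound: "\<bar>a * se n x\<bar> \<le> \<bar>a\<bar>"
  using se_bound[of n x] by (simp add: abs_mult mult_left_le)

lemma summable_ser: "summable (\<lambda>n. \<bar>a n\<bar>) \<Longrightarrow> summable (\<lambda>n. a n * se n x)"
  by (rule summable_comparison_test[where g="\<lambda>n. \<bar>a n\<bar>"]) (auto simp: term_bound)

lemma ser_bound: assumes "summable (\<lambda>n. \<bar>a n\<bar>)" shows "\<bar>ser a x\<bar> \<le> (\<Sum>n. \<bar>a n\<bar>)"
proof -
  have s: "summable (\<lambda>n. \<bar>a n * se n x\<bar>)"
    by (rule summable_comparison_test[OF _ assms]) (auto simp: term_bound)
  have "\<bar>ser a x\<bar> \<le> (\<Sum>n. \<bar>a n * se n x\<bar>)" unfolding ser_def by (rule summable_rabs[OF s])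
  also have "\<dots> \<le> (\<Sum>n. \<bar>a n\<bar>)" by (intro suminf_le s assms term_bound)
  finally show ?thesis .
qed

lemma ser_diff:
  assumes "summable (\<lambda>n. \<bar>a n\<bar>)" "summable (\<lambda>n. \<bar>b n\<bar>)"
  shows "ser (\<lambda>n. a n - b n) x = ser a x - ser b x"
  unfolding ser_def left_diff_distrib
  by (rule suminf_diff[symmetric]) (intro summable_ser assms)+

lemma continuous_on_ser: "summable (\<lambda>n. \<bar>a n\<bar>) \<Longrightarrow> continuous_on A (ser a)"
  unfolding ser_def[abs_def]
  by (rule suminf_continuous_on[where M="\<lambda>n. \<bar>a n\<bar>"]) (auto intro!: continuous_intros simp: term_bound)

lemma l2_expands_ser: assumes "summable (\<lambda>n. \<bar>a n\<bar>)" shows "l2_expands se a (ser a)"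
  unfolding l2_expands_def
proof
  show "ser a \<in> L2" by (intro L2_continuous continuous_on_ser assms)
  show "(\<lambda>N. l2_norm (\<lambda>x. (\<Sum>n<N. a n * se n x) - ser a x)) \<longlonglongrightarrow> 0"
  proof (rule l2_tendsto_dominated[where B="2 * (\<Sum>n. \<bar>a n\<bar>)"])
    show "(\<lambda>x. \<Sum>n<N. a n * se n x) \<in> borel_measurable mu" for N
      by (intro L2_measurable orthonormal_sum_L2 orthonormal_se)
    show "ser a \<in> borel_measurable mu" by (intro borel_measurable_mu_continuous continuous_on_ser assms)
    show "AE x in mu. (\<lambda>N. \<Sum>n<N. a n * se n x) \<longlonglongrightarrow> ser a x"
      unfolding ser_def using summable_LIMSEQ[OF summable_ser[OF assms]] by simp
    show "AE x in mu. \<bar>(\<Sum>n<N. a n * se n x) - ser a x\<bar> \<le> 2 * (\<Sum>n. \<bar>a n\<bar>)" for N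
    proof (rule AE_I2)
      fix x
      have "\<bar>\<Sum>n<N. a n * se n x\<bar> \<le> (\<Sum>n<N. \<bar>a n\<bar>)"
        by (intro order_trans[OF sum_abs] sum_mono term_bound)
      also have "\<dots> \<le> (\<Sum>n. \<bar>a n\<bar>)" by (intro sum_le_suminf assms) auto
      finally show "\<bar>(\<Sum>n<N. a n * se n x) - ser a x\<bar> \<le> 2 * (\<Sum>n. \<bar>a n\<bar>)"
        using ser_bound[OF assms, of x] by linarith
    qed
  qed
qed

lemma ser_L2: "summable (\<lambda>n. \<bar>a n\<bar>) \<Longrightarrow> ser a \<in> L2"
  using l2_expands_ser by (simp add: l2_expands_def)

lemma coef_ser: "summable (\<lambda>n. \<bar>a n\<bar>) \<Longrightarrow> coef (ser a) n = a n"
  unfolding coef_def by (intro l2_expands_coeff[OF orthonormal_se] l2_expands_ser)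

lemma ae_eq_ser_coef:
  assumes "u \<in> H10" shows "ae_eq u (ser (coef u))"
proof -
  have "summable (\<lambda>n. \<bar>coef u n\<bar>)" using summable_abs_of_W H10_D(2)[OF assms] by blast
  then show ?thesis using assms by (intro coef_eq_imp_ae_eq ser_L2) (auto simp: coef_ser H10_D)
qed

lemma H10_sup_bound:
  assumes "u \<in> H10" shows "AE x in mu. \<bar>u x\<bar> \<le> CW * sqrt (\<Sum>n. (W n * coef u n)\<^sup>2)"
proof -
  note s = summable_abs_of_W[OF H10_D(2)[OF assms]]
  show ?thesis
    using ae_eq_ser_coef[OF assms] unfolding ae_eq_iff
  proof eventually_elim
    case (elim x)
    then show ?case using ser_bound[OF s(1), of x] s(2) by linarith
  qed
qed

section \<open>The forced harmonic oscillator\<close>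

definition dP :: "real \<Rightarrow> real \<Rightarrow> (real \<Rightarrow> real) \<Rightarrow> real \<Rightarrow> real" where
  "dP l u0 g t = l * u0 + integral {0..t} (\<lambda>s. sin (l * s) * g s)"

definition dQ :: "real \<Rightarrow> real \<Rightarrow> (real \<Rightarrow> real) \<Rightarrow> real \<Rightarrow> real" where
  "dQ l u1 g t = u1 - integral {0..t} (\<lambda>s. cos (l * s) * g s)"

text \<open>Duhamel's formula for \<open>u'' + l\<^sup>2 u + g = 0\<close>, with \<open>(dP, dQ)\<close> the phase-space point
  \<open>(l u, u')\<close> transported back to time 0.\<close>

definition du :: "real \<Rightarrow> real \<Rightarrow> real \<Rightarrow> (real \<Rightarrow> real) \<Rightarrow> real \<Rightarrow> real" where
  "du l u0 u1 g t = (dP l u0 g t * cos (l * t) + dQ l u1 g t * sin (l * t)) / l"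

definition dv :: "real \<Rightarrow> real \<Rightarrow> real \<Rightarrow> (real \<Rightarrow> real) \<Rightarrow> real \<Rightarrow> real" where
  "dv l u0 u1 g t = - dP l u0 g t * sin (l * t) + dQ l u1 g t * cos (l * t)"

lemma integral_DERIV_within:
  fixes g :: "real \<Rightarrow> real"
  assumes "continuous_on UNIV g" "t \<ge> 0"
  shows "((\<lambda>t. integral {0..t} g) has_real_derivative g t) (at t within {0..})"
proof -
  \<comment> \<open>The interval extends beyond t so that near t it agrees with [0, infinity), also
    at t = 0.\<close>
  have "((\<lambda>t. integral {0..t} g) has_real_derivative g t) (at t within {0..t+1})"
    using assms by (intro integral_has_real_derivative) (auto intro: continuous_on_subset)
  moreover have "at t within {0..t+1} = at t within {0..}"
    by (rule at_within_nhd[where S="{..<t+1}"]) auto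
  ultimately show ?thesis by simp
qed

lemma du_zero: "l \<noteq> 0 \<Longrightarrow> du l u0 u1 g 0 = u0" "dv l u0 u1 g 0 = u1"
  by (simp_all add: du_def dv_def dP_def dQ_def)

lemma du_DERIV:
  assumes g: "continuous_on UNIV g" and l: "l > 0" and t: "t \<ge> 0"
  shows "(du l u0 u1 g has_real_derivative dv l u0 u1 g t) (at t within {0..})"
    and "(dv l u0 u1 g has_real_derivative - l\<^sup>2 * du l u0 u1 g t - g t) (at t within {0..})"
proof -
  have P: "(dP l u0 g has_real_derivative sin (l * t) * g t) (at t within {0..})"
    unfolding dP_def[abs_def] using g t
    by (auto intro!: derivative_eq_intros integral_DERIV_within continuous_intros)
  have Q: "(dQ l u1 g has_real_derivative - (cos (l * t) * g t)) (at t within {0..})"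
    unfolding dQ_def[abs_def] using g t
    by (auto intro!: derivative_eq_intros integral_DERIV_within continuous_intros)
  have c: "((\<lambda>t. cos (l * t)) has_real_derivative - (sin (l * t)) * l) (at t within {0..})"
    and s: "((\<lambda>t. sin (l * t)) has_real_derivative cos (l * t) * l) (at t within {0..})"
    by (auto intro!: derivative_eq_intros)
  show "(du l u0 u1 g has_real_derivative dv l u0 u1 g t) (at t within {0..})"
    unfolding du_def[abs_def] dv_def
    by (rule DERIV_cong[OF DERIV_cdivide[OF DERIV_add[OF DERIV_mult[OF P c] DERIV_mult[OF Q s]]]])
       (use l in \<open>simp add: field_simps\<close>)
  have "sin (l * t) * g t * sin (l * t) + cos (l * t) * g t * cos (l * t) = g t * ((sin (l * t))\<^sup>2 + (cos (l * t))\<^sup>2)"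
    by algebra
  then have e: "sin (l * t) * g t * sin (l * t) + cos (l * t) * g t * cos (l * t) = g t"
    by (simp only: sin_cos_squared_add mult_1_right)
  have ld: "l\<^sup>2 * du l u0 u1 g t = l * dP l u0 g t * cos (l * t) + l * dQ l u1 g t * sin (l * t)"
    using l by (simp add: du_def power2_eq_square field_simps)
  have "((\<lambda>t. - (dP l u0 g t * sin (l * t)) + dQ l u1 g t * cos (l * t)) has_real_derivative
      - l\<^sup>2 * du l u0 u1 g t - g t) (at t within {0..})"
    by (rule DERIV_cong[OF DERIV_add[OF DERIV_minus[OF DERIV_mult[OF P s]] DERIV_mult[OF Q c]]])
       (use e in \<open>simp add: ld algebra_simps\<close>)
  then show "(dv l u0 u1 g has_real_derivative - l\<^sup>2 * du l u0 u1 g t - g t) (at t within {0..})"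
    unfolding dv_def[abs_def] by simp
qed

text \<open>Transport from time 0 to time t rotates the point (dP, dQ) in the phase plane, which
  preserves its Euclidean norm.\<close>

lemma du_energy:
  assumes "l > 0"
  shows "(l * du l u0 u1 g t)\<^sup>2 + (dv l u0 u1 g t)\<^sup>2 = (dP l u0 g t)\<^sup>2 + (dQ l u1 g t)\<^sup>2"
proof -
  have "(P * c + Q * s)\<^sup>2 + (- P * s + Q * c)\<^sup>2 = (P\<^sup>2 + Q\<^sup>2) * (s\<^sup>2 + c\<^sup>2)" for P Q c s :: real
    by (simp add: power2_eq_square algebra_simps)
  then show ?thesis using assms by (simp add: du_def dv_def)
qed

text \<open>Expanding the nonnegative integral of (g - m)^2, with m the mean of g on the interval,
  gives this Cauchy-Schwarz inequality against the constant function.\<close>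

lemma integral_square_le:
  fixes g :: "real \<Rightarrow> real"
  assumes g: "continuous_on {0..t} g" and t: "t \<ge> 0"
  shows "(integral {0..t} g)\<^sup>2 \<le> t * integral {0..t} (\<lambda>s. (g s)\<^sup>2)"
proof (cases "t = 0")
  case False
  with t have t: "t > 0" by simp
  define m where "m = integral {0..t} g / t"
  have i: "g integrable_on {0..t}" "(\<lambda>s. (g s)\<^sup>2) integrable_on {0..t}"
    using g by (auto intro!: integrable_continuous_real continuous_intros)
  have "0 \<le> integral {0..t} (\<lambda>s. (g s - m)\<^sup>2)"
    using g by (intro integral_nonneg integrable_continuous_real continuous_intros) auto
  also have "(\<lambda>s. (g s - m)\<^sup>2) = (\<lambda>s. ((g s)\<^sup>2 - (2 * m) * g s) + m\<^sup>2)"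
    by (auto simp: power2_eq_square algebra_simps)
  also have "integral {0..t} (\<lambda>s. ((g s)\<^sup>2 - (2 * m) * g s) + m\<^sup>2)
      = integral {0..t} (\<lambda>s. (g s)\<^sup>2) - 2 * m * integral {0..t} g + t * m\<^sup>2"
    using t integral_add[OF integrable_diff[OF i(2) integrable_on_mult_right[OF i(1), of "2 * m"]] integrable_const_ivl[of "m\<^sup>2" 0 t]]
      integral_diff[OF i(2) integrable_on_mult_right[OF i(1), of "2 * m"]] by simp
  also have "\<dots> = integral {0..t} (\<lambda>s. (g s)\<^sup>2) - (integral {0..t} g)\<^sup>2 / t"
    using t by (simp add: m_def power2_eq_square field_simps)
  finally show ?thesis using t by (simp add: field_simps)
qed simp

text \<open>By \<open>du_energy\<close> it suffices to bound \<open>dP\<close> and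
  \<open>dQ\<close>, where the oscillating factor under the integral is at most 1 in modulus. The
  inequality (a + b)^2 \<le> 2 a^2 + 2 b^2, used once for each, gives the factors 2 and, for the two
  integrals together, 4 T.\<close>

lemma du_bound:
  assumes g: "continuous_on UNIV g" and l: "l > 0" and t: "0 \<le> t" "t \<le> T"
  shows "(l * du l u0 u1 g t)\<^sup>2 + (dv l u0 u1 g t)\<^sup>2
      \<le> 2 * (l * u0)\<^sup>2 + 2 * u1\<^sup>2 + 4 * T * integral {0..T} (\<lambda>s. (g s)\<^sup>2)"
proof -
  have c: "continuous_on A g" for A using g continuous_on_subset by blast
  have bnd: "(integral {0..t} (\<lambda>s. k s * g s))\<^sup>2 \<le> T * integral {0..T} (\<lambda>s. (g s)\<^sup>2)"
    if k: "continuous_on UNIV k" "\<And>s. \<bar>k s\<bar> \<le> 1" for k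
  proof -
    have ck: "continuous_on A k" for A using k(1) continuous_on_subset by blast
    have "(integral {0..t} (\<lambda>s. k s * g s))\<^sup>2 \<le> t * integral {0..t} (\<lambda>s. (k s * g s)\<^sup>2)"
      by (intro integral_square_le continuous_intros c ck t)
    also have "\<dots> \<le> t * integral {0..t} (\<lambda>s. (g s)\<^sup>2)"
    proof (intro mult_left_mono integral_le integrable_continuous_real continuous_intros c ck t)
      fix s
      have "(k s)\<^sup>2 \<le> 1" using k(2)[of s] by (simp add: abs_square_le_1)
      then show "(k s * g s)\<^sup>2 \<le> (g s)\<^sup>2" by (simp add: power_mult_distrib mult_left_le_one_le)
    qed
    also have "\<dots> \<le> T * integral {0..T} (\<lambda>s. (g s)\<^sup>2)"
      using t by (intro mult_mono integral_subset_le integral_nonneg integrable_continuous_real continuous_intros c) auto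
    finally show ?thesis .
  qed
  have sq: "(a + b)\<^sup>2 \<le> 2 * a\<^sup>2 + 2 * b\<^sup>2" "(a - b)\<^sup>2 \<le> 2 * a\<^sup>2 + 2 * b\<^sup>2" for a b :: real
    using sum_squares_bound[of a b] sum_squares_bound[of a "-b"] by (auto simp: power2_sum power2_diff)
  have "(dP l u0 g t)\<^sup>2 \<le> 2 * (l * u0)\<^sup>2 + 2 * (T * integral {0..T} (\<lambda>s. (g s)\<^sup>2))"
    unfolding dP_def
    by (rule order_trans[OF sq(1)]) (intro add_mono mult_left_mono bnd order_refl continuous_intros, auto)
  moreover have "(dQ l u1 g t)\<^sup>2 \<le> 2 * u1\<^sup>2 + 2 * (T * integral {0..T} (\<lambda>s. (g s)\<^sup>2))"
    unfolding dQ_def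
    by (rule order_trans[OF sq(2)]) (intro add_mono mult_left_mono bnd order_refl continuous_intros, auto)
  ultimately show ?thesis unfolding du_energy[OF l] by (simp add: mult.assoc)
qed

text \<open>The differences of \<open>dP\<close> and \<open>dQ\<close> each contribute one integral
  of |g - h|, whence the factor 2. Dividing by the frequency leaves 1/w, the weight that
  \<open>sum_weighted_le\<close> needs to sum over all modes.\<close>

lemma du_diff_bound:
  assumes g: "continuous_on UNIV g" and h: "continuous_on UNIV h" and l: "l \<ge> w" "w > 0" and t: "0 \<le> t"
  shows "\<bar>du l u0 u1 g t - du l u0 u1 h t\<bar> \<le> integral {0..t} (\<lambda>s. 2 * (\<bar>g s - h s\<bar> / w))"
proof -
  have c: "continuous_on A g" "continuous_on A h" for A using g h continuous_on_subset by blast+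
  have l0: "l > 0" using l by linarith
  have bnd: "\<bar>integral {0..t} (\<lambda>s. k s * g s) - integral {0..t} (\<lambda>s. k s * h s)\<bar> \<le> integral {0..t} (\<lambda>s. \<bar>g s - h s\<bar>)"
    if k: "continuous_on UNIV k" "\<And>s. \<bar>k s\<bar> \<le> 1" for k
  proof -
    have ck: "continuous_on A k" for A using k(1) continuous_on_subset by blast
    have "integral {0..t} (\<lambda>s. k s * g s) - integral {0..t} (\<lambda>s. k s * h s) = integral {0..t} (\<lambda>s. k s * (g s - h s))"
      unfolding right_diff_distrib
      by (intro integral_diff[symmetric] integrable_continuous_real continuous_intros c ck)
    also have "\<bar>\<dots>\<bar> \<le> integral {0..t} (\<lambda>s. \<bar>g s - h s\<bar>)"
      unfolding real_norm_def[symmetric]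
    proof (intro integral_norm_bound_integral integrable_continuous_real continuous_intros c ck)
      fix s
      show "norm (k s * (g s - h s)) \<le> norm (g s - h s)"
        using k(2)[of s] by (simp add: abs_mult mult_left_le_one_le)
    qed
    finally show ?thesis .
  qed
  have "\<bar>dP l u0 g t - dP l u0 h t\<bar> \<le> integral {0..t} (\<lambda>s. \<bar>g s - h s\<bar>)"
    unfolding dP_def using bnd[of "\<lambda>s. sin (l * s)"] by (simp add: continuous_intros)
  moreover have "\<bar>dQ l u1 g t - dQ l u1 h t\<bar> \<le> integral {0..t} (\<lambda>s. \<bar>g s - h s\<bar>)"
    unfolding dQ_def using bnd[of "\<lambda>s. cos (l * s)"] by (simp add: continuous_intros abs_minus_commute)
  moreover have "\<bar>a * cos x + b * sin x\<bar> \<le> \<bar>a\<bar> + \<bar>b\<bar>" for a b x :: real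
    by (rule order_trans[OF abs_triangle_ineq])
       (auto simp: abs_mult intro!: add_mono mult_left_le abs_cos_le_one abs_sin_le_one)
  from this[of "dP l u0 g t - dP l u0 h t" "l * t" "dQ l u1 g t - dQ l u1 h t"]
  have "\<bar>l * (du l u0 u1 g t - du l u0 u1 h t)\<bar> \<le> \<bar>dP l u0 g t - dP l u0 h t\<bar> + \<bar>dQ l u1 g t - dQ l u1 h t\<bar>"
  proof -
    assume *: "\<bar>(dP l u0 g t - dP l u0 h t) * cos (l * t) + (dQ l u1 g t - dQ l u1 h t) * sin (l * t)\<bar>
      \<le> \<bar>dP l u0 g t - dP l u0 h t\<bar> + \<bar>dQ l u1 g t - dQ l u1 h t\<bar>"
    have "l * du l u0 u1 f t = dP l u0 f t * cos (l * t) + dQ l u1 f t * sin (l * t)" for f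
      using l0 by (simp add: du_def)
    then have "l * (du l u0 u1 g t - du l u0 u1 h t)
       = (dP l u0 g t - dP l u0 h t) * cos (l * t) + (dQ l u1 g t - dQ l u1 h t) * sin (l * t)"
      by (simp add: right_diff_distrib left_diff_distrib)
    then show ?thesis using * by simp
  qed
  ultimately have "l * \<bar>du l u0 u1 g t - du l u0 u1 h t\<bar> \<le> 2 * integral {0..t} (\<lambda>s. \<bar>g s - h s\<bar>)"
    using l0 by (simp add: abs_mult)
  moreover have "w * \<bar>du l u0 u1 g t - du l u0 u1 h t\<bar> \<le> l * \<bar>du l u0 u1 g t - du l u0 u1 h t\<bar>"
    using l by (intro mult_right_mono) auto
  ultimately have "\<bar>du l u0 u1 g t - du l u0 u1 h t\<bar> \<le> (2 / w) * integral {0..t} (\<lambda>s. \<bar>g s - h s\<bar>)"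
    using l by (simp add: field_simps)
  also have "\<dots> = integral {0..t} (\<lambda>s. (2 / w) * \<bar>g s - h s\<bar>)" by simp
  finally show ?thesis by (simp only: times_divide_eq_left times_divide_eq_right)
qed

section \<open>Bounded Lipschitz nonlinearities\<close>

text \<open>The time integrals of the squared forcing coefficients are summable over the modes
  because the partial sums of the squares are bounded, uniformly in time, by \<open>B2\<close>. The
  estimate \<open>du_bound\<close> then has a right-hand side that is free of t on [0, T].\<close>

lemma du_majorant:
  assumes lam: "\<And>n. lam n \<ge> W n"
    and s0: "summable (\<lambda>n. (lam n * a0 n)\<^sup>2)" and s1: "summable (\<lambda>n. (a1 n)\<^sup>2)"
    and g: "\<And>n. continuous_on UNIV (g n)" and B: "\<And>s N. (\<Sum>n<N. (g n s)\<^sup>2) \<le> B2" and T: "T \<ge> 0"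
  shows "\<exists>M. summable M \<and> (\<Sum>n. M n) \<le> (\<Sum>n. 2 * (lam n * a0 n)\<^sup>2) + (\<Sum>n. 2 * (a1 n)\<^sup>2) + 4 * T\<^sup>2 * B2 \<and>
    (\<forall>n t. 0 \<le> t \<longrightarrow> t \<le> T \<longrightarrow>
      (lam n * du (lam n) (a0 n) (a1 n) (g n) t)\<^sup>2 + (dv (lam n) (a0 n) (a1 n) (g n) t)\<^sup>2 \<le> M n)"
proof -
  define I where "I n = integral {0..T} (\<lambda>s. (g n s)\<^sup>2)" for n
  have gi: "(\<lambda>s. (g n s)\<^sup>2) integrable_on {0..T}" for n
    by (intro integrable_continuous_real continuous_intros continuous_on_subset[OF g]) auto
  have I0: "I n \<ge> 0" for n unfolding I_def by (intro integral_nonneg gi) auto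
  have IN: "(\<Sum>n<N. I n) \<le> T * B2" for N
  proof -
    have "(\<Sum>n<N. I n) = integral {0..T} (\<lambda>s. \<Sum>n<N. (g n s)\<^sup>2)"
      unfolding I_def by (intro integral_sum[symmetric] gi) auto
    also have "\<dots> \<le> integral {0..T} (\<lambda>s. B2)"
      by (intro integral_le integrable_sum gi B) auto
    finally show ?thesis using T by simp
  qed
  have sI: "summable I" using I0 IN by (intro summableI_nonneg_bounded) auto
  have I: "(\<Sum>n. I n) \<le> T * B2" using IN by (intro suminf_le_const sI)
  define M where "M n = 2 * (lam n * a0 n)\<^sup>2 + 2 * (a1 n)\<^sup>2 + 4 * T * I n" for n
  have sM: "summable M" unfolding M_def by (intro summable_add summable_mult s0 s1 sI)
  have "(\<Sum>n. M n) = (\<Sum>n. 2 * (lam n * a0 n)\<^sup>2) + (\<Sum>n. 2 * (a1 n)\<^sup>2) + 4 * T * (\<Sum>n. I n)"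
  proof -
    note s2 = summable_mult[OF s0, of 2] summable_mult[OF s1, of 2] summable_mult[OF sI, of "4 * T"]
    show ?thesis
      unfolding M_def suminf_add[OF summable_add[OF s2(1,2)] s2(3), symmetric]
        suminf_add[OF s2(1,2), symmetric] suminf_mult[OF sI] by simp
  qed
  also have "\<dots> \<le> (\<Sum>n. 2 * (lam n * a0 n)\<^sup>2) + (\<Sum>n. 2 * (a1 n)\<^sup>2) + 4 * T * (T * B2)"
    using I T by (intro add_left_mono mult_left_mono) auto
  finally have "(\<Sum>n. M n) \<le> (\<Sum>n. 2 * (lam n * a0 n)\<^sup>2) + (\<Sum>n. 2 * (a1 n)\<^sup>2) + 4 * T\<^sup>2 * B2"
    by (simp add: power2_eq_square mult.assoc)
  moreover have "(lam n * du (lam n) (a0 n) (a1 n) (g n) t)\<^sup>2 + (dv (lam n) (a0 n) (a1 n) (g n) t)\<^sup>2 \<le> M n"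
    if "0 \<le> t" "t \<le> T" for n t
    unfolding M_def I_def using lam[of n] W_pos[of n] that by (intro du_bound g) auto
  ultimately show ?thesis using sM by blast
qed

lemma W_le_lam_square:
  assumes "l \<ge> W n" shows "(W n * a)\<^sup>2 \<le> (l * a)\<^sup>2"
  unfolding power_mult_distrib using assms W_pos[of n] by (intro mult_right_mono power_mono) auto

lemma majorant_imp_summable_W:
  assumes "\<And>n. lam n \<ge> W n" "summable M" "\<And>n. (lam n * a n)\<^sup>2 + (b n)\<^sup>2 \<le> M n"
  shows "summable (\<lambda>n. (W n * a n)\<^sup>2)" "(\<Sum>n. (W n * a n)\<^sup>2) \<le> (\<Sum>n. M n)"
proof -
  have *: "(W n * a n)\<^sup>2 \<le> M n" for n
    using W_le_lam_square[OF assms(1)[of n], of "a n"] assms(3)[of n] zero_le_power2[of "b n"] by linarith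
  show s: "summable (\<lambda>n. (W n * a n)\<^sup>2)"
    by (rule summable_comparison_test[OF _ assms(2)]) (use * in auto)
  show "(\<Sum>n. (W n * a n)\<^sup>2) \<le> (\<Sum>n. M n)" by (intro suminf_le * s assms(2))
qed

text \<open>Writing |a| as 1/W n times W n |a| and using 2 p q \<le> p^2 + q^2 bounds it by terms of
  two summable sequences, without taking roots of the majorant.\<close>

lemma abs_le_majorant:
  assumes "l \<ge> W n" "(l * a)\<^sup>2 + b\<^sup>2 \<le> M" shows "\<bar>a\<bar> \<le> (1 / W n)\<^sup>2 + M"
proof -
  have "\<bar>a\<bar> = (1 / W n) * \<bar>W n * a\<bar>" using W_pos[of n] by (simp add: abs_mult)
  also have "2 * \<dots> \<le> (1 / W n)\<^sup>2 + \<bar>W n * a\<bar>\<^sup>2"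
    using sum_squares_bound[of "1 / W n" "\<bar>W n * a\<bar>"] by (simp only: mult.assoc)
  also have "\<bar>W n * a\<bar>\<^sup>2 \<le> M"
    unfolding power2_abs using W_le_lam_square[OF assms(1), of a] assms(2) zero_le_power2[of b] by linarith
  finally show ?thesis by linarith
qed

lemma coef_param_continuous:
  assumes H: "continuous_on UNIV (\<lambda>p. H (fst p) (snd p))" and B: "\<And>s x. \<bar>H s x\<bar> \<le> (B::real)"
  shows "continuous_on UNIV (\<lambda>s::real. coef (H s) n)"
proof -
  have Hx: "continuous_on UNIV (H s)" for s
    using continuous_on_compose2[OF H, of UNIV "\<lambda>x. (s, x)"] by (simp add: continuous_intros)
  have Hs: "continuous_on UNIV (\<lambda>s. H s x)" for x
    using continuous_on_compose2[OF H, of UNIV "\<lambda>s. (s, x)"] by (simp add: continuous_intros)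
  have "continuous (at s) (\<lambda>s. coef (H s) n)" for s
    unfolding continuous_at_sequentially
  proof (intro allI impI)
    fix r assume r: "r \<longlonglongrightarrow> s"
    have "(\<lambda>k. l2_norm (\<lambda>x. H (r k) x - H s x)) \<longlonglongrightarrow> 0"
    proof (rule l2_tendsto_dominated[where B="2 * B"])
      show "H (r k) \<in> borel_measurable mu" "H s \<in> borel_measurable mu" for k
        by (intro L2_measurable L2_continuous Hx)+
      show "AE x in mu. (\<lambda>k. H (r k) x) \<longlonglongrightarrow> H s x"
        using continuous_on_tendsto_compose[OF Hs r] by simp
      show "AE x in mu. \<bar>H (r k) x - H s x\<bar> \<le> 2 * B" for k
      proof (rule AE_I2)
        fix x show "\<bar>H (r k) x - H s x\<bar> \<le> 2 * B" using B[of "r k" x] B[of s x] by linarith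
      qed
    qed
    then show "((\<lambda>s. coef (H s) n) \<circ> r) \<longlonglongrightarrow> coef (H s) n"
      unfolding coef_def o_def by (intro l2_inner_tendsto L2_continuous Hx se_L2)
  qed
  then show ?thesis by (simp add: continuous_on_eq_continuous_at)
qed

lemma sum_coef_le:
  assumes "continuous_on UNIV H" "\<And>x. \<bar>H x\<bar> \<le> B"
  shows "(\<Sum>n<N. (coef H n)\<^sup>2) \<le> pi * B\<^sup>2"
proof -
  have B: "B \<ge> 0" using assms(2)[of 0] by linarith
  have L: "H \<in> L2" by (rule L2_continuous[OF assms(1)])
  have "(\<Sum>n<N. (coef H n)\<^sup>2) \<le> (l2_norm H)\<^sup>2"
    unfolding coef_def l2_norm_power2 by (rule Bessel_finite[OF orthonormal_se L]) simp
  also have "\<dots> \<le> (sqrt pi * B)\<^sup>2"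
    using assms B by (intro power_mono l2_norm_le_bound L2_measurable L) auto
  finally show ?thesis by (simp add: power_mult_distrib)
qed

text \<open>A summable majorant exists only up to a finite time, so continuity is shown on each open
  strip of times below T, and these strips cover the plane. The argument \<open>max 0\<close>
  extends the solution to negative times as a constant.\<close>

lemma du_ser_continuous:
  assumes lam: "\<And>n. lam n \<ge> W n"
    and s0: "summable (\<lambda>n. (lam n * a0 n)\<^sup>2)" and s1: "summable (\<lambda>n. (a1 n)\<^sup>2)"
    and g: "\<And>n. continuous_on UNIV (g n)" and B: "\<And>s N. (\<Sum>n<N. (g n s)\<^sup>2) \<le> B2"
  shows "continuous_on UNIV (\<lambda>p. ser (\<lambda>n. du (lam n) (a0 n) (a1 n) (g n) (max 0 (fst p))) (snd p))"
    (is "continuous_on UNIV ?f")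
proof -
  have "continuous_on ({..<real T} \<times> UNIV) ?f" for T :: nat
  proof -
    obtain M where M: "summable M" "\<And>n t. 0 \<le> t \<Longrightarrow> t \<le> real T \<Longrightarrow>
      (lam n * du (lam n) (a0 n) (a1 n) (g n) t)\<^sup>2 + (dv (lam n) (a0 n) (a1 n) (g n) t)\<^sup>2 \<le> M n"
      using du_majorant[OF lam s0 s1 g B, of "real T"] by auto
    show ?thesis
      unfolding ser_def
    proof (rule suminf_continuous_on)
      show "summable (\<lambda>n. (1 / W n)\<^sup>2 + M n)" by (intro summable_add summable_W M)
      fix n
      have "continuous_on {0..} (du (lam n) (a0 n) (a1 n) (g n))"
        by (rule DERIV_continuous_on[OF du_DERIV(1)[OF g]]) (use lam[of n] W_pos[of n] in auto)
      then have "continuous_on UNIV (\<lambda>p. du (lam n) (a0 n) (a1 n) (g n) (max 0 (fst (p::real\<times>real))))"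
        by (rule continuous_on_compose2) (auto intro!: continuous_intros)
      then have "continuous_on UNIV (\<lambda>p. du (lam n) (a0 n) (a1 n) (g n) (max 0 (fst (p::real\<times>real))) * se n (snd p))"
        by (intro continuous_intros continuous_on_compose2[OF continuous_on_se[of UNIV]]) auto
      then show "continuous_on ({..<real T} \<times> UNIV) (\<lambda>p. du (lam n) (a0 n) (a1 n) (g n) (max 0 (fst p)) * se n (snd p))"
        by (rule continuous_on_subset) auto
      fix p :: "real \<times> real" assume "p \<in> {..<real T} \<times> UNIV"
      then have "0 \<le> max 0 (fst p)" "max 0 (fst p) \<le> real T" by auto
      from order_trans[OF term_bound abs_le_majorant[OF lam M(2)[OF this]]]
      show "\<bar>du (lam n) (a0 n) (a1 n) (g n) (max 0 (fst p)) * se n (snd p)\<bar> \<le> (1 / W n)\<^sup>2 + M n" .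
    qed
  qed
  then have "continuous_on (\<Union>T::nat. {..<real T} \<times> UNIV) ?f"
    by (intro continuous_on_open_UN) (auto intro: open_Times)
  moreover have "(\<Union>T::nat. {..<real T} \<times> UNIV) = (UNIV :: (real \<times> real) set)"
    using reals_Archimedean2 by fastforce
  ultimately show ?thesis by simp
qed

text \<open>The oscillators grow at most linearly in time under bounded forcing; the exponential
  weight turns this into a bound, because K t \<le> exp(K t).\<close>

lemma mult_exp_minus_le: "K > 0 \<Longrightarrow> t \<ge> 0 \<Longrightarrow> exp (- K * t) * (a + b * t) \<le> a + b / K" if "a \<ge> 0" "b \<ge> 0" for a b :: real
proof -
  assume K: "K > 0" and t: "t \<ge> 0"
  have "K * t \<le> exp (K * t)" using exp_ge_add_one_self[of "K * t"] by linarith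
  then have 1: "exp (- K * t) * t \<le> 1 / K" using K by (simp add: exp_minus field_simps)
  have "exp (- K * t) * (a + b * t) = exp (- K * t) * a + b * (exp (- K * t) * t)" by (simp add: algebra_simps)
  also have "\<dots> \<le> 1 * a + b * (1 / K)"
    using that K t 1 by (intro add_mono mult_right_mono mult_left_mono) auto
  finally show ?thesis by simp
qed

text \<open>With forcing bounded in L2 uniformly in time, the energy grows at most quadratically
  (\<open>du_majorant\<close> with T = t), so its root, and with it the sup norm, grows at most
  linearly.\<close>

lemma du_ser_bound:
  assumes lam: "\<And>n. lam n \<ge> W n"
    and s0: "summable (\<lambda>n. (lam n * a0 n)\<^sup>2)" and s1: "summable (\<lambda>n. (a1 n)\<^sup>2)"
    and g: "\<And>n. continuous_on UNIV (g n)" and B: "\<And>s N. (\<Sum>n<N. (g n s)\<^sup>2) \<le> B2" and t: "t \<ge> 0"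
  shows "summable (\<lambda>n. \<bar>du (lam n) (a0 n) (a1 n) (g n) t\<bar>)"
    and "\<bar>ser (\<lambda>n. du (lam n) (a0 n) (a1 n) (g n) t) x\<bar>
     \<le> CW * sqrt ((\<Sum>n. 2 * (lam n * a0 n)\<^sup>2) + (\<Sum>n. 2 * (a1 n)\<^sup>2)) + 2 * CW * sqrt B2 * t"
proof -
  define D where "D = (\<Sum>n. 2 * (lam n * a0 n)\<^sup>2) + (\<Sum>n. 2 * (a1 n)\<^sup>2)"
  have D: "D \<ge> 0" unfolding D_def by (intro add_nonneg_nonneg suminf_nonneg summable_mult s0 s1) auto
  have B2: "B2 \<ge> 0" using B[where N=0] by simp
  obtain M where M: "summable M" "(\<Sum>n. M n) \<le> D + 4 * t\<^sup>2 * B2"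
      "\<And>n. (lam n * du (lam n) (a0 n) (a1 n) (g n) t)\<^sup>2 + (dv (lam n) (a0 n) (a1 n) (g n) t)\<^sup>2 \<le> M n"
    using du_majorant[OF lam s0 s1 g B t] t unfolding D_def by auto
  note mw = majorant_imp_summable_W[OF lam M(1,3)]
  note s = summable_abs_of_W[OF mw(1)]
  show "summable (\<lambda>n. \<bar>du (lam n) (a0 n) (a1 n) (g n) t\<bar>)" by (rule s(1))
  have "\<bar>ser (\<lambda>n. du (lam n) (a0 n) (a1 n) (g n) t) x\<bar> \<le> CW * sqrt (\<Sum>n. (W n * du (lam n) (a0 n) (a1 n) (g n) t)\<^sup>2)"
    using ser_bound[OF s(1), of x] s(2) by linarith
  also have "\<dots> \<le> CW * sqrt (D + 4 * t\<^sup>2 * B2)"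
    using mw(2) M(2) by (intro mult_left_mono real_sqrt_le_mono CW_nonneg) linarith
  also have "\<dots> \<le> CW * (sqrt D + sqrt (4 * t\<^sup>2 * B2))"
    using D B2 by (intro mult_left_mono CW_nonneg sqrt_add_le_add_sqrt) auto
  also have "\<dots> = CW * sqrt D + 2 * CW * sqrt B2 * t" using t by (simp add: real_sqrt_mult algebra_simps)
  finally show "\<bar>ser (\<lambda>n. du (lam n) (a0 n) (a1 n) (g n) t) x\<bar> \<le> CW * sqrt D + 2 * CW * sqrt B2 * t" .
qed

text \<open>This is the source of the contraction. The difference of the forcings is allowed to grow
  like exp(K s); integrating that up to t gains the factor 1/K, which a large K makes as small as
  desired. Summation over the modes costs only the factor \<open>CW\<close>, thanks to the weights
  1/W n from \<open>du_diff_bound\<close>.\<close>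

lemma du_ser_diff:
  assumes lam: "\<And>n. lam n \<ge> W n"
    and sg: "summable (\<lambda>n. \<bar>du (lam n) (a0 n) (a1 n) (g n) t\<bar>)"
    and sh: "summable (\<lambda>n. \<bar>du (lam n) (a0 n) (a1 n) (h n) t\<bar>)"
    and g: "\<And>n. continuous_on UNIV (g n)" and h: "\<And>n. continuous_on UNIV (h n)"
    and D: "\<And>s N. (\<Sum>n<N. (g n s - h n s)\<^sup>2) \<le> (D * exp (K * s))\<^sup>2" and D0: "D \<ge> 0" and K: "K > 0" and t: "t \<ge> 0"
  shows "\<bar>ser (\<lambda>n. du (lam n) (a0 n) (a1 n) (g n) t) x - ser (\<lambda>n. du (lam n) (a0 n) (a1 n) (h n) t) x\<bar>
     \<le> 2 * CW * D * exp (K * t) / K"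
proof -
  let ?w = "\<lambda>n. du (lam n) (a0 n) (a1 n) (g n) t - du (lam n) (a0 n) (a1 n) (h n) t"
  have c: "continuous_on A (g n)" "continuous_on A (h n)" for A n using g h continuous_on_subset by blast+
  have gi: "(\<lambda>s. 2 * (\<bar>g n s - h n s\<bar> / W n)) integrable_on {0..t}" for n
    by (intro integrable_continuous_real continuous_intros c) auto
  have bN: "(\<Sum>n<N. \<bar>?w n\<bar>) \<le> 2 * CW * D * exp (K * t) / K" for N
  proof -
    have "(\<Sum>n<N. \<bar>?w n\<bar>) \<le> (\<Sum>n<N. integral {0..t} (\<lambda>s. 2 * (\<bar>g n s - h n s\<bar> / W n)))"
      by (intro sum_mono du_diff_bound g h lam W_pos t)
    also have "\<dots> = integral {0..t} (\<lambda>s. \<Sum>n<N. 2 * (\<bar>g n s - h n s\<bar> / W n))"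
      by (intro integral_sum[symmetric] gi) auto
    also have "\<dots> \<le> integral {0..t} (\<lambda>s. 2 * CW * D * exp (K * s))"
    proof (intro integral_le integrable_sum gi)
      fix s assume "s \<in> {0..t}"
      have "(\<Sum>n<N. 2 * (\<bar>g n s - h n s\<bar> / W n)) = 2 * (\<Sum>n<N. \<bar>g n s - h n s\<bar> / W n)" by (simp add: sum_distrib_left)
      also have "\<dots> \<le> 2 * (CW * sqrt (\<Sum>n<N. (g n s - h n s)\<^sup>2))" by (intro mult_left_mono sum_weighted_le) auto
      also have "\<dots> \<le> 2 * (CW * sqrt ((D * exp (K * s))\<^sup>2))"
        by (intro mult_left_mono real_sqrt_le_mono D CW_nonneg) auto
      also have "\<dots> = 2 * CW * D * exp (K * s)" using D0 by simp
      finally show "(\<Sum>n<N. 2 * (\<bar>g n s - h n s\<bar> / W n)) \<le> 2 * CW * D * exp (K * s)" .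
    qed (auto intro!: integrable_continuous_real continuous_intros)
    also have "\<dots> = 2 * CW * D * exp (K * t) / K - 2 * CW * D * exp (K * 0) / K"
      using K t
      by (intro integral_unique fundamental_theorem_of_calculus[where f="\<lambda>s. 2 * CW * D * exp (K * s) / K"])
         (auto intro!: derivative_eq_intros simp: has_real_derivative_iff_has_vector_derivative[symmetric])
    also have "\<dots> \<le> 2 * CW * D * exp (K * t) / K" using K CW_nonneg D0 by simp
    finally show ?thesis .
  qed
  have sw: "summable (\<lambda>n. \<bar>?w n\<bar>)" using bN by (intro summableI_nonneg_bounded) auto
  have "\<bar>ser ?w x\<bar> \<le> (\<Sum>n. \<bar>?w n\<bar>)" by (rule ser_bound[OF sw])
  also have "\<dots> \<le> 2 * CW * D * exp (K * t) / K" by (rule suminf_le_const[OF sw bN])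
  finally show ?thesis unfolding ser_diff[OF sg sh] .
qed

text \<open>Differentiability of single modes says nothing about their sum; the last clause supplies
  the summable majorant, uniform on bounded time intervals, under which all limits over the modes
  are taken. Derivatives are taken within [0, infinity), so they are one-sided at 0.\<close>

definition modal_curve ::
  "(nat \<Rightarrow> real) \<Rightarrow> (nat \<Rightarrow> real \<Rightarrow> real) \<Rightarrow> (nat \<Rightarrow> real \<Rightarrow> real) \<Rightarrow> (real \<Rightarrow> real \<Rightarrow> real) \<Rightarrow> bool" where
  "modal_curve lam a a' G \<longleftrightarrow>
    (\<forall>n. \<forall>t\<ge>0. (a n has_real_derivative a' n t) (at t within {0..})) \<and>
    (\<forall>n. \<forall>t\<ge>0. (a' n has_real_derivative - (lam n)\<^sup>2 * a n t - coef (G t) n) (at t within {0..})) \<and>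
    (\<forall>T\<ge>0. \<exists>M. summable M \<and> (\<forall>n t. 0 \<le> t \<longrightarrow> t \<le> T \<longrightarrow> (lam n * a n t)\<^sup>2 + (a' n t)\<^sup>2 \<le> M n))"

definition lip_bounded :: "real \<Rightarrow> real \<Rightarrow> (real \<Rightarrow> real \<Rightarrow> real) \<Rightarrow> bool" where
  "lip_bounded L B N \<longleftrightarrow> L \<ge> 0 \<and> (\<forall>y z y' z'. \<bar>N y z - N y' z'\<bar> \<le> L * (\<bar>y - y'\<bar> + \<bar>z - z'\<bar>)) \<and> (\<forall>y z. \<bar>N y z\<bar> \<le> B)"

lemma lip_boundedD:
  assumes "lip_bounded L B N"
  shows "L \<ge> 0" "\<bar>N y z - N y' z'\<bar> \<le> L * (\<bar>y - y'\<bar> + \<bar>z - z'\<bar>)" "\<bar>N y z\<bar> \<le> B"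
  using assms by (auto simp: lip_bounded_def)

lemma lip_bounded_continuous:
  assumes "lip_bounded L B N" "continuous_on A f" "continuous_on A g"
  shows "continuous_on A (\<lambda>x. N (f x) (g x))"
proof -
  have "(2 * L)-lipschitz_on UNIV (\<lambda>p. N (fst p) (snd p))"
  proof (rule lipschitz_onI)
    fix p q :: "real \<times> real"
    have "dist (N (fst p) (snd p)) (N (fst q) (snd q)) \<le> L * (dist (fst p) (fst q) + dist (snd p) (snd q))"
      using lip_boundedD(2)[OF assms(1)] by (simp add: dist_real_def)
    also have "\<dots> \<le> L * (dist p q + dist p q)"
      using lip_boundedD(1)[OF assms(1)] by (intro mult_left_mono add_mono dist_fst_le dist_snd_le) auto
    finally show "dist (N (fst p) (snd p)) (N (fst q) (snd q)) \<le> 2 * L * dist p q" by simp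
  qed (use lip_boundedD(1)[OF assms(1)] in simp)
  then have "continuous_on UNIV (\<lambda>p. N (fst p) (snd p))" by (rule lipschitz_on_continuous_on)
  from continuous_on_compose2[OF this continuous_on_Pair[OF assms(2,3)]] show ?thesis by simp
qed

lemma du_ser_bcontfun:
  assumes lam: "\<And>n. lam n \<ge> W n"
    and s0: "summable (\<lambda>n. (lam n * a0 n)\<^sup>2)" and s1: "summable (\<lambda>n. (a1 n)\<^sup>2)"
    and g: "\<And>n. continuous_on UNIV (g n)" and B: "\<And>s N. (\<Sum>n<N. (g n s)\<^sup>2) \<le> B2" and K: "K > 0"
  shows "continuous_on UNIV (\<lambda>p. exp (- K * max 0 (fst p)) * ser (\<lambda>n. du (lam n) (a0 n) (a1 n) (g n) (max 0 (fst p))) (snd p))"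
    and "\<exists>C. \<forall>p. \<bar>exp (- K * max 0 (fst p)) * ser (\<lambda>n. du (lam n) (a0 n) (a1 n) (g n) (max 0 (fst p))) (snd p)\<bar> \<le> C"
proof -
  show "continuous_on UNIV (\<lambda>p. exp (- K * max 0 (fst p)) * ser (\<lambda>n. du (lam n) (a0 n) (a1 n) (g n) (max 0 (fst p))) (snd p))"
    by (intro continuous_on_mult du_ser_continuous[OF lam s0 s1 g B] continuous_intros)
  define D where "D = CW * sqrt ((\<Sum>n. 2 * (lam n * a0 n)\<^sup>2) + (\<Sum>n. 2 * (a1 n)\<^sup>2))"
  have D: "D \<ge> 0" unfolding D_def
    by (intro mult_nonneg_nonneg CW_nonneg real_sqrt_ge_zero add_nonneg_nonneg suminf_nonneg summable_mult s0 s1) auto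
  have E: "2 * CW * sqrt B2 \<ge> 0" using CW_nonneg B[where N=0] by simp
  have "\<bar>exp (- K * max 0 (fst p)) * ser (\<lambda>n. du (lam n) (a0 n) (a1 n) (g n) (max 0 (fst p))) (snd p)\<bar> \<le> D + 2 * CW * sqrt B2 / K" for p :: "real \<times> real"
  proof -
    have "\<bar>exp (- K * max 0 (fst p)) * ser (\<lambda>n. du (lam n) (a0 n) (a1 n) (g n) (max 0 (fst p))) (snd p)\<bar>
      \<le> exp (- K * max 0 (fst p)) * (D + 2 * CW * sqrt B2 * max 0 (fst p))"
      unfolding abs_mult D_def abs_exp_cancel
      by (intro mult_left_mono du_ser_bound(2)[OF lam s0 s1 g B]) auto
    also have "\<dots> \<le> D + 2 * CW * sqrt B2 / K"
      by (rule mult_exp_minus_le[OF D E K]) simp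
    finally show ?thesis .
  qed
  then show "\<exists>C. \<forall>p. \<bar>exp (- K * max 0 (fst p)) * ser (\<lambda>n. du (lam n) (a0 n) (a1 n) (g n) (max 0 (fst p))) (snd p)\<bar> \<le> C"
    by blast
qed

text \<open>Instead of weighting the norm, the unknown is rescaled: the fixed point is exp(-K t)
  times the pair of series, sought in the complete space of bounded continuous functions from the
  plane to the plane. The map \<open>H\<close> undoes the scaling before applying the nonlinearity,
  and \<open>S\<close> restores it after Duhamel's formula.\<close>

theorem modal_existence:
  assumes lam: "\<And>n. lam n \<ge> W n" "\<And>n. kap n \<ge> W n"
    and N: "lip_bounded L B N1" "lip_bounded L B N2"
    and s: "summable (\<lambda>n. (lam n * a0 n)\<^sup>2)" "summable (\<lambda>n. (a1 n)\<^sup>2)"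
       "summable (\<lambda>n. (kap n * b0 n)\<^sup>2)" "summable (\<lambda>n. (b1 n)\<^sup>2)"
  obtains a a' b b' where
    "modal_curve lam a a' (\<lambda>t x. N1 (ser (\<lambda>n. a n t) x) (ser (\<lambda>n. b n t) x))"
    "modal_curve kap b b' (\<lambda>t x. N2 (ser (\<lambda>n. a n t) x) (ser (\<lambda>n. b n t) x))"
    "\<And>n. a n 0 = a0 n" "\<And>n. a' n 0 = a1 n" "\<And>n. b n 0 = b0 n" "\<And>n. b' n 0 = b1 n"
proof -
  \<comment> \<open>The forcings differ in L2 by at most 2 sqrt(pi) L exp(K s) times the distance
    (\<open>gD\<close>), so \<open>du_ser_diff\<close> gives 4 CW sqrt(pi) L / K times the distance
    for each component and 8 CW sqrt(pi) L / K for both. The value of K makes this at most 1/2; the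
    summand 1 keeps K positive when L = 0.\<close>
  define K where "K = 16 * CW * sqrt pi * L + 1"
  have L: "L \<ge> 0" using lip_boundedD(1)[OF N(1)] .
  have K: "K > 0" using L CW_nonneg by (simp add: K_def add_nonneg_pos)
  define H where "H N v s x = N (exp (K * s) * fst (apply_bcontfun v (s, x))) (exp (K * s) * snd (apply_bcontfun v (s, x)))"
    for N :: "real \<Rightarrow> real \<Rightarrow> real" and v :: "(real \<times> real) \<Rightarrow>\<^sub>C (real \<times> real)" and s x
  define g where "g N v n s = coef (H N v s) n" for N v n s
  have Hc: "continuous_on UNIV (\<lambda>p. H N v (fst p) (snd p))" if "lip_bounded L B N" for N v
    unfolding H_def by (intro lip_bounded_continuous[OF that] continuous_intros) auto
  have Hx: "continuous_on UNIV (H N v s)" if "lip_bounded L B N" for N v s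
    using continuous_on_compose2[OF Hc[OF that], of UNIV "\<lambda>x. (s, x)"] by (simp add: continuous_intros)
  have HB: "\<bar>H N v s x\<bar> \<le> B" if "lip_bounded L B N" for N v s x
    unfolding H_def by (rule lip_boundedD(3)[OF that])
  have g: "continuous_on UNIV (g N v n)" if "lip_bounded L B N" for N v n
    unfolding g_def[abs_def] by (rule coef_param_continuous[OF Hc[OF that] HB[OF that]])
  have gB: "(\<Sum>n<M. (g N v n s)\<^sup>2) \<le> pi * B\<^sup>2" if "lip_bounded L B N" for N v s M
    unfolding g_def by (rule sum_coef_le[OF Hx[OF that] HB[OF that]])
  have gD: "(\<Sum>n<M. (g N v n s - g N w n s)\<^sup>2) \<le> ((sqrt pi * (2 * L * dist v w)) * exp (K * s))\<^sup>2"
    if NN: "lip_bounded L B N" for N v w s M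
  proof -
    have L2: "H N v s \<in> L2" for v by (rule L2_continuous[OF Hx[OF NN]])
    have "g N v n s - g N w n s = coef (\<lambda>x. H N v s x - H N w s x) n" for n
      unfolding g_def by (rule coef_diff[OF L2 L2, symmetric])
    then have "(\<Sum>n<M. (g N v n s - g N w n s)\<^sup>2) = (\<Sum>n<M. (coef (\<lambda>x. H N v s x - H N w s x) n)\<^sup>2)" by simp
    also have "\<dots> \<le> pi * (2 * L * dist v w * exp (K * s))\<^sup>2"
    proof (rule sum_coef_le)
      show "continuous_on UNIV (\<lambda>x. H N v s x - H N w s x)" by (intro continuous_intros Hx[OF NN])
      fix x
      have d: "dist (v (s,x)) (w (s,x)) \<le> dist v w" by (rule dist_bounded)
      have "\<bar>exp (K * s) * fst (v (s,x)) - exp (K * s) * fst (w (s,x))\<bar> \<le> exp (K * s) * dist v w"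
        using order_trans[OF dist_fst_le d] by (simp add: right_diff_distrib[symmetric] abs_mult dist_real_def)
      moreover have "\<bar>exp (K * s) * snd (v (s,x)) - exp (K * s) * snd (w (s,x))\<bar> \<le> exp (K * s) * dist v w"
        using order_trans[OF dist_snd_le d] by (simp add: right_diff_distrib[symmetric] abs_mult dist_real_def)
      ultimately have "\<bar>H N v s x - H N w s x\<bar> \<le> L * (exp (K * s) * dist v w + exp (K * s) * dist v w)"
        unfolding H_def by (intro order_trans[OF lip_boundedD(2)[OF NN]] mult_left_mono add_mono L)
      then show "\<bar>H N v s x - H N w s x\<bar> \<le> 2 * L * dist v w * exp (K * s)" by (simp add: algebra_simps)
    qed
    also have "\<dots> = ((sqrt pi * (2 * L * dist v w)) * exp (K * s))\<^sup>2" by (simp add: power_mult_distrib)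
    finally show ?thesis .
  qed
  define u where "u v n t = du (lam n) (a0 n) (a1 n) (g N1 v n) t" for v n t
  define z where "z v n t = du (kap n) (b0 n) (b1 n) (g N2 v n) t" for v n t
  define S where "S v p = (exp (- K * max 0 (fst p)) * ser (\<lambda>n. u v n (max 0 (fst p))) (snd p),
      exp (- K * max 0 (fst p)) * ser (\<lambda>n. z v n (max 0 (fst p))) (snd p))" for v and p :: "real \<times> real"
  have Sb: "S v \<in> bcontfun" for v
  proof -
    note bu = du_ser_bcontfun[OF lam(1) s(1,2) g[OF N(1)] gB[OF N(1)] K, of v]
    note bz = du_ser_bcontfun[OF lam(2) s(3,4) g[OF N(2)] gB[OF N(2)] K, of v]
    obtain C1 where C1: "\<And>p. \<bar>exp (- K * max 0 (fst p)) * ser (\<lambda>n. u v n (max 0 (fst p))) (snd p)\<bar> \<le> C1"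
      using bu(2) unfolding u_def by blast
    obtain C2 where C2: "\<And>p. \<bar>exp (- K * max 0 (fst p)) * ser (\<lambda>n. z v n (max 0 (fst p))) (snd p)\<bar> \<le> C2"
      using bz(2) unfolding z_def by blast
    show ?thesis
    proof (rule bcontfun_normI[where b="C1 + C2"])
      show "continuous_on UNIV (S v)"
        unfolding S_def[abs_def] u_def z_def by (intro continuous_on_Pair bu(1) bz(1))
      show "norm (S v p) \<le> C1 + C2" for p
        using norm_Pair_le[of "fst (S v p)" "snd (S v p)"] C1[of p] C2[of p] by (simp add: S_def)
    qed
  qed
  have Sa: "apply_bcontfun (Bcontfun (S v)) = S v" for v by (simp add: Bcontfun_inverse Sb)
  have contr: "dist (Bcontfun (S v)) (Bcontfun (S w)) \<le> (1/2) * dist v w" for v w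
  proof (rule dist_bound)
    fix p :: "real \<times> real"
    define t where "t = max 0 (fst p)"
    have t: "t \<ge> 0" by (simp add: t_def)
    define D where "D = sqrt pi * (2 * L * dist v w)"
    have D: "D \<ge> 0" using L by (simp add: D_def)
    have gD': "(\<Sum>n<M. (g N v n s - g N w n s)\<^sup>2) \<le> (D * exp (K * s))\<^sup>2" if "lip_bounded L B N" for N s M
      unfolding D_def by (rule gD[OF that])
    have e: "exp (- K * t) * exp (K * t) = 1" by (simp add: exp_add[symmetric])
    have c: "\<bar>exp (- K * t) * r - exp (- K * t) * r'\<bar> \<le> 2 * CW * D / K" if "\<bar>r - r'\<bar> \<le> 2 * CW * D * exp (K * t) / K" for r r'
    proof -
      have "\<bar>exp (- K * t) * r - exp (- K * t) * r'\<bar> = exp (- K * t) * \<bar>r - r'\<bar>"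
        by (simp only: right_diff_distrib[symmetric] abs_mult abs_exp_cancel)
      also have "\<dots> \<le> exp (- K * t) * (2 * CW * D * exp (K * t) / K)" by (intro mult_left_mono that) auto
      also have "\<dots> = (exp (- K * t) * exp (K * t)) * (2 * CW * D / K)" by (simp only: ac_simps times_divide_eq_right)
      finally show ?thesis by (simp only: e mult_1_left)
    qed
    have "\<bar>fst (S v p) - fst (S w p)\<bar> \<le> 2 * CW * D / K"
      unfolding S_def fst_conv t_def[symmetric] u_def
      by (intro c du_ser_diff[OF lam(1) _ _ g[OF N(1)] g[OF N(1)] gD'[OF N(1)] D K t]
          du_ser_bound(1)[OF lam(1) s(1,2) g[OF N(1)] gB[OF N(1)] t])
    moreover have "\<bar>snd (S v p) - snd (S w p)\<bar> \<le> 2 * CW * D / K"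
      unfolding S_def snd_conv t_def[symmetric] z_def
      by (intro c du_ser_diff[OF lam(2) _ _ g[OF N(2)] g[OF N(2)] gD'[OF N(2)] D K t]
          du_ser_bound(1)[OF lam(2) s(3,4) g[OF N(2)] gB[OF N(2)] t])
    moreover have "dist (S v p) (S w p) \<le> \<bar>fst (S v p) - fst (S w p)\<bar> + \<bar>snd (S v p) - snd (S w p)\<bar>"
      unfolding dist_prod_def dist_real_def by (rule sqrt_sum_squares_le_sum_abs[THEN order_trans]) simp
    moreover have "2 * CW * D / K + 2 * CW * D / K \<le> (1/2) * dist v w"
    proof -
      have "8 * (CW * sqrt pi * L) * dist v w \<le> (K / 2) * dist v w"
        by (intro mult_right_mono) (auto simp: K_def)
      then have "8 * (CW * sqrt pi * L) * dist v w / K \<le> (K / 2) * dist v w / K"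
        using K by (intro divide_right_mono) auto
      moreover have "2 * CW * D / K + 2 * CW * D / K = 8 * (CW * sqrt pi * L) * dist v w / K"
        by (simp add: D_def add_divide_distrib[symmetric])
      moreover have "(K / 2) * dist v w / K = (1/2) * dist v w" using K by simp
      ultimately show ?thesis by linarith
    qed
    ultimately show "dist (Bcontfun (S v) p) (Bcontfun (S w) p) \<le> (1/2) * dist v w"
      unfolding Sa by linarith
  qed
  then obtain v where v: "Bcontfun (S v) = v"
    using banach_fix_type[of "1/2" "\<lambda>v. Bcontfun (S v)"] by auto
  have vS: "apply_bcontfun v p = S v p" for p using Sa[of v] v by simp
  \<comment> \<open>At the fixed point the factors exp(K t) and exp(-K t) cancel, so for t \<ge> 0
    the forcing inside Duhamel's formula is the nonlinearity evaluated at the solution.\<close>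
  have Hv: "H N v t = (\<lambda>x. N (ser (\<lambda>n. u v n t) x) (ser (\<lambda>n. z v n t) x))" if "t \<ge> 0" for N t
  proof
    fix x
    have e: "exp (K * t) * (exp (- K * t) * r) = r" for r by (simp add: mult.assoc[symmetric] exp_add[symmetric])
    have "max 0 t = t" using that by simp
    then show "H N v t x = N (ser (\<lambda>n. u v n t) x) (ser (\<lambda>n. z v n t) x)"
      unfolding H_def vS S_def fst_conv snd_conv by (simp only: e)
  qed
  have gv: "g N v n t = coef (\<lambda>x. N (ser (\<lambda>n. u v n t) x) (ser (\<lambda>n. z v n t) x)) n" if "t \<ge> 0" for N n t
    unfolding g_def Hv[OF that] ..
  have lp: "lam n > 0" "kap n > 0" for n using lam[of n] W_pos[of n] by linarith+
  show thesis
  proof (rule that)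
    show "modal_curve lam (u v) (\<lambda>n t. dv (lam n) (a0 n) (a1 n) (g N1 v n) t)
      (\<lambda>t x. N1 (ser (\<lambda>n. u v n t) x) (ser (\<lambda>n. z v n t) x))"
      unfolding modal_curve_def
    proof (intro conjI allI impI)
      fix n and t :: real assume t: "t \<ge> 0"
      show "(u v n has_real_derivative dv (lam n) (a0 n) (a1 n) (g N1 v n) t) (at t within {0..})"
        unfolding u_def[abs_def] by (rule du_DERIV(1)[OF g[OF N(1)] lp(1) t])
      show "(dv (lam n) (a0 n) (a1 n) (g N1 v n) has_real_derivative
          - (lam n)\<^sup>2 * u v n t - coef (\<lambda>x. N1 (ser (\<lambda>n. u v n t) x) (ser (\<lambda>n. z v n t) x)) n) (at t within {0..})"
        unfolding gv[OF t, symmetric] unfolding u_def by (rule du_DERIV(2)[OF g[OF N(1)] lp(1) t])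
    next
      fix T :: real assume "T \<ge> 0"
      from du_majorant[OF lam(1) s(1,2) g[OF N(1)] gB[OF N(1)] this]
      show "\<exists>M. summable M \<and> (\<forall>n t. 0 \<le> t \<longrightarrow> t \<le> T \<longrightarrow> (lam n * u v n t)\<^sup>2 + (dv (lam n) (a0 n) (a1 n) (g N1 v n) t)\<^sup>2 \<le> M n)"
        unfolding u_def by blast
    qed
    show "modal_curve kap (z v) (\<lambda>n t. dv (kap n) (b0 n) (b1 n) (g N2 v n) t)
      (\<lambda>t x. N2 (ser (\<lambda>n. u v n t) x) (ser (\<lambda>n. z v n t) x))"
      unfolding modal_curve_def
    proof (intro conjI allI impI)
      fix n and t :: real assume t: "t \<ge> 0"
      show "(z v n has_real_derivative dv (kap n) (b0 n) (b1 n) (g N2 v n) t) (at t within {0..})"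
        unfolding z_def[abs_def] by (rule du_DERIV(1)[OF g[OF N(2)] lp(2) t])
      show "(dv (kap n) (b0 n) (b1 n) (g N2 v n) has_real_derivative
          - (kap n)\<^sup>2 * z v n t - coef (\<lambda>x. N2 (ser (\<lambda>n. u v n t) x) (ser (\<lambda>n. z v n t) x)) n) (at t within {0..})"
        unfolding gv[OF t, symmetric] unfolding z_def by (rule du_DERIV(2)[OF g[OF N(2)] lp(2) t])
    next
      fix T :: real assume "T \<ge> 0"
      from du_majorant[OF lam(2) s(3,4) g[OF N(2)] gB[OF N(2)] this]
      show "\<exists>M. summable M \<and> (\<forall>n t. 0 \<le> t \<longrightarrow> t \<le> T \<longrightarrow> (kap n * z v n t)\<^sup>2 + (dv (kap n) (b0 n) (b1 n) (g N2 v n) t)\<^sup>2 \<le> M n)"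
        unfolding z_def by blast
    qed
  qed (use lp in \<open>simp_all add: u_def z_def du_zero less_imp_neq[symmetric]\<close>)
qed

section \<open>Conservation of energy\<close>

lemma modal_curveD:
  assumes "modal_curve lam a a' G"
  shows "t \<ge> 0 \<Longrightarrow> (a n has_real_derivative a' n t) (at t within {0..})"
    "t \<ge> 0 \<Longrightarrow> (a' n has_real_derivative - (lam n)\<^sup>2 * a n t - coef (G t) n) (at t within {0..})"
    "T \<ge> 0 \<Longrightarrow> \<exists>M. summable M \<and> (\<forall>n t. 0 \<le> t \<longrightarrow> t \<le> T \<longrightarrow> (lam n * a n t)\<^sup>2 + (a' n t)\<^sup>2 \<le> M n)"
  using assms unfolding modal_curve_def by blast+

lemma modal_curve_summable:
  assumes "modal_curve lam a a' G" "t \<ge> 0"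
  shows "summable (\<lambda>n. (lam n * a n t)\<^sup>2)" "summable (\<lambda>n. (a' n t)\<^sup>2)"
    "summable (\<lambda>n. (lam n * a n t)\<^sup>2 + (a' n t)\<^sup>2)"
proof -
  obtain M where M: "summable M" "\<And>n. (lam n * a n t)\<^sup>2 + (a' n t)\<^sup>2 \<le> M n"
    using modal_curveD(3)[OF assms] assms(2) by blast
  show s: "summable (\<lambda>n. (lam n * a n t)\<^sup>2 + (a' n t)\<^sup>2)"
    by (rule summable_comparison_test[OF _ M(1)]) (use M(2) in auto)
  show "summable (\<lambda>n. (lam n * a n t)\<^sup>2)" "summable (\<lambda>n. (a' n t)\<^sup>2)"
    by (rule summable_comparison_test[OF _ s]; auto)+
qed

lemma modal_curve_summable_abs:
  assumes "modal_curve lam a a' G" "t \<ge> 0" "\<And>n. lam n \<ge> W n"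
  shows "summable (\<lambda>n. (W n * a n t)\<^sup>2)" "summable (\<lambda>n. \<bar>a n t\<bar>)"
    "\<bar>ser (\<lambda>n. a n t) x\<bar> \<le> CW * sqrt (\<Sum>n. (lam n * a n t)\<^sup>2)"
proof -
  note s = modal_curve_summable[OF assms(1,2)]
  have mw: "summable (\<lambda>n. (W n * a n t)\<^sup>2)" "(\<Sum>n. (W n * a n t)\<^sup>2) \<le> (\<Sum>n. (lam n * a n t)\<^sup>2)"
    using majorant_imp_summable_W[OF assms(3) s(1), of "\<lambda>n. a n t" "\<lambda>n. 0"] by auto
  show "summable (\<lambda>n. (W n * a n t)\<^sup>2)" by (rule mw(1))
  show sa: "summable (\<lambda>n. \<bar>a n t\<bar>)" by (rule summable_abs_of_W[OF mw(1)])
  have "\<bar>ser (\<lambda>n. a n t) x\<bar> \<le> CW * sqrt (\<Sum>n. (W n * a n t)\<^sup>2)"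
    using ser_bound[OF sa, of x] summable_abs_of_W(2)[OF mw(1)] by linarith
  also have "\<dots> \<le> CW * sqrt (\<Sum>n. (lam n * a n t)\<^sup>2)"
    by (intro mult_left_mono real_sqrt_le_mono mw(2) CW_nonneg)
  finally show "\<bar>ser (\<lambda>n. a n t) x\<bar> \<le> CW * sqrt (\<Sum>n. (lam n * a n t)\<^sup>2)" .
qed

lemma modal_increment_bound:
  assumes a: "\<And>t. t \<ge> 0 \<Longrightarrow> (a has_real_derivative a' t) (at t within {0..})"
    and M: "\<And>t. 0 \<le> t \<Longrightarrow> t \<le> T \<Longrightarrow> (a' t)\<^sup>2 \<le> M"
    and st: "0 \<le> s" "s \<le> T" "0 \<le> t" "t \<le> T"
  shows "(a s - a t)\<^sup>2 \<le> M * (s - t)\<^sup>2"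
proof -
  have M0: "M \<ge> 0" using order_trans[OF zero_le_power2 M[OF st(1,2)]] .
  have "norm (a s - a t) \<le> sqrt M * norm (s - t)"
  proof (rule field_differentiable_bound[where S="{0..T}" and f'=a'])
    fix r assume "r \<in> {0..T}"
    then show "(a has_real_derivative a' r) (at r within {0..T})"
      by (intro DERIV_subset[OF a]) auto
    show "norm (a' r) \<le> sqrt M" using M[of r] \<open>r \<in> {0..T}\<close> by (auto intro: real_le_rsqrt)
  qed (use st in auto)
  then have "(norm (a s - a t))\<^sup>2 \<le> (sqrt M * norm (s - t))\<^sup>2" by (intro power_mono) auto
  then show ?thesis using M0 by (simp add: power_mult_distrib)
qed

lemma DERIV_mean_value:
  fixes f :: "real \<Rightarrow> real"
  assumes "\<And>x. (f has_real_derivative f' x) (at x)"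
  obtains c where "min x y \<le> c" "c \<le> max x y" "f y - f x = (y - x) * f' c"
proof -
  consider "x = y" | "x < y" | "y < x" by linarith
  then show thesis
  proof cases
    case 1 then show thesis using that[of x] by simp
  next
    case 2
    then obtain c where "x < c" "c < y" "f y - f x = (y - x) * f' c" using MVT2[of x y f f'] assms by blast
    then show thesis using that[of c] 2 by simp
  next
    case 3
    then obtain c where "y < c" "c < x" "f x - f y = (x - y) * f' c" using MVT2[of y x f f'] assms by blast
    then show thesis using that[of c] 3 by (simp add: algebra_simps)
  qed
qed

lemma sum_mult_le_squares: "\<bar>\<Sum>n<N. p n * q n\<bar> \<le> (\<Sum>n<N. (p n)\<^sup>2) + (\<Sum>n<N. (q n)\<^sup>2)" for p q :: "nat \<Rightarrow> real"
proof -
  have "\<bar>\<Sum>n<N. p n * q n\<bar> \<le> (\<Sum>n<N. (p n)\<^sup>2 + (q n)\<^sup>2)"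
  proof (intro order_trans[OF sum_abs] sum_mono)
    fix n
    have "2 * \<bar>p n\<bar> * \<bar>q n\<bar> \<le> \<bar>p n\<bar>\<^sup>2 + \<bar>q n\<bar>\<^sup>2" by (rule sum_squares_bound)
    moreover have "0 \<le> \<bar>p n\<bar> * \<bar>q n\<bar>" by simp
    ultimately show "\<bar>p n * q n\<bar> \<le> (p n)\<^sup>2 + (q n)\<^sup>2"
      unfolding abs_mult power2_abs mult.assoc by linarith
  qed
  then show ?thesis by (simp add: sum.distrib)
qed

lemma abs_mult_le_squares: "\<bar>p * q\<bar> \<le> p\<^sup>2 + q\<^sup>2" for p q :: real
  using sum_mult_le_squares[of "\<lambda>_. p" "\<lambda>_. q" 1] by simp

text \<open>The two variables are changed one after the other, z first and then y, with the mean
  value theorem for each. Lipschitz continuity of the partial derivatives makes the error quadratic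
  in the increments, although \<Psi> need not be twice differentiable.\<close>

lemma potential_Taylor:
  assumes d1: "\<And>y z. ((\<lambda>y. \<Psi> y z) has_real_derivative N1 y z) (at y)"
    and d2: "\<And>y z. ((\<lambda>z. \<Psi> y z) has_real_derivative \<kappa> * N2 y z) (at z)"
    and N: "lip_bounded L B N1" "lip_bounded L B N2" and \<kappa>: "\<kappa> \<ge> 0"
  shows "\<bar>\<Psi> y' z' - \<Psi> y z - (N1 y z * (y' - y) + \<kappa> * (N2 y z * (z' - z)))\<bar>
     \<le> 2 * L * (1 + \<kappa>) * ((y' - y)\<^sup>2 + (z' - z)\<^sup>2)"
proof -
  have L: "L \<ge> 0" by (rule lip_boundedD(1)[OF N(1)])
  obtain c where c: "min y y' \<le> c" "c \<le> max y y'" "\<Psi> y' z' - \<Psi> y z' = (y' - y) * N1 c z'"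
    using DERIV_mean_value[OF d1, of y y' z'] by blast
  obtain d where d: "min z z' \<le> d" "d \<le> max z z'" "\<Psi> y z' - \<Psi> y z = (z' - z) * (\<kappa> * N2 y d)"
    using DERIV_mean_value[OF d2, of z z' y] by blast
  have cd: "\<bar>c - y\<bar> \<le> \<bar>y' - y\<bar>" "\<bar>d - z\<bar> \<le> \<bar>z' - z\<bar>" using c d by auto
  have n1: "\<bar>N1 c z' - N1 y z\<bar> \<le> L * (\<bar>y' - y\<bar> + \<bar>z' - z\<bar>)"
    by (rule order_trans[OF lip_boundedD(2)[OF N(1)]]) (intro mult_left_mono add_mono cd L order_refl)
  have n2: "\<bar>N2 y d - N2 y z\<bar> \<le> L * \<bar>z' - z\<bar>"
    using lip_boundedD(2)[OF N(2), of y d y z] mult_left_mono[OF cd(2) L] by simp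
  have "\<Psi> y' z' - \<Psi> y z - (N1 y z * (y' - y) + \<kappa> * (N2 y z * (z' - z)))
     = (y' - y) * (N1 c z' - N1 y z) + \<kappa> * ((z' - z) * (N2 y d - N2 y z))"
    using c(3) d(3) by (simp add: algebra_simps)
  then have "\<bar>\<Psi> y' z' - \<Psi> y z - (N1 y z * (y' - y) + \<kappa> * (N2 y z * (z' - z)))\<bar>
     = \<bar>(y' - y) * (N1 c z' - N1 y z) + \<kappa> * ((z' - z) * (N2 y d - N2 y z))\<bar>" by simp
  also have "\<dots> \<le> \<bar>y' - y\<bar> * \<bar>N1 c z' - N1 y z\<bar> + \<kappa> * (\<bar>z' - z\<bar> * \<bar>N2 y d - N2 y z\<bar>)"
    by (rule order_trans[OF abs_triangle_ineq]) (use \<kappa> in \<open>simp add: abs_mult\<close>)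
  also have "\<dots> \<le> \<bar>y' - y\<bar> * (L * (\<bar>y' - y\<bar> + \<bar>z' - z\<bar>)) + \<kappa> * (\<bar>z' - z\<bar> * (L * \<bar>z' - z\<bar>))"
    by (intro add_mono mult_left_mono n1 n2 \<kappa>) auto
  also have "\<dots> = L * (\<bar>y' - y\<bar>\<^sup>2 + \<bar>y' - y\<bar> * \<bar>z' - z\<bar>) + L * \<kappa> * \<bar>z' - z\<bar>\<^sup>2"
    by (simp add: power2_eq_square algebra_simps)
  also have "\<dots> \<le> L * (2 * (\<bar>y' - y\<bar>\<^sup>2 + \<bar>z' - z\<bar>\<^sup>2)) + L * \<kappa> * (2 * (\<bar>y' - y\<bar>\<^sup>2 + \<bar>z' - z\<bar>\<^sup>2))"
  proof (intro add_mono mult_left_mono)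
    have "p\<^sup>2 + p * q \<le> 2 * (p\<^sup>2 + q\<^sup>2)" for p q :: real
    proof -
      have "p * q \<le> p\<^sup>2 + q\<^sup>2" using abs_mult_le_squares by (rule abs_le_D1)
      moreover have "q\<^sup>2 \<ge> 0" by simp
      ultimately show ?thesis unfolding distrib_left by linarith
    qed
    then show "\<bar>y' - y\<bar>\<^sup>2 + \<bar>y' - y\<bar> * \<bar>z' - z\<bar> \<le> 2 * (\<bar>y' - y\<bar>\<^sup>2 + \<bar>z' - z\<bar>\<^sup>2)" .
    show "\<bar>z' - z\<bar>\<^sup>2 \<le> 2 * (\<bar>y' - y\<bar>\<^sup>2 + \<bar>z' - z\<bar>\<^sup>2)" by simp
  qed (use L \<kappa> in auto)
  finally show ?thesis by (simp add: algebra_simps)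
qed

text \<open>Both nonlinearities share the constants L and B, so facts about \<open>G N\<close> are
  proved once for any N with \<open>lip_bounded L B N\<close> and serve both equations.\<close>

locale modal_pair =
  fixes lam kap :: "nat \<Rightarrow> real" and a a' b b' :: "nat \<Rightarrow> real \<Rightarrow> real"
    and N1 N2 :: "real \<Rightarrow> real \<Rightarrow> real" and L B :: real
  assumes lam: "\<And>n. lam n \<ge> W n" and kap: "\<And>n. kap n \<ge> W n"
    and N1: "lip_bounded L B N1" and N2: "lip_bounded L B N2"
    and ma: "modal_curve lam a a' (\<lambda>t x. N1 (ser (\<lambda>n. a n t) x) (ser (\<lambda>n. b n t) x))"
    and mb: "modal_curve kap b b' (\<lambda>t x. N2 (ser (\<lambda>n. a n t) x) (ser (\<lambda>n. b n t) x))"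
begin

abbreviation y where "y t x \<equiv> ser (\<lambda>n. a n t) x"
abbreviation z where "z t x \<equiv> ser (\<lambda>n. b n t) x"
abbreviation G where "G N t x \<equiv> N (y t x) (z t x)"

lemma y_cont: "t \<ge> 0 \<Longrightarrow> continuous_on A (y t)" and z_cont: "t \<ge> 0 \<Longrightarrow> continuous_on A (z t)"
  by (intro continuous_on_ser modal_curve_summable_abs(2)[OF ma _ lam] modal_curve_summable_abs(2)[OF mb _ kap]; assumption)+

lemma G_cont: "lip_bounded L B N \<Longrightarrow> t \<ge> 0 \<Longrightarrow> continuous_on A (G N t)"
  by (rule lip_bounded_continuous[OF _ y_cont z_cont])

lemma G_L2: "lip_bounded L B N \<Longrightarrow> t \<ge> 0 \<Longrightarrow> G N t \<in> L2"
  by (rule L2_continuous[OF G_cont])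

lemma G_coef: "lip_bounded L B N \<Longrightarrow> t \<ge> 0 \<Longrightarrow> (\<Sum>n<M. (coef (G N t) n)\<^sup>2) \<le> pi * B\<^sup>2"
  by (rule sum_coef_le[OF G_cont lip_boundedD(3)])

lemma y_increment:
  assumes "s \<ge> 0" "t \<ge> 0"
  shows "(\<lambda>x. y s x - y t x) \<in> L2" "coef (\<lambda>x. y s x - y t x) n = a n s - a n t"
    "(\<lambda>x. z s x - z t x) \<in> L2" "coef (\<lambda>x. z s x - z t x) n = b n s - b n t"
proof -
  note sa = modal_curve_summable_abs(2)[OF ma _ lam] and sb = modal_curve_summable_abs(2)[OF mb _ kap]
  show "(\<lambda>x. y s x - y t x) \<in> L2" "(\<lambda>x. z s x - z t x) \<in> L2"
    by (intro L2_diff ser_L2 sa sb assms)+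
  show "coef (\<lambda>x. y s x - y t x) n = a n s - a n t" "coef (\<lambda>x. z s x - z t x) n = b n s - b n t"
    by (simp_all add: coef_diff ser_L2 coef_ser sa sb assms)
qed

end

text \<open>By the mean value inequality, the majorant of the squared velocities also bounds the
  squared difference quotients. Paired with g, these are dominated by g^2 + M, so the limit may be
  taken mode by mode. The second claim makes the increments of order |s - t| in L2, so that
  quadratic remainders are negligible.\<close>

lemma modal_pairing_tendsto:
  assumes a: "\<And>n t. t \<ge> 0 \<Longrightarrow> (a n has_real_derivative a' n t) (at t within {0..})"
    and M: "summable M" "\<And>n t. 0 \<le> t \<Longrightarrow> t \<le> T \<Longrightarrow> (a' n t)\<^sup>2 \<le> M n"
    and g: "summable (\<lambda>n. (g n)\<^sup>2)" and t: "0 \<le> t" "t < T"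
  shows "((\<lambda>s. \<Sum>n. g n * ((a n s - a n t) / (s - t))) \<longlongrightarrow> (\<Sum>n. g n * a' n t)) (at t within {0..})"
    and "\<forall>\<^sub>F s in at t within {0..}. (\<Sum>n. (a n s - a n t)\<^sup>2) \<le> (\<Sum>n. M n) * (s - t)\<^sup>2"
proof -
  have ev: "\<forall>\<^sub>F s in at t within {0..}. 0 \<le> s \<and> s \<le> T \<and> s \<noteq> t"
    using eventually_at_topological t
    by (subst eventually_at_topological, intro exI[of _ "{..<T}"]) auto
  have inc: "(a n s - a n t)\<^sup>2 \<le> M n * (s - t)\<^sup>2" if "0 \<le> s" "s \<le> T" for n s
    using that t by (intro modal_increment_bound[of "a n" "a' n" T] a M(2)) auto
  show "((\<lambda>s. \<Sum>n. g n * ((a n s - a n t) / (s - t))) \<longlongrightarrow> (\<Sum>n. g n * a' n t)) (at t within {0..})"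
  proof (rule suminf_tendsto)
    show "((\<lambda>s. g n * ((a n s - a n t) / (s - t))) \<longlongrightarrow> g n * a' n t) (at t within {0..})" for n
      using a[OF t(1), of n] by (intro tendsto_mult_left) (simp add: has_field_derivative_iff)
    show "summable (\<lambda>n. (g n)\<^sup>2 + M n)" by (intro summable_add g M)
    show "\<forall>\<^sub>F s in at t within {0..}. \<forall>n. \<bar>g n * ((a n s - a n t) / (s - t))\<bar> \<le> (g n)\<^sup>2 + M n"
      using ev
    proof eventually_elim
      case (elim s)
      show ?case
      proof
        fix n
        have "((a n s - a n t) / (s - t))\<^sup>2 \<le> M n" using inc[of s n] elim by (simp add: power_divide divide_le_eq)
        then show "\<bar>g n * ((a n s - a n t) / (s - t))\<bar> \<le> (g n)\<^sup>2 + M n"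
          using abs_mult_le_squares[of "g n" "(a n s - a n t) / (s - t)"] by linarith
      qed
    qed
  qed
  show "\<forall>\<^sub>F s in at t within {0..}. (\<Sum>n. (a n s - a n t)\<^sup>2) \<le> (\<Sum>n. M n) * (s - t)\<^sup>2"
    using ev
  proof eventually_elim
    case (elim s)
    have sm: "summable (\<lambda>n. M n * (s - t)\<^sup>2)" by (intro summable_mult2 M)
    have "summable (\<lambda>n. (a n s - a n t)\<^sup>2)"
      by (rule summable_comparison_test[OF _ sm]) (use inc elim in auto)
    then have "(\<Sum>n. (a n s - a n t)\<^sup>2) \<le> (\<Sum>n. M n * (s - t)\<^sup>2)" using inc elim by (intro suminf_le sm) auto
    then show ?case by (simp add: suminf_mult2[OF M(1)])
  qed
qed

lemma modal_energy_derivative: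
  assumes "modal_curve lam a a' G" "t \<ge> 0"
  shows "((\<lambda>t. \<Sum>n<N. (lam n * a n t)\<^sup>2 + (a' n t)\<^sup>2) has_real_derivative
     - 2 * (\<Sum>n<N. coef (G t) n * a' n t)) (at t within {0..})"
proof -
  have "((\<lambda>t. (lam n * a n t)\<^sup>2 + (a' n t)\<^sup>2) has_real_derivative - 2 * (coef (G t) n * a' n t)) (at t within {0..})" for n
    using modal_curveD(1,2)[OF assms(1) assms(2), of n]
    by (auto intro!: derivative_eq_intros simp: power2_eq_square algebra_simps)
  then show ?thesis unfolding sum_distrib_left by (intro DERIV_sum)
qed

lemma summable_mult_squares:
  fixes p q :: "nat \<Rightarrow> real"
  assumes "summable (\<lambda>n. (p n)\<^sup>2)" "summable (\<lambda>n. (q n)\<^sup>2)" shows "summable (\<lambda>n. p n * q n)"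
  by (rule summable_comparison_test[OF _ summable_add[OF assms]]) (auto simp: abs_mult_le_squares)

lemma l2_norm_power2_integral: "(l2_norm u)\<^sup>2 = (\<integral>x. (u x)\<^sup>2 \<partial>mu)"
  by (simp add: l2_norm_def LINT_mu)

context modal_pair
begin

lemma coef_G_summable: "lip_bounded L B N \<Longrightarrow> t \<ge> 0 \<Longrightarrow> summable (\<lambda>n. (coef (G N t) n)\<^sup>2)"
  by (rule parseval_norm(1)[OF G_L2])

text \<open>The values y(t, x) are not known to be differentiable in t for fixed x, so the chain
  rule is not applied pointwise. Instead \<open>potential_Taylor\<close> is integrated over x: by
  Parseval the linear part becomes a pairing of coefficients, whose limit is given by
  \<open>modal_pairing_tendsto\<close>, and the remainder is quadratic in the L2 increments.\<close>

lemma potential_derivative: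
  assumes d1: "\<And>y z. ((\<lambda>y. \<Psi> y z) has_real_derivative N1 y z) (at y)"
    and d2: "\<And>y z. ((\<lambda>z. \<Psi> y z) has_real_derivative \<kappa> * N2 y z) (at z)" and \<kappa>: "\<kappa> \<ge> 0"
    and c: "continuous_on UNIV (\<lambda>p. \<Psi> (fst p) (snd p))" and t: "t \<ge> 0"
  shows "((\<lambda>t. \<integral>x. \<Psi> (y t x) (z t x) \<partial>mu) has_real_derivative
     (\<Sum>n. coef (G N1 t) n * a' n t) + \<kappa> * (\<Sum>n. coef (G N2 t) n * b' n t)) (at t within {0..})"
proof -
  define C where "C = 2 * L * (1 + \<kappa>)"
  have C: "C \<ge> 0" using lip_boundedD(1)[OF N1] \<kappa> by (simp add: C_def)
  define P where "P t = (\<integral>x. \<Psi> (y t x) (z t x) \<partial>mu)" for t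
  obtain Ma where Ma: "summable Ma" "\<And>n s. 0 \<le> s \<Longrightarrow> s \<le> t + 1 \<Longrightarrow> (lam n * a n s)\<^sup>2 + (a' n s)\<^sup>2 \<le> Ma n"
    using modal_curveD(3)[OF ma, of "t + 1"] t by auto
  obtain Mb where Mb: "summable Mb" "\<And>n s. 0 \<le> s \<Longrightarrow> s \<le> t + 1 \<Longrightarrow> (kap n * b n s)\<^sup>2 + (b' n s)\<^sup>2 \<le> Mb n"
    using modal_curveD(3)[OF mb, of "t + 1"] t by auto
  have Ma': "(a' n s)\<^sup>2 \<le> Ma n" and Mb': "(b' n s)\<^sup>2 \<le> Mb n" if "0 \<le> s" "s \<le> t + 1" for n s
    using Ma(2)[OF that, of n] Mb(2)[OF that, of n] zero_le_power2[of "lam n * a n s"] zero_le_power2[of "kap n * b n s"]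
    by linarith+
  have t1: "t < t + 1" by simp
  have qa: "((\<lambda>s. \<Sum>n. coef (G N1 t) n * ((a n s - a n t) / (s - t))) \<longlongrightarrow> (\<Sum>n. coef (G N1 t) n * a' n t)) (at t within {0..})"
    "\<forall>\<^sub>F s in at t within {0..}. (\<Sum>n. (a n s - a n t)\<^sup>2) \<le> (\<Sum>n. Ma n) * (s - t)\<^sup>2"
    by (rule modal_pairing_tendsto[OF modal_curveD(1)[OF ma] Ma(1) Ma' coef_G_summable[OF N1 t] t t1]; assumption)+
  have qb: "((\<lambda>s. \<Sum>n. coef (G N2 t) n * ((b n s - b n t) / (s - t))) \<longlongrightarrow> (\<Sum>n. coef (G N2 t) n * b' n t)) (at t within {0..})"
    "\<forall>\<^sub>F s in at t within {0..}. (\<Sum>n. (b n s - b n t)\<^sup>2) \<le> (\<Sum>n. Mb n) * (s - t)\<^sup>2"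
    by (rule modal_pairing_tendsto[OF modal_curveD(1)[OF mb] Mb(1) Mb' coef_G_summable[OF N2 t] t t1]; assumption)+
  define A where "A s = (\<Sum>n. coef (G N1 t) n * ((a n s - a n t) / (s - t)))" for s
  define A' where "A' s = (\<Sum>n. coef (G N2 t) n * ((b n s - b n t) / (s - t)))" for s
  have \<Psi>c: "continuous_on UNIV (\<lambda>x. \<Psi> (y s x) (z s x))" if "s \<ge> 0" for s
    using continuous_on_compose2[OF c continuous_on_Pair[OF y_cont z_cont], of s s UNIV] that by simp
  have one: "(\<lambda>x. 1) \<in> L2" by (intro L2_continuous continuous_intros)
  have \<Psi>i: "integrable mu (\<lambda>x. \<Psi> (y s x) (z s x))" if "s \<ge> 0" for s
    using L2_integrable_mult[OF L2_continuous[OF \<Psi>c[OF that]] one] by simp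
  have R: "\<bar>P s - P t - (s - t) * (A s + \<kappa> * A' s)\<bar> \<le> C * ((\<Sum>n. (a n s - a n t)\<^sup>2) + (\<Sum>n. (b n s - b n t)\<^sup>2))"
    if s: "s \<ge> 0" and st: "s \<noteq> t" for s
  proof -
    note inc = y_increment[OF s t]
    have i1: "integrable mu (\<lambda>x. G N1 t x * (y s x - y t x))" by (rule L2_integrable_mult[OF G_L2[OF N1 t] inc(1)])
    have i2: "integrable mu (\<lambda>x. G N2 t x * (z s x - z t x))" by (rule L2_integrable_mult[OF G_L2[OF N2 t] inc(3)])
    have sq: "integrable mu (\<lambda>x. (y s x - y t x)\<^sup>2)" "integrable mu (\<lambda>x. (z s x - z t x)\<^sup>2)"
      using inc by (auto simp: L2_iff)
    have e1: "(\<integral>x. G N1 t x * (y s x - y t x) \<partial>mu) = (s - t) * A s"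
    proof -
      have "(\<lambda>n. coef (G N1 t) n * (a n s - a n t)) sums (\<integral>x. G N1 t x * (y s x - y t x) \<partial>mu)"
        using parseval[OF G_L2[OF N1 t] inc(1)] unfolding inc(2) l2_inner_mu .
      then have "(\<lambda>n. coef (G N1 t) n * (a n s - a n t) / (s - t)) sums ((\<integral>x. G N1 t x * (y s x - y t x) \<partial>mu) / (s - t))"
        by (rule sums_divide)
      then have "A s = (\<integral>x. G N1 t x * (y s x - y t x) \<partial>mu) / (s - t)"
        unfolding A_def by (simp add: sums_iff)
      then show ?thesis using st by simp
    qed
    have e2: "(\<integral>x. G N2 t x * (z s x - z t x) \<partial>mu) = (s - t) * A' s"
    proof -
      have "(\<lambda>n. coef (G N2 t) n * (b n s - b n t)) sums (\<integral>x. G N2 t x * (z s x - z t x) \<partial>mu)"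
        using parseval[OF G_L2[OF N2 t] inc(3)] unfolding inc(4) l2_inner_mu .
      then have "(\<lambda>n. coef (G N2 t) n * (b n s - b n t) / (s - t)) sums ((\<integral>x. G N2 t x * (z s x - z t x) \<partial>mu) / (s - t))"
        by (rule sums_divide)
      then have "A' s = (\<integral>x. G N2 t x * (z s x - z t x) \<partial>mu) / (s - t)"
        unfolding A'_def by (simp add: sums_iff)
      then show ?thesis using st by simp
    qed
    have "P s - P t - (s - t) * (A s + \<kappa> * A' s) = P s - P t - ((s - t) * A s + \<kappa> * ((s - t) * A' s))"
      by (simp add: algebra_simps)
    also have "\<dots> = (\<integral>x. \<Psi> (y s x) (z s x) - \<Psi> (y t x) (z t x) - (G N1 t x * (y s x - y t x) + \<kappa> * (G N2 t x * (z s x - z t x))) \<partial>mu)"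
      unfolding P_def e1[symmetric] e2[symmetric] using i1 i2 \<Psi>i[OF s] \<Psi>i[OF t] by simp
    finally have "\<bar>P s - P t - (s - t) * (A s + \<kappa> * A' s)\<bar> =
      \<bar>\<integral>x. \<Psi> (y s x) (z s x) - \<Psi> (y t x) (z t x) - (G N1 t x * (y s x - y t x) + \<kappa> * (G N2 t x * (z s x - z t x))) \<partial>mu\<bar>"
      by simp
    also have "\<dots> \<le> (\<integral>x. \<bar>\<Psi> (y s x) (z s x) - \<Psi> (y t x) (z t x) - (G N1 t x * (y s x - y t x) + \<kappa> * (G N2 t x * (z s x - z t x)))\<bar> \<partial>mu)"
      by (rule integral_abs_bound)
    also have "\<dots> \<le> (\<integral>x. C * ((y s x - y t x)\<^sup>2 + (z s x - z t x)\<^sup>2) \<partial>mu)"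
      unfolding C_def using i1 i2 \<Psi>i[OF s] \<Psi>i[OF t] sq
      by (intro integral_mono potential_Taylor[OF d1 d2 N1 N2 \<kappa>]) auto
    also have "\<dots> = C * ((\<integral>x. (y s x - y t x)\<^sup>2 \<partial>mu) + (\<integral>x. (z s x - z t x)\<^sup>2 \<partial>mu))" using sq by simp
    also have "(\<integral>x. (y s x - y t x)\<^sup>2 \<partial>mu) = (\<Sum>n. (a n s - a n t)\<^sup>2)"
      using parseval_norm(2)[OF inc(1)] unfolding inc(2) by (simp only: l2_norm_power2_integral)
    also have "(\<integral>x. (z s x - z t x)\<^sup>2 \<partial>mu) = (\<Sum>n. (b n s - b n t)\<^sup>2)"
      using parseval_norm(2)[OF inc(3)] unfolding inc(4) by (simp only: l2_norm_power2_integral)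
    finally show ?thesis .
  qed
  define D where "D = (\<Sum>n. coef (G N1 t) n * a' n t) + \<kappa> * (\<Sum>n. coef (G N2 t) n * b' n t)"
  have lim: "((\<lambda>s. A s + \<kappa> * A' s) \<longlongrightarrow> D) (at t within {0..})"
    unfolding A_def A'_def D_def by (intro tendsto_add tendsto_mult_left qa(1) qb(1))
  have "((\<lambda>s. (P s - P t) / (s - t) - (A s + \<kappa> * A' s)) \<longlongrightarrow> 0) (at t within {0..})"
  proof (rule Lim_null_comparison)
    have ev: "\<forall>\<^sub>F s in at t within {0..}. 0 \<le> s \<and> s \<noteq> t" by (simp add: eventually_at_filter)
    show "\<forall>\<^sub>F s in at t within {0..}. norm ((P s - P t) / (s - t) - (A s + \<kappa> * A' s)) \<le> C * ((\<Sum>n. Ma n) + (\<Sum>n. Mb n)) * \<bar>s - t\<bar>"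
      using ev qa(2) qb(2)
    proof eventually_elim
      case (elim s)
      then have st: "s - t \<noteq> 0" by simp
      have "\<bar>P s - P t - (s - t) * (A s + \<kappa> * A' s)\<bar> \<le> C * ((\<Sum>n. (a n s - a n t)\<^sup>2) + (\<Sum>n. (b n s - b n t)\<^sup>2))"
        using elim by (intro R) auto
      also have "\<dots> \<le> C * ((\<Sum>n. Ma n) * (s - t)\<^sup>2 + (\<Sum>n. Mb n) * (s - t)\<^sup>2)"
        using elim by (intro mult_left_mono add_mono C) auto
      also have "\<dots> = C * ((\<Sum>n. Ma n) + (\<Sum>n. Mb n)) * \<bar>s - t\<bar> * \<bar>s - t\<bar>"
      proof -
        have "(s - t)\<^sup>2 = \<bar>s - t\<bar> * \<bar>s - t\<bar>" by (simp add: power2_eq_square)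
        then show ?thesis by (simp only: distrib_right distrib_left mult.assoc)
      qed
      finally have "\<bar>P s - P t - (s - t) * (A s + \<kappa> * A' s)\<bar> / \<bar>s - t\<bar> \<le> C * ((\<Sum>n. Ma n) + (\<Sum>n. Mb n)) * \<bar>s - t\<bar>"
        using st by (simp add: divide_le_eq)
      moreover have "(P s - P t) / (s - t) - (A s + \<kappa> * A' s) = (P s - P t - (s - t) * (A s + \<kappa> * A' s)) / (s - t)"
        using st by (simp only: diff_divide_distrib nonzero_mult_div_cancel_left not_False_eq_True)
      ultimately show ?case by (simp only: real_norm_def abs_divide)
    qed
    have "((\<lambda>s. C * ((\<Sum>n. Ma n) + (\<Sum>n. Mb n)) * \<bar>s - t\<bar>) \<longlongrightarrow> C * ((\<Sum>n. Ma n) + (\<Sum>n. Mb n)) * \<bar>t - t\<bar>) (at t within {0..})"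
      by (intro tendsto_intros)
    then show "((\<lambda>s. C * ((\<Sum>n. Ma n) + (\<Sum>n. Mb n)) * \<bar>s - t\<bar>) \<longlongrightarrow> 0) (at t within {0..})" by simp
  qed
  from tendsto_add[OF this lim] have "((\<lambda>s. (P s - P t) / (s - t)) \<longlongrightarrow> D) (at t within {0..})" by simp
  then show ?thesis unfolding has_field_derivative_iff P_def D_def .
qed

text \<open>Rather than differentiating the full mode sum, the identity for the partial sums
  \<open>Q N\<close> is integrated over [0, t]. The integrals of \<open>pN N\<close> converge by
  domination to the integral of p, which is the increment of the potential energy.\<close>

lemma energy_conservation:
  assumes d1: "\<And>y z. ((\<lambda>y. \<Psi> y z) has_real_derivative N1 y z) (at y)"
    and d2: "\<And>y z. ((\<lambda>z. \<Psi> y z) has_real_derivative \<kappa> * N2 y z) (at z)" and \<kappa>: "\<kappa> \<ge> 0"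
    and c: "continuous_on UNIV (\<lambda>p. \<Psi> (fst p) (snd p))" and t: "t \<ge> 0"
  defines "E \<equiv> \<lambda>t. (\<Sum>n. (lam n * a n t)\<^sup>2 + (a' n t)\<^sup>2) + \<kappa> * (\<Sum>n. (kap n * b n t)\<^sup>2 + (b' n t)\<^sup>2)
      + 2 * (\<integral>x. \<Psi> (y t x) (z t x) \<partial>mu)"
  shows "E t = E 0"
proof -
  define P where "P t = (\<integral>x. \<Psi> (y t x) (z t x) \<partial>mu)" for t
  define p where "p s = (\<Sum>n. coef (G N1 s) n * a' n s) + \<kappa> * (\<Sum>n. coef (G N2 s) n * b' n s)" for s
  define pN where "pN N s = (\<Sum>n<N. coef (G N1 s) n * a' n s) + \<kappa> * (\<Sum>n<N. coef (G N2 s) n * b' n s)" for N s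
  define Q where "Q N s = (\<Sum>n<N. (lam n * a n s)\<^sup>2 + (a' n s)\<^sup>2) + \<kappa> * (\<Sum>n<N. (kap n * b n s)\<^sup>2 + (b' n s)\<^sup>2)" for N s
  have "(p has_integral (P t - P 0)) {0..t}"
  proof (rule fundamental_theorem_of_calculus[OF t])
    fix s assume s: "s \<in> {0..t}"
    have "(P has_real_derivative p s) (at s within {0..t})"
      unfolding P_def[abs_def] p_def
      by (rule DERIV_subset[OF potential_derivative[OF d1 d2 \<kappa> c]]) (use s in auto)
    then show "(P has_vector_derivative p s) (at s within {0..t})"
      by (simp add: has_real_derivative_iff_has_vector_derivative)
  qed
  then have pint: "integral {0..t} p = P t - P 0" by (rule integral_unique)
  \<comment> \<open>Each mode loses energy at the rate 2 coef(G) times its velocity, so -Q/2 is an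
    antiderivative of the partial power \<open>pN N\<close>.\<close>
  have Qint: "(pN N has_integral (- Q N t / 2 - - Q N 0 / 2)) {0..t}" for N
  proof (rule fundamental_theorem_of_calculus[OF t])
    fix s assume s: "s \<in> {0..t}"
    then have s0: "s \<ge> 0" by simp
    have "(Q N has_real_derivative - 2 * (\<Sum>n<N. coef (G N1 s) n * a' n s) + \<kappa> * (- 2 * (\<Sum>n<N. coef (G N2 s) n * b' n s))) (at s within {0..})"
      unfolding Q_def[abs_def]
      by (intro DERIV_add DERIV_cmult modal_energy_derivative[OF ma s0] modal_energy_derivative[OF mb s0])
    then have "((\<lambda>s. - Q N s / 2) has_real_derivative - (- 2 * (\<Sum>n<N. coef (G N1 s) n * a' n s) + \<kappa> * (- 2 * (\<Sum>n<N. coef (G N2 s) n * b' n s))) / 2) (at s within {0..})"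
      by (intro DERIV_cdivide DERIV_minus)
    moreover have "- (- 2 * (\<Sum>n<N. coef (G N1 s) n * a' n s) + \<kappa> * (- 2 * (\<Sum>n<N. coef (G N2 s) n * b' n s))) / 2 = pN N s"
      by (simp add: pN_def)
    ultimately have "((\<lambda>s. - Q N s / 2) has_real_derivative pN N s) (at s within {0..t})"
      using s by (auto intro: DERIV_subset)
    then show "((\<lambda>s. - Q N s / 2) has_vector_derivative pN N s) (at s within {0..t})"
      by (simp add: has_real_derivative_iff_has_vector_derivative)
  qed
  obtain Ma where Ma: "summable Ma" "\<And>n s. 0 \<le> s \<Longrightarrow> s \<le> t \<Longrightarrow> (lam n * a n s)\<^sup>2 + (a' n s)\<^sup>2 \<le> Ma n"
    using modal_curveD(3)[OF ma t] by blast
  obtain Mb where Mb: "summable Mb" "\<And>n s. 0 \<le> s \<Longrightarrow> s \<le> t \<Longrightarrow> (kap n * b n s)\<^sup>2 + (b' n s)\<^sup>2 \<le> Mb n"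
    using modal_curveD(3)[OF mb t] by blast
  have Ma': "(a' n s)\<^sup>2 \<le> Ma n" and Mb': "(b' n s)\<^sup>2 \<le> Mb n" if "0 \<le> s" "s \<le> t" for n s
    using Ma(2)[OF that, of n] Mb(2)[OF that, of n] zero_le_power2[of "lam n * a n s"] zero_le_power2[of "kap n * b n s"]
    by linarith+
  have "(\<lambda>N. integral {0..t} (pN N)) \<longlonglongrightarrow> integral {0..t} p"
  proof (rule dominated_convergence(2))
    show "pN N integrable_on {0..t}" for N using Qint by (rule has_integral_integrable)
    \<comment> \<open>Each product is at most the sum of the two squares; the squared forcing
      coefficients sum to at most pi B^2 by Bessel, the squared velocities to at most the sum of the
      majorant.\<close>
    show "(\<lambda>s. (pi * B\<^sup>2 + (\<Sum>n. Ma n)) + \<kappa> * (pi * B\<^sup>2 + (\<Sum>n. Mb n))) integrable_on {0..t}"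
      by (rule integrable_const_ivl)
    fix N s assume "s \<in> {0..t}"
    then have s: "0 \<le> s" "s \<le> t" by auto
    have pos: "0 \<le> Ma n" "0 \<le> Mb n" for n using Ma'[OF s] Mb'[OF s] by (meson order_trans zero_le_power2)+
    have "\<bar>\<Sum>n<N. coef (G N1 s) n * a' n s\<bar> \<le> pi * B\<^sup>2 + (\<Sum>n. Ma n)"
    proof (rule order_trans[OF sum_mult_le_squares], rule add_mono[OF G_coef[OF N1 s(1)]])
      have "(\<Sum>n<N. (a' n s)\<^sup>2) \<le> (\<Sum>n<N. Ma n)" by (intro sum_mono Ma' s)
      also have "\<dots> \<le> (\<Sum>n. Ma n)" by (intro sum_le_suminf Ma) (auto simp: pos)
      finally show "(\<Sum>n<N. (a' n s)\<^sup>2) \<le> (\<Sum>n. Ma n)" .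
    qed
    moreover have "\<bar>\<Sum>n<N. coef (G N2 s) n * b' n s\<bar> \<le> pi * B\<^sup>2 + (\<Sum>n. Mb n)"
    proof (rule order_trans[OF sum_mult_le_squares], rule add_mono[OF G_coef[OF N2 s(1)]])
      have "(\<Sum>n<N. (b' n s)\<^sup>2) \<le> (\<Sum>n<N. Mb n)" by (intro sum_mono Mb' s)
      also have "\<dots> \<le> (\<Sum>n. Mb n)" by (intro sum_le_suminf Mb) (auto simp: pos)
      finally show "(\<Sum>n<N. (b' n s)\<^sup>2) \<le> (\<Sum>n. Mb n)" .
    qed
    ultimately have "\<bar>\<Sum>n<N. coef (G N1 s) n * a' n s\<bar> + \<kappa> * \<bar>\<Sum>n<N. coef (G N2 s) n * b' n s\<bar>
        \<le> (pi * B\<^sup>2 + (\<Sum>n. Ma n)) + \<kappa> * (pi * B\<^sup>2 + (\<Sum>n. Mb n))"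
      by (intro add_mono mult_left_mono \<kappa>)
    moreover have "\<bar>pN N s\<bar> \<le> \<bar>\<Sum>n<N. coef (G N1 s) n * a' n s\<bar> + \<kappa> * \<bar>\<Sum>n<N. coef (G N2 s) n * b' n s\<bar>"
      unfolding pN_def by (rule order_trans[OF abs_triangle_ineq]) (use \<kappa> in \<open>simp add: abs_mult\<close>)
    ultimately show "norm (pN N s) \<le> (pi * B\<^sup>2 + (\<Sum>n. Ma n)) + \<kappa> * (pi * B\<^sup>2 + (\<Sum>n. Mb n))"
      unfolding real_norm_def by linarith
  next
    fix s assume "s \<in> {0..t}"
    then have s: "0 \<le> s" by auto
    show "(\<lambda>N. pN N s) \<longlonglongrightarrow> p s"
      unfolding pN_def p_def
      by (intro tendsto_add tendsto_mult_left summable_LIMSEQ summable_mult_squares coef_G_summable N1 N2 s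
          modal_curve_summable(2)[OF ma s] modal_curve_summable(2)[OF mb s])
  qed
  then have 1: "(\<lambda>N. - Q N t / 2 - - Q N 0 / 2) \<longlonglongrightarrow> P t - P 0"
    using integral_unique[OF Qint] pint by simp
  have Ql: "(\<lambda>N. Q N s) \<longlonglongrightarrow> (\<Sum>n. (lam n * a n s)\<^sup>2 + (a' n s)\<^sup>2) + \<kappa> * (\<Sum>n. (kap n * b n s)\<^sup>2 + (b' n s)\<^sup>2)" if s: "s \<ge> 0" for s
    unfolding Q_def
    by (intro tendsto_add tendsto_mult_left summable_LIMSEQ modal_curve_summable(3)[OF ma s] modal_curve_summable(3)[OF mb s])
  have "(\<lambda>N. - Q N t / 2 - - Q N 0 / 2) \<longlonglongrightarrow>
      - ((\<Sum>n. (lam n * a n t)\<^sup>2 + (a' n t)\<^sup>2) + \<kappa> * (\<Sum>n. (kap n * b n t)\<^sup>2 + (b' n t)\<^sup>2)) / 2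
      - - ((\<Sum>n. (lam n * a n 0)\<^sup>2 + (a' n 0)\<^sup>2) + \<kappa> * (\<Sum>n. (kap n * b n 0)\<^sup>2 + (b' n 0)\<^sup>2)) / 2"
    by (intro tendsto_diff tendsto_divide tendsto_minus Ql t tendsto_const order_refl) simp_all
  from LIMSEQ_unique[OF this 1] show ?thesis unfolding E_def P_def by (simp add: field_simps)
qed

end

section \<open>Truncation of the nonlinearity\<close>

text \<open>The argument is clamped rather than the value: f is frozen beyond the ends of [-R, R].
  Monotonicity and the value 0 at 0 survive, so the truncated potential is still nonnegative, and a
  Lipschitz bound on a compact interval becomes global.\<close>

definition clampf :: "real \<Rightarrow> (real \<Rightarrow> real) \<Rightarrow> real \<Rightarrow> real" where
  "clampf R f s = f (max (- R) (min R s))"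

lemma clampf_id: "\<bar>s\<bar> \<le> R \<Longrightarrow> clampf R f s = f s"
  unfolding clampf_def by (rule arg_cong[where f=f]) auto

lemma clampf_mono: "mono f \<Longrightarrow> s \<le> t \<Longrightarrow> clampf R f s \<le> clampf R f t"
  unfolding clampf_def by (erule monoD) auto

text \<open>Compactness of [-R, R]. The function is read as a time-dependent family over the single
  time 0, the form in which \<open>local_lipschitz\<close> is stated.\<close>

lemma locally_lipschitz_on_Icc:
  fixes f :: "real \<Rightarrow> real"
  assumes f: "\<forall>x. \<exists>e>0. \<exists>L. L-lipschitz_on (ball x e) f"
  obtains L where "L \<ge> 0" "\<And>x y. x \<in> {-R..R} \<Longrightarrow> y \<in> {-R..R} \<Longrightarrow> \<bar>f x - f y\<bar> \<le> L * \<bar>x - y\<bar>"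
proof -
  have "local_lipschitz {0::real} {-R..R} (\<lambda>_. f)"
    unfolding local_lipschitz_def
  proof (intro ballI)
    fix x :: real and t :: real
    obtain e L where e: "e > 0" "L-lipschitz_on (ball x e) f" using f by blast
    then have "L-lipschitz_on (cball x (e/2) \<inter> {-R..R}) f" by (intro lipschitz_on_subset[OF e(2)]) auto
    then show "\<exists>u>0. \<exists>L. \<forall>t\<in>cball t u \<inter> {0}. L-lipschitz_on (cball x u \<inter> {-R..R}) f"
      using e(1) by (intro exI[of _ "e/2"]) auto
  qed
  then obtain L where "L-lipschitz_on {-R..R} f"
    by (rule local_lipschitz_compact_implies_lipschitz) auto
  then show thesis
    by (intro that[of L]) (auto simp: lipschitz_on_def dist_real_def)
qed

lemma clampf_lipschitz:
  fixes f :: "real \<Rightarrow> real"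
  assumes f: "\<forall>x. \<exists>e>0. \<exists>L. L-lipschitz_on (ball x e) f" and "mono f" and R: "R \<ge> 0"
  obtains L B where "L \<ge> 0" "\<And>x y. \<bar>clampf R f x - clampf R f y\<bar> \<le> L * \<bar>x - y\<bar>" "\<And>x. \<bar>clampf R f x\<bar> \<le> B"
proof -
  obtain L where L: "L \<ge> 0" "\<And>x y. x \<in> {-R..R} \<Longrightarrow> y \<in> {-R..R} \<Longrightarrow> \<bar>f x - f y\<bar> \<le> L * \<bar>x - y\<bar>"
    using locally_lipschitz_on_Icc[OF f] by blast
  show thesis
  proof (rule that[of L "\<bar>f R\<bar> + \<bar>f (-R)\<bar>"])
    fix x y
    have "\<bar>clampf R f x - clampf R f y\<bar> \<le> L * \<bar>max (- R) (min R x) - max (- R) (min R y)\<bar>"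
      unfolding clampf_def using R by (intro L(2)) auto
    also have "\<dots> \<le> L * \<bar>x - y\<bar>" by (intro mult_left_mono L(1)) linarith
    finally show "\<bar>clampf R f x - clampf R f y\<bar> \<le> L * \<bar>x - y\<bar>" .
    have "f (- R) \<le> clampf R f x" "clampf R f x \<le> f R"
      unfolding clampf_def using R by (intro monoD[OF \<open>mono f\<close>]; simp)+
    then show "\<bar>clampf R f x\<bar> \<le> \<bar>f R\<bar> + \<bar>f (-R)\<bar>" by linarith
  qed (rule L(1))
qed

definition NY :: "(real \<Rightarrow> real) \<Rightarrow> real \<Rightarrow> real \<Rightarrow> real \<Rightarrow> real" where
  "NY h l y z = h (y - l * sin z) + h (y + l * sin z)"

text \<open>The forcing of the second equation after division by l, so that the linear part is a
  plain wave operator with frequencies \<open>W n\<close>.\<close>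

definition NT :: "(real \<Rightarrow> real) \<Rightarrow> real \<Rightarrow> real \<Rightarrow> real \<Rightarrow> real" where
  "NT h l y z = 3 / l * (cos z * (h (y + l * sin z) - h (y - l * sin z)))"

lemma sin_lipschitz: "\<bar>sin x - sin y\<bar> \<le> \<bar>x - y\<bar>" and cos_lipschitz: "\<bar>cos x - cos y\<bar> \<le> \<bar>x - (y::real)\<bar>"
proof -
  obtain c where "sin x - sin y = (x - y) * cos c"
    using DERIV_mean_value[of sin cos y x] DERIV_sin by blast
  then show "\<bar>sin x - sin y\<bar> \<le> \<bar>x - y\<bar>" by (simp add: abs_mult mult_left_le)
  obtain d where "cos x - cos y = (x - y) * - sin d"
    using DERIV_mean_value[of cos "\<lambda>x. - sin x" y x] DERIV_cos by blast
  then show "\<bar>cos x - cos y\<bar> \<le> \<bar>x - y\<bar>" by (simp add: abs_mult mult_left_le)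
qed

text \<open>The factor cos z makes \<open>NT\<close> a product, so its Lipschitz constant involves
  the bound B on h and not only the Lipschitz constant of h; truncation provides both.\<close>

lemma NY_NT_lip_bounded:
  assumes L: "L \<ge> 0" "\<And>x y. \<bar>h x - h y\<bar> \<le> L * \<bar>x - y\<bar>" and B: "\<And>x. \<bar>h x\<bar> \<le> B" and l: "l > 0"
  shows "\<exists>L' B'. lip_bounded L' B' (NY h l) \<and> lip_bounded L' B' (NT h l)"
proof -
  have B0: "B \<ge> 0" using B[of 0] by linarith
  define k where "k = L * (1 + l)"
  have k: "k \<ge> 0" using L l by (simp add: k_def)
  have shift: "\<bar>h (y + r * sin z) - h (y' + r * sin z')\<bar> \<le> k * (\<bar>y - y'\<bar> + \<bar>z - z'\<bar>)" if r: "\<bar>r\<bar> = l" for r y z y' z'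
  proof -
    have "\<bar>(y + r * sin z) - (y' + r * sin z')\<bar> \<le> \<bar>y - y'\<bar> + \<bar>r * (sin z - sin z')\<bar>"
      using abs_triangle_ineq[of "y - y'" "r * (sin z - sin z')"] by (simp add: algebra_simps)
    also have "\<bar>r * (sin z - sin z')\<bar> \<le> l * \<bar>z - z'\<bar>"
      unfolding abs_mult r using l by (intro mult_left_mono sin_lipschitz) auto
    also have "\<bar>y - y'\<bar> + l * \<bar>z - z'\<bar> \<le> (1 + l) * (\<bar>y - y'\<bar> + \<bar>z - z'\<bar>)"
      using l by (simp add: algebra_simps)
    finally have "L * \<bar>(y + r * sin z) - (y' + r * sin z')\<bar> \<le> L * ((1 + l) * (\<bar>y - y'\<bar> + \<bar>z - z'\<bar>))"
      by (intro mult_left_mono L(1)) auto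
    then show ?thesis using L(2)[of "y + r * sin z" "y' + r * sin z'"] unfolding k_def by (simp only: mult.assoc)
  qed
  have p: "\<bar>h (y + l * sin z) - h (y' + l * sin z')\<bar> \<le> k * (\<bar>y - y'\<bar> + \<bar>z - z'\<bar>)" for y z y' z'
    using shift[of l] l by simp
  have m: "\<bar>h (y - l * sin z) - h (y' - l * sin z')\<bar> \<le> k * (\<bar>y - y'\<bar> + \<bar>z - z'\<bar>)" for y z y' z'
    using shift[of "- l" y z y' z'] l by simp
  \<comment> \<open>Sums of the constants that the two nonlinearities need separately, so that one
    pair serves both.\<close>
  define L' B' where "L' = 2 * k + 3 / l * (2 * k + 2 * B)" and "B' = 2 * B + 3 / l * (2 * B)"
  have l3: "3 / l \<ge> 0" using l by simp
  have "lip_bounded L' B' (NY h l)"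
    unfolding lip_bounded_def
  proof (intro conjI allI)
    show "L' \<ge> 0" unfolding L'_def using k B0 l3 by (intro add_nonneg_nonneg mult_nonneg_nonneg) auto
    fix y z y' z'
    have "\<bar>NY h l y z - NY h l y' z'\<bar> \<le> 2 * k * (\<bar>y - y'\<bar> + \<bar>z - z'\<bar>)"
      unfolding NY_def using p[of y z y' z'] m[of y z y' z'] by linarith
    also have "\<dots> \<le> L' * (\<bar>y - y'\<bar> + \<bar>z - z'\<bar>)"
      unfolding L'_def using k B0 l3 by (intro mult_right_mono) auto
    finally show "\<bar>NY h l y z - NY h l y' z'\<bar> \<le> L' * (\<bar>y - y'\<bar> + \<bar>z - z'\<bar>)" .
    have "\<bar>NY h l y z\<bar> \<le> 2 * B"
      unfolding NY_def using B[of "y - l * sin z"] B[of "y + l * sin z"] by linarith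
    also have "\<dots> \<le> B'" unfolding B'_def using l3 B0 by simp
    finally show "\<bar>NY h l y z\<bar> \<le> B'" .
  qed
  moreover have "lip_bounded L' B' (NT h l)"
    unfolding lip_bounded_def
  proof (intro conjI allI)
    show "L' \<ge> 0" unfolding L'_def using k B0 l3 by (intro add_nonneg_nonneg mult_nonneg_nonneg) auto
    fix y z y' z'
    define d d' where "d = h (y + l * sin z) - h (y - l * sin z)" and "d' = h (y' + l * sin z') - h (y' - l * sin z')"
    have dd: "\<bar>d - d'\<bar> \<le> 2 * k * (\<bar>y - y'\<bar> + \<bar>z - z'\<bar>)"
      unfolding d_def d'_def using p[of y z y' z'] m[of y z y' z'] by linarith
    have dB: "\<bar>d\<bar> \<le> 2 * B" "\<bar>d'\<bar> \<le> 2 * B"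
      unfolding d_def d'_def using B[of "y - l * sin z"] B[of "y + l * sin z"] B[of "y' - l * sin z'"] B[of "y' + l * sin z'"] by linarith+
    have "cos z * d - cos z' * d' = cos z * (d - d') + (cos z - cos z') * d'" by (simp add: algebra_simps)
    then have "\<bar>cos z * d - cos z' * d'\<bar> \<le> \<bar>cos z\<bar> * \<bar>d - d'\<bar> + \<bar>cos z - cos z'\<bar> * \<bar>d'\<bar>"
      by (metis abs_mult abs_triangle_ineq)
    also have "\<dots> \<le> 1 * (2 * k * (\<bar>y - y'\<bar> + \<bar>z - z'\<bar>)) + \<bar>z - z'\<bar> * (2 * B)"
      by (intro add_mono mult_mono dd dB cos_lipschitz abs_cos_le_one) (use k in auto)
    also have "\<dots> \<le> (2 * k + 2 * B) * (\<bar>y - y'\<bar> + \<bar>z - z'\<bar>)"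
      using B0 by (simp add: algebra_simps)
    finally have "3 / l * \<bar>cos z * d - cos z' * d'\<bar> \<le> 3 / l * ((2 * k + 2 * B) * (\<bar>y - y'\<bar> + \<bar>z - z'\<bar>))"
      by (intro mult_left_mono l3)
    moreover have "\<bar>NT h l y z - NT h l y' z'\<bar> = 3 / l * \<bar>cos z * d - cos z' * d'\<bar>"
    proof -
      have "NT h l y z - NT h l y' z' = 3 / l * (cos z * d - cos z' * d')"
        unfolding NT_def d_def d'_def by (simp only: right_diff_distrib)
      then show ?thesis by (simp only: abs_mult abs_of_nonneg[OF l3])
    qed
    moreover have "3 / l * ((2 * k + 2 * B) * (\<bar>y - y'\<bar> + \<bar>z - z'\<bar>)) \<le> L' * (\<bar>y - y'\<bar> + \<bar>z - z'\<bar>)"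
      unfolding L'_def mult.assoc[symmetric] using k by (intro mult_right_mono) auto
    ultimately show "\<bar>NT h l y z - NT h l y' z'\<bar> \<le> L' * (\<bar>y - y'\<bar> + \<bar>z - z'\<bar>)" by linarith
    have "\<bar>NT h l y z\<bar> = 3 / l * (\<bar>cos z\<bar> * \<bar>d\<bar>)" unfolding NT_def d_def[symmetric] using l by (simp add: abs_mult)
    also have "\<dots> \<le> 3 / l * (1 * (2 * B))" by (intro mult_left_mono mult_mono dB abs_cos_le_one l3) auto
    also have "\<dots> \<le> B'" unfolding B'_def using B0 by simp
    finally show "\<bar>NT h l y z\<bar> \<le> B'" .
  qed
  ultimately show ?thesis by blast
qed

lemma NY_NT_clampf:
  assumes "\<bar>y\<bar> + l \<le> R" "l > 0"
  shows "NY (clampf R f) l y z = NY f l y z" "NT (clampf R f) l y z = NT f l y z"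
proof -
  have "\<bar>l * sin z\<bar> \<le> l" using assms(2) by (simp add: abs_mult mult_left_le)
  then have "clampf R f (y - l * sin z) = f (y - l * sin z)" "clampf R f (y + l * sin z) = f (y + l * sin z)"
    using assms by (auto intro!: clampf_id)
  then show "NY (clampf R f) l y z = NY f l y z" "NT (clampf R f) l y z = NT f l y z"
    by (simp_all add: NY_def NT_def)
qed

text \<open>Normalised by F 0 = 0, the mean value theorem gives F s = s h(c) with c between 0 and s,
  and h has the sign of its argument. The upper bound uses h only on [-|s|, |s|]; it serves to
  estimate the initial potential energy independently of the truncation.\<close>

lemma antiderivative_sign:
  fixes h :: "real \<Rightarrow> real"
  assumes hc: "continuous_on UNIV h" and h: "\<And>s t. s \<le> t \<Longrightarrow> h s \<le> h t" "h 0 = 0"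
  obtains F where "\<And>s. (F has_real_derivative h s) (at s)" "\<And>s. F s \<ge> 0"
    "\<And>s. F s \<le> \<bar>s\<bar> * (\<bar>h \<bar>s\<bar>\<bar> + \<bar>h (- \<bar>s\<bar>)\<bar>)"
proof -
  have "\<exists>F. \<forall>x::real. - \<infinity> < ereal x \<longrightarrow> ereal x < \<infinity> \<longrightarrow> (F has_vector_derivative h x) (at x)"
    using hc by (intro einterval_antiderivative) (auto simp: continuous_on_eq_continuous_at)
  then obtain F0 where F0: "\<And>x. (F0 has_real_derivative h x) (at x)"
    by (auto simp: has_real_derivative_iff_has_vector_derivative)
  define F where "F x = F0 x - F0 0" for x
  have F: "(F has_real_derivative h x) (at x)" for x
    unfolding F_def[abs_def] by (auto intro!: derivative_eq_intros F0)
  have mv: "\<exists>c. min 0 s \<le> c \<and> c \<le> max 0 s \<and> F s = s * h c" for s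
  proof -
    obtain c where "min 0 s \<le> c" "c \<le> max 0 s" "F s - F 0 = (s - 0) * h c"
      using DERIV_mean_value[OF F, of 0 s] by blast
    then show ?thesis by (intro exI[of _ c]) (simp add: F_def)
  qed
  show thesis
  proof (rule that[OF F])
    fix s
    obtain c where c: "min 0 s \<le> c" "c \<le> max 0 s" "F s = s * h c" using mv by blast
    show "F s \<ge> 0"
    proof (cases "s \<ge> 0")
      case True
      then have "h c \<ge> 0" using h(1)[of 0 c] h(2) c by simp
      then show ?thesis using True c by simp
    next
      case False
      then have "h c \<le> 0" using h(1)[of c 0] h(2) c by simp
      then show ?thesis using False c by (simp add: mult_nonpos_nonpos)
    qed
    have "\<bar>c\<bar> \<le> \<bar>s\<bar>" using c by auto
    then have "h (- \<bar>s\<bar>) \<le> h c" "h c \<le> h \<bar>s\<bar>" by (auto intro!: h(1))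
    then have "\<bar>h c\<bar> \<le> \<bar>h \<bar>s\<bar>\<bar> + \<bar>h (- \<bar>s\<bar>)\<bar>" by linarith
    then have "\<bar>s\<bar> * \<bar>h c\<bar> \<le> \<bar>s\<bar> * (\<bar>h \<bar>s\<bar>\<bar> + \<bar>h (- \<bar>s\<bar>)\<bar>)" by (intro mult_left_mono) auto
    then show "F s \<le> \<bar>s\<bar> * (\<bar>h \<bar>s\<bar>\<bar> + \<bar>h (- \<bar>s\<bar>)\<bar>)"
      using abs_ge_self[of "s * h c"] unfolding c(3) abs_mult by linarith
  qed
qed

text \<open>The danger is a circle: R has to exceed the sup bound, the bound comes from the energy,
  and the energy is computed with the function truncated at R. The circle is broken at time 0, where
  the arguments of f lie in [-R0, R0]: for every R \<ge> R0 the initial energy has a bound in terms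
  of f on that interval alone.\<close>

theorem global_modal_existence:
  fixes f :: "real \<Rightarrow> real"
  assumes l: "l > 0" and f: "\<forall>x. \<exists>e>0. \<exists>L. L-lipschitz_on (ball x e) f" "mono f" "f 0 = 0"
    and lam: "\<And>n. lam n \<ge> W n" "\<And>n. kap n \<ge> W n"
    and s: "summable (\<lambda>n. (lam n * a0 n)\<^sup>2)" "summable (\<lambda>n. (a1 n)\<^sup>2)"
       "summable (\<lambda>n. (kap n * b0 n)\<^sup>2)" "summable (\<lambda>n. (b1 n)\<^sup>2)"
  obtains R L B a a' b b' where
    "modal_pair lam kap a a' b b' (NY (clampf R f) l) (NT (clampf R f) l) L B"
    "\<And>t x. t \<ge> 0 \<Longrightarrow> \<bar>ser (\<lambda>n. a n t) x\<bar> + l \<le> R"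
    "\<And>n. a n 0 = a0 n" "\<And>n. a' n 0 = a1 n" "\<And>n. b n 0 = b0 n" "\<And>n. b' n 0 = b1 n"
proof -
  \<comment> \<open>The weight that makes \<open>NY\<close> and \<open>\<kappa> * NT\<close> the
    partial derivatives of one function \<Psi>: it turns the factor 3 / l of \<open>NT\<close> into
    l, the inner derivative of l sin z.\<close>
  define \<kappa> where "\<kappa> = l\<^sup>2 / 3"
  have \<kappa>: "\<kappa> \<ge> 0" by (simp add: \<kappa>_def)
  define D0 where "D0 = (\<Sum>n. (lam n * a0 n)\<^sup>2 + (a1 n)\<^sup>2) + \<kappa> * (\<Sum>n. (kap n * b0 n)\<^sup>2 + (b1 n)\<^sup>2)"
  \<comment> \<open>A bound for the arguments y + l sin z and y - l sin z at time 0.\<close>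
  define R0 where "R0 = CW * sqrt (\<Sum>n. (lam n * a0 n)\<^sup>2) + l"
  have R0: "R0 \<ge> 0" unfolding R0_def using l CW_nonneg
    by (intro add_nonneg_nonneg mult_nonneg_nonneg real_sqrt_ge_zero suminf_nonneg s) auto
  \<comment> \<open>D bounds F on [-R0, R0], so \<Psi> is at most 2 D at time 0; the interval has
    length pi and the energy counts the potential twice, whence E0.\<close>
  define D where "D = R0 * (\<bar>f R0\<bar> + \<bar>f (- R0)\<bar>)"
  define E0 where "E0 = D0 + 2 * (pi * (2 * D))"
  \<comment> \<open>Both demands on R are met by adding them: R \<ge> R0 for the initial energy, and
    R \<ge> CW sqrt |E0| + l for the solution at all times. The absolute value avoids a separate
    proof that E0 is nonnegative.\<close>
  define R where "R = R0 + (CW * sqrt \<bar>E0\<bar> + l)"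
  have CE: "CW * sqrt \<bar>E0\<bar> \<ge> 0" using CW_nonneg by simp
  have R: "R \<ge> R0" "R \<ge> 0" "R \<ge> CW * sqrt \<bar>E0\<bar> + l" using R0 CE l by (auto simp: R_def)
  define h where "h = clampf R f"
  obtain L1 B1 where h1: "L1 \<ge> 0" "\<And>x y. \<bar>h x - h y\<bar> \<le> L1 * \<bar>x - y\<bar>" "\<And>x. \<bar>h x\<bar> \<le> B1"
    unfolding h_def using clampf_lipschitz[OF f(1,2) R(2)] by blast
  then obtain L B where LB: "lip_bounded L B (NY h l)" "lip_bounded L B (NT h l)"
    using NY_NT_lip_bounded[OF h1 l] by blast
  obtain a a' b b' where
    ma: "modal_curve lam a a' (\<lambda>t x. NY h l (ser (\<lambda>n. a n t) x) (ser (\<lambda>n. b n t) x))" and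
    mb: "modal_curve kap b b' (\<lambda>t x. NT h l (ser (\<lambda>n. a n t) x) (ser (\<lambda>n. b n t) x))" and
    ini: "\<And>n. a n 0 = a0 n" "\<And>n. a' n 0 = a1 n" "\<And>n. b n 0 = b0 n" "\<And>n. b' n 0 = b1 n"
    using modal_existence[OF lam LB s] by blast
  interpret modal_pair lam kap a a' b b' "NY h l" "NT h l" L B
    by unfold_locales (fact lam LB ma mb)+
  have hc: "continuous_on UNIV h"
    by (rule lipschitz_on_continuous_on[of L1]) (auto intro!: lipschitz_onI h1 simp: dist_real_def)
  have hm: "h s \<le> h t" if "s \<le> t" for s t unfolding h_def by (rule clampf_mono[OF f(2) that])
  have h0: "h 0 = 0" unfolding h_def using clampf_id[of 0 R f] R f(3) by simp
  obtain F where F: "\<And>s. (F has_real_derivative h s) (at s)" "\<And>s. F s \<ge> 0"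
    "\<And>s. F s \<le> \<bar>s\<bar> * (\<bar>h \<bar>s\<bar>\<bar> + \<bar>h (- \<bar>s\<bar>)\<bar>)"
    using antiderivative_sign[OF hc hm h0] by blast
  have Fc: "continuous_on UNIV F" using F(1) by (meson DERIV_isCont continuous_at_imp_continuous_on)
  define \<Psi> where "\<Psi> y z = F (y - l * sin z) + F (y + l * sin z)" for y z
  have \<Psi>0: "\<Psi> y z \<ge> 0" for y z unfolding \<Psi>_def using F(2) by (intro add_nonneg_nonneg)
  have d1: "((\<lambda>y. \<Psi> y z) has_real_derivative NY h l y z) (at y)" for y z
    unfolding \<Psi>_def NY_def by (auto intro!: derivative_eq_intros DERIV_chain2[OF F(1)])
  have d2: "((\<lambda>z. \<Psi> y z) has_real_derivative \<kappa> * NT h l y z) (at z)" for y z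
  proof -
    have "((\<lambda>z. y - l * sin z) has_real_derivative - (l * cos z)) (at z)"
         "((\<lambda>z. y + l * sin z) has_real_derivative l * cos z) (at z)"
      by (auto intro!: derivative_eq_intros)
    then have "((\<lambda>z. \<Psi> y z) has_real_derivative h (y - l * sin z) * - (l * cos z) + h (y + l * sin z) * (l * cos z)) (at z)"
      unfolding \<Psi>_def by (intro DERIV_add DERIV_chain2[OF F(1)])
    moreover have "h (y - l * sin z) * - (l * cos z) + h (y + l * sin z) * (l * cos z) = \<kappa> * NT h l y z"
      using l by (simp add: \<kappa>_def NT_def power2_eq_square field_simps)
    ultimately show ?thesis by simp
  qed
  have \<Psi>c: "continuous_on UNIV (\<lambda>p. \<Psi> (fst p) (snd p))"
    unfolding \<Psi>_def by (intro continuous_intros continuous_on_compose2[OF Fc]) auto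
  define P where "P t = (\<integral>x. \<Psi> (y t x) (z t x) \<partial>mu)" for t
  have P0: "P t \<ge> 0" for t unfolding P_def using \<Psi>0 by (intro integral_nonneg_AE) simp
  have FD: "F s \<le> D" if "\<bar>s\<bar> \<le> R0" for s
  proof -
    have "h \<bar>s\<bar> = f \<bar>s\<bar>" "h (- \<bar>s\<bar>) = f (- \<bar>s\<bar>)" unfolding h_def using that R by (auto intro!: clampf_id)
    moreover have "f (- R0) \<le> f (- \<bar>s\<bar>)" "f (- \<bar>s\<bar>) \<le> f 0" "f 0 \<le> f \<bar>s\<bar>" "f \<bar>s\<bar> \<le> f R0"
      using that by (auto intro!: monoD[OF f(2)])
    ultimately have "\<bar>h \<bar>s\<bar>\<bar> + \<bar>h (- \<bar>s\<bar>)\<bar> \<le> \<bar>f R0\<bar> + \<bar>f (- R0)\<bar>" using f(3) by linarith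
    then have "\<bar>s\<bar> * (\<bar>h \<bar>s\<bar>\<bar> + \<bar>h (- \<bar>s\<bar>)\<bar>) \<le> D" unfolding D_def using that R0 by (intro mult_mono) auto
    then show ?thesis using F(3)[of s] by linarith
  qed
  have P00: "P 0 \<le> pi * (2 * D)"
  proof -
    have y0: "\<bar>y 0 x\<bar> \<le> CW * sqrt (\<Sum>n. (lam n * a0 n)\<^sup>2)" for x
      using modal_curve_summable_abs(3)[OF ma order_refl lam(1), of x] by (simp add: ini)
    have z0: "\<bar>l * sin (z 0 x)\<bar> \<le> l" for x using l by (simp add: abs_mult mult_left_le)
    have "\<bar>y 0 x - l * sin (z 0 x)\<bar> \<le> R0" "\<bar>y 0 x + l * sin (z 0 x)\<bar> \<le> R0" for x
      unfolding R0_def using y0[of x] z0[of x] by linarith+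
    from FD[OF this(1)] FD[OF this(2)] have \<Psi>D: "\<Psi> (y 0 x) (z 0 x) \<le> 2 * D" for x
      unfolding \<Psi>_def mult_2 by (intro add_mono)
    have "P 0 \<le> (\<integral>x. 2 * D \<partial>mu)"
    proof (unfold P_def, rule integral_mono')
      show "integrable mu (\<lambda>x. 2 * D)" by simp
    qed (use \<Psi>D \<Psi>0 order_trans[OF \<Psi>0 \<Psi>D] in auto)
    then show ?thesis by (simp add: measure_mu[simplified])
  qed
  \<comment> \<open>All other terms of the energy are nonnegative, so the elastic energy of y alone
    is at most |E0|, a quantity that does not depend on R.\<close>
  have bound: "\<bar>y t x\<bar> + l \<le> R" if t: "t \<ge> 0" for t x
  proof -
    have ec: "(\<Sum>n. (lam n * a n t)\<^sup>2 + (a' n t)\<^sup>2) + \<kappa> * (\<Sum>n. (kap n * b n t)\<^sup>2 + (b' n t)\<^sup>2) + 2 * P t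
      = D0 + 2 * P 0"
      using energy_conservation[OF d1 d2 \<kappa> \<Psi>c t] unfolding P_def D0_def ini .
    have n1: "(\<Sum>n. (lam n * a n t)\<^sup>2) \<le> (\<Sum>n. (lam n * a n t)\<^sup>2 + (a' n t)\<^sup>2)"
      by (intro suminf_le modal_curve_summable[OF ma t]) auto
    have n2: "\<kappa> * (\<Sum>n. (kap n * b n t)\<^sup>2 + (b' n t)\<^sup>2) \<ge> 0"
      using \<kappa> by (intro mult_nonneg_nonneg suminf_nonneg modal_curve_summable[OF mb t]) auto
    have "(\<Sum>n. (lam n * a n t)\<^sup>2) \<le> \<bar>E0\<bar>"
      using ec n1 n2 P0[of t] P00 unfolding E0_def by linarith
    then have "CW * sqrt (\<Sum>n. (lam n * a n t)\<^sup>2) \<le> CW * sqrt \<bar>E0\<bar>"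
      by (intro mult_left_mono real_sqrt_le_mono CW_nonneg)
    then show ?thesis using modal_curve_summable_abs(3)[OF ma t lam(1), of x] R(3) by linarith
  qed
  show thesis
    by (rule that[OF modal_pair_axioms[unfolded h_def] bound ini])
qed

section \<open>From modes to weak solutions and back\<close>

lemma tendsto_zero_of_square:
  fixes r S :: "'a \<Rightarrow> real"
  assumes "(S \<longlongrightarrow> 0) F" "\<forall>\<^sub>F s in F. 0 \<le> r s \<and> (r s)\<^sup>2 \<le> C * S s"
  shows "(r \<longlongrightarrow> 0) F"
proof (rule Lim_null_comparison)
  have "((\<lambda>s. sqrt (C * S s)) \<longlongrightarrow> sqrt (C * 0)) F" by (intro tendsto_intros assms(1))
  then show "((\<lambda>s. sqrt (C * S s)) \<longlongrightarrow> 0) F" by simp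
  show "\<forall>\<^sub>F s in F. norm (r s) \<le> sqrt (C * S s)"
    using assms(2) by eventually_elim (auto intro: real_le_rsqrt)
qed

lemma diff_square_le: "(x - y)\<^sup>2 \<le> 2 * x\<^sup>2 + 2 * y\<^sup>2" for x y :: real
  using sum_squares_bound[of x "- y"] by (simp add: power2_diff)

lemma suminf_Cauchy_Schwarz:
  fixes p q :: "nat \<Rightarrow> real"
  assumes p: "summable (\<lambda>n. (p n)\<^sup>2)" and q: "summable (\<lambda>n. (q n)\<^sup>2)"
  shows "\<bar>\<Sum>n. p n * q n\<bar> \<le> sqrt (\<Sum>n. (p n)\<^sup>2) * sqrt (\<Sum>n. (q n)\<^sup>2)"
proof (rule LIMSEQ_le_const2)
  show "(\<lambda>N. \<bar>\<Sum>n<N. p n * q n\<bar>) \<longlonglongrightarrow> \<bar>\<Sum>n. p n * q n\<bar>"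
    by (intro tendsto_rabs summable_LIMSEQ summable_mult_squares p q)
  show "\<exists>N0. \<forall>N\<ge>N0. \<bar>\<Sum>n<N. p n * q n\<bar> \<le> sqrt (\<Sum>n. (p n)\<^sup>2) * sqrt (\<Sum>n. (q n)\<^sup>2)"
  proof (intro exI allI impI)
    fix N :: nat
    have "\<bar>\<Sum>n<N. p n * q n\<bar> \<le> (\<Sum>n<N. \<bar>p n\<bar> * \<bar>q n\<bar>)" by (rule order_trans[OF sum_abs]) (simp add: abs_mult)
    also have "\<dots> \<le> L2_set p {..<N} * L2_set q {..<N}" by (rule L2_set_mult_ineq)
    also have "\<dots> \<le> sqrt (\<Sum>n. (p n)\<^sup>2) * sqrt (\<Sum>n. (q n)\<^sup>2)"
      unfolding L2_set_def using p q
      by (intro mult_mono real_sqrt_le_mono sum_le_suminf real_sqrt_ge_zero suminf_nonneg sum_nonneg) auto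
    finally show "\<bar>\<Sum>n<N. p n * q n\<bar> \<le> sqrt (\<Sum>n. (p n)\<^sup>2) * sqrt (\<Sum>n. (q n)\<^sup>2)" .
  qed
qed

text \<open>What \<open>H10\<close> with frequencies W n and \<open>H2H10\<close> with frequencies
  (W n)^2 have in common, so that the passage between modes and weak solutions is made once for both
  equations. The factor 3 allows for the lower-order terms of the H2 norm, each dominated by the top
  one.\<close>

locale spectral_space =
  fixes V :: "(real \<Rightarrow> real) set" and nrm :: "(real \<Rightarrow> real) \<Rightarrow> real" and lam :: "nat \<Rightarrow> real"
    and ip :: "(real \<Rightarrow> real) \<Rightarrow> (real \<Rightarrow> real) \<Rightarrow> real"
  assumes lam: "\<And>n. lam n \<ge> W n"
    and V_iff: "u \<in> V \<longleftrightarrow> u \<in> L2 \<and> summable (\<lambda>n. (lam n * coef u n)\<^sup>2)"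
    and nrm_nonneg: "nrm u \<ge> 0"
    and nrm_lower: "u \<in> V \<Longrightarrow> (\<Sum>n. (lam n * coef u n)\<^sup>2) \<le> (nrm u)\<^sup>2"
    and nrm_upper: "u \<in> V \<Longrightarrow> (nrm u)\<^sup>2 \<le> 3 * (\<Sum>n. (lam n * coef u n)\<^sup>2)"
    and ip: "u \<in> V \<Longrightarrow> v \<in> V \<Longrightarrow> (\<lambda>n. (lam n)\<^sup>2 * coef u n * coef v n) sums ip u v"
begin

lemma lam_pos: "lam n > 0" using lam[of n] W_pos[of n] by linarith

lemma V_L2: "u \<in> V \<Longrightarrow> u \<in> L2" by (simp add: V_iff)

lemma V_summable: "u \<in> V \<Longrightarrow> summable (\<lambda>n. (lam n * coef u n)\<^sup>2)" by (simp add: V_iff)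

lemma V_summable_W:
  assumes "u \<in> V" shows "summable (\<lambda>n. (W n * coef u n)\<^sup>2)" "(\<Sum>n. (W n * coef u n)\<^sup>2) \<le> (\<Sum>n. (lam n * coef u n)\<^sup>2)"
  using majorant_imp_summable_W[OF lam V_summable[OF assms], of "coef u" "\<lambda>n. 0"] by auto

lemma V_H10: "u \<in> V \<Longrightarrow> u \<in> H10"
  by (simp add: H10_iff V_L2 V_summable_W)

lemma se_V: "se m \<in> V"
  unfolding V_iff
proof
  have "summable (\<lambda>n. if n = m then (lam m)\<^sup>2 else 0)" by (rule summable_single)
  then show "summable (\<lambda>n. (lam n * coef (se m) n)\<^sup>2)"
    by (rule summable_cong[THEN iffD1, rotated]) (auto simp: coef_se intro!: always_eventually)
qed (rule se_L2)

lemma V_lin: assumes "u \<in> V" "v \<in> V" shows "(\<lambda>x. p * u x + q * v x) \<in> V"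
  unfolding V_iff
proof
  have L: "u \<in> L2" "v \<in> L2" using assms V_L2 by auto
  show "(\<lambda>x. p * u x + q * v x) \<in> L2" by (intro L2_add L2_scale L)
  have c: "lam n * coef (\<lambda>x. p * u x + q * v x) n = p * (lam n * coef u n) - (- q) * (lam n * coef v n)" for n
    by (simp add: coef_add coef_scale L2_scale L algebra_simps)
  have s: "summable (\<lambda>n. 2 * (p * (lam n * coef u n))\<^sup>2 + 2 * ((- q) * (lam n * coef v n))\<^sup>2)"
    unfolding power_mult_distrib[of p] power_mult_distrib[of "- q"]
    by (intro summable_add summable_mult V_summable assms)
  show "summable (\<lambda>n. (lam n * coef (\<lambda>x. p * u x + q * v x) n)\<^sup>2)"
    unfolding c
    by (rule summable_comparison_test[OF _ s], intro exI[of _ 0] allI impI)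
       (simp only: real_norm_def abs_power2 diff_square_le)
qed

lemma V_diff: "u \<in> V \<Longrightarrow> v \<in> V \<Longrightarrow> (\<lambda>x. u x - v x) \<in> V"
  using V_lin[of u v 1 "-1"] by simp

text \<open>Since \<open>dual_norm\<close> is a bare \<open>Sup\<close> of reals, both inequalities
  rest on the underlying set being nonempty, with the zero function as witness, and bounded
  above.\<close>

lemma dual_norm_le:
  assumes "\<And>\<phi>. \<phi> \<in> V \<Longrightarrow> \<bar>\<Lambda> \<phi>\<bar> \<le> K * nrm \<phi>" "K \<ge> 0"
  shows "0 \<le> dual_norm V nrm \<Lambda>" "dual_norm V nrm \<Lambda> \<le> K"
proof -
  let ?S = "{\<bar>\<Lambda> u\<bar> |u. u \<in> V \<and> nrm u \<le> 1}"
  have z: "(\<lambda>x. 0) \<in> V" using V_lin[OF se_V[of 0] se_V[of 0], of 0 0] by simp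
  have "coef (\<lambda>x. 0) n = 0" for n using coef_scale[of 0 "\<lambda>x. 0" n] by simp
  then have "(nrm (\<lambda>x. 0))\<^sup>2 \<le> 0" using nrm_upper[OF z] by simp
  then have "nrm (\<lambda>x. 0) \<le> 1" by simp
  then have ne: "\<bar>\<Lambda> (\<lambda>x. 0)\<bar> \<in> ?S" using z by blast
  have ub: "r \<le> K" if "r \<in> ?S" for r
  proof -
    from that obtain u where u: "r = \<bar>\<Lambda> u\<bar>" "u \<in> V" "nrm u \<le> 1" by blast
    then have "r \<le> K * nrm u" using assms(1) by simp
    also have "\<dots> \<le> K" using u assms(2) by (simp add: mult_left_le)
    finally show ?thesis .
  qed
  show "dual_norm V nrm \<Lambda> \<le> K" unfolding dual_norm_def using ne ub by (intro cSup_least) auto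
  have "bdd_above ?S" using ub by (rule bdd_aboveI)
  from cSup_upper[OF ne this] show "0 \<le> dual_norm V nrm \<Lambda>" unfolding dual_norm_def
    by (rule order_trans[OF abs_ge_zero])
qed

text \<open>The test function is divided by a number above its norm, so that it enters the supremum;
  the summand 1 keeps this number positive. Boundedness of the functional is assumed because the
  supremum of an unbounded set carries no information.\<close>

lemma dual_norm_apply:
  assumes "\<And>\<phi>. \<phi> \<in> V \<Longrightarrow> \<bar>\<Lambda> \<phi>\<bar> \<le> K * nrm \<phi>"
    and \<phi>: "\<phi> \<in> V" and sc: "\<And>p u. u \<in> V \<Longrightarrow> \<Lambda> (\<lambda>x. p * u x) = p * \<Lambda> u"
  shows "\<bar>\<Lambda> \<phi>\<bar> \<le> dual_norm V nrm \<Lambda> * (sqrt 3 * sqrt (\<Sum>n. (lam n * coef \<phi> n)\<^sup>2) + 1)"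
proof -
  define k where "k = sqrt 3 * sqrt (\<Sum>n. (lam n * coef \<phi> n)\<^sup>2) + 1"
  have k: "k > 0" unfolding k_def using suminf_nonneg[OF V_summable[OF \<phi>]] by (simp add: add_nonneg_pos)
  let ?u = "\<lambda>x. (1 / k) * \<phi> x"
  have uV: "?u \<in> V" using V_lin[OF \<phi> \<phi>, of "1 / k" 0] by simp
  have n1: "nrm ?u \<le> 1"
  proof (rule power2_le_imp_le)
    have "(nrm ?u)\<^sup>2 \<le> 3 * (\<Sum>n. (lam n * coef ?u n)\<^sup>2)" by (rule nrm_upper[OF uV])
    also have "(\<lambda>n. (lam n * coef ?u n)\<^sup>2) = (\<lambda>n. (1 / k)\<^sup>2 * (lam n * coef \<phi> n)\<^sup>2)"
      unfolding coef_scale by (simp add: power_mult_distrib[symmetric] mult_ac)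
    also have "(\<Sum>n. (1 / k)\<^sup>2 * (lam n * coef \<phi> n)\<^sup>2) = (1 / k)\<^sup>2 * (\<Sum>n. (lam n * coef \<phi> n)\<^sup>2)"
      by (rule suminf_mult[OF V_summable[OF \<phi>]])
    also have "3 * ((1 / k)\<^sup>2 * (\<Sum>n. (lam n * coef \<phi> n)\<^sup>2)) \<le> 1\<^sup>2"
    proof -
      have "(sqrt 3 * sqrt (\<Sum>n. (lam n * coef \<phi> n)\<^sup>2))\<^sup>2 \<le> k\<^sup>2"
        unfolding k_def using suminf_nonneg[OF V_summable[OF \<phi>]] by (intro power_mono) auto
      then have "3 * (\<Sum>n. (lam n * coef \<phi> n)\<^sup>2) \<le> k\<^sup>2"
        using suminf_nonneg[OF V_summable[OF \<phi>]] by (simp add: power_mult_distrib)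
      then show ?thesis using k by (simp add: power_divide field_simps)
    qed
    finally show "(nrm ?u)\<^sup>2 \<le> 1\<^sup>2" .
  qed simp
  have bdd: "bdd_above {\<bar>\<Lambda> u\<bar> |u. u \<in> V \<and> nrm u \<le> 1}"
  proof (rule bdd_aboveI)
    fix r assume "r \<in> {\<bar>\<Lambda> u\<bar> |u. u \<in> V \<and> nrm u \<le> 1}"
    then obtain u where u: "r = \<bar>\<Lambda> u\<bar>" "u \<in> V" "nrm u \<le> 1" by blast
    have "r \<le> K * nrm u" using assms(1)[OF u(2)] u(1) by simp
    also have "\<dots> \<le> \<bar>K\<bar> * 1" using u(3) nrm_nonneg[of u] by (intro mult_mono) auto
    finally show "r \<le> \<bar>K\<bar>" by simp
  qed
  have "\<bar>\<Lambda> ?u\<bar> \<le> dual_norm V nrm \<Lambda>"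
    unfolding dual_norm_def using uV n1 by (intro cSup_upper bdd) blast
  then show ?thesis unfolding k_def[symmetric] sc[OF \<phi>] using k by (simp add: abs_mult field_simps)
qed

text \<open>A coefficient sequence that is square summable after division by \<open>lam n\<close>
  acts on V by Cauchy-Schwarz, the missing factor \<open>lam n\<close> being supplied by the test
  function.\<close>

lemma dual_series:
  assumes d: "summable (\<lambda>n. (d n / lam n)\<^sup>2)" and \<phi>: "\<phi> \<in> V"
  shows "summable (\<lambda>n. d n * coef \<phi> n)" "\<bar>\<Sum>n. d n * coef \<phi> n\<bar> \<le> sqrt (\<Sum>n. (d n / lam n)\<^sup>2) * nrm \<phi>"
proof -
  have e: "d n * coef \<phi> n = (d n / lam n) * (lam n * coef \<phi> n)" for n using lam_pos[of n] by simp
  show "summable (\<lambda>n. d n * coef \<phi> n)" unfolding e by (rule summable_mult_squares[OF d V_summable[OF \<phi>]])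
  have "\<bar>\<Sum>n. d n * coef \<phi> n\<bar> \<le> sqrt (\<Sum>n. (d n / lam n)\<^sup>2) * sqrt (\<Sum>n. (lam n * coef \<phi> n)\<^sup>2)"
    unfolding e by (rule suminf_Cauchy_Schwarz[OF d V_summable[OF \<phi>]])
  also have "\<dots> \<le> sqrt (\<Sum>n. (d n / lam n)\<^sup>2) * nrm \<phi>"
    using nrm_lower[OF \<phi>] nrm_nonneg[of \<phi>] suminf_nonneg[OF d]
    by (intro mult_left_mono real_le_lsqrt) (auto simp: suminf_nonneg V_summable[OF \<phi>])
  finally show "\<bar>\<Sum>n. d n * coef \<phi> n\<bar> \<le> sqrt (\<Sum>n. (d n / lam n)\<^sup>2) * nrm \<phi>" .
qed

lemma dual_norm_series_tendsto:
  assumes \<Lambda>: "\<forall>\<^sub>F s in F. \<forall>\<phi>\<in>V. \<Lambda> s \<phi> = (\<Sum>n. d s n * coef \<phi> n)"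
    and lim: "\<And>n. ((\<lambda>s. d s n) \<longlongrightarrow> 0) F"
    and M: "\<forall>\<^sub>F s in F. \<forall>n. (d s n / lam n)\<^sup>2 \<le> M n" "summable M"
  shows "((\<lambda>s. dual_norm V nrm (\<Lambda> s)) \<longlongrightarrow> 0) F"
proof (rule tendsto_zero_of_square[where C=1])
  show "((\<lambda>s. \<Sum>n. (d s n / lam n)\<^sup>2) \<longlongrightarrow> 0) F"
  proof (rule suminf_tendsto_zero[OF _ _ M(2)])
    show "((\<lambda>s. (d s n / lam n)\<^sup>2) \<longlongrightarrow> 0) F" for n
      using lim[of n] lam_pos[of n] by (auto intro!: tendsto_eq_intros)
    show "\<forall>\<^sub>F s in F. \<forall>n. \<bar>(d s n / lam n)\<^sup>2\<bar> \<le> M n" using M(1) by simp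
  qed
  show "\<forall>\<^sub>F s in F. 0 \<le> dual_norm V nrm (\<Lambda> s) \<and> (dual_norm V nrm (\<Lambda> s))\<^sup>2 \<le> 1 * (\<Sum>n. (d s n / lam n)\<^sup>2)"
    using \<Lambda> M(1)
  proof eventually_elim
    case (elim s)
    have sd: "summable (\<lambda>n. (d s n / lam n)\<^sup>2)"
      by (rule summable_comparison_test[OF _ M(2)]) (use elim in auto)
    have *: "\<bar>\<Lambda> s \<phi>\<bar> \<le> sqrt (\<Sum>n. (d s n / lam n)\<^sup>2) * nrm \<phi>" if "\<phi> \<in> V" for \<phi>
      using dual_series(2)[OF sd that] elim that by simp
    have n0: "(\<Sum>n. (d s n / lam n)\<^sup>2) \<ge> 0" by (intro suminf_nonneg sd) auto
    note dn = dual_norm_le[OF * real_sqrt_ge_zero[OF n0]]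
    have "(dual_norm V nrm (\<Lambda> s))\<^sup>2 \<le> (sqrt (\<Sum>n. (d s n / lam n)\<^sup>2))\<^sup>2" by (intro power_mono dn)
    then show ?case using dn(1) n0 by simp
  qed
qed

text \<open>The velocity is a function, obtained from its coefficients by Riesz-Fischer. The
  acceleration is a functional: its coefficients are square summable after division by
  \<open>lam n\<close>. Every continuity or differentiability claim becomes a series of squares that
  tends to 0 termwise under a summable majorant.\<close>

lemma existence_half:
  assumes mc: "modal_curve lam a a' G" and GL2: "\<forall>t\<ge>0. G t \<in> L2"
    and GB: "\<forall>t\<ge>0. \<forall>n. \<bar>coef (G t) n\<bar> \<le> Bc"
    and Gc: "\<forall>t\<ge>0. \<forall>n. ((\<lambda>s. coef (G s) n) \<longlongrightarrow> coef (G t) n) (at t within {0..})"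
  defines "y \<equiv> \<lambda>t. ser (\<lambda>n. a n t)"
  shows "\<exists>yt ytt. (\<forall>t\<ge>0. y t \<in> V) \<and> curve_cont nrm y \<and>
     (\<forall>t\<ge>0. yt t \<in> L2) \<and> curve_deriv l2_norm y yt \<and> curve_cont l2_norm yt \<and>
     (\<forall>t\<ge>0. ytt t \<in> dual_space V nrm) \<and>
     dcurve_deriv_of_l2 V nrm yt ytt \<and> dcurve_cont V nrm ytt \<and>
     (\<forall>n. coef (yt 0) n = a' n 0) \<and>
     (\<forall>t\<ge>0. \<forall>\<phi>\<in>V. ytt t \<phi> + ip (y t) \<phi> + l2_inner (G t) \<phi> = 0)"
proof -
  note GL2 = GL2[rule_format] and GB = GB[rule_format] and Gc = Gc[rule_format]
  note s = modal_curve_summable[OF mc] and sa = modal_curve_summable_abs[OF mc _ lam]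
  note D = modal_curveD[OF mc]
  have yL2: "y t \<in> L2" and cy: "coef (y t) n = a n t" if "t \<ge> 0" for t n
    unfolding y_def by (rule ser_L2[OF sa(2)[OF that]], rule coef_ser[OF sa(2)[OF that]])
  have yV: "y t \<in> V" if "t \<ge> 0" for t
    unfolding V_iff using yL2[OF that] s(1)[OF that] by (simp add: cy[OF that])
  have "\<exists>u. l2_expands se (\<lambda>n. a' n t) u" if "t \<ge> 0" for t
    using Riesz_Fischer[OF orthonormal_se s(2)[OF that]] by blast
  then obtain yt where yt: "\<And>t. t \<ge> 0 \<Longrightarrow> l2_expands se (\<lambda>n. a' n t) (yt t)" by metis
  have ytL2: "yt t \<in> L2" and cyt: "coef (yt t) n = a' n t" if "t \<ge> 0" for t n
    using yt[OF that] l2_expands_coeff[OF orthonormal_se yt[OF that]] by (auto simp: l2_expands_def coef_def)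
  define a2 where "a2 n t = - (lam n)\<^sup>2 * a n t - coef (G t) n" for n t
  define ytt where "ytt t \<phi> = (\<Sum>n. a2 n t * coef \<phi> n)" for t \<phi>
  have maj: "\<exists>M M2. summable M \<and> summable M2 \<and>
      (\<forall>n t. 0 \<le> t \<longrightarrow> t \<le> T \<longrightarrow> (lam n * a n t)\<^sup>2 \<le> M n \<and> (a' n t)\<^sup>2 \<le> M n \<and> (a2 n t / lam n)\<^sup>2 \<le> M2 n)"
    if T: "T \<ge> 0" for T
  proof -
    obtain M where M: "summable M" "\<And>n t. 0 \<le> t \<Longrightarrow> t \<le> T \<Longrightarrow> (lam n * a n t)\<^sup>2 + (a' n t)\<^sup>2 \<le> M n"
      using D(3)[OF T] by blast
    \<comment> \<open>From a2 / lam = - lam a - coef / lam: the first term is dominated by the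
      energy majorant, and in the second the coefficient is at most Bc while 1/lam n \<le> 1/W n,
      which is square summable.\<close>
    define M2 where "M2 n = 2 * M n + 2 * (Bc\<^sup>2 * (1 / W n)\<^sup>2)" for n
    have "summable M2" unfolding M2_def by (intro summable_add summable_mult M summable_W)
    moreover have "(lam n * a n t)\<^sup>2 \<le> M n \<and> (a' n t)\<^sup>2 \<le> M n \<and> (a2 n t / lam n)\<^sup>2 \<le> M2 n" if t: "0 \<le> t" "t \<le> T" for n t
    proof (intro conjI)
      show 1: "(lam n * a n t)\<^sup>2 \<le> M n" and "(a' n t)\<^sup>2 \<le> M n"
        using M(2)[OF t, of n] zero_le_power2[of "lam n * a n t"] zero_le_power2[of "a' n t"] by linarith+
      have "a2 n t / lam n = - (lam n * a n t) - coef (G t) n / lam n"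
        unfolding a2_def using lam_pos[of n] by (simp add: power2_eq_square field_simps)
      then have "(a2 n t / lam n)\<^sup>2 \<le> 2 * (lam n * a n t)\<^sup>2 + 2 * (coef (G t) n / lam n)\<^sup>2"
        using diff_square_le[of "- (lam n * a n t)" "coef (G t) n / lam n"] by simp
      moreover have "(coef (G t) n / lam n)\<^sup>2 \<le> Bc\<^sup>2 * (1 / W n)\<^sup>2"
      proof -
        have "\<bar>coef (G t) n / lam n\<bar> \<le> Bc / W n"
          unfolding abs_divide using GB[OF t(1), of n] lam[of n] W_pos[of n] by (intro frac_le) auto
        then have "\<bar>coef (G t) n / lam n\<bar>\<^sup>2 \<le> (Bc / W n)\<^sup>2" by (intro power_mono) auto
        then show ?thesis by (simp add: power_divide)
      qed
      ultimately show "(a2 n t / lam n)\<^sup>2 \<le> M2 n" unfolding M2_def using 1 by linarith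
    qed
    ultimately show ?thesis using M(1) by blast
  qed
  have sd: "summable (\<lambda>n. (a2 n t / lam n)\<^sup>2)" if t: "t \<ge> 0" for t
  proof -
    obtain M2 where M2: "summable M2" "\<And>n. (a2 n t / lam n)\<^sup>2 \<le> M2 n" using maj[OF t] t by blast
    show ?thesis by (rule summable_comparison_test[OF _ M2(1)]) (use M2(2) in auto)
  qed
  have ac: "((\<lambda>s. a n s) \<longlongrightarrow> a n t) (at t within {0..})" "((\<lambda>s. a' n s) \<longlongrightarrow> a' n t) (at t within {0..})"
    "((\<lambda>s. a2 n s) \<longlongrightarrow> a2 n t) (at t within {0..})" if t: "t \<ge> 0" for n t
  proof -
    show 1: "((\<lambda>s. a n s) \<longlongrightarrow> a n t) (at t within {0..})" "((\<lambda>s. a' n s) \<longlongrightarrow> a' n t) (at t within {0..})"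
      using DERIV_continuous[OF D(1)[OF t]] DERIV_continuous[OF D(2)[OF t]] by (simp_all add: continuous_within)
    show "((\<lambda>s. a2 n s) \<longlongrightarrow> a2 n t) (at t within {0..})"
      unfolding a2_def by (intro tendsto_intros 1 Gc[OF t])
  qed
  have ev: "\<forall>\<^sub>F s in at t within {0..}. 0 \<le> s \<and> s \<le> t + 1 \<and> s \<noteq> t" if "t \<ge> 0" for t :: real
    by (subst eventually_at_topological, intro exI[of _ "{..<t+1}"]) auto
  have "curve_cont nrm y"
    unfolding curve_cont_def
  proof (intro allI impI)
    fix t :: real assume t: "t \<ge> 0"
    obtain M where M: "summable M" "\<And>n s. 0 \<le> s \<Longrightarrow> s \<le> t + 1 \<Longrightarrow> (lam n * a n s)\<^sup>2 \<le> M n"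
      using maj[of "t + 1"] t by (auto simp: add_nonneg_nonneg)
    have "((\<lambda>s. \<Sum>n. (lam n * (a n s - a n t))\<^sup>2) \<longlongrightarrow> 0) (at t within {0..})"
    proof (rule suminf_tendsto_zero)
      show "((\<lambda>s. (lam n * (a n s - a n t))\<^sup>2) \<longlongrightarrow> 0) (at t within {0..})" for n
        using ac(1)[OF t, of n] by (auto intro!: tendsto_eq_intros)
      \<comment> \<open>The 4 comes from (p - q)^2 \<le> 2 p^2 + 2 q^2 with both squares at most M
        n; it recurs in the majorants below.\<close>
      show "summable (\<lambda>n. 4 * M n)" by (intro summable_mult M)
      show "\<forall>\<^sub>F s in at t within {0..}. \<forall>n. \<bar>(lam n * (a n s - a n t))\<^sup>2\<bar> \<le> 4 * M n"
        using ev[OF t]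
      proof eventually_elim
        case (elim s)
        show ?case
        proof
          fix n
          have "(lam n * a n s)\<^sup>2 \<le> M n" "(lam n * a n t)\<^sup>2 \<le> M n" using M(2)[of s n] M(2)[of t n] elim t by auto
          then show "\<bar>(lam n * (a n s - a n t))\<^sup>2\<bar> \<le> 4 * M n"
            unfolding right_diff_distrib abs_power2 using diff_square_le[of "lam n * a n s" "lam n * a n t"] by linarith
        qed
      qed
    qed
    then show "((\<lambda>s. nrm (\<lambda>x. y s x - y t x)) \<longlongrightarrow> 0) (at t within {0..})"
    proof (rule tendsto_zero_of_square[where C=3])
      show "\<forall>\<^sub>F s in at t within {0..}. 0 \<le> nrm (\<lambda>x. y s x - y t x) \<and> (nrm (\<lambda>x. y s x - y t x))\<^sup>2 \<le> 3 * (\<Sum>n. (lam n * (a n s - a n t))\<^sup>2)"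
        using ev[OF t]
      proof eventually_elim
        case (elim s)
        then have s0: "s \<ge> 0" by simp
        have "coef (\<lambda>x. y s x - y t x) n = a n s - a n t" for n
          by (simp add: coef_diff yL2 cy s0 t)
        then show ?case using nrm_upper[OF V_diff[OF yV[OF s0] yV[OF t]]] nrm_nonneg by simp
      qed
    qed
  qed
  moreover have "curve_deriv l2_norm y yt"
    unfolding curve_deriv_def
  proof (intro allI impI)
    fix t :: real assume t: "t \<ge> 0"
    obtain M where M: "summable M" "\<And>n s. 0 \<le> s \<Longrightarrow> s \<le> t + 1 \<Longrightarrow> (a' n s)\<^sup>2 \<le> M n"
      using maj[of "t + 1"] t by (auto simp: add_nonneg_nonneg)
    have "((\<lambda>s. \<Sum>n. ((a n s - a n t) / (s - t) - a' n t)\<^sup>2) \<longlongrightarrow> 0) (at t within {0..})"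
    proof (rule suminf_tendsto_zero)
      fix n
      have "((\<lambda>s. (a n s - a n t) / (s - t)) \<longlongrightarrow> a' n t) (at t within {0..})"
        using D(1)[OF t, of n] by (simp add: has_field_derivative_iff)
      then show "((\<lambda>s. ((a n s - a n t) / (s - t) - a' n t)\<^sup>2) \<longlongrightarrow> 0) (at t within {0..})"
        by (intro tendsto_null_power LIM_zero) simp_all
    next
      show "summable (\<lambda>n. 4 * M n)" by (intro summable_mult M)
      show "\<forall>\<^sub>F s in at t within {0..}. \<forall>n. \<bar>((a n s - a n t) / (s - t) - a' n t)\<^sup>2\<bar> \<le> 4 * M n"
        using ev[OF t]
      proof eventually_elim
        case (elim s)
        show ?case
        proof
          fix n
          have "(a n s - a n t)\<^sup>2 \<le> M n * (s - t)\<^sup>2"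
            using elim t by (intro modal_increment_bound[of "a n" "a' n" "t + 1"] D(1) M(2)) auto
          then have "((a n s - a n t) / (s - t))\<^sup>2 \<le> M n" using elim by (simp add: power_divide divide_le_eq)
          moreover have "(a' n t)\<^sup>2 \<le> M n" using M(2)[of t n] t by simp
          ultimately show "\<bar>((a n s - a n t) / (s - t) - a' n t)\<^sup>2\<bar> \<le> 4 * M n"
            unfolding abs_power2 using diff_square_le[of "(a n s - a n t) / (s - t)" "a' n t"] by linarith
        qed
      qed
    qed
    then show "((\<lambda>s. l2_norm (\<lambda>x. (y s x - y t x) / (s - t) - yt t x)) \<longlongrightarrow> 0) (at t within {0..})"
    proof (rule tendsto_zero_of_square[where C=1])
      show "\<forall>\<^sub>F s in at t within {0..}. 0 \<le> l2_norm (\<lambda>x. (y s x - y t x) / (s - t) - yt t x) \<and>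
         (l2_norm (\<lambda>x. (y s x - y t x) / (s - t) - yt t x))\<^sup>2 \<le> 1 * (\<Sum>n. ((a n s - a n t) / (s - t) - a' n t)\<^sup>2)"
        using ev[OF t]
      proof eventually_elim
        case (elim s)
        then have s0: "s \<ge> 0" by simp
        have L: "(\<lambda>x. (y s x - y t x) / (s - t)) \<in> L2" by (intro L2_divide L2_diff yL2 s0 t)
        have "coef (\<lambda>x. (y s x - y t x) / (s - t) - yt t x) n = (a n s - a n t) / (s - t) - a' n t" for n
          by (simp add: coef_diff[OF L ytL2[OF t]] coef_divide coef_diff[OF yL2[OF s0] yL2[OF t]] cy cyt s0 t)
        then show ?case using parseval_norm(2)[OF L2_diff[OF L ytL2[OF t]]] by simp
      qed
    qed
  qed
  moreover have "curve_cont l2_norm yt"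
    unfolding curve_cont_def
  proof (intro allI impI)
    fix t :: real assume t: "t \<ge> 0"
    obtain M where M: "summable M" "\<And>n s. 0 \<le> s \<Longrightarrow> s \<le> t + 1 \<Longrightarrow> (a' n s)\<^sup>2 \<le> M n"
      using maj[of "t + 1"] t by (auto simp: add_nonneg_nonneg)
    have "((\<lambda>s. \<Sum>n. (a' n s - a' n t)\<^sup>2) \<longlongrightarrow> 0) (at t within {0..})"
    proof (rule suminf_tendsto_zero)
      show "((\<lambda>s. (a' n s - a' n t)\<^sup>2) \<longlongrightarrow> 0) (at t within {0..})" for n
        using ac(2)[OF t, of n] by (auto intro!: tendsto_eq_intros)
      show "summable (\<lambda>n. 4 * M n)" by (intro summable_mult M)
      show "\<forall>\<^sub>F s in at t within {0..}. \<forall>n. \<bar>(a' n s - a' n t)\<^sup>2\<bar> \<le> 4 * M n"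
        using ev[OF t]
      proof eventually_elim
        case (elim s)
        show ?case
        proof
          fix n
          have "(a' n s)\<^sup>2 \<le> M n" "(a' n t)\<^sup>2 \<le> M n" using M(2)[of s n] M(2)[of t n] elim t by auto
          then show "\<bar>(a' n s - a' n t)\<^sup>2\<bar> \<le> 4 * M n"
            unfolding abs_power2 using diff_square_le[of "a' n s" "a' n t"] by linarith
        qed
      qed
    qed
    then show "((\<lambda>s. l2_norm (\<lambda>x. yt s x - yt t x)) \<longlongrightarrow> 0) (at t within {0..})"
    proof (rule tendsto_zero_of_square[where C=1])
      show "\<forall>\<^sub>F s in at t within {0..}. 0 \<le> l2_norm (\<lambda>x. yt s x - yt t x) \<and>
         (l2_norm (\<lambda>x. yt s x - yt t x))\<^sup>2 \<le> 1 * (\<Sum>n. (a' n s - a' n t)\<^sup>2)"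
        using ev[OF t]
      proof eventually_elim
        case (elim s)
        then have s0: "s \<ge> 0" by simp
        have "coef (\<lambda>x. yt s x - yt t x) n = a' n s - a' n t" for n
          by (simp add: coef_diff ytL2 cyt s0 t)
        then show ?case using parseval_norm(2)[OF L2_diff[OF ytL2[OF s0] ytL2[OF t]]] by simp
      qed
    qed
  qed
  moreover have "\<forall>t\<ge>0. ytt t \<in> dual_space V nrm"
  proof (intro allI impI)
    fix t :: real assume t: "t \<ge> 0"
    have "ytt t (\<lambda>x. p * u x + q * v x) = p * ytt t u + q * ytt t v" if uv: "u \<in> V" "v \<in> V" for u v p q
    proof -
      note su = dual_series(1)[OF sd[OF t] uv(1)] and sv = dual_series(1)[OF sd[OF t] uv(2)]
      have "a2 n t * coef (\<lambda>x. p * u x + q * v x) n = p * (a2 n t * coef u n) + q * (a2 n t * coef v n)" for n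
        by (simp add: coef_add coef_scale L2_scale V_L2 uv algebra_simps)
      then show ?thesis
        unfolding ytt_def
        by (simp only: suminf_add[OF summable_mult[OF su] summable_mult[OF sv], symmetric] suminf_mult[OF su] suminf_mult[OF sv])
    qed
    then show "ytt t \<in> dual_space V nrm"
      unfolding dual_space_def using dual_series(2)[OF sd[OF t]] unfolding ytt_def by blast
  qed
  moreover have "dcurve_deriv_of_l2 V nrm yt ytt"
    unfolding dcurve_deriv_of_l2_def
  proof (intro allI impI)
    fix t :: real assume t: "t \<ge> 0"
    obtain M2 where M: "summable M2" "\<And>n s. 0 \<le> s \<Longrightarrow> s \<le> t + 1 \<Longrightarrow> (a2 n s / lam n)\<^sup>2 \<le> M2 n"
      using maj[of "t + 1"] t by (auto simp: add_nonneg_nonneg)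
    show "((\<lambda>s. dual_norm V nrm (\<lambda>\<phi>. (l2_inner (yt s) \<phi> - l2_inner (yt t) \<phi>) / (s - t) - ytt t \<phi>)) \<longlongrightarrow> 0) (at t within {0..})"
    proof (rule dual_norm_series_tendsto[where d="\<lambda>s n. (a' n s - a' n t) / (s - t) - a2 n t" and M="\<lambda>n. 4 * M2 n"])
      show "\<forall>\<^sub>F s in at t within {0..}. \<forall>\<phi>\<in>V. (l2_inner (yt s) \<phi> - l2_inner (yt t) \<phi>) / (s - t) - ytt t \<phi>
          = (\<Sum>n. ((a' n s - a' n t) / (s - t) - a2 n t) * coef \<phi> n)"
        using ev[OF t]
      proof eventually_elim
        case (elim s)
        then have s0: "s \<ge> 0" by simp
        show ?case
        proof
          fix \<phi> assume \<phi>: "\<phi> \<in> V"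
          have "(\<lambda>n. coef (yt r) n * coef \<phi> n) sums l2_inner (yt r) \<phi>" if "r \<ge> 0" for r
            by (rule parseval[OF ytL2[OF that] V_L2[OF \<phi>]])
          then have 1: "(\<lambda>n. a' n r * coef \<phi> n) sums l2_inner (yt r) \<phi>" if "r \<ge> 0" for r
            using that by (simp add: cyt)
          have 2: "(\<lambda>n. a2 n t * coef \<phi> n) sums ytt t \<phi>"
            unfolding ytt_def by (rule summable_sums[OF dual_series(1)[OF sd[OF t] \<phi>]])
          have "(\<lambda>n. (a' n s * coef \<phi> n - a' n t * coef \<phi> n) / (s - t) - a2 n t * coef \<phi> n) sums
             ((l2_inner (yt s) \<phi> - l2_inner (yt t) \<phi>) / (s - t) - ytt t \<phi>)"
            by (intro sums_diff sums_divide 1 2 s0 t)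
          moreover have "(a' n s * coef \<phi> n - a' n t * coef \<phi> n) / (s - t) - a2 n t * coef \<phi> n
              = ((a' n s - a' n t) / (s - t) - a2 n t) * coef \<phi> n" for n
            by (simp add: left_diff_distrib)
          ultimately show "(l2_inner (yt s) \<phi> - l2_inner (yt t) \<phi>) / (s - t) - ytt t \<phi>
             = (\<Sum>n. ((a' n s - a' n t) / (s - t) - a2 n t) * coef \<phi> n)" by (simp add: sums_iff)
        qed
      qed
      fix n
      have "((\<lambda>s. (a' n s - a' n t) / (s - t)) \<longlongrightarrow> a2 n t) (at t within {0..})"
        using D(2)[OF t, of n] unfolding a2_def by (simp add: has_field_derivative_iff)
      then show "((\<lambda>s. (a' n s - a' n t) / (s - t) - a2 n t) \<longlongrightarrow> 0) (at t within {0..})"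
        by (rule LIM_zero)
    next
      show "summable (\<lambda>n. 4 * M2 n)" by (intro summable_mult M)
      show "\<forall>\<^sub>F s in at t within {0..}. \<forall>n. (((a' n s - a' n t) / (s - t) - a2 n t) / lam n)\<^sup>2 \<le> 4 * M2 n"
        using ev[OF t]
      proof eventually_elim
        case (elim s)
        show ?case
        proof
          fix n
          have l0: "(lam n)\<^sup>2 > 0" using lam_pos[of n] by simp
          have m2: "(a2 n r)\<^sup>2 \<le> (lam n)\<^sup>2 * M2 n" if "0 \<le> r" "r \<le> t + 1" for r
            using M(2)[OF that, of n] l0 by (simp add: power_divide field_simps)
          have "(a' n s - a' n t)\<^sup>2 \<le> ((lam n)\<^sup>2 * M2 n) * (s - t)\<^sup>2"
            using elim t D(2) m2 unfolding a2_def by (intro modal_increment_bound[where T="t + 1"]) auto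
          then have "((a' n s - a' n t) / (s - t) / lam n)\<^sup>2 \<le> M2 n"
            using elim l0 lam_pos[of n] by (simp add: power_divide power_mult_distrib divide_le_eq mult_ac)
          moreover have "(a2 n t / lam n)\<^sup>2 \<le> M2 n" using M(2)[of t n] t by simp
          ultimately show "(((a' n s - a' n t) / (s - t) - a2 n t) / lam n)\<^sup>2 \<le> 4 * M2 n"
            unfolding diff_divide_distrib[of _ "a2 n t"] using diff_square_le[of "(a' n s - a' n t) / (s - t) / lam n" "a2 n t / lam n"] by linarith
        qed
      qed
    qed
  qed
  moreover have "dcurve_cont V nrm ytt"
    unfolding dcurve_cont_def
  proof (intro allI impI)
    fix t :: real assume t: "t \<ge> 0"
    obtain M2 where M: "summable M2" "\<And>n s. 0 \<le> s \<Longrightarrow> s \<le> t + 1 \<Longrightarrow> (a2 n s / lam n)\<^sup>2 \<le> M2 n"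
      using maj[of "t + 1"] t by (auto simp: add_nonneg_nonneg)
    show "((\<lambda>s. dual_norm V nrm (\<lambda>\<phi>. ytt s \<phi> - ytt t \<phi>)) \<longlongrightarrow> 0) (at t within {0..})"
    proof (rule dual_norm_series_tendsto[where d="\<lambda>s n. a2 n s - a2 n t" and M="\<lambda>n. 4 * M2 n"])
      show "\<forall>\<^sub>F s in at t within {0..}. \<forall>\<phi>\<in>V. ytt s \<phi> - ytt t \<phi> = (\<Sum>n. (a2 n s - a2 n t) * coef \<phi> n)"
        using ev[OF t]
      proof eventually_elim
        case (elim s)
        then have s0: "s \<ge> 0" by simp
        show ?case
          unfolding ytt_def left_diff_distrib
          by (intro ballI suminf_diff dual_series(1) sd s0 t)
      qed
      show "((\<lambda>s. a2 n s - a2 n t) \<longlongrightarrow> 0) (at t within {0..})" for n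
        by (rule LIM_zero[OF ac(3)[OF t]])
      show "summable (\<lambda>n. 4 * M2 n)" by (intro summable_mult M)
      show "\<forall>\<^sub>F s in at t within {0..}. \<forall>n. ((a2 n s - a2 n t) / lam n)\<^sup>2 \<le> 4 * M2 n"
        using ev[OF t]
      proof eventually_elim
        case (elim s)
        show ?case
        proof
          fix n
          have "(a2 n s / lam n)\<^sup>2 \<le> M2 n" "(a2 n t / lam n)\<^sup>2 \<le> M2 n" using M(2)[of s n] M(2)[of t n] elim t by auto
          then show "((a2 n s - a2 n t) / lam n)\<^sup>2 \<le> 4 * M2 n"
            unfolding diff_divide_distrib using diff_square_le[of "a2 n s / lam n" "a2 n t / lam n"] by linarith
        qed
      qed
    qed
  qed
  moreover have "\<forall>t\<ge>0. \<forall>\<phi>\<in>V. ytt t \<phi> + ip (y t) \<phi> + l2_inner (G t) \<phi> = 0"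
  proof (intro allI impI ballI)
    fix t :: real and \<phi> assume t: "t \<ge> 0" and \<phi>: "\<phi> \<in> V"
    have "(\<lambda>n. a2 n t * coef \<phi> n + (lam n)\<^sup>2 * coef (y t) n * coef \<phi> n + coef (G t) n * coef \<phi> n) sums
       (ytt t \<phi> + ip (y t) \<phi> + l2_inner (G t) \<phi>)"
      unfolding ytt_def
      by (intro sums_add summable_sums dual_series(1)[OF sd[OF t] \<phi>] ip yV t \<phi> parseval GL2 V_L2)
    moreover have "a2 n t * coef \<phi> n + (lam n)\<^sup>2 * coef (y t) n * coef \<phi> n + coef (G t) n * coef \<phi> n = 0" for n
      by (simp add: a2_def cy[OF t] algebra_simps)
    ultimately have "(\<lambda>n. 0) sums (ytt t \<phi> + ip (y t) \<phi> + l2_inner (G t) \<phi>)" by simp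
    then show "ytt t \<phi> + ip (y t) \<phi> + l2_inner (G t) \<phi> = 0" by (rule sums_unique2[OF _ sums_zero])
  qed
  ultimately show ?thesis using yV ytL2 cyt[OF order_refl] by blast
qed

end

section \<open>Weak solutions: uniform bounds and mode equations\<close>

lemma bounded_of_locally_bounded:
  fixes F :: "real \<Rightarrow> real"
  assumes "\<And>t. t \<in> {0..T} \<Longrightarrow> \<exists>c. \<forall>\<^sub>F s in at t within {0..}. F s \<le> c"
  obtains C where "\<And>t. t \<in> {0..T} \<Longrightarrow> F t \<le> C"
proof -
  have "\<exists>U c. open U \<and> t \<in> U \<and> (\<forall>s\<in>U \<inter> {0..}. F s \<le> c)" if tT: "t \<in> {0..T}" for t
  proof -
    obtain c where "\<forall>\<^sub>F s in at t within {0..}. F s \<le> c" using assms[OF tT] by blast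
    then obtain U where "open U" "t \<in> U" "\<And>s. s \<in> U \<Longrightarrow> s \<noteq> t \<Longrightarrow> s \<in> {0..} \<Longrightarrow> F s \<le> c"
      unfolding eventually_at_topological by blast
    \<comment> \<open>The filter leaves out t itself, so the value F t is added to the local
      bound.\<close>
    then show ?thesis by (intro exI[of _ U] exI[of _ "max c (F t)"]) (auto simp: le_max_iff_disj)
  qed
  then obtain U c where U: "\<And>t. t \<in> {0..T} \<Longrightarrow> open (U t)" "\<And>t. t \<in> {0..T} \<Longrightarrow> t \<in> U t"
    "\<And>t s. t \<in> {0..T} \<Longrightarrow> s \<in> U t \<Longrightarrow> s \<ge> 0 \<Longrightarrow> F s \<le> c t" by (metis IntI atLeast_iff)
  have "{0..T} \<subseteq> (\<Union>t\<in>{0..T}. U t)" using U(2) by blast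
  then obtain D where D: "D \<subseteq> {0..T}" "finite D" "{0..T} \<subseteq> (\<Union>t\<in>D. U t)"
    using compactE_image[OF compact_Icc, of "{0..T}" U 0 T] U(1) by blast
  \<comment> \<open>A sum of absolute values stands in for the maximum over the finite set D; it
    makes sense also for empty D.\<close>
  show thesis
  proof (rule that[of "\<Sum>t\<in>D. \<bar>c t\<bar>"])
    fix s assume s: "s \<in> {0..T}"
    then obtain t where t: "t \<in> D" "s \<in> U t" using D(3) by blast
    then have "F s \<le> c t" using U(3)[of t s] D(1) s by auto
    also have "\<dots> \<le> \<bar>c t\<bar>" by simp
    also have "\<dots> \<le> (\<Sum>t\<in>D. \<bar>c t\<bar>)" using D(2) t(1) by (intro member_le_sum) auto
    finally show "F s \<le> (\<Sum>t\<in>D. \<bar>c t\<bar>)" .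
  qed
qed

lemma suminf_diff_square:
  fixes p q :: "nat \<Rightarrow> real"
  assumes "summable (\<lambda>n. (p n)\<^sup>2)" "summable (\<lambda>n. (q n)\<^sup>2)"
  shows "summable (\<lambda>n. (p n - q n)\<^sup>2)" "(\<Sum>n. (p n - q n)\<^sup>2) \<le> 2 * (\<Sum>n. (p n)\<^sup>2) + 2 * (\<Sum>n. (q n)\<^sup>2)"
proof -
  have s: "summable (\<lambda>n. 2 * (p n)\<^sup>2 + 2 * (q n)\<^sup>2)" by (intro summable_add summable_mult assms)
  show sd: "summable (\<lambda>n. (p n - q n)\<^sup>2)"
    by (rule summable_comparison_test[OF _ s], intro exI[of _ 0] allI impI)
       (simp only: real_norm_def abs_power2 diff_square_le)
  have "(\<Sum>n. (p n - q n)\<^sup>2) \<le> (\<Sum>n. 2 * (p n)\<^sup>2 + 2 * (q n)\<^sup>2)" by (intro suminf_le sd s diff_square_le)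
  also have "\<dots> = 2 * (\<Sum>n. (p n)\<^sup>2) + 2 * (\<Sum>n. (q n)\<^sup>2)"
    by (simp only: suminf_add[OF summable_mult[OF assms(1)] summable_mult[OF assms(2)], symmetric]
        suminf_mult[OF assms(1)] suminf_mult[OF assms(2)])
  finally show "(\<Sum>n. (p n - q n)\<^sup>2) \<le> 2 * (\<Sum>n. (p n)\<^sup>2) + 2 * (\<Sum>n. (q n)\<^sup>2)" .
qed

context spectral_space
begin

lemma coef_square_le: "(coef u n)\<^sup>2 \<le> (lam n * coef u n)\<^sup>2"
proof -
  have "1 * (coef u n)\<^sup>2 \<le> (lam n)\<^sup>2 * (coef u n)\<^sup>2"
    using lam[of n] W_ge_1[of n] by (intro mult_right_mono) auto
  then show ?thesis by (simp add: power_mult_distrib)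
qed

lemma l2_norm_le_nrm: assumes "u \<in> V" shows "l2_norm u \<le> nrm u"
proof (rule power2_le_imp_le)
  have "(l2_norm u)\<^sup>2 \<le> (\<Sum>n. (lam n * coef u n)\<^sup>2)"
    unfolding parseval_norm(2)[OF V_L2[OF assms]]
    by (intro suminf_le coef_square_le parseval_norm(1) V_L2 V_summable assms)
  then show "(l2_norm u)\<^sup>2 \<le> (nrm u)\<^sup>2" using nrm_lower[OF assms] by linarith
qed (rule nrm_nonneg)

lemma V_sup_bound:
  assumes "u \<in> V" "(\<Sum>n. (lam n * coef u n)\<^sup>2) \<le> C" shows "AE x in mu. \<bar>u x\<bar> \<le> CW * sqrt C"
  using H10_sup_bound[OF V_H10[OF assms(1)]]
proof eventually_elim
  case (elim x)
  also have "CW * sqrt (\<Sum>n. (W n * coef u n)\<^sup>2) \<le> CW * sqrt C"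
    using V_summable_W(2)[OF assms(1)] assms(2) by (intro mult_left_mono real_sqrt_le_mono CW_nonneg) auto
  finally show ?case .
qed

lemma ip_se: assumes "u \<in> V" shows "ip u (se n) = (lam n)\<^sup>2 * coef u n"
proof -
  have "(\<lambda>m. (lam m)\<^sup>2 * coef u m * coef (se n) m) = (\<lambda>m. if m = n then (lam m)\<^sup>2 * coef u m else 0)"
    by (auto simp: coef_se)
  then show ?thesis using ip[OF assms se_V[of n]] sums_single[of n "\<lambda>m. (lam m)\<^sup>2 * coef u m"] sums_unique2 by metis
qed

text \<open>Testing with the single mode \<open>se n\<close> turns the weak formulation into scalar
  differential equations. The weak equation is postulated for positive times, so the equation for
  the velocity coefficient is obtained there, and its continuity, including time 0, is recorded
  separately. The bounds on [0, T] come from continuity of the curves in norm and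
  compactness.\<close>

lemma uniqueness_half:
  assumes yV: "\<forall>t\<ge>0. y t \<in> V" and cc: "curve_cont nrm y"
    and ytL2: "\<forall>t\<ge>0. yt t \<in> L2" and cd: "curve_deriv l2_norm y yt" and cct: "curve_cont l2_norm yt"
    and ds: "\<forall>t\<ge>0. ytt t \<in> dual_space V nrm" and dd: "dcurve_deriv_of_l2 V nrm yt ytt"
    and eq: "\<forall>t>0. \<forall>\<phi>\<in>V. ytt t \<phi> + ip (y t) \<phi> + l2_inner (G t) \<phi> = 0"
  shows "t \<ge> 0 \<Longrightarrow> ((\<lambda>s. coef (y s) n) has_real_derivative coef (yt t) n) (at t within {0..})"
    and "t > 0 \<Longrightarrow> ((\<lambda>s. coef (yt s) n) has_real_derivative - (lam n)\<^sup>2 * coef (y t) n - coef (G t) n) (at t within {0..})"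
    and "t \<ge> 0 \<Longrightarrow> ((\<lambda>s. coef (yt s) n) \<longlongrightarrow> coef (yt t) n) (at t within {0..})"
    and "\<exists>C. \<forall>t\<in>{0..T}. (\<Sum>n. (lam n * coef (y t) n)\<^sup>2) \<le> C \<and> (\<Sum>n. (coef (yt t) n)\<^sup>2) \<le> C"
proof -
  have ev: "\<forall>\<^sub>F s in at t within {0..}. 0 \<le> s \<and> s \<noteq> t" for t :: real by (simp add: eventually_at_filter)
  have yL2: "y t \<in> L2" if "t \<ge> 0" for t using yV V_L2 that by blast
  have ytL2: "yt t \<in> L2" if "t \<ge> 0" for t using ytL2 that by blast
  show "((\<lambda>s. coef (y s) n) has_real_derivative coef (yt t) n) (at t within {0..})" if t: "t \<ge> 0" for t n
  proof -
    have "((\<lambda>s. (coef (y s) n - coef (y t) n) / (s - t) - coef (yt t) n) \<longlongrightarrow> 0) (at t within {0..})"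
    proof (rule Lim_null_comparison)
      show "((\<lambda>s. l2_norm (\<lambda>x. (y s x - y t x) / (s - t) - yt t x)) \<longlongrightarrow> 0) (at t within {0..})"
        using cd t unfolding curve_deriv_def by blast
      show "\<forall>\<^sub>F s in at t within {0..}. norm ((coef (y s) n - coef (y t) n) / (s - t) - coef (yt t) n)
          \<le> l2_norm (\<lambda>x. (y s x - y t x) / (s - t) - yt t x)"
        using ev
      proof eventually_elim
        case (elim s)
        then have s0: "s \<ge> 0" by simp
        have L: "(\<lambda>x. (y s x - y t x) / (s - t)) \<in> L2" by (intro L2_divide L2_diff yL2 s0 t)
        have "coef (\<lambda>x. (y s x - y t x) / (s - t) - yt t x) n = (coef (y s) n - coef (y t) n) / (s - t) - coef (yt t) n"
          by (simp add: coef_diff[OF L ytL2[OF t]] coef_divide coef_diff[OF yL2[OF s0] yL2[OF t]])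
        then show ?case using coef_bound[OF L2_diff[OF L ytL2[OF t]], of n] by simp
      qed
    qed
    then show ?thesis unfolding has_field_derivative_iff by (rule LIM_zero_cancel)
  qed
  show "((\<lambda>s. coef (yt s) n) \<longlongrightarrow> coef (yt t) n) (at t within {0..})" if t: "t \<ge> 0" for t n
  proof -
    have "((\<lambda>s. coef (yt s) n - coef (yt t) n) \<longlongrightarrow> 0) (at t within {0..})"
    proof (rule Lim_null_comparison)
      show "((\<lambda>s. l2_norm (\<lambda>x. yt s x - yt t x)) \<longlongrightarrow> 0) (at t within {0..})"
        using cct t unfolding curve_cont_def by blast
      show "\<forall>\<^sub>F s in at t within {0..}. norm (coef (yt s) n - coef (yt t) n) \<le> l2_norm (\<lambda>x. yt s x - yt t x)"
        using ev
      proof eventually_elim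
        case (elim s)
        then have s0: "s \<ge> 0" by simp
        show ?case using coef_bound[OF L2_diff[OF ytL2[OF s0] ytL2[OF t]], of n]
          by (simp add: coef_diff[OF ytL2[OF s0] ytL2[OF t]])
      qed
    qed
    then show ?thesis by (rule LIM_zero_cancel)
  qed
  show "((\<lambda>s. coef (yt s) n) has_real_derivative - (lam n)\<^sup>2 * coef (y t) n - coef (G t) n) (at t within {0..})" if t: "t > 0" for t n
  proof -
    have t0: "t \<ge> 0" using t by simp
    \<comment> \<open>The factor from \<open>dual_norm_apply\<close> for the test function
      \<open>se n\<close>; with it, convergence in the dual norm gives convergence at
      \<open>se n\<close>.\<close>
    define k where "k = sqrt 3 * sqrt (\<Sum>m. (lam m * coef (se n) m)\<^sup>2) + 1"
    define \<Lambda> where "\<Lambda> s \<phi> = (l2_inner (yt s) \<phi> - l2_inner (yt t) \<phi>) / (s - t) - ytt t \<phi>" for s \<phi>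
    have "((\<lambda>s. dual_norm V nrm (\<Lambda> s)) \<longlongrightarrow> 0) (at t within {0..})"
      using dd t0 unfolding dcurve_deriv_of_l2_def \<Lambda>_def[abs_def] by blast
    then have lim: "((\<lambda>s. dual_norm V nrm (\<Lambda> s) * k) \<longlongrightarrow> 0) (at t within {0..})"
      by (rule tendsto_mult_left_zero)
    have lim0: "((\<lambda>s. \<Lambda> s (se n)) \<longlongrightarrow> 0) (at t within {0..})"
    proof (rule Lim_null_comparison[OF _ lim])
      obtain K0 where K0: "\<And>u. u \<in> V \<Longrightarrow> \<bar>ytt t u\<bar> \<le> K0 * nrm u"
        and linr: "\<And>u v p q. u \<in> V \<Longrightarrow> v \<in> V \<Longrightarrow> ytt t (\<lambda>x. p * u x + q * v x) = p * ytt t u + q * ytt t v"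
        using ds t0 unfolding dual_space_def by blast
      have sc: "ytt t (\<lambda>x. p * u x) = p * ytt t u" if "u \<in> V" for p u
        using linr[OF that that, of p 0] by simp
      show "\<forall>\<^sub>F s in at t within {0..}. norm (\<Lambda> s (se n)) \<le> dual_norm V nrm (\<Lambda> s) * k"
        using ev
      proof eventually_elim
        case (elim s)
        then have s0: "s \<ge> 0" by simp
        show ?case
          unfolding real_norm_def k_def
        proof (rule dual_norm_apply[OF _ se_V])
          fix u assume u: "u \<in> V"
          have i: "\<bar>l2_inner (yt r) u\<bar> \<le> l2_norm (yt r) * nrm u" if "r \<ge> 0" for r
            using l2_Cauchy_Schwarz[OF ytL2[OF that] V_L2[OF u]] mult_left_mono[OF l2_norm_le_nrm[OF u], of "l2_norm (yt r)"]
            by simp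
          have "\<bar>(l2_inner (yt s) u - l2_inner (yt t) u) / (s - t)\<bar> \<le> (l2_norm (yt s) * nrm u + l2_norm (yt t) * nrm u) / \<bar>s - t\<bar>"
            unfolding abs_divide using i[OF s0] i[OF t0] by (intro divide_right_mono) auto
          then have "\<bar>\<Lambda> s u\<bar> \<le> (l2_norm (yt s) * nrm u + l2_norm (yt t) * nrm u) / \<bar>s - t\<bar> + K0 * nrm u"
            unfolding \<Lambda>_def using K0[OF u] by linarith
          \<comment> \<open>This constant may blow up as s approaches t; it only ensures that the
            supremum in \<open>dual_norm\<close> is taken over a bounded set.\<close>
          then show "\<bar>\<Lambda> s u\<bar> \<le> ((l2_norm (yt s) + l2_norm (yt t)) / \<bar>s - t\<bar> + K0) * nrm u"
            by (simp add: distrib_right add_divide_distrib)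
          show "\<Lambda> s (\<lambda>x. p * u x) = p * \<Lambda> s u" for p
            unfolding \<Lambda>_def sc[OF u] l2_inner_scale_right by (simp add: right_diff_distrib)
        qed
      qed
    qed
    have e: "ytt t (se n) = - (lam n)\<^sup>2 * coef (y t) n - coef (G t) n"
    proof -
      have "ytt t (se n) + ip (y t) (se n) + coef (G t) n = 0" unfolding coef_def using eq t se_V[of n] by blast
      moreover have "ip (y t) (se n) = (lam n)\<^sup>2 * coef (y t) n" using yV t0 by (intro ip_se) blast
      ultimately show ?thesis by simp
    qed
    from LIM_zero_cancel[OF lim0[unfolded \<Lambda>_def e coef_def[symmetric]]]
    show ?thesis unfolding has_field_derivative_iff .
  qed
  show "\<exists>C. \<forall>t\<in>{0..T}. (\<Sum>n. (lam n * coef (y t) n)\<^sup>2) \<le> C \<and> (\<Sum>n. (coef (yt t) n)\<^sup>2) \<le> C"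
  proof -
    obtain C1 where C1: "\<And>t. t \<in> {0..T} \<Longrightarrow> (\<Sum>n. (lam n * coef (y t) n)\<^sup>2) \<le> C1"
    proof (rule bounded_of_locally_bounded)
      fix t assume "t \<in> {0..T}"
      then have t: "t \<ge> 0" by simp
      have "((\<lambda>s. nrm (\<lambda>x. y s x - y t x)) \<longlongrightarrow> 0) (at t within {0..})"
        using cc t unfolding curve_cont_def by blast
      from order_tendstoD(2)[OF this, of 1]
      have "\<forall>\<^sub>F s in at t within {0..}. nrm (\<lambda>x. y s x - y t x) < 1" by simp
      with ev have "\<forall>\<^sub>F s in at t within {0..}. (\<Sum>n. (lam n * coef (y s) n)\<^sup>2) \<le> 2 * 1 + 2 * (\<Sum>n. (- (lam n * coef (y t) n))\<^sup>2)"
      proof eventually_elim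
        case (elim s)
        then have s0: "s \<ge> 0" by simp
        have dV: "(\<lambda>x. y s x - y t x) \<in> V" using yV s0 t by (intro V_diff) auto
        have "(nrm (\<lambda>x. y s x - y t x))\<^sup>2 \<le> 1" using elim nrm_nonneg by (simp add: power_le_one)
        then have d1: "(\<Sum>n. (lam n * coef (\<lambda>x. y s x - y t x) n)\<^sup>2) \<le> 1" using nrm_lower[OF dV] by linarith
        have st: "summable (\<lambda>n. (- (lam n * coef (y t) n))\<^sup>2)" using V_summable yV t by simp
        have e: "lam n * coef (\<lambda>x. y s x - y t x) n - - (lam n * coef (y t) n) = lam n * coef (y s) n" for n
          by (simp add: coef_diff[OF yL2[OF s0] yL2[OF t]] algebra_simps)
        show ?case using suminf_diff_square(2)[OF V_summable[OF dV] st] d1 unfolding e by linarith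
      qed
      then show "\<exists>c. \<forall>\<^sub>F s in at t within {0..}. (\<Sum>n. (lam n * coef (y s) n)\<^sup>2) \<le> c" by blast
    qed blast
    obtain C2 where C2: "\<And>t. t \<in> {0..T} \<Longrightarrow> (\<Sum>n. (coef (yt t) n)\<^sup>2) \<le> C2"
    proof (rule bounded_of_locally_bounded)
      fix t assume "t \<in> {0..T}"
      then have t: "t \<ge> 0" by simp
      have "((\<lambda>s. l2_norm (\<lambda>x. yt s x - yt t x)) \<longlongrightarrow> 0) (at t within {0..})"
        using cct t unfolding curve_cont_def by blast
      from order_tendstoD(2)[OF this, of 1]
      have "\<forall>\<^sub>F s in at t within {0..}. l2_norm (\<lambda>x. yt s x - yt t x) < 1" by simp
      with ev have "\<forall>\<^sub>F s in at t within {0..}. (\<Sum>n. (coef (yt s) n)\<^sup>2) \<le> 2 * 1 + 2 * (\<Sum>n. (- coef (yt t) n)\<^sup>2)"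
      proof eventually_elim
        case (elim s)
        then have s0: "s \<ge> 0" by simp
        have dL: "(\<lambda>x. yt s x - yt t x) \<in> L2" by (intro L2_diff ytL2 s0 t)
        have "(l2_norm (\<lambda>x. yt s x - yt t x))\<^sup>2 \<le> 1" using elim by (simp add: power_le_one)
        then have d1: "(\<Sum>n. (coef (\<lambda>x. yt s x - yt t x) n)\<^sup>2) \<le> 1" using parseval_norm(2)[OF dL] by linarith
        have st: "summable (\<lambda>n. (- coef (yt t) n)\<^sup>2)" using parseval_norm(1)[OF ytL2[OF t]] by simp
        have e: "coef (\<lambda>x. yt s x - yt t x) n - - coef (yt t) n = coef (yt s) n" for n
          by (simp add: coef_diff[OF ytL2[OF s0] ytL2[OF t]])
        show ?case using suminf_diff_square(2)[OF parseval_norm(1)[OF dL] st] d1 unfolding e by linarith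
      qed
      then show "\<exists>c. \<forall>\<^sub>F s in at t within {0..}. (\<Sum>n. (coef (yt s) n)\<^sup>2) \<le> c" by blast
    qed blast
    show ?thesis
    proof (intro exI[of _ "max C1 C2"] ballI conjI)
      fix t assume "t \<in> {0..T}"
      from C1[OF this] C2[OF this]
      show "(\<Sum>n. (lam n * coef (y t) n)\<^sup>2) \<le> max C1 C2" "(\<Sum>n. (coef (yt t) n)\<^sup>2) \<le> max C1 C2" by linarith+
    qed
  qed
qed

end

text \<open>A Gronwall argument that does not differentiate the series \<open>\<Phi> t = (\<Sum>n. e n t)\<close>: if
  \<open>m\<close> is the supremum of \<open>exp (- k t) \<Phi> t\<close>, the differential inequality for the partial sums gives
  \<open>m \<le> m / 2\<close>.\<close>

lemma modal_uniqueness: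
  fixes w w' v v' g h :: "nat \<Rightarrow> real \<Rightarrow> real"
  assumes cont: "\<And>n. continuous_on {0..T} (w n)" "\<And>n. continuous_on {0..T} (w' n)"
      "\<And>n. continuous_on {0..T} (v n)" "\<And>n. continuous_on {0..T} (v' n)"
    and der: "\<And>n t. 0 < t \<Longrightarrow> t < T \<Longrightarrow> (w n has_real_derivative w' n t) (at t)"
      "\<And>n t. 0 < t \<Longrightarrow> t < T \<Longrightarrow> (w' n has_real_derivative - (lam n)\<^sup>2 * w n t - g n t) (at t)"
      "\<And>n t. 0 < t \<Longrightarrow> t < T \<Longrightarrow> (v n has_real_derivative v' n t) (at t)"
      "\<And>n t. 0 < t \<Longrightarrow> t < T \<Longrightarrow> (v' n has_real_derivative - (kap n)\<^sup>2 * v n t - h n t) (at t)"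
    and ini: "\<And>n. w n 0 = 0" "\<And>n. w' n 0 = 0" "\<And>n. v n 0 = 0" "\<And>n. v' n 0 = 0"
  defines "e \<equiv> \<lambda>n t. (lam n * w n t)\<^sup>2 + (w' n t)\<^sup>2 + ((kap n * v n t)\<^sup>2 + (v' n t)\<^sup>2)"
  assumes sm: "\<And>t. t \<in> {0..T} \<Longrightarrow> summable (\<lambda>n. e n t)" "\<And>t. t \<in> {0..T} \<Longrightarrow> (\<Sum>n. e n t) \<le> C"
    and gh: "\<And>t N. 0 < t \<Longrightarrow> t < T \<Longrightarrow> (\<Sum>n<N. (g n t)\<^sup>2 + (h n t)\<^sup>2) \<le> K * (\<Sum>n. e n t)" and K: "K \<ge> 0"
    and t: "t \<in> {0..T}"
  shows "e n t = 0"
proof -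
  \<comment> \<open>The partial sums have slope at most (K + 1) \<Phi>, and \<Phi> is at most m
    exp(k s); with k twice K + 1 this bound is the derivative of m/2 exp(k s), which produces the
    half.\<close>
  define k where "k = 2 * (K + 1)"
  define \<Phi> where "\<Phi> t = (\<Sum>n. e n t)" for t
  have e0: "e n t \<ge> 0" for n t unfolding e_def by simp
  have \<Phi>0: "\<Phi> t \<ge> 0" if "t \<in> {0..T}" for t unfolding \<Phi>_def by (intro suminf_nonneg sm that e0)
  define S where "S = (\<lambda>t. exp (- k * t) * \<Phi> t) ` {0..T}"
  define m where "m = Sup S"
  have k: "k > 0" using K by (simp add: k_def)
  have bdd: "bdd_above S"
  proof (rule bdd_aboveI[where M=C])
    fix r assume "r \<in> S"
    then obtain s where s: "s \<in> {0..T}" "r = exp (- k * s) * \<Phi> s" unfolding S_def by blast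
    have "r \<le> 1 * \<Phi> s" unfolding s(2) using s(1) k \<Phi>0[OF s(1)] by (intro mult_right_mono) auto
    then show "r \<le> C" using sm(2)[OF s(1)] by (simp add: \<Phi>_def)
  qed
  have ne: "S \<noteq> {}" using t unfolding S_def by auto
  have up: "\<Phi> s \<le> m * exp (k * s)" if "s \<in> {0..T}" for s
  proof -
    have "exp (- k * s) * \<Phi> s \<le> m" unfolding m_def using that by (intro cSup_upper bdd) (auto simp: S_def)
    then have "exp (- k * s) * \<Phi> s * exp (k * s) \<le> m * exp (k * s)" by (intro mult_right_mono) auto
    then show ?thesis by (simp add: mult_ac exp_minus field_simps)
  qed
  have m0: "m \<ge> 0"
  proof -
    have "0 \<le> \<Phi> t * exp (- k * t)" using \<Phi>0[OF t] by simp
    also have "\<dots> \<le> m" unfolding m_def using t by (intro cSup_upper bdd) (auto simp: S_def mult.commute)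
    finally show ?thesis .
  qed
  have main: "(\<Sum>n<N. e n t) \<le> m / 2 * exp (k * t)" if t: "t \<in> {0..T}" for N t
  proof -
    \<comment> \<open>Only finitely many terms are differentiated; the full sum enters as a bound.
      The equations hold inside (0, T), so monotonicity is derived on the open interval and extended
      to the ends by continuity.\<close>
    define \<psi> where "\<psi> s = (\<Sum>n<N. e n s) - m / 2 * exp (k * s)" for s
    have "\<psi> t \<le> \<psi> 0"
    proof (rule DERIV_nonpos_imp_decreasing_open[where f=\<psi>])
      show "0 \<le> t" using t by simp
      show "continuous_on {0..t} \<psi>"
        unfolding \<psi>_def e_def using t
        by (intro continuous_intros continuous_on_subset[OF cont(1)] continuous_on_subset[OF cont(2)]
            continuous_on_subset[OF cont(3)] continuous_on_subset[OF cont(4)]) auto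
      fix s assume s: "0 < s" "s < t"
      then have sT: "0 < s" "s < T" "s \<in> {0..T}" using t by auto
      have "((\<lambda>s. e n s) has_real_derivative - 2 * (g n s * w' n s + h n s * v' n s)) (at s)" for n
        unfolding e_def using der[OF sT(1,2), of n]
        by (auto intro!: derivative_eq_intros simp: power2_eq_square algebra_simps)
      then have "(\<psi> has_real_derivative (\<Sum>n<N. - 2 * (g n s * w' n s + h n s * v' n s)) - m / 2 * (exp (k * s) * k)) (at s)"
        unfolding \<psi>_def[abs_def] by (auto intro!: derivative_eq_intros)
      moreover have "(\<Sum>n<N. - 2 * (g n s * w' n s + h n s * v' n s)) - m / 2 * (exp (k * s) * k) \<le> 0"
      proof -
        have "- 2 * (g n s * w' n s + h n s * v' n s) \<le> ((g n s)\<^sup>2 + (h n s)\<^sup>2) + e n s" for n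
        proof -
          have "- 2 * (g n s * w' n s) \<le> (g n s)\<^sup>2 + (w' n s)\<^sup>2" "- 2 * (h n s * v' n s) \<le> (h n s)\<^sup>2 + (v' n s)\<^sup>2"
            using sum_squares_bound[of "- g n s" "w' n s"] sum_squares_bound[of "- h n s" "v' n s"] by simp_all
          moreover have "(w' n s)\<^sup>2 + (v' n s)\<^sup>2 \<le> e n s" unfolding e_def by simp
          ultimately show ?thesis unfolding distrib_left by linarith
        qed
        then have "(\<Sum>n<N. - 2 * (g n s * w' n s + h n s * v' n s)) \<le> (\<Sum>n<N. ((g n s)\<^sup>2 + (h n s)\<^sup>2) + e n s)"
          by (intro sum_mono)
        also have "\<dots> = (\<Sum>n<N. (g n s)\<^sup>2 + (h n s)\<^sup>2) + (\<Sum>n<N. e n s)" by (rule sum.distrib)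
        also have "\<dots> \<le> K * \<Phi> s + \<Phi> s"
          unfolding \<Phi>_def by (intro add_mono gh sT sum_le_suminf sm e0) auto
        also have "\<dots> = (K + 1) * \<Phi> s" by (simp add: distrib_right)
        also have "\<dots> \<le> (K + 1) * (m * exp (k * s))" using K by (intro mult_left_mono up sT) auto
        also have "\<dots> = m / 2 * (exp (k * s) * k)" by (simp add: k_def)
        finally show ?thesis by simp
      qed
      ultimately show "\<exists>D. (\<psi> has_real_derivative D) (at s) \<and> D \<le> 0" by blast
    qed
    moreover have "\<psi> 0 \<le> 0" using m0 by (simp add: \<psi>_def e_def ini)
    ultimately show ?thesis by (simp add: \<psi>_def)
  qed
  have "Sup S \<le> m / 2"
  proof (rule cSup_least[OF ne])
    fix r assume "r \<in> S"
    then obtain s where s: "s \<in> {0..T}" "r = exp (- k * s) * \<Phi> s" unfolding S_def by blast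
    have "\<Phi> s \<le> m / 2 * exp (k * s)" unfolding \<Phi>_def by (rule suminf_le_const[OF sm(1)[OF s(1)] main[OF s(1)]])
    then have "exp (- k * s) * \<Phi> s \<le> exp (- k * s) * (m / 2 * exp (k * s))" by (intro mult_left_mono) auto
    then show "r \<le> m / 2" unfolding s(2) by (simp add: exp_minus field_simps)
  qed
  then have "m = 0" using m0 unfolding m_def[symmetric] by simp
  then have "\<Phi> t \<le> 0" using up[OF t] by simp
  then have "\<Phi> t = 0" using \<Phi>0[OF t] by simp
  then show ?thesis unfolding \<Phi>_def using suminf_eq_zero_iff[OF sm(1)[OF t]] e0 by simp
qed

section \<open>Existence and uniqueness\<close>

lemma spectral_H10: "spectral_space H10 h1_norm W (\<lambda>u v. l2_inner (wd u) (wd v))"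
proof
  fix u v
  show "u \<in> H10 \<longleftrightarrow> u \<in> L2 \<and> summable (\<lambda>n. (W n * coef u n)\<^sup>2)" by (rule H10_iff)
  show "0 \<le> h1_norm u" by (simp add: h1_norm_def)
  assume u: "u \<in> H10"
  have s: "summable (\<lambda>n. (coef u n)\<^sup>2)" "summable (\<lambda>n. (W n * coef u n)\<^sup>2)"
    using parseval_norm(1)[OF H10_D(1)[OF u]] H10_D(2)[OF u] by auto
  have le: "(coef u n)\<^sup>2 \<le> (W n * coef u n)\<^sup>2" for n
  proof -
    have "1 * (coef u n)\<^sup>2 \<le> (W n)\<^sup>2 * (coef u n)\<^sup>2" using W_ge_1[of n] by (intro mult_right_mono) auto
    then show ?thesis by (simp add: power_mult_distrib)
  qed
  have "(\<Sum>n. (coef u n)\<^sup>2) \<le> (\<Sum>n. (W n * coef u n)\<^sup>2)" by (intro suminf_le le s)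
  moreover have "0 \<le> (\<Sum>n. (coef u n)\<^sup>2)" by (intro suminf_nonneg s) auto
  ultimately show "(\<Sum>n. (W n * coef u n)\<^sup>2) \<le> (h1_norm u)\<^sup>2" "(h1_norm u)\<^sup>2 \<le> 3 * (\<Sum>n. (W n * coef u n)\<^sup>2)"
    using h1_norm_power2[OF u] by linarith+
  assume "v \<in> H10"
  with u show "(\<lambda>n. (W n)\<^sup>2 * coef u n * coef v n) sums l2_inner (wd u) (wd v)" by (rule H10_inner)
qed simp

lemma spectral_H2H10: "spectral_space H2H10 h2_norm (\<lambda>n. (W n)\<^sup>2) (\<lambda>u v. l2_inner (wd (wd u)) (wd (wd v)))"
proof
  show "W n \<le> (W n)\<^sup>2" for n using W_ge_1[of n] by (simp add: self_le_power)
  fix u v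
  show "u \<in> H2H10 \<longleftrightarrow> u \<in> L2 \<and> summable (\<lambda>n. ((W n)\<^sup>2 * coef u n)\<^sup>2)" by (rule H2H10_iff)
  show "0 \<le> h2_norm u" by (simp add: h2_norm_def)
  assume u: "u \<in> H2H10"
  have s: "summable (\<lambda>n. (coef u n)\<^sup>2)" "summable (\<lambda>n. (W n * coef u n)\<^sup>2)" "summable (\<lambda>n. ((W n)\<^sup>2 * coef u n)\<^sup>2)"
    using parseval_norm(1)[OF H2H10_D(1)[OF u]] H10_D(2)[OF H2H10_D(2)[OF u]] H2H10_D(3)[OF u] by auto
  have le: "r\<^sup>2 \<le> (W n * r)\<^sup>2" for n r
  proof -
    have "1 * r\<^sup>2 \<le> (W n)\<^sup>2 * r\<^sup>2" using W_ge_1[of n] by (intro mult_right_mono) auto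
    then show ?thesis by (simp add: power_mult_distrib)
  qed
  have le2: "(W n * coef u n)\<^sup>2 \<le> ((W n)\<^sup>2 * coef u n)\<^sup>2" for n
    using le[of "W n * coef u n" n] by (simp add: power2_eq_square mult.assoc)
  have "(\<Sum>n. (coef u n)\<^sup>2) \<le> (\<Sum>n. (W n * coef u n)\<^sup>2)" by (intro suminf_le le s)
  moreover have "(\<Sum>n. (W n * coef u n)\<^sup>2) \<le> (\<Sum>n. ((W n)\<^sup>2 * coef u n)\<^sup>2)" by (intro suminf_le le2 s)
  moreover have "0 \<le> (\<Sum>n. (coef u n)\<^sup>2)" by (intro suminf_nonneg s) auto
  ultimately show "(\<Sum>n. ((W n)\<^sup>2 * coef u n)\<^sup>2) \<le> (h2_norm u)\<^sup>2" "(h2_norm u)\<^sup>2 \<le> 3 * (\<Sum>n. ((W n)\<^sup>2 * coef u n)\<^sup>2)"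
    using h2_norm_power2[OF u] by linarith+
  assume "v \<in> H2H10"
  with u show "(\<lambda>n. ((W n)\<^sup>2)\<^sup>2 * coef u n * coef v n) sums l2_inner (wd (wd u)) (wd (wd v))" by (rule H2H10_inner)
qed

interpretation SH1: spectral_space H10 h1_norm W "\<lambda>u v. l2_inner (wd u) (wd v)"
  by (rule spectral_H10)

interpretation SH2: spectral_space H2H10 h2_norm "\<lambda>n. (W n)\<^sup>2" "\<lambda>u v. l2_inner (wd (wd u)) (wd (wd v))"
  by (rule spectral_H2H10)

section \<open>Continuity in time of the forcing and existence of solutions\<close>

lemma modal_sup_tendsto:
  assumes mc: "modal_curve lam a a' G" and lam: "\<And>n. lam n \<ge> W n" and t: "t \<ge> 0"
  shows "((\<lambda>s. \<Sum>n. \<bar>a n s - a n t\<bar>) \<longlongrightarrow> 0) (at t within {0..})"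
proof -
  obtain M where M: "summable M" "\<And>n s. 0 \<le> s \<Longrightarrow> s \<le> t + 1 \<Longrightarrow> (lam n * a n s)\<^sup>2 + (a' n s)\<^sup>2 \<le> M n"
    using modal_curveD(3)[OF mc, of "t + 1"] t by auto
  show ?thesis
  proof (rule suminf_tendsto_zero)
    fix n
    have "(a n \<longlongrightarrow> a n t) (at t within {0..})"
      using DERIV_continuous[OF modal_curveD(1)[OF mc t, of n]] by (simp add: continuous_within)
    then show "((\<lambda>s. \<bar>a n s - a n t\<bar>) \<longlongrightarrow> 0) (at t within {0..})"
      by (intro tendsto_rabs_zero LIM_zero)
  next
    show "summable (\<lambda>n. 2 * ((1 / W n)\<^sup>2 + M n))" by (intro summable_mult summable_add summable_W M)
    have "\<forall>\<^sub>F s in at t within {0..}. 0 \<le> s \<and> s \<le> t + 1"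
      by (subst eventually_at_topological, intro exI[of _ "{..<t+1}"]) auto
    then show "\<forall>\<^sub>F s in at t within {0..}. \<forall>n. \<bar>\<bar>a n s - a n t\<bar>\<bar> \<le> 2 * ((1 / W n)\<^sup>2 + M n)"
    proof eventually_elim
      case (elim s)
      show ?case
      proof
        fix n
        have "\<bar>a n s\<bar> \<le> (1 / W n)\<^sup>2 + M n" "\<bar>a n t\<bar> \<le> (1 / W n)\<^sup>2 + M n"
          using elim t by (auto intro!: abs_le_majorant[OF lam M(2)])
        then show "\<bar>\<bar>a n s - a n t\<bar>\<bar> \<le> 2 * ((1 / W n)\<^sup>2 + M n)"
          unfolding abs_abs mult_2 using abs_triangle_ineq4[of "a n s" "a n t"] by linarith
      qed
    qed
  qed
qed

context modal_pair
begin

text \<open>The absolute sums of the coefficient increments tend to 0, so the series converge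
  uniformly in x; the Lipschitz forcing then converges uniformly and hence in L2.\<close>

lemma G_coef_tendsto:
  assumes N: "lip_bounded L B N" and t: "t \<ge> 0"
  shows "((\<lambda>s. coef (G N s) n) \<longlongrightarrow> coef (G N t) n) (at t within {0..})"
proof (rule LIM_zero_cancel, rule Lim_null_comparison)
  let ?A = "\<lambda>s. \<Sum>n. \<bar>a n s - a n t\<bar>" and ?B = "\<lambda>s. \<Sum>n. \<bar>b n s - b n t\<bar>"
  note lims = modal_sup_tendsto[OF ma lam t] modal_sup_tendsto[OF mb kap t]
  have "((\<lambda>s. sqrt pi * (L * (?A s + ?B s))) \<longlongrightarrow> sqrt pi * (L * (0 + 0))) (at t within {0..})"
    by (intro tendsto_intros lims)
  then show "((\<lambda>s. sqrt pi * (L * (?A s + ?B s))) \<longlongrightarrow> 0) (at t within {0..})" by simp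
  have "\<forall>\<^sub>F s in at t within {0..}. 0 \<le> s" by (simp add: eventually_at_filter)
  then show "\<forall>\<^sub>F s in at t within {0..}. norm (coef (G N s) n - coef (G N t) n) \<le> sqrt pi * (L * (?A s + ?B s))"
  proof eventually_elim
    case (elim s)
    note sa = modal_curve_summable_abs(2)[OF ma _ lam] and sb = modal_curve_summable_abs(2)[OF mb _ kap]
    have abs_diff: "summable (\<lambda>n. \<bar>p n - q n\<bar>)" if "summable (\<lambda>n. \<bar>p n\<bar>)" "summable (\<lambda>n. \<bar>q n\<bar>)" for p q :: "nat \<Rightarrow> real"
      by (rule summable_comparison_test[OF _ summable_add[OF that]]) (auto intro: abs_triangle_ineq4)
    have da: "summable (\<lambda>n. \<bar>a n s - a n t\<bar>)" and db: "summable (\<lambda>n. \<bar>b n s - b n t\<bar>)"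
      by (intro abs_diff sa sb elim t)+
    have L0: "L \<ge> 0" by (rule lip_boundedD(1)[OF N])
    have bnd: "\<bar>G N s x - G N t x\<bar> \<le> L * (?A s + ?B s)" for x
    proof (rule order_trans[OF lip_boundedD(2)[OF N]], intro mult_left_mono add_mono L0)
      show "\<bar>y s x - y t x\<bar> \<le> ?A s" using ser_bound[OF da, of x] unfolding ser_diff[OF sa[OF elim] sa[OF t]] .
      show "\<bar>z s x - z t x\<bar> \<le> ?B s" using ser_bound[OF db, of x] unfolding ser_diff[OF sb[OF elim] sb[OF t]] .
    qed
    have Ld: "(\<lambda>x. G N s x - G N t x) \<in> L2" by (intro L2_diff G_L2[OF N] elim t)
    have "\<bar>coef (G N s) n - coef (G N t) n\<bar> \<le> l2_norm (\<lambda>x. G N s x - G N t x)"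
      using coef_bound[OF Ld, of n] unfolding coef_diff[OF G_L2[OF N elim] G_L2[OF N t]] .
    also have "\<dots> \<le> sqrt pi * (L * (?A s + ?B s))"
      using bnd order_trans[OF abs_ge_zero bnd[of 0]] by (intro l2_norm_le_bound L2_measurable[OF Ld]) auto
    finally show ?case by simp
  qed
qed

lemma G_coef_bound: "lip_bounded L B N \<Longrightarrow> t \<ge> 0 \<Longrightarrow> \<bar>coef (G N t) n\<bar> \<le> sqrt pi * B"
proof -
  assume N: "lip_bounded L B N" and t: "t \<ge> 0"
  have "l2_norm (G N t) \<le> sqrt pi * B"
    using lip_boundedD(3)[OF N] order_trans[OF abs_ge_zero lip_boundedD(3)[OF N]]
    by (intro l2_norm_le_bound L2_measurable[OF G_L2[OF N t]]) auto
  then show ?thesis using coef_bound[OF G_L2[OF N t], of n] by linarith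
qed

end

lemma solution_exists:
  fixes f :: "real \<Rightarrow> real"
  assumes l: "l > 0" and f: "\<forall>x. \<exists>e>0. \<exists>L. L-lipschitz_on (ball x e) f" "mono f" "f 0 = 0"
    and \<eta>0: "\<eta>0 \<in> H2H10" and \<theta>0: "\<theta>0 \<in> H10" and \<eta>1: "\<eta>1 \<in> L2" and \<theta>1: "\<theta>1 \<in> L2"
  shows "\<exists>y \<theta>. is_solution l f \<eta>0 \<eta>1 \<theta>0 \<theta>1 y \<theta>"
proof -
  obtain R L B a a' b b' where
    mp: "modal_pair (\<lambda>n. (W n)\<^sup>2) W a a' b b' (NY (clampf R f) l) (NT (clampf R f) l) L B"
    and bd: "\<And>t x. t \<ge> 0 \<Longrightarrow> \<bar>ser (\<lambda>n. a n t) x\<bar> + l \<le> R"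
    and ini: "\<And>n. a n 0 = coef \<eta>0 n" "\<And>n. a' n 0 = coef \<eta>1 n" "\<And>n. b n 0 = coef \<theta>0 n" "\<And>n. b' n 0 = coef \<theta>1 n"
    by (rule global_modal_existence[OF l f SH2.lam SH1.lam SH2.V_summable[OF \<eta>0] parseval_norm(1)[OF \<eta>1]
        SH1.V_summable[OF \<theta>0] parseval_norm(1)[OF \<theta>1]]) (rule that)
  interpret modal_pair "\<lambda>n. (W n)\<^sup>2" W a a' b b' "NY (clampf R f) l" "NT (clampf R f) l" L B by (rule mp)
  define Y where "Y = (\<lambda>t. ser (\<lambda>n. a n t))"
  define Z where "Z = (\<lambda>t. ser (\<lambda>n. b n t))"
  \<comment> \<open>The bound on \<open>ser\<close> holds at every real x, so the truncated and the
    original forcing agree as functions, not merely almost everywhere.\<close>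
  have GY: "(\<lambda>x. NY (clampf R f) l (Y t x) (Z t x)) = (\<lambda>x. f (Y t x - l * sin (Z t x)) + f (Y t x + l * sin (Z t x)))" if "t \<ge> 0" for t
    unfolding Y_def Z_def NY_NT_clampf(1)[OF bd[OF that] l] unfolding NY_def by (rule refl)
  have GZ: "(\<lambda>x. NT (clampf R f) l (Y t x) (Z t x)) = (\<lambda>x. 3 / l * (cos (Z t x) * (f (Y t x + l * sin (Z t x)) - f (Y t x - l * sin (Z t x)))))" if "t \<ge> 0" for t
    unfolding Y_def Z_def NY_NT_clampf(2)[OF bd[OF that] l] unfolding NT_def by (rule refl)
  have Gs: "\<forall>t\<ge>0. (\<lambda>x. G N t x) \<in> L2" "\<forall>t\<ge>0. \<forall>n. \<bar>coef (\<lambda>x. G N t x) n\<bar> \<le> sqrt pi * B"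
    "\<forall>t\<ge>0. \<forall>n. ((\<lambda>s. coef (\<lambda>x. G N s x) n) \<longlongrightarrow> coef (\<lambda>x. G N t x) n) (at t within {0..})"
    if "lip_bounded L B N" for N
    using G_L2[OF that] G_coef_bound[OF that] G_coef_tendsto[OF that] by simp_all
  obtain yt ytt where y: "\<forall>t\<ge>0. Y t \<in> H2H10" "curve_cont h2_norm Y"
     "\<forall>t\<ge>0. yt t \<in> L2" "curve_deriv l2_norm Y yt" "curve_cont l2_norm yt"
     "\<forall>t\<ge>0. ytt t \<in> dual_space H2H10 h2_norm"
     "dcurve_deriv_of_l2 H2H10 h2_norm yt ytt" "dcurve_cont H2H10 h2_norm ytt"
     "\<forall>n. coef (yt 0) n = a' n 0"
     "\<forall>t\<ge>0. \<forall>\<phi>\<in>H2H10. ytt t \<phi> + l2_inner (wd (wd (Y t))) (wd (wd \<phi>)) + l2_inner (\<lambda>x. NY (clampf R f) l (Y t x) (Z t x)) \<phi> = 0"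
    using SH2.existence_half[OF ma Gs[OF N1]]
    unfolding Y_def[symmetric] fun_cong[OF Y_def, symmetric] fun_cong[OF Z_def, symmetric] by - (elim exE conjE, rule that)
  obtain zt ztt where z: "\<forall>t\<ge>0. Z t \<in> H10" "curve_cont h1_norm Z"
     "\<forall>t\<ge>0. zt t \<in> L2" "curve_deriv l2_norm Z zt" "curve_cont l2_norm zt"
     "\<forall>t\<ge>0. ztt t \<in> dual_space H10 h1_norm"
     "dcurve_deriv_of_l2 H10 h1_norm zt ztt" "dcurve_cont H10 h1_norm ztt"
     "\<forall>n. coef (zt 0) n = b' n 0"
     "\<forall>t\<ge>0. \<forall>\<phi>\<in>H10. ztt t \<phi> + l2_inner (wd (Z t)) (wd \<phi>) + l2_inner (\<lambda>x. NT (clampf R f) l (Y t x) (Z t x)) \<phi> = 0"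
    using SH1.existence_half[OF mb Gs[OF N2]]
    unfolding Z_def[symmetric] fun_cong[OF Y_def, symmetric] fun_cong[OF Z_def, symmetric] by - (elim exE conjE, rule that)
  note sa = modal_curve_summable_abs(2)[OF ma order_refl lam] and sb = modal_curve_summable_abs(2)[OF mb order_refl kap]
  have i1: "ae_eq (Y 0) \<eta>0"
    unfolding Y_def using coef_ser[OF sa]
    by (intro coef_eq_imp_ae_eq ser_L2[OF sa] SH2.V_L2[OF \<eta>0]) (simp only: ini)
  have i3: "ae_eq (Z 0) \<theta>0"
    unfolding Z_def using coef_ser[OF sb]
    by (intro coef_eq_imp_ae_eq ser_L2[OF sb] SH1.V_L2[OF \<theta>0]) (simp only: ini)
  have i2: "ae_eq (yt 0) \<eta>1" using y(3,9) \<eta>1 by (intro coef_eq_imp_ae_eq) (auto simp: ini)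
  have i4: "ae_eq (zt 0) \<theta>1" using z(3,9) \<theta>1 by (intro coef_eq_imp_ae_eq) (auto simp: ini)
  have e1: "ytt t \<phi> + l2_inner (wd (wd (Y t))) (wd (wd \<phi>))
        + l2_inner (\<lambda>x. f (Y t x - l * sin (Z t x)) + f (Y t x + l * sin (Z t x))) \<phi> = 0"
    if "t > 0" "\<phi> \<in> H2H10" for t \<phi>
    using y(10)[rule_format, of t \<phi>] that GY[of t] by simp
  have e2: "l * ztt t \<psi> + l * l2_inner (wd (Z t)) (wd \<psi>)
        + 3 * l2_inner (\<lambda>x. cos (Z t x) * (f (Y t x + l * sin (Z t x)) - f (Y t x - l * sin (Z t x)))) \<psi> = 0"
    if t: "t > 0" and \<psi>: "\<psi> \<in> H10" for t \<psi>
  proof -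
    let ?I = "l2_inner (\<lambda>x. cos (Z t x) * (f (Y t x + l * sin (Z t x)) - f (Y t x - l * sin (Z t x)))) \<psi>"
    have "ztt t \<psi> + l2_inner (wd (Z t)) (wd \<psi>) + 3 / l * ?I = 0"
      using z(10)[rule_format, of t \<psi>] t \<psi> GZ[of t] by (simp only: l2_inner_scale_left less_imp_le)
    then have "l * (ztt t \<psi> + l2_inner (wd (Z t)) (wd \<psi>) + 3 / l * ?I) = 0" by simp
    then show ?thesis using l by (simp add: distrib_left)
  qed
  have "is_solution l f \<eta>0 \<eta>1 \<theta>0 \<theta>1 Y Z"
    unfolding is_solution_def
    by (rule exI[of _ yt], rule exI[of _ ytt], rule exI[of _ zt], rule exI[of _ ztt], intro conjI)
       (fact y z i1 i2 i3 i4 | use e1 e2 in blast)+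
  then show ?thesis by blast
qed

text \<open>A solution in the sense of the definition is bounded only almost everywhere, so N and N0
  agree along it only almost everywhere, and measurability of the composites with N0 enters as an
  assumption. The factor 2 comes from (p + q)^2 \<le> 2 p^2 + 2 q^2.\<close>

lemma nonlinearity_difference:
  assumes N: "lip_bounded L B N" and NN: "\<And>y z. \<bar>y\<bar> \<le> r \<Longrightarrow> N y z = N0 y z"
    and m: "u \<in> L2" "v \<in> L2" "u' \<in> L2" "v' \<in> L2"
    and g: "g \<in> borel_measurable mu" "g' \<in> borel_measurable mu"
    and gd: "g = (\<lambda>x. N0 (u x) (v x))" "g' = (\<lambda>x. N0 (u' x) (v' x))"
    and r: "AE x in mu. \<bar>u x\<bar> \<le> r" "AE x in mu. \<bar>u' x\<bar> \<le> r"
  shows "g \<in> L2" "g' \<in> L2"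
    "(l2_norm (\<lambda>x. g x - g' x))\<^sup>2 \<le> 2 * L\<^sup>2 * ((l2_norm (\<lambda>x. u x - u' x))\<^sup>2 + (l2_norm (\<lambda>x. v x - v' x))\<^sup>2)"
proof -
  have L0: "L \<ge> 0" by (rule lip_boundedD(1)[OF N])
  have "AE x in mu. \<bar>g x\<bar> \<le> B"
    using r(1) by eventually_elim (use lip_boundedD(3)[OF N] NN in \<open>simp add: gd(1)\<close>, metis)
  then show gL: "g \<in> L2" by (rule L2_bounded[OF g(1)])
  have "AE x in mu. \<bar>g' x\<bar> \<le> B"
    using r(2) by eventually_elim (use lip_boundedD(3)[OF N] NN in \<open>simp add: gd(2)\<close>, metis)
  then show gL': "g' \<in> L2" by (rule L2_bounded[OF g(2)])
  have du: "(\<lambda>x. u x - u' x) \<in> L2" and dv: "(\<lambda>x. v x - v' x) \<in> L2" and dg: "(\<lambda>x. g x - g' x) \<in> L2"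
    by (intro L2_diff m gL gL')+
  have "(l2_norm (\<lambda>x. g x - g' x))\<^sup>2 \<le> (\<integral>x. 2 * L\<^sup>2 * ((u x - u' x)\<^sup>2 + (v x - v' x)\<^sup>2) \<partial>mu)"
    unfolding l2_norm_power2_integral
  proof (rule integral_mono_AE)
    show "integrable mu (\<lambda>x. (g x - g' x)\<^sup>2)" using dg by (simp add: L2_iff)
    show "integrable mu (\<lambda>x. 2 * L\<^sup>2 * ((u x - u' x)\<^sup>2 + (v x - v' x)\<^sup>2))" using du dv by (simp add: L2_iff)
    show "AE x in mu. (g x - g' x)\<^sup>2 \<le> 2 * L\<^sup>2 * ((u x - u' x)\<^sup>2 + (v x - v' x)\<^sup>2)"
      using r
    proof eventually_elim
      case (elim x)
      have "\<bar>g x - g' x\<bar> \<le> L * (\<bar>u x - u' x\<bar> + \<bar>v x - v' x\<bar>)"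
        using lip_boundedD(2)[OF N, of "u x" "v x" "u' x" "v' x"] NN[OF elim(1), of "v x"] NN[OF elim(2), of "v' x"]
        by (simp add: gd)
      then have "\<bar>g x - g' x\<bar>\<^sup>2 \<le> (L * (\<bar>u x - u' x\<bar> + \<bar>v x - v' x\<bar>))\<^sup>2" by (intro power_mono) auto
      also have "\<dots> = L\<^sup>2 * (\<bar>u x - u' x\<bar> - - \<bar>v x - v' x\<bar>)\<^sup>2" by (simp add: power_mult_distrib)
      also have "\<dots> \<le> L\<^sup>2 * (2 * \<bar>u x - u' x\<bar>\<^sup>2 + 2 * (- \<bar>v x - v' x\<bar>)\<^sup>2)"
        by (intro mult_left_mono diff_square_le) auto
      also have "\<dots> = 2 * L\<^sup>2 * ((u x - u' x)\<^sup>2 + (v x - v' x)\<^sup>2)" by (simp add: algebra_simps)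
      finally show ?case by simp
    qed
  qed
  also have "\<dots> = 2 * L\<^sup>2 * ((\<integral>x. (u x - u' x)\<^sup>2 \<partial>mu) + (\<integral>x. (v x - v' x)\<^sup>2 \<partial>mu))"
    using du dv by (simp add: L2_iff)
  finally show "(l2_norm (\<lambda>x. g x - g' x))\<^sup>2 \<le> 2 * L\<^sup>2 * ((l2_norm (\<lambda>x. u x - u' x))\<^sup>2 + (l2_norm (\<lambda>x. v x - v' x))\<^sup>2)"
    by (simp only: l2_norm_power2_integral)
qed

text \<open>The interface between \<open>is_solution\<close> and the mode equations, applied to each
  of two solutions that are to be compared. The second equation is divided by l to match the form
  used in \<open>spectral_space\<close>.\<close>

lemma solution_modes:
  assumes sol: "is_solution l f \<eta>0 \<eta>1 \<theta>0 \<theta>1 y \<theta>" and l: "l > 0"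
    and \<eta>0: "\<eta>0 \<in> H2H10" and \<theta>0: "\<theta>0 \<in> H10" and \<eta>1: "\<eta>1 \<in> L2" and \<theta>1: "\<theta>1 \<in> L2"
  obtains yt \<theta>t where
    "\<And>t. t \<ge> 0 \<Longrightarrow> y t \<in> H2H10" "\<And>t. t \<ge> 0 \<Longrightarrow> \<theta> t \<in> H10"
    "\<And>t. t \<ge> 0 \<Longrightarrow> yt t \<in> L2" "\<And>t. t \<ge> 0 \<Longrightarrow> \<theta>t t \<in> L2"
    "\<And>t n. t \<ge> 0 \<Longrightarrow> ((\<lambda>s. coef (y s) n) has_real_derivative coef (yt t) n) (at t within {0..})"
    "\<And>t n. t > 0 \<Longrightarrow> ((\<lambda>s. coef (yt s) n) has_real_derivative
        - ((W n)\<^sup>2)\<^sup>2 * coef (y t) n - coef (\<lambda>x. NY f l (y t x) (\<theta> t x)) n) (at t within {0..})"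
    "\<And>t n. t \<ge> 0 \<Longrightarrow> ((\<lambda>s. coef (yt s) n) \<longlongrightarrow> coef (yt t) n) (at t within {0..})"
    "\<And>t n. t \<ge> 0 \<Longrightarrow> ((\<lambda>s. coef (\<theta> s) n) has_real_derivative coef (\<theta>t t) n) (at t within {0..})"
    "\<And>t n. t > 0 \<Longrightarrow> ((\<lambda>s. coef (\<theta>t s) n) has_real_derivative
        - (W n)\<^sup>2 * coef (\<theta> t) n - coef (\<lambda>x. NT f l (y t x) (\<theta> t x)) n) (at t within {0..})"
    "\<And>t n. t \<ge> 0 \<Longrightarrow> ((\<lambda>s. coef (\<theta>t s) n) \<longlongrightarrow> coef (\<theta>t t) n) (at t within {0..})"
    "\<And>T. \<exists>C. \<forall>t\<in>{0..T}. (\<Sum>n. ((W n)\<^sup>2 * coef (y t) n)\<^sup>2) \<le> C \<and> (\<Sum>n. (coef (yt t) n)\<^sup>2) \<le> C \<and>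
        (\<Sum>n. (W n * coef (\<theta> t) n)\<^sup>2) \<le> C \<and> (\<Sum>n. (coef (\<theta>t t) n)\<^sup>2) \<le> C"
    "\<And>n. coef (y 0) n = coef \<eta>0 n" "\<And>n. coef (yt 0) n = coef \<eta>1 n"
    "\<And>n. coef (\<theta> 0) n = coef \<theta>0 n" "\<And>n. coef (\<theta>t 0) n = coef \<theta>1 n"
proof -
  obtain yt ytt \<theta>t \<theta>tt where
    y: "\<forall>t\<ge>0. y t \<in> H2H10" "curve_cont h2_norm y" "\<forall>t\<ge>0. yt t \<in> L2" "curve_deriv l2_norm y yt" "curve_cont l2_norm yt"
     "\<forall>t\<ge>0. ytt t \<in> dual_space H2H10 h2_norm" "dcurve_deriv_of_l2 H2H10 h2_norm yt ytt" and
    z: "\<forall>t\<ge>0. \<theta> t \<in> H10" "curve_cont h1_norm \<theta>" "\<forall>t\<ge>0. \<theta>t t \<in> L2" "curve_deriv l2_norm \<theta> \<theta>t" "curve_cont l2_norm \<theta>t"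
     "\<forall>t\<ge>0. \<theta>tt t \<in> dual_space H10 h1_norm" "dcurve_deriv_of_l2 H10 h1_norm \<theta>t \<theta>tt" and
    ini: "ae_eq (y 0) \<eta>0" "ae_eq (yt 0) \<eta>1" "ae_eq (\<theta> 0) \<theta>0" "ae_eq (\<theta>t 0) \<theta>1" and
    e1: "\<forall>t>0. \<forall>\<phi>\<in>H2H10. ytt t \<phi> + l2_inner (wd (wd (y t))) (wd (wd \<phi>))
        + l2_inner (\<lambda>x. f (y t x - l * sin (\<theta> t x)) + f (y t x + l * sin (\<theta> t x))) \<phi> = 0" and
    e2: "\<forall>t>0. \<forall>\<psi>\<in>H10. l * \<theta>tt t \<psi> + l * l2_inner (wd (\<theta> t)) (wd \<psi>)
        + 3 * l2_inner (\<lambda>x. cos (\<theta> t x) * (f (y t x + l * sin (\<theta> t x)) - f (y t x - l * sin (\<theta> t x)))) \<psi> = 0"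
    using sol unfolding is_solution_def by - (elim exE conjE, rule that)
  have eq1: "\<forall>t>0. \<forall>\<phi>\<in>H2H10. ytt t \<phi> + l2_inner (wd (wd (y t))) (wd (wd \<phi>)) + l2_inner (\<lambda>x. NY f l (y t x) (\<theta> t x)) \<phi> = 0"
    unfolding NY_def by (rule e1)
  have eq2: "\<forall>t>0. \<forall>\<psi>\<in>H10. \<theta>tt t \<psi> + l2_inner (wd (\<theta> t)) (wd \<psi>) + l2_inner (\<lambda>x. NT f l (y t x) (\<theta> t x)) \<psi> = 0"
  proof (intro allI impI ballI)
    fix t :: real and \<psi> assume "t > 0" "\<psi> \<in> H10"
    from e2[rule_format, OF this] have "l * (\<theta>tt t \<psi> + l2_inner (wd (\<theta> t)) (wd \<psi>) + l2_inner (\<lambda>x. NT f l (y t x) (\<theta> t x)) \<psi>) = 0"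
      using l unfolding NT_def l2_inner_scale_left by (simp add: distrib_left)
    then show "\<theta>tt t \<psi> + l2_inner (wd (\<theta> t)) (wd \<psi>) + l2_inner (\<lambda>x. NT f l (y t x) (\<theta> t x)) \<psi> = 0" using l by simp
  qed
  note uy = SH2.uniqueness_half[OF y(1-7) eq1]
  note uz = SH1.uniqueness_half[OF z(1-7) eq2]
  have b: "\<exists>C. \<forall>t\<in>{0..T}. (\<Sum>n. ((W n)\<^sup>2 * coef (y t) n)\<^sup>2) \<le> C \<and> (\<Sum>n. (coef (yt t) n)\<^sup>2) \<le> C \<and>
        (\<Sum>n. (W n * coef (\<theta> t) n)\<^sup>2) \<le> C \<and> (\<Sum>n. (coef (\<theta>t t) n)\<^sup>2) \<le> C" for T
  proof -
    obtain C1 where C1: "\<And>t. t \<in> {0..T} \<Longrightarrow> (\<Sum>n. ((W n)\<^sup>2 * coef (y t) n)\<^sup>2) \<le> C1 \<and> (\<Sum>n. (coef (yt t) n)\<^sup>2) \<le> C1"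
      using uy(4)[of T] by blast
    obtain C2 where C2: "\<And>t. t \<in> {0..T} \<Longrightarrow> (\<Sum>n. (W n * coef (\<theta> t) n)\<^sup>2) \<le> C2 \<and> (\<Sum>n. (coef (\<theta>t t) n)\<^sup>2) \<le> C2"
      using uz(4)[of T] by blast
    show ?thesis
    proof (intro exI[of _ "max C1 C2"] ballI)
      fix t assume "t \<in> {0..T}"
      from C1[OF this] C2[OF this] show "(\<Sum>n. ((W n)\<^sup>2 * coef (y t) n)\<^sup>2) \<le> max C1 C2 \<and> (\<Sum>n. (coef (yt t) n)\<^sup>2) \<le> max C1 C2 \<and>
        (\<Sum>n. (W n * coef (\<theta> t) n)\<^sup>2) \<le> max C1 C2 \<and> (\<Sum>n. (coef (\<theta>t t) n)\<^sup>2) \<le> max C1 C2" by linarith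
    qed
  qed
  have i: "coef (y 0) n = coef \<eta>0 n" "coef (yt 0) n = coef \<eta>1 n" "coef (\<theta> 0) n = coef \<theta>0 n" "coef (\<theta>t 0) n = coef \<theta>1 n" for n
  proof -
    have "y 0 \<in> L2" "yt 0 \<in> L2" "\<theta> 0 \<in> L2" "\<theta>t 0 \<in> L2"
      using y(1,3) z(1,3) SH2.V_L2[of "y 0"] SH1.V_L2[of "\<theta> 0"] by simp_all
    with SH2.V_L2[OF \<eta>0] SH1.V_L2[OF \<theta>0] \<eta>1 \<theta>1
    show "coef (y 0) n = coef \<eta>0 n" "coef (yt 0) n = coef \<eta>1 n" "coef (\<theta> 0) n = coef \<theta>0 n" "coef (\<theta>t 0) n = coef \<theta>1 n"
      by (simp_all only: coef_cong_ae[OF ini(1)] coef_cong_ae[OF ini(2)] coef_cong_ae[OF ini(3)] coef_cong_ae[OF ini(4)])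
  qed
  show thesis
    by (rule that[OF y(1)[rule_format] z(1)[rule_format] y(3)[rule_format] z(3)[rule_format] uy(1-3) uz(1-3) b i])
qed

lemma at_within_atLeast: "0 < t \<Longrightarrow> at t within {0..} = at (t::real)"
  by (rule at_within_interior) simp

lemma continuous_on_Icc_of_tendsto:
  fixes F :: "real \<Rightarrow> real"
  assumes "\<And>t. t \<ge> 0 \<Longrightarrow> (F \<longlongrightarrow> F t) (at t within {0..})"
  shows "continuous_on {0..T} F"
  unfolding continuous_on_def
proof
  fix t assume "t \<in> {0..T}"
  then show "(F \<longlongrightarrow> F t) (at t within {0..T})" by (intro tendsto_within_subset[OF assms]) auto
qed

lemma solution_unique:
  fixes f :: "real \<Rightarrow> real"
  assumes l: "l > 0" and f: "\<forall>x. \<exists>e>0. \<exists>L. L-lipschitz_on (ball x e) f" "mono f"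
    and \<eta>0: "\<eta>0 \<in> H2H10" and \<theta>0: "\<theta>0 \<in> H10" and \<eta>1: "\<eta>1 \<in> L2" and \<theta>1: "\<theta>1 \<in> L2"
    and sol: "is_solution l f \<eta>0 \<eta>1 \<theta>0 \<theta>1 y \<theta>" and sol': "is_solution l f \<eta>0 \<eta>1 \<theta>0 \<theta>1 y' \<theta>'"
    and t: "t \<ge> 0"
  shows "ae_eq (y' t) (y t) \<and> ae_eq (\<theta>' t) (\<theta> t)"
proof -
  obtain yt \<theta>t where S:
    "\<And>t. t \<ge> 0 \<Longrightarrow> y t \<in> H2H10" "\<And>t. t \<ge> 0 \<Longrightarrow> \<theta> t \<in> H10"
    "\<And>t. t \<ge> 0 \<Longrightarrow> yt t \<in> L2" "\<And>t. t \<ge> 0 \<Longrightarrow> \<theta>t t \<in> L2"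
    "\<And>t n. t \<ge> 0 \<Longrightarrow> ((\<lambda>s. coef (y s) n) has_real_derivative coef (yt t) n) (at t within {0..})"
    "\<And>t n. t > 0 \<Longrightarrow> ((\<lambda>s. coef (yt s) n) has_real_derivative
        - ((W n)\<^sup>2)\<^sup>2 * coef (y t) n - coef (\<lambda>x. NY f l (y t x) (\<theta> t x)) n) (at t within {0..})"
    "\<And>t n. t \<ge> 0 \<Longrightarrow> ((\<lambda>s. coef (yt s) n) \<longlongrightarrow> coef (yt t) n) (at t within {0..})"
    "\<And>t n. t \<ge> 0 \<Longrightarrow> ((\<lambda>s. coef (\<theta> s) n) has_real_derivative coef (\<theta>t t) n) (at t within {0..})"
    "\<And>t n. t > 0 \<Longrightarrow> ((\<lambda>s. coef (\<theta>t s) n) has_real_derivative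
        - (W n)\<^sup>2 * coef (\<theta> t) n - coef (\<lambda>x. NT f l (y t x) (\<theta> t x)) n) (at t within {0..})"
    "\<And>t n. t \<ge> 0 \<Longrightarrow> ((\<lambda>s. coef (\<theta>t s) n) \<longlongrightarrow> coef (\<theta>t t) n) (at t within {0..})"
    "\<And>T. \<exists>C. \<forall>t\<in>{0..T}. (\<Sum>n. ((W n)\<^sup>2 * coef (y t) n)\<^sup>2) \<le> C \<and> (\<Sum>n. (coef (yt t) n)\<^sup>2) \<le> C \<and>
        (\<Sum>n. (W n * coef (\<theta> t) n)\<^sup>2) \<le> C \<and> (\<Sum>n. (coef (\<theta>t t) n)\<^sup>2) \<le> C"
    "\<And>n. coef (y 0) n = coef \<eta>0 n" "\<And>n. coef (yt 0) n = coef \<eta>1 n"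
    "\<And>n. coef (\<theta> 0) n = coef \<theta>0 n" "\<And>n. coef (\<theta>t 0) n = coef \<theta>1 n"
    by (rule solution_modes[OF sol l \<eta>0 \<theta>0 \<eta>1 \<theta>1]) (rule that)
  obtain yt' \<theta>t' where S':
    "\<And>t. t \<ge> 0 \<Longrightarrow> y' t \<in> H2H10" "\<And>t. t \<ge> 0 \<Longrightarrow> \<theta>' t \<in> H10"
    "\<And>t. t \<ge> 0 \<Longrightarrow> yt' t \<in> L2" "\<And>t. t \<ge> 0 \<Longrightarrow> \<theta>t' t \<in> L2"
    "\<And>t n. t \<ge> 0 \<Longrightarrow> ((\<lambda>s. coef (y' s) n) has_real_derivative coef (yt' t) n) (at t within {0..})"
    "\<And>t n. t > 0 \<Longrightarrow> ((\<lambda>s. coef (yt' s) n) has_real_derivative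
        - ((W n)\<^sup>2)\<^sup>2 * coef (y' t) n - coef (\<lambda>x. NY f l (y' t x) (\<theta>' t x)) n) (at t within {0..})"
    "\<And>t n. t \<ge> 0 \<Longrightarrow> ((\<lambda>s. coef (yt' s) n) \<longlongrightarrow> coef (yt' t) n) (at t within {0..})"
    "\<And>t n. t \<ge> 0 \<Longrightarrow> ((\<lambda>s. coef (\<theta>' s) n) has_real_derivative coef (\<theta>t' t) n) (at t within {0..})"
    "\<And>t n. t > 0 \<Longrightarrow> ((\<lambda>s. coef (\<theta>t' s) n) has_real_derivative
        - (W n)\<^sup>2 * coef (\<theta>' t) n - coef (\<lambda>x. NT f l (y' t x) (\<theta>' t x)) n) (at t within {0..})"
    "\<And>t n. t \<ge> 0 \<Longrightarrow> ((\<lambda>s. coef (\<theta>t' s) n) \<longlongrightarrow> coef (\<theta>t' t) n) (at t within {0..})"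
    "\<And>T. \<exists>C. \<forall>t\<in>{0..T}. (\<Sum>n. ((W n)\<^sup>2 * coef (y' t) n)\<^sup>2) \<le> C \<and> (\<Sum>n. (coef (yt' t) n)\<^sup>2) \<le> C \<and>
        (\<Sum>n. (W n * coef (\<theta>' t) n)\<^sup>2) \<le> C \<and> (\<Sum>n. (coef (\<theta>t' t) n)\<^sup>2) \<le> C"
    "\<And>n. coef (y' 0) n = coef \<eta>0 n" "\<And>n. coef (yt' 0) n = coef \<eta>1 n"
    "\<And>n. coef (\<theta>' 0) n = coef \<theta>0 n" "\<And>n. coef (\<theta>t' 0) n = coef \<theta>1 n"
    by (rule solution_modes[OF sol' l \<eta>0 \<theta>0 \<eta>1 \<theta>1]) (rule that)
  define T where "T = t + 1"
  obtain C1 where C1: "\<And>s. s \<in> {0..T} \<Longrightarrow> (\<Sum>n. ((W n)\<^sup>2 * coef (y s) n)\<^sup>2) \<le> C1 \<and> (\<Sum>n. (coef (yt s) n)\<^sup>2) \<le> C1 \<and>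
        (\<Sum>n. (W n * coef (\<theta> s) n)\<^sup>2) \<le> C1 \<and> (\<Sum>n. (coef (\<theta>t s) n)\<^sup>2) \<le> C1"
    using S(11)[of T] by blast
  obtain C2 where C2: "\<And>s. s \<in> {0..T} \<Longrightarrow> (\<Sum>n. ((W n)\<^sup>2 * coef (y' s) n)\<^sup>2) \<le> C2 \<and> (\<Sum>n. (coef (yt' s) n)\<^sup>2) \<le> C2 \<and>
        (\<Sum>n. (W n * coef (\<theta>' s) n)\<^sup>2) \<le> C2 \<and> (\<Sum>n. (coef (\<theta>t' s) n)\<^sup>2) \<le> C2"
    using S'(11)[of T] by blast
  \<comment> \<open>A sup bound on [0, T] for the y components of both solutions, from the embedding
    constant and their bounds in \<open>H2H10\<close>.\<close>
  define r where "r = CW * sqrt (max C1 C2)"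
  have yr: "AE x in mu. \<bar>y s x\<bar> \<le> r" "AE x in mu. \<bar>y' s x\<bar> \<le> r" if s: "s \<in> {0..T}" for s
    unfolding r_def using s C1[OF s] C2[OF s]
    by (intro SH2.V_sup_bound S(1) S'(1); simp add: le_max_iff_disj)+
  \<comment> \<open>Up to time T, the arguments y + l sin z and y - l sin z of either solution lie
    almost everywhere in [-R, R]; the absolute value gives R \<ge> 0 whatever the sign of r.\<close>
  define R where "R = \<bar>r\<bar> + l"
  have R: "R \<ge> 0" using l by (simp add: R_def)
  obtain L1 B1 where h1: "L1 \<ge> 0" "\<And>x y. \<bar>clampf R f x - clampf R f y\<bar> \<le> L1 * \<bar>x - y\<bar>" "\<And>x. \<bar>clampf R f x\<bar> \<le> B1"
    using clampf_lipschitz[OF f R] by blast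
  then obtain L B where LB: "lip_bounded L B (NY (clampf R f) l)" "lip_bounded L B (NT (clampf R f) l)"
    using NY_NT_lip_bounded[OF h1 l] by blast
  have NN: "NY (clampf R f) l p q = NY f l p q" "NT (clampf R f) l p q = NT f l p q" if "\<bar>p\<bar> \<le> r" for p q
    using that l by (auto intro!: NY_NT_clampf simp: R_def)
  have fm [measurable]: "f \<in> borel_measurable borel" by (rule borel_measurable_mono[OF f(2)])
  have gm: "(\<lambda>x. NY f l (p x) (q x)) \<in> borel_measurable mu" "(\<lambda>x. NT f l (p x) (q x)) \<in> borel_measurable mu"
    if [measurable]: "p \<in> borel_measurable mu" "q \<in> borel_measurable mu" for p q
    unfolding NY_def NT_def by measurable
  define w where "w n s = coef (y s) n - coef (y' s) n" for n s
  define w' where "w' n s = coef (yt s) n - coef (yt' s) n" for n s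
  define v where "v n s = coef (\<theta> s) n - coef (\<theta>' s) n" for n s
  define v' where "v' n s = coef (\<theta>t s) n - coef (\<theta>t' s) n" for n s
  define g where "g n s = coef (\<lambda>x. NY f l (y s x) (\<theta> s x)) n - coef (\<lambda>x. NY f l (y' s x) (\<theta>' s x)) n" for n s
  define h where "h n s = coef (\<lambda>x. NT f l (y s x) (\<theta> s x)) n - coef (\<lambda>x. NT f l (y' s x) (\<theta>' s x)) n" for n s
  have L2s: "y s \<in> L2" "y' s \<in> L2" "\<theta> s \<in> L2" "\<theta>' s \<in> L2" if "s \<ge> 0" for s
    using S(1,2)[OF that] S'(1,2)[OF that] SH2.V_L2 SH1.V_L2 by blast+
  have dw: "((\<lambda>s. w n s) has_real_derivative w' n s) (at s within {0..})"
    "((\<lambda>s. v n s) has_real_derivative v' n s) (at s within {0..})" if "s \<ge> 0" for n s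
    unfolding w_def w'_def v_def v'_def by (intro DERIV_diff S S' that)+
  have dw': "((\<lambda>s. w' n s) has_real_derivative - ((W n)\<^sup>2)\<^sup>2 * w n s - g n s) (at s)"
    "((\<lambda>s. v' n s) has_real_derivative - (W n)\<^sup>2 * v n s - h n s) (at s)" if "s > 0" for n s
    using DERIV_diff[OF S(6)[OF that, of n] S'(6)[OF that, of n]] DERIV_diff[OF S(9)[OF that, of n] S'(9)[OF that, of n]]
    unfolding w_def w'_def v_def v'_def g_def h_def at_within_atLeast[OF that] by (simp_all add: algebra_simps)
  define e where "e n s = ((W n)\<^sup>2 * w n s)\<^sup>2 + (w' n s)\<^sup>2 + ((W n * v n s)\<^sup>2 + (v' n s)\<^sup>2)" for n s
  have parts: "summable (\<lambda>n. ((W n)\<^sup>2 * w n s)\<^sup>2) \<and> (\<Sum>n. ((W n)\<^sup>2 * w n s)\<^sup>2) \<le> 2 * C1 + 2 * C2"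
    "summable (\<lambda>n. (w' n s)\<^sup>2) \<and> (\<Sum>n. (w' n s)\<^sup>2) \<le> 2 * C1 + 2 * C2"
    "summable (\<lambda>n. (W n * v n s)\<^sup>2) \<and> (\<Sum>n. (W n * v n s)\<^sup>2) \<le> 2 * C1 + 2 * C2"
    "summable (\<lambda>n. (v' n s)\<^sup>2) \<and> (\<Sum>n. (v' n s)\<^sup>2) \<le> 2 * C1 + 2 * C2" if s: "s \<in> {0..T}" for s
  proof -
    have s0: "s \<ge> 0" using s by simp
    note q1 = suminf_diff_square[OF SH2.V_summable[OF S(1)[OF s0]] SH2.V_summable[OF S'(1)[OF s0]]]
    note q2 = suminf_diff_square[OF parseval_norm(1)[OF S(3)[OF s0]] parseval_norm(1)[OF S'(3)[OF s0]]]
    note q3 = suminf_diff_square[OF SH1.V_summable[OF S(2)[OF s0]] SH1.V_summable[OF S'(2)[OF s0]]]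
    note q4 = suminf_diff_square[OF parseval_norm(1)[OF S(4)[OF s0]] parseval_norm(1)[OF S'(4)[OF s0]]]
    show "summable (\<lambda>n. ((W n)\<^sup>2 * w n s)\<^sup>2) \<and> (\<Sum>n. ((W n)\<^sup>2 * w n s)\<^sup>2) \<le> 2 * C1 + 2 * C2"
      unfolding w_def right_diff_distrib using q1 C1[OF s] C2[OF s] by (intro conjI) (assumption | linarith)+
    show "summable (\<lambda>n. (w' n s)\<^sup>2) \<and> (\<Sum>n. (w' n s)\<^sup>2) \<le> 2 * C1 + 2 * C2"
      unfolding w'_def using q2 C1[OF s] C2[OF s] by (intro conjI) (assumption | linarith)+
    show "summable (\<lambda>n. (W n * v n s)\<^sup>2) \<and> (\<Sum>n. (W n * v n s)\<^sup>2) \<le> 2 * C1 + 2 * C2"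
      unfolding v_def right_diff_distrib using q3 C1[OF s] C2[OF s] by (intro conjI) (assumption | linarith)+
    show "summable (\<lambda>n. (v' n s)\<^sup>2) \<and> (\<Sum>n. (v' n s)\<^sup>2) \<le> 2 * C1 + 2 * C2"
      unfolding v'_def using q4 C1[OF s] C2[OF s] by (intro conjI) (assumption | linarith)+
  qed
  have se: "summable (\<lambda>n. e n s)" "(\<Sum>n. e n s) = ((\<Sum>n. ((W n)\<^sup>2 * w n s)\<^sup>2) + (\<Sum>n. (w' n s)\<^sup>2)) + ((\<Sum>n. (W n * v n s)\<^sup>2) + (\<Sum>n. (v' n s)\<^sup>2))"
    if s: "s \<in> {0..T}" for s
  proof -
    note p = parts(1)[OF s, THEN conjunct1] parts(2)[OF s, THEN conjunct1] parts(3)[OF s, THEN conjunct1] parts(4)[OF s, THEN conjunct1]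
    show "summable (\<lambda>n. e n s)" unfolding e_def by (intro summable_add p)
    show "(\<Sum>n. e n s) = ((\<Sum>n. ((W n)\<^sup>2 * w n s)\<^sup>2) + (\<Sum>n. (w' n s)\<^sup>2)) + ((\<Sum>n. (W n * v n s)\<^sup>2) + (\<Sum>n. (v' n s)\<^sup>2))"
      unfolding e_def
      by (simp only: suminf_add[OF summable_add[OF p(1,2)] summable_add[OF p(3,4)], symmetric]
          suminf_add[OF p(1,2), symmetric] suminf_add[OF p(3,4), symmetric])
  qed
  \<comment> \<open>Lipschitz continuity bounds the forcing differences by the L2 norms of the
    differences of y and \<theta>, and these are bounded by the energy since all frequencies are at
    least 1. Each nonlinearity contributes 2 L^2.\<close>
  have gh: "(\<Sum>n<M. (g n s)\<^sup>2 + (h n s)\<^sup>2) \<le> 4 * L\<^sup>2 * (\<Sum>n. e n s)" if s: "s \<in> {0..T}" for s M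
  proof -
    have s0: "s \<ge> 0" using s by simp
    note m = L2s[OF s0]
    note mm = L2_measurable[OF m(1)] L2_measurable[OF m(2)] L2_measurable[OF m(3)] L2_measurable[OF m(4)]
    note dY = nonlinearity_difference[OF LB(1) NN(1) m(1,3,2,4) gm(1)[OF mm(1,3)] gm(1)[OF mm(2,4)] refl refl yr[OF s]]
    note dT = nonlinearity_difference[OF LB(2) NN(2) m(1,3,2,4) gm(2)[OF mm(1,3)] gm(2)[OF mm(2,4)] refl refl yr[OF s]]
    define X where "X = (l2_norm (\<lambda>x. y s x - y' s x))\<^sup>2 + (l2_norm (\<lambda>x. \<theta> s x - \<theta>' s x))\<^sup>2"
    have bes: "(\<Sum>n<M. (coef p n - coef q n)\<^sup>2) \<le> (l2_norm (\<lambda>x. p x - q x))\<^sup>2" if pq: "p \<in> L2" "q \<in> L2" for p q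
      unfolding coef_diff[OF pq, symmetric] l2_norm_power2 unfolding coef_def
      by (rule Bessel_finite[OF orthonormal_se L2_diff[OF pq]]) simp
    have "(\<Sum>n<M. (g n s)\<^sup>2) \<le> 2 * L\<^sup>2 * X"
      unfolding g_def X_def by (rule order_trans[OF bes[OF dY(1,2)] dY(3)])
    moreover have "(\<Sum>n<M. (h n s)\<^sup>2) \<le> 2 * L\<^sup>2 * X"
      unfolding h_def X_def by (rule order_trans[OF bes[OF dT(1,2)] dT(3)])
    ultimately have 1: "(\<Sum>n<M. (g n s)\<^sup>2 + (h n s)\<^sup>2) \<le> 4 * L\<^sup>2 * X" unfolding sum.distrib by linarith
    have wV: "(\<lambda>x. y s x - y' s x) \<in> H2H10" "(\<lambda>x. \<theta> s x - \<theta>' s x) \<in> H10"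
      by (intro SH2.V_diff SH1.V_diff S S' s0)+
    have "(l2_norm (\<lambda>x. y s x - y' s x))\<^sup>2 \<le> (\<Sum>n. ((W n)\<^sup>2 * w n s)\<^sup>2)"
    proof -
      have "(l2_norm (\<lambda>x. y s x - y' s x))\<^sup>2 \<le> (\<Sum>n. ((W n)\<^sup>2 * coef (\<lambda>x. y s x - y' s x) n)\<^sup>2)"
        unfolding parseval_norm(2)[OF SH2.V_L2[OF wV(1)]]
        by (intro suminf_le SH2.coef_square_le parseval_norm(1) SH2.V_L2 SH2.V_summable wV)
      then show ?thesis unfolding coef_diff[OF m(1,2)] w_def .
    qed
    moreover have "(l2_norm (\<lambda>x. \<theta> s x - \<theta>' s x))\<^sup>2 \<le> (\<Sum>n. (W n * v n s)\<^sup>2)"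
    proof -
      have "(l2_norm (\<lambda>x. \<theta> s x - \<theta>' s x))\<^sup>2 \<le> (\<Sum>n. (W n * coef (\<lambda>x. \<theta> s x - \<theta>' s x) n)\<^sup>2)"
        unfolding parseval_norm(2)[OF SH1.V_L2[OF wV(2)]]
        by (intro suminf_le SH1.coef_square_le parseval_norm(1) SH1.V_L2 SH1.V_summable wV)
      then show ?thesis unfolding coef_diff[OF m(3,4)] v_def .
    qed
    moreover have "(\<Sum>n. (w' n s)\<^sup>2) \<ge> 0" "(\<Sum>n. (v' n s)\<^sup>2) \<ge> 0"
      using parts[OF s] by (auto intro!: suminf_nonneg)
    ultimately have "X \<le> (\<Sum>n. e n s)" unfolding X_def se(2)[OF s] by linarith
    then have "4 * L\<^sup>2 * X \<le> 4 * L\<^sup>2 * (\<Sum>n. e n s)" by (intro mult_left_mono) auto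
    with 1 show ?thesis by linarith
  qed
  have "e n t = 0" for n
  proof (rule modal_uniqueness[where lam="\<lambda>n. (W n)\<^sup>2" and kap=W and w=w and w'=w' and v=v and v'=v'
        and g=g and h=h and T=T and K="4 * L\<^sup>2" and C="4 * (2 * C1 + 2 * C2)" and t=t and n=n, folded e_def])
    fix n
    have "continuous_on {0..} (w n)" "continuous_on {0..} (v n)"
      by (rule DERIV_continuous_on[OF dw(1)], simp, rule DERIV_continuous_on[OF dw(2)], simp)
    then show "continuous_on {0..T} (w n)" "continuous_on {0..T} (v n)"
      by (auto intro: continuous_on_subset)
    show "continuous_on {0..T} (w' n)" "continuous_on {0..T} (v' n)"
      unfolding w'_def v'_def
      by (rule continuous_on_Icc_of_tendsto, intro tendsto_diff S S', assumption+)+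
    show "w n 0 = 0" "w' n 0 = 0" "v n 0 = 0" "v' n 0 = 0"
      by (simp_all add: w_def w'_def v_def v'_def S(12-15) S'(12-15))
    fix s assume s: "0 < s" "s < T"
    show "(w n has_real_derivative w' n s) (at s)" "(v n has_real_derivative v' n s) (at s)"
      using dw[of s n] s at_within_atLeast[OF s(1)] by simp_all
    show "(w' n has_real_derivative - ((W n)\<^sup>2)\<^sup>2 * w n s - g n s) (at s)"
      "(v' n has_real_derivative - (W n)\<^sup>2 * v n s - h n s) (at s)" by (rule dw'[OF s(1)])+
  next
    fix s assume s: "s \<in> {0..T}"
    show "summable (\<lambda>n. e n s)" by (rule se(1)[OF s])
    show "(\<Sum>n. e n s) \<le> 4 * (2 * C1 + 2 * C2)"
    proof -
      have "p \<le> c \<Longrightarrow> q \<le> c \<Longrightarrow> p' \<le> c \<Longrightarrow> q' \<le> c \<Longrightarrow> (p + q) + (p' + q') \<le> 4 * c" for p q p' q' c :: real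
        by linarith
      from this[OF parts(1)[OF s, THEN conjunct2] parts(2)[OF s, THEN conjunct2]
          parts(3)[OF s, THEN conjunct2] parts(4)[OF s, THEN conjunct2]]
      show ?thesis unfolding se(2)[OF s] .
    qed
  next
    fix s M assume "0 < s" "s < T"
    then show "(\<Sum>n<M. (g n s)\<^sup>2 + (h n s)\<^sup>2) \<le> 4 * L\<^sup>2 * (\<Sum>n. e n s)" by (intro gh) auto
  qed (use t in \<open>auto simp: T_def\<close>)
  then have z: "((W n)\<^sup>2 * w n t)\<^sup>2 = 0" "(W n * v n t)\<^sup>2 = 0" for n
    unfolding e_def by (simp_all add: add_nonneg_eq_0_iff)
  have "coef (y' t) n = coef (y t) n" "coef (\<theta>' t) n = coef (\<theta> t) n" for n
    using z[of n] by (simp_all add: w_def v_def)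
  then show ?thesis by (intro conjI coef_eq_imp_ae_eq L2s t)
qed

theorem theorem2p1:
  fixes l :: real and f :: "real \<Rightarrow> real"
    and \<eta>0 \<eta>1 \<theta>0 \<theta>1 :: "real \<Rightarrow> real"
  assumes l_pos: "l > 0"
    and f_loclip: "\<forall>x. \<exists>e>0. \<exists>L. L-lipschitz_on (ball x e) f"
    and f_mono: "mono f"
    and f0: "f 0 = 0"
    and f_growth: "\<exists>C>0. \<exists>p\<ge>1. \<forall>s. s \<noteq> 0 \<longrightarrow> \<bar>f s\<bar> \<le> C * (1 + \<bar>s\<bar> powr p)"
    and \<eta>0: "\<eta>0 \<in> H2H10" and \<theta>0: "\<theta>0 \<in> H10"
    and \<eta>1: "\<eta>1 \<in> L2" and \<theta>1: "\<theta>1 \<in> L2"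
  shows "\<exists>y \<theta>. is_solution l f \<eta>0 \<eta>1 \<theta>0 \<theta>1 y \<theta> \<and>
           (\<forall>y' \<theta>'. is_solution l f \<eta>0 \<eta>1 \<theta>0 \<theta>1 y' \<theta>' \<longrightarrow>
               (\<forall>t\<ge>0. ae_eq (y' t) (y t) \<and> ae_eq (\<theta>' t) (\<theta> t)))"
proof -
  obtain y \<theta> where s: "is_solution l f \<eta>0 \<eta>1 \<theta>0 \<theta>1 y \<theta>"
    using solution_exists[OF l_pos f_loclip f_mono f0 \<eta>0 \<theta>0 \<eta>1 \<theta>1] by blast
  show ?thesis
  proof (rule exI[of _ y], rule exI[of _ \<theta>], intro conjI allI impI)
    fix y' \<theta>' and t :: real assume s': "is_solution l f \<eta>0 \<eta>1 \<theta>0 \<theta>1 y' \<theta>'" and t: "0 \<le> t"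
    note u = solution_unique[OF l_pos f_loclip f_mono \<eta>0 \<theta>0 \<eta>1 \<theta>1 s s' t]
    show "ae_eq (y' t) (y t)" "ae_eq (\<theta>' t) (\<theta> t)" using u by simp_all
  qed (rule s)
qed

end
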